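(* Let $n\ge 2$ and let $A_1,\ldots,A_n\in\mathcal K_2(\mathbb C^n)$ be such that $$\int_{\partial B_{2n}}\operatorname{Re}\big\langle\nabla h_{A_1}(u),\,\Xi(A_2,\ldots,A_n)(u)\,u\big\rangle\,\upsilon_{\partial B_{2n}}=0 .$$ Then $$Q_n(A_1,\ldots,A_n)=\frac{4^{n-1}}{\varkappa_n}\int_{\partial B_{2n}}h_{A_1}\,D_n\big(I_n,\mathrm{Hess}_{\mathbb C}h_{A_2},\ldots,\mathrm{Hess}_{\mathbb C}h_{A_n}\big)\,\upsilon_{\partial B_{2n}} .$$
   Context: $\mathbb C^n$ carries the Hermitian product $\langle z,w\rangle=\sum_\ell z_\ell\bar w_\ell$. $\mathcal K_2(\mathbb C^n)$ is the set of convex bodies (non-empty compact convex subsets) $A\subset\mathbb C^n$ whose support function $h_A(z)=\max_{v\in A}\operatorname{Re}\langle z,v\rangle$ is of class $\mathcal C^2$ on $\mathbb C^n\setminus\{0\}$. $B_{2n}$ is the closed unit ball of $\mathbb C^n$ centred at the origin, $\upsilon_{\partial B_{2n}}$ the standard volume form of the sphere $\partial B_{2n}$, $\varkappa_m$ the Lebesgue measure of the unit ball of $\mathbb R^m$, $I_n$ the identity matrix. $d^c=i(\bar\partial-\partial)$, so $dd^c=2i\partial\bar\partial$. The Kazarnovskiĭ mixed pseudovolume is $$Q_n(A_1,\ldots,A_n)=\frac{1}{n!\,\varkappa_n}\int_{B_{2n}}dd^c h_{A_1}\wedge\cdots\wedge dd^c h_{A_n}$$ (wedge products of currents in the Bedford–Taylor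 sense). The gradient is $\nabla h=2\big(\partial h/\partial\bar z_1,\ldots,\partial h/\partial\bar z_n\big)$, i.e. the real gradient under $\mathbb R^{2n}\simeq\mathbb C^n$. $\mathrm{Hess}_{\mathbb C}h=\big(\partial^2h/\partial z_j\partial\bar z_k\big)_{j,k}$. For $m\times m$ matrices $M_\ell=(m^{(\ell)}_{j,k})$, the mixed discriminant is $D_m(M_1,\ldots,M_m)=\frac1{m!}\sum_{\sigma,\tau\in\mathfrak S_m}\operatorname{sgn}(\sigma\tau)\prod_{\ell=1}^m m^{(\ell)}_{\sigma(\ell),\tau(\ell)}$. $M^{[j,k]}$ is $M$ with row $j$ and column $k$ deleted. For $u\neq0$ put $$Z_{j,k}(u)=\frac{(-1)^{j+k}}{n}D_{n-1}\big(\mathrm{Hess}_{\mathbb C}h_{A_2}(u)^{[j,k]},\ldots,\mathrm{Hess}_{\mathbb C}h_{A_n}(u)^{[j,k]}\big),$$ and let $\Xi(A_2,\ldots,A_n)(u)$ be the $n\times n$ Hermitian matrix with entries $\Xi_{j,k}=Z_{j,k}(u)$ for $j\ne k$ and $\Xi_{j,j}=-\sum_{\ell\neq j}Z_{\ell,\ell}(u)$. *)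

theory Defs
  imports "HOL-Analysis.Analysis"
begin

text \<open>
  The space \<open>\<complex>\<^sup>n\<close> is \<^typ>\<open>complex^'n\<close> with \<open>n = CARD('n)\<close>.  The index type is linearly ordered, so
  that signs such as \<open>(-1)\<^bsup>j+k\<^esup>\<close> and the orientation of the basis of differential forms make sense.
\<close>

section \<open>Convex bodies and support functions\<close>

definition herm :: "complex^'n \<Rightarrow> complex^'n \<Rightarrow> complex" where
  "herm z w = (\<Sum>l\<in>UNIV. z $ l * cnj (w $ l))"

definition support_fun :: "(complex^'n) set \<Rightarrow> complex^'n \<Rightarrow> real" where
  "support_fun A z = (SUP v\<in>A. Re (herm z v))"

text \<open>Class \<open>C\<^sup>k\<close> on an open set \<open>S\<close> of a finite-dimensional space.\<close>

primrec C_on :: "nat \<Rightarrow> 'a::real_normed_vector set \<Rightarrow> ('a \<Rightarrow> 'b::real_normed_vector) \<Rightarrow> bool" where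
  "C_on 0 S f \<longleftrightarrow> continuous_on S f"
| "C_on (Suc k) S f \<longleftrightarrow>
     (\<forall>x\<in>S. f differentiable (at x)) \<and> (\<forall>v. C_on k S (\<lambda>x. frechet_derivative f (at x) v))"

definition K2 :: "(complex^'n) set set" where
  "K2 = {A. A \<noteq> {} \<and> compact A \<and> convex A \<and> C_on 2 (UNIV - {0}) (support_fun A)}"

section \<open>Wirtinger derivatives\<close>

definition dz :: "'n \<Rightarrow> (complex^'n \<Rightarrow> complex) \<Rightarrow> complex^'n \<Rightarrow> complex" where
  "dz j f z = (frechet_derivative f (at z) (axis j 1)
                - \<i> * frechet_derivative f (at z) (axis j \<i>)) / 2"

definition dzbar :: "'n \<Rightarrow> (complex^'n \<Rightarrow> complex) \<Rightarrow> complex^'n \<Rightarrow> complex" where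
  "dzbar j f z = (frechet_derivative f (at z) (axis j 1)
                + \<i> * frechet_derivative f (at z) (axis j \<i>)) / 2"

definition grad :: "(complex^'n \<Rightarrow> real) \<Rightarrow> complex^'n \<Rightarrow> complex^'n" where
  "grad h z = (\<chi> j. 2 * dzbar j (\<lambda>w. complex_of_real (h w)) z)"

definition HessC :: "(complex^'n \<Rightarrow> real) \<Rightarrow> complex^'n \<Rightarrow> complex^'n^'n" where
  "HessC h z = (\<chi> j k. dz j (dzbar k (\<lambda>w. complex_of_real (h w))) z)"

section \<open>Mixed discriminants and the matrix \<open>\<Xi>\<close>\<close>

text \<open>
  As the size varies, the matrices here are functions of two natural indices, of which only the
  values at indices in \<open>{1..m}\<close> matter.
\<close>

definition mixed_disc :: "nat \<Rightarrow> (nat \<Rightarrow> nat \<Rightarrow> nat \<Rightarrow> complex) \<Rightarrow> complex" where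
  "mixed_disc m M = (1 / fact m) *
     (\<Sum>\<sigma> | \<sigma> permutes {1..m}. \<Sum>\<tau> | \<tau> permutes {1..m}.
        of_int (sign (\<sigma> \<circ> \<tau>)) * (\<Prod>l=1..m. M l (\<sigma> l) (\<tau> l)))"

definition delete_row_col :: "nat \<Rightarrow> nat \<Rightarrow> (nat \<Rightarrow> nat \<Rightarrow> complex) \<Rightarrow> nat \<Rightarrow> nat \<Rightarrow> complex" where
  "delete_row_col j k M r s = M (if r < j then r else r + 1) (if s < k then s else s + 1)"

text \<open>The order isomorphism between \<open>'n\<close> and \<open>{1..n}\<close>, in both directions.\<close>

definition pos :: "'n::{finite,wellorder} \<Rightarrow> nat" where
  "pos j = card {..j}"

definition idx :: "nat \<Rightarrow> 'n::{finite,wellorder}" where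
  "idx r = (THE j. pos j = r)"

definition nat_mat :: "complex^'n::{finite,wellorder}^'n::_ \<Rightarrow> nat \<Rightarrow> nat \<Rightarrow> complex" where
  "nat_mat M r s = M $ idx r $ idx s"

text \<open>In the following two definitions only the bodies \<open>A 2, \<dots>, A n\<close> are used.\<close>

definition Zcoef ::
  "(nat \<Rightarrow> (complex^'n::{finite,wellorder}) set) \<Rightarrow> 'n \<Rightarrow> 'n \<Rightarrow> complex^'n::_ \<Rightarrow> complex" where
  "Zcoef A j k u = (-1) ^ (pos j + pos k) / of_nat CARD('n) *
     mixed_disc (CARD('n) - 1)
       (\<lambda>l. delete_row_col (pos j) (pos k) (nat_mat (HessC (support_fun (A (l + 1))) u)))"

definition Xi ::
  "(nat \<Rightarrow> (complex^'n::{finite,wellorder}) set) \<Rightarrow> complex^'n::_ \<Rightarrow> complex^'n::_^'n::_" where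
  "Xi A u = (\<chi> j k. if j \<noteq> k then Zcoef A j k u else - (\<Sum>l\<in>UNIV - {j}. Zcoef A l l u))"

section \<open>The volume of the unit sphere\<close>

text \<open>
  The standard volume of the unit sphere, as a Borel measure on the ambient Euclidean space: a Borel
  subset \<open>E\<close> of the sphere has measure \<open>N\<close> times the Lebesgue measure of the cone
  \<open>{t u | 0 < t \<le> 1, u \<in> E}\<close>, where \<open>N\<close> is the dimension of the space.  Equivalently,
  \<open>dx = r\<^bsup>N-1\<^esup> dr d\<sigma>\<close> in polar coordinates.
\<close>

definition sphere_measure :: "'a::euclidean_space measure" where
  "sphere_measure =
     scale_measure (of_nat DIM('a)) (distr (restrict_space lborel (cball 0 1)) borel sgn)"

section \<open>Differential forms\<close>

text \<open>
  A complex differential form on \<open>\<complex>\<^sup>n\<close>, possibly of mixed bidegree, is given by its coefficients: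
  \<open>\<omega> = (\<Sum>I J. \<omega> I J dz\<^sub>I \<and> dz\<^sup>*\<^sub>J)\<close>, where \<open>dz\<^sub>I = dz\<^bsub>i\<^sub>1\<^esub> \<and> \<dots> \<and> dz\<^bsub>i\<^sub>p\<^esub>\<close> for \<open>I = {i\<^sub>1 < \<dots> < i\<^sub>p}\<close>
  and \<open>dz\<^sup>*\<close> is the conjugate of \<open>dz\<close>.
\<close>

type_synonym 'n form = "'n set \<Rightarrow> 'n set \<Rightarrow> complex^'n \<Rightarrow> complex"

text \<open>For \<open>j \<notin> I\<close> one has \<open>dz\<^sub>j \<and> dz\<^sub>I = insert_sign j I dz\<^bsub>I \<union> {j}\<^esub>\<close>.\<close>

definition insert_sign :: "'n::{finite,wellorder} \<Rightarrow> 'n set \<Rightarrow> complex" where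
  "insert_sign j I = (-1) ^ card {i \<in> I. i < j}"

definition del :: "'n::{finite,wellorder} form \<Rightarrow> 'n form" where
  "del \<omega> I J z = (\<Sum>j\<in>I. insert_sign j (I - {j}) * dz j (\<omega> (I - {j}) J) z)"

text \<open>The factor \<open>(-1)\<^bsup>card I\<^esup>\<close> comes from moving \<open>dz\<^sup>*\<^sub>j\<close> past \<open>dz\<^sub>I\<close>.\<close>

definition delbar :: "'n::{finite,wellorder} form \<Rightarrow> 'n form" where
  "delbar \<omega> I J z =
     (-1) ^ card I * (\<Sum>j\<in>J. insert_sign j (J - {j}) * dzbar j (\<omega> I (J - {j})) z)"

definition ext_d :: "'n::{finite,wellorder} form \<Rightarrow> 'n form" where
  "ext_d \<omega> I J z = del \<omega> I J z + delbar \<omega> I J z"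

definition ext_dc :: "'n::{finite,wellorder} form \<Rightarrow> 'n form" where
  "ext_dc \<omega> I J z = \<i> * (delbar \<omega> I J z - del \<omega> I J z)"

definition fun_times_form :: "(complex^'n \<Rightarrow> real) \<Rightarrow> 'n form \<Rightarrow> 'n form" where
  "fun_times_form h \<omega> I J z = complex_of_real (h z) * \<omega> I J z"

definition form_of_fun :: "(complex^'n \<Rightarrow> real) \<Rightarrow> 'n form" where
  "form_of_fun f I J z = (if I = {} \<and> J = {} then complex_of_real (f z) else 0)"

text \<open>Continuous, respectively smooth, forms with compact support.\<close>

definition cc_form :: "'n::finite form \<Rightarrow> bool" where
  "cc_form \<omega> \<longleftrightarrow>
     (\<forall>I J. continuous_on UNIV (\<omega> I J) \<and> compact (closure {z. \<omega> I J z \<noteq> 0}))"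

definition test_form :: "'n::finite form \<Rightarrow> bool" where
  "test_form \<omega> \<longleftrightarrow>
     (\<forall>I J. (\<forall>k. C_on k UNIV (\<omega> I J)) \<and> compact (closure {z. \<omega> I J z \<noteq> 0}))"

section \<open>Currents of order zero and Bedford--Taylor products\<close>

text \<open>
  A current of order zero is a continuous linear functional on the continuous forms with compact
  support (equivalently, a form with complex Radon measures as coefficients).  By convention it
  vanishes outside its domain, so that equality of currents is equality of functions.
\<close>

type_synonym 'n current = "'n form \<Rightarrow> complex"

definition order0_current :: "'n::finite current \<Rightarrow> bool" where
  "order0_current T \<longleftrightarrow>
     (\<forall>\<omega>. \<not> cc_form \<omega> \<longrightarrow> T \<omega> = 0) \<and>
     (\<forall>\<omega> \<eta>. cc_form \<omega> \<and> cc_form \<eta> \<longrightarrow> T (\<lambda>I J z. \<omega> I J z + \<eta> I J z) = T \<omega> + T \<eta>) \<and>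
     (\<forall>c \<omega>. cc_form \<omega> \<longrightarrow> T (\<lambda>I J z. c * \<omega> I J z) = c * T \<omega>) \<and>
     (\<forall>K. compact K \<longrightarrow> (\<exists>C. \<forall>\<omega> M. cc_form \<omega> \<and> (\<forall>I J z. norm (\<omega> I J z) \<le> M) \<and>
        (\<forall>I J z. z \<notin> K \<longrightarrow> \<omega> I J z = 0) \<longrightarrow> norm (T \<omega>) \<le> C * M))"

text \<open>
  The current \<open>1\<close>, that is, integration over \<open>\<complex>\<^sup>n\<close>.  The constant comes from \<open>dz \<and> dz\<^sup>* = -2\<i> dx \<and> dy\<close> and
  \<open>dz\<^sub>1 \<and> \<dots> \<and> dz\<^sub>n \<and> dz\<^sup>*\<^sub>1 \<and> \<dots> \<and> dz\<^sup>*\<^sub>n = (-1)\<^bsup>n(n-1)/2\<^esup> (dz\<^sub>1 \<and> dz\<^sup>*\<^sub>1) \<and> \<dots> \<and> (dz\<^sub>n \<and> dz\<^sup>*\<^sub>n)\<close>; the orientation is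
  \<open>dx\<^sub>1 \<and> dy\<^sub>1 \<and> \<dots> \<and> dx\<^sub>n \<and> dy\<^sub>n\<close>.
\<close>

definition current_one :: "'n::finite current" where
  "current_one \<omega> =
     (if cc_form \<omega>
      then (-1) ^ (CARD('n) * (CARD('n) - 1) div 2) * (- 2 * \<i>) ^ CARD('n) *
           (LINT z|lborel. \<omega> UNIV UNIV z)
      else 0)"

text \<open>
  Bedford--Taylor: \<open>dd\<^sup>c h \<and> T := dd\<^sup>c (h T)\<close> for a continuous plurisubharmonic function \<open>h\<close> and a closed
  positive current \<open>T\<close>.  The current \<open>dd\<^sup>c (h T)\<close> acts on test forms by \<open>\<phi> \<mapsto> T (h dd\<^sup>c \<phi>)\<close> (no sign, as \<open>T\<close>
  has even degree); it is again positive, hence has a unique extension to a current of order zero.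
\<close>

definition ddc_wedge :: "(complex^'n::{finite,wellorder} \<Rightarrow> real) \<Rightarrow> 'n current \<Rightarrow> 'n current" where
  "ddc_wedge h T = (THE S. order0_current S \<and>
     (\<forall>\<phi>. test_form \<phi> \<longrightarrow> S \<phi> = T (fun_times_form h (ext_d (ext_dc \<phi>)))))"

definition BT_product :: "(complex^'n::{finite,wellorder} \<Rightarrow> real) list \<Rightarrow> 'n current" where
  "BT_product hs = foldr ddc_wedge hs current_one"

text \<open>The positive Radon measure given by a positive current of bidegree \<open>(n, n)\<close>.\<close>

definition current_measure :: "'n::finite current \<Rightarrow> (complex^'n) measure" where
  "current_measure T = (THE \<mu>. sets \<mu> = sets borel \<and> (\<forall>K. compact K \<longrightarrow> emeasure \<mu> K < \<infinity>) \<and>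
     (\<forall>f :: complex^'n \<Rightarrow> real. continuous_on UNIV f \<and> compact (closure {z. f z \<noteq> 0}) \<longrightarrow>
        T (form_of_fun f) = complex_of_real (LINT z|\<mu>. f z)))"

text \<open>The bodies are \<open>A 1, \<dots>, A n\<close>; the volume of the unit ball of \<open>\<real>\<^sup>n\<close> is \<open>unit_ball_vol n\<close>.\<close>

definition mixed_pseudovolume :: "(nat \<Rightarrow> (complex^'n::{finite,wellorder}) set) \<Rightarrow> real" where
  "mixed_pseudovolume A =
     1 / (fact CARD('n) * unit_ball_vol (real CARD('n))) *
     measure (current_measure (BT_product (map (\<lambda>l. support_fun (A l)) [1..<CARD('n) + 1])))
       (cball 0 1)"

end

theory Submission
  imports Defs "HOL-Computational_Algebra.Polynomial" "HOL-Real_Asymp.Real_Asymp"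
begin

text \<open>
  Away from the origin the current \<open>dd\<^sup>c h\<^sub>1 \<and> \<dots> \<and> dd\<^sup>c h\<^sub>n\<close> has the density \<open>4\<^sup>n n! D\<^sub>n(Hess h\<^sub>1, \<dots>, Hess h\<^sub>n)\<close> with
  respect to Lebesgue measure.  A support function is homogeneous of degree one, so its complex Hessian
  is \<open>O(1/|z|)\<close>; hence the density is locally integrable, and by induction on the number of factors the
  current has no mass at the origin.  In polar coordinates the mass of the unit ball becomes the integral
  of \<open>D\<^sub>n(Hess h\<^sub>1, \<dots>, Hess h\<^sub>n) = (\<Sum>j k. (Hess h\<^sub>1)\<^sub>j\<^sub>k Z\<^sub>j\<^sub>k)\<close> (Laplace expansion) over the sphere, which by
  Stokes' theorem is \<open>n/2\<close> times the integral of \<open>b(u) = (\<Sum>j k. u\<^sup>*\<^sub>j (\<partial>h\<^sub>1/\<partial>z\<^sup>*\<^sub>k) Z\<^sub>j\<^sub>k)\<close>.  Since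
  \<open>\<Xi> = Z - tr(Z) I\<close> and \<open>Re \<langle>\<nabla>h\<^sub>1, u\<rangle> = h\<^sub>1\<close> by Euler's identity, \<open>Re \<langle>\<nabla>h\<^sub>1, \<Xi> u\<rangle> = 2 Re b - tr(Z) h\<^sub>1\<close>, where
  \<open>tr(Z) = D\<^sub>n(I, Hess h\<^sub>2, \<dots>, Hess h\<^sub>n)\<close>; so the hypothesis replaces \<open>2 Re b\<close> by \<open>h\<^sub>1 tr(Z)\<close>.
\<close>

section \<open>Iterated directional derivatives\<close>

text \<open>\<open>ddc_wedge\<close> and \<open>current_measure\<close> are definite descriptions,
  so existence and uniqueness must be proved before anything can be computed. For
  \<open>ddc_wedge\<close>, existence is an order-zero estimate for an explicit integral current T
  together with the identity T(h dd^c \<phi>) = (dd^c h \<and> T)(\<phi>) on all test forms;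
  uniqueness is density of test forms by mollification. The obstacle is that \<open>h\<close> is
  singular at the origin, where \<phi> need not vanish: a cut-off costs |z|^-2, \<open>h\<close>
  gains |z|, and with k factors present the integrand is O(|z|^-(k+1)), integrable since k + 1 <= n
  < 2n. Closedness and the identity feed each other: moving dd^c from \<phi> to \<open>h\<close>
  uses that T is closed, and the identity on exact forms makes the next current closed. Positivity
  of mixed discriminants is what turns the final current into a measure. The n/2 of Stokes' theorem
  is a ratio of radial integrals over an annulus; its n cancels against the 1/n from integrating
  r^(n-1) over the unit interval, and its 1/2 turns 4^n into 4^(n-1) once 2 Re b is
  replaced.\<close>

abbreviation dirder :: "'a::real_normed_vector \<Rightarrow> ('a \<Rightarrow> 'b::real_normed_vector) \<Rightarrow> 'a \<Rightarrow> 'b" where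
  "dirder v f x \<equiv> frechet_derivative f (at x) v"

lemma has_derivative_dirder:
  "f differentiable (at x) \<Longrightarrow> (f has_derivative (\<lambda>v. dirder v f x)) (at x)"
  using frechet_derivative_works by blast

lemma dirder_eq: "(f has_derivative f') (at x) \<Longrightarrow> dirder v f x = f' v"
  using frechet_derivative_at by metis

lemma dirder_cong_open:
  assumes "open S" "x \<in> S" "\<And>x. x \<in> S \<Longrightarrow> f x = g x"
  shows "dirder v f x = dirder v g x"
proof (cases "f differentiable (at x)")
  case True
  then show ?thesis using frechet_derivative_transform_within_open[OF True assms(1,2)] assms(3) by metis
next
  case False
  \<comment> \<open>Where \<open>f\<close> is not differentiable, \<open>frechet_derivative\<close>
    is a choice from an unsatisfiable predicate. That predicate depends only on the germ of the
    function, so even the arbitrary values agree.\<close>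
  have "(f has_derivative f') (at x) \<longleftrightarrow> (g has_derivative f') (at x)" for f'
    using has_derivative_transform_within_open[OF _ assms(1,2)] assms(3) by metis
  then show ?thesis by (simp add: frechet_derivative_def)
qed

lemma differentiable_cong_open:
  assumes "open S" "x \<in> S" "\<And>x. x \<in> S \<Longrightarrow> f x = g x" "f differentiable (at x)"
  shows "g differentiable (at x)"
  using assms has_derivative_transform_within_open[OF _ assms(1,2)] unfolding differentiable_def by metis

text \<open>\<open>C_on\<close> recurses through \<open>dirder v f\<close> as a function on the
  whole space, whereas a rule such as Leibniz's identifies the derivative only at points of
  \<open>S\<close>. All closure rules below transfer the formula with this congruence.\<close>

lemma C_on_cong:
  assumes "open S" "\<And>x. x \<in> S \<Longrightarrow> f x = g x" "C_on k S f"
  shows "C_on k S g"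
  using assms(2,3)
proof (induction k arbitrary: f g)
  case 0
  then show ?case by (simp cong: continuous_on_cong)
next
  case (Suc k)
  have "\<forall>x\<in>S. g differentiable (at x)"
    using differentiable_cong_open[OF assms(1)] Suc.prems by (metis C_on.simps(2))
  moreover have "C_on k S (dirder v g)" for v
  proof (rule Suc.IH[of "dirder v f"])
    show "dirder v f x = dirder v g x" if "x \<in> S" for x
      using dirder_cong_open[OF assms(1) that] Suc.prems by blast
  qed (use Suc.prems in auto)
  ultimately show ?case by simp
qed

lemma C_on_subset: "C_on k S f \<Longrightarrow> S' \<subseteq> S \<Longrightarrow> C_on k S' f"
  by (induction k arbitrary: f) (auto intro: continuous_on_subset)

lemma C_on_Suc_imp: "C_on (Suc k) S f \<Longrightarrow> C_on k S f"
proof (induction k arbitrary: f)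
  case 0
  then have "\<forall>x\<in>S. isCont f x" using differentiable_imp_continuous_within by auto
  then show ?case by (simp add: continuous_at_imp_continuous_on)
next
  case (Suc k)
  then show ?case by (metis C_on.simps(2))
qed

lemma C_on_le: "C_on k S f \<Longrightarrow> m \<le> k \<Longrightarrow> C_on m S f"
  by (induction k) (auto simp: le_Suc_eq simp del: C_on.simps intro: C_on_Suc_imp)

lemma C_on_imp_continuous_on: "C_on k S f \<Longrightarrow> continuous_on S f"
  using C_on_le[of k S f 0] by simp

lemma C_on_const: "C_on k S (\<lambda>x. c)"
  by (induction k arbitrary: c) auto

lemma C_on_bounded_linear_compose:
  assumes "open S" "bounded_linear T" "C_on k S f"
  shows "C_on k S (\<lambda>x. T (f x))"
  using assms(3)
proof (induction k arbitrary: f)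
  case 0
  then show ?case using assms(2) by (simp add: bounded_linear.continuous_on)
next
  case (Suc k)
  have der: "((\<lambda>x. T (f x)) has_derivative (\<lambda>v. T (dirder v f x))) (at x)" if "x \<in> S" for x
    using that Suc.prems by (intro bounded_linear.has_derivative[OF assms(2)] has_derivative_dirder) auto
  have "C_on k S (dirder v (\<lambda>x. T (f x)))" for v
    by (rule C_on_cong[OF assms(1), of "\<lambda>x. T (dirder v f x)"])
       (use Suc dirder_eq[OF der] in auto)
  then show ?case using der by (auto simp: differentiable_def)
qed

lemma C_on_bounded_linear:
  assumes "bounded_linear f" shows "C_on k S f"
proof (cases k)
  case 0
  then show ?thesis using assms by (simp add: linear_continuous_on)
next
  case (Suc n)
  have der: "(f has_derivative f) (at x)" for x using assms bounded_linear_imp_has_derivative by blast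
  have "dirder v f = (\<lambda>x. f v)" for v using dirder_eq[OF der] by auto
  then show ?thesis using Suc der C_on_const by (auto simp: differentiable_def simp del: C_on.simps(1))
qed

lemma C_on_add:
  assumes "open S" "C_on k S f" "C_on k S g"
  shows "C_on k S (\<lambda>x. f x + g x)"
  using assms(2,3)
proof (induction k arbitrary: f g)
  case 0
  then show ?case by (simp add: continuous_on_add)
next
  case (Suc k)
  have der: "((\<lambda>x. f x + g x) has_derivative (\<lambda>v. dirder v f x + dirder v g x)) (at x)" if "x \<in> S" for x
    using that Suc.prems by (intro has_derivative_add has_derivative_dirder) auto
  have "C_on k S (dirder v (\<lambda>x. f x + g x))" for v
    by (rule C_on_cong[OF assms(1), of "\<lambda>x. dirder v f x + dirder v g x"])
       (use Suc dirder_eq[OF der] in auto)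
  then show ?case using der by (auto simp: differentiable_def)
qed

lemma C_on_sum:
  assumes "open S" "\<And>i. i \<in> I \<Longrightarrow> C_on k S (f i)"
  shows "C_on k S (\<lambda>x. \<Sum>i\<in>I. f i x)"
  using assms(2)
  by (induction I rule: infinite_finite_induct) (auto simp: C_on_const intro!: C_on_add assms(1) simp del: C_on.simps)

lemma C_on_bilinear:
  assumes "open S" "bounded_bilinear b" "C_on k S f" "C_on k S g"
  shows "C_on k S (\<lambda>x. b (f x) (g x))"
  using assms(3,4)
proof (induction k arbitrary: f g)
  case 0
  then show ?case using assms(2) by (simp add: bounded_bilinear.continuous_on)
next
  case (Suc k)
  have der: "((\<lambda>x. b (f x) (g x)) has_derivative (\<lambda>v. b (f x) (dirder v g x) + b (dirder v f x) (g x))) (at x)"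
    if "x \<in> S" for x
    using that Suc.prems by (intro bounded_bilinear.FDERIV[OF assms(2)] has_derivative_dirder) auto
  have "C_on k S (dirder v (\<lambda>x. b (f x) (g x)))" for v
    by (rule C_on_cong[OF assms(1), of "\<lambda>x. b (f x) (dirder v g x) + b (dirder v f x) (g x)"])
       (use Suc.IH C_on_Suc_imp[OF Suc.prems(1)] C_on_Suc_imp[OF Suc.prems(2)] Suc.prems dirder_eq[OF der]
          in \<open>auto intro!: C_on_add assms(1)\<close>)
  then show ?case using der by (auto simp: differentiable_def)
qed

lemmas C_on_mult = C_on_bilinear[OF _ bounded_bilinear_mult]

lemma C_on_cmult:
  fixes f :: "_ \<Rightarrow> 'b::real_normed_algebra"
  shows "open S \<Longrightarrow> C_on k S f \<Longrightarrow> C_on k S (\<lambda>x. c * f x)"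
  by (rule C_on_mult[OF _ C_on_const])

lemma C_on_diff:
  assumes "open S" "C_on k S f" "C_on k S g"
  shows "C_on k S (\<lambda>x. f x - g x)"
  using C_on_add[OF assms(1,2) C_on_bounded_linear_compose[OF assms(1) bounded_linear_minus[OF bounded_linear_ident] assms(3)]]
  by simp

text \<open>The outer function comes as a whole sequence of successive derivatives because the
  induction on \<open>k\<close> differentiates \<open>F i\<close> and then needs the same claim for
  \<open>F (Suc i)\<close>.\<close>

lemma C_on_real_compose:
  fixes F :: "nat \<Rightarrow> real \<Rightarrow> real"
  assumes "open S" "\<And>i t. (F i has_real_derivative F (Suc i) t) (at t)" "C_on k S q"
  shows "C_on k S (\<lambda>x. F i (q x))"
  using assms(3)
proof (induction k arbitrary: i q)
  case 0
  have "continuous_on UNIV (F i)" using assms(2)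
    by (meson DERIV_isCont continuous_at_imp_continuous_on)
  then show ?case using 0 by (auto intro: continuous_on_compose2)
next
  case (Suc k)
  have der: "((\<lambda>x. F i (q x)) has_derivative (\<lambda>v. F (Suc i) (q x) * dirder v q x)) (at x)"
    if "x \<in> S" for x
  proof -
    have "(q has_derivative (\<lambda>v. dirder v q x)) (at x)"
      using that Suc.prems by (intro has_derivative_dirder) auto
    from has_derivative_compose[OF this] assms(2)[of i "q x", unfolded has_field_derivative_def]
    show ?thesis by blast
  qed
  have "C_on k S (dirder v (\<lambda>x. F i (q x)))" for v
    by (rule C_on_cong[OF assms(1), of "\<lambda>x. F (Suc i) (q x) * dirder v q x"])
       (use Suc.IH C_on_Suc_imp[OF Suc.prems] Suc.prems dirder_eq[OF der] in \<open>auto intro!: C_on_mult assms(1)\<close>)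
  then show ?case using der by (auto simp: differentiable_def)
qed

section \<open>Smooth cut-off functions and mollification\<close>

text \<open>The functions p(1/t) exp(-1/t), extended by 0 to t <= 0, are closed under
  differentiation. Smoothness of the classical flat function, the case p = 1, thus reduces to one
  derivative computation.\<close>

definition flat_poly :: "real poly \<Rightarrow> real \<Rightarrow> real" where
  "flat_poly p t = (if t \<le> 0 then 0 else poly p (1 / t) * exp (- (1 / t)))"

text \<open>The derivative of p(1/t) exp(-1/t) is t^-2 (p - p')(1/t) exp(-1/t); the factor X^2
  represents t^-2 as a polynomial in 1/t.\<close>

definition flat_step :: "real poly \<Rightarrow> real poly" where
  "flat_step p = [:0, 0, 1:] * (p - pderiv p)"

lemma poly_times_exp_neg_tendsto_0: "((\<lambda>x::real. poly p x * exp (- x)) \<longlongrightarrow> 0) at_top"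
proof -
  have mon: "((\<lambda>x::real. x ^ k * exp (- x)) \<longlongrightarrow> 0) at_top" for k :: nat
    using tendsto_power_div_exp_0[of k] by (simp add: exp_minus field_simps)
  have "((\<lambda>x. \<Sum>i\<le>degree p. coeff p i * (x ^ i * exp (- x))) \<longlongrightarrow> (\<Sum>i\<le>degree p. coeff p i * 0)) at_top"
    by (intro tendsto_sum tendsto_mult mon tendsto_const)
  then show ?thesis by (simp add: poly_altdef sum_distrib_right mult.assoc)
qed

lemma flat_poly_tendsto_0: "((\<lambda>t. poly p (1 / t) * exp (- (1 / t))) \<longlongrightarrow> 0) (at_right (0::real))"
  using filterlim_compose[OF poly_times_exp_neg_tendsto_0[of p] filterlim_inverse_at_top_right]
  by (simp add: inverse_eq_divide)

lemma flat_poly_deriv: "(flat_poly p has_real_derivative flat_poly (flat_step p) t) (at t)"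
proof -
  consider "t < 0" | "t > 0" | "t = 0" by linarith
  then show ?thesis
  proof cases
    case 1
    have "((\<lambda>_. 0) has_real_derivative 0) (at t)" by simp
    then have "(flat_poly p has_real_derivative 0) (at t)"
      by (rule DERIV_cong_ev[THEN iffD1, rotated -1])
         (auto simp: flat_poly_def eventually_nhds intro!: exI[of _ "{..<0}"] 1)
    then show ?thesis using 1 by (simp add: flat_poly_def)
  next
    case 2
    have "((\<lambda>t. poly p (1 / t) * exp (- (1 / t))) has_real_derivative
        poly p (1 / t) * (exp (- (1 / t)) * (1 / t^2)) + poly (pderiv p) (1 / t) * (- (1 / t^2)) * exp (- (1 / t))) (at t)"
      using 2 by (auto intro!: derivative_eq_intros DERIV_chain'[OF _ poly_DERIV] simp: power2_eq_square field_simps)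
    then have "(flat_poly p has_real_derivative
        poly p (1 / t) * (exp (- (1 / t)) * (1 / t^2)) + poly (pderiv p) (1 / t) * (- (1 / t^2)) * exp (- (1 / t))) (at t)"
      by (rule DERIV_cong_ev[THEN iffD1, rotated -1])
         (use 2 in \<open>auto simp: flat_poly_def eventually_nhds intro!: exI[of _ "{0<..}"]\<close>)
    moreover have "flat_poly (flat_step p) t =
        poly p (1 / t) * (exp (- (1 / t)) * (1 / t^2)) + poly (pderiv p) (1 / t) * (- (1 / t^2)) * exp (- (1 / t))"
      using 2 by (simp add: flat_poly_def flat_step_def power2_eq_square field_simps)
    ultimately show ?thesis by simp
  next
    case 3
    \<comment> \<open>Dividing by h multiplies the polynomial by X, so the difference quotient at 0
      is again of the flat form and tends to 0.\<close>
    have "((\<lambda>h. (flat_poly p (0 + h) - flat_poly p 0) / h) \<longlongrightarrow> 0) (at_right 0)"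
    proof (rule Lim_transform_eventually[OF flat_poly_tendsto_0[of "[:0,1:] * p"]])
      show "\<forall>\<^sub>F t in at_right 0. poly ([:0,1:] * p) (1 / t) * exp (- (1 / t)) = (flat_poly p (0 + t) - flat_poly p 0) / t"
        by (simp add: eventually_at_right_less eventually_at_filter flat_poly_def)
    qed
    moreover have "((\<lambda>h. (flat_poly p (0 + h) - flat_poly p 0) / h) \<longlongrightarrow> 0) (at_left 0)"
      by (rule tendsto_eventually) (simp add: eventually_at_filter flat_poly_def)
    ultimately have "((\<lambda>h. (flat_poly p (0 + h) - flat_poly p 0) / h) \<longlongrightarrow> 0) (at 0)"
      using filterlim_split_at by blast
    then show ?thesis using 3 by (simp add: DERIV_def flat_poly_def)
  qed
qed

definition flat :: "real \<Rightarrow> real" where "flat = flat_poly 1"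

lemma flat_eq: "flat t = (if t \<le> 0 then 0 else exp (- (1 / t)))"
  by (simp add: flat_def flat_poly_def)

lemma flat_nonneg: "flat t \<ge> 0" by (simp add: flat_eq)

lemma C_on_flat_poly:
  assumes "open S" "C_on k S q"
  shows "C_on k S (\<lambda>x. flat_poly p (q x))"
  using C_on_real_compose[where F = "\<lambda>i. flat_poly ((flat_step ^^ i) p)" and i=0, OF assms(1) _ assms(2)]
  by (simp add: flat_poly_deriv)

lemmas C_on_flat = C_on_flat_poly[of _ _ _ 1, folded flat_def]

lemma C_on_norm_sq:
  shows "C_on k UNIV (\<lambda>x::'a::euclidean_space. (norm x)\<^sup>2)"
proof -
  have "C_on k UNIV (\<lambda>x::'a. x \<bullet> x)"
    by (intro C_on_bilinear[OF _ bounded_bilinear_inner] C_on_bounded_linear) auto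
  then show ?thesis by (simp add: power2_norm_eq_inner)
qed

text \<open>Schwarz's theorem. The mixed second difference over the parallelogram spanned by t v and
  t w is t^2 times a value of either iterated derivative at a nearby point, by applying the mean
  value theorem twice in either order. Continuity of the second derivatives lets t tend to
  0.\<close>

lemma second_derivative_symmetric:
  fixes f :: "'a::real_normed_vector \<Rightarrow> real"
  assumes "open S" "C_on 2 S f" "z \<in> S"
  shows "dirder v (dirder w f) z = dirder w (dirder v f) z"
proof -
  have c2: "C_on (Suc (Suc 0)) S f" using assms(2) by (simp add: numeral_2_eq_2)
  define Df where "Df u x = dirder u f x" for u x
  define DD where "DD u w x = dirder u (Df w) x" for u w x
  have df: "(f has_derivative (\<lambda>u. Df u x)) (at x)" if "x \<in> S" for x
    using c2 that has_derivative_dirder unfolding Df_def by auto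
  have dd: "(Df w has_derivative (\<lambda>u. DD u w x)) (at x)" if "x \<in> S" for x w
    unfolding DD_def by (rule has_derivative_dirder) (use c2 that in \<open>simp add: Df_def [abs_def]\<close>)
  have cont: "continuous_on S (DD u w)" for u w
    using c2 by (simp add: DD_def [abs_def] Df_def [abs_def])
  obtain r where r: "r > 0" "ball z r \<subseteq> S" using assms(1,3) open_contains_ball by blast
  define B where "B = norm v + norm w + 1"
  have Bpos: "B > 0" unfolding B_def by (simp add: add_nonneg_pos)
  define \<delta> where "\<delta> = r / B"
  have inS: "z + s *\<^sub>R v + t *\<^sub>R w \<in> S" if "\<bar>s\<bar> < \<delta>" "\<bar>t\<bar> < \<delta>" for s t
  proof -
    have "norm (s *\<^sub>R v + t *\<^sub>R w) \<le> \<bar>s\<bar> * norm v + \<bar>t\<bar> * norm w"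
      by (rule norm_triangle_le) simp
    also have "\<dots> \<le> \<delta> * norm v + \<delta> * norm w" using that by (intro add_mono mult_right_mono) auto
    also have "\<dots> < \<delta> * B" unfolding B_def using r Bpos by (simp add: \<delta>_def algebra_simps)
    also have "\<dots> = r" using Bpos by (simp add: \<delta>_def)
    finally have "z + (s *\<^sub>R v + t *\<^sub>R w) \<in> ball z r"
      by (metis add_diff_cancel_left' dist_commute dist_norm mem_ball)
    then show ?thesis using r by (auto simp: add.assoc)
  qed
  \<comment> \<open>\<open>v\<close> and \<open>w\<close> are bound afresh, with the inclusion in
    \<open>S\<close> as a premise, so that the same statement serves with the two directions
    exchanged.\<close>
  have mv: "\<exists>a b. 0 < a \<and> a < t \<and> 0 < b \<and> b < t \<and>
     f (z + t *\<^sub>R v + t *\<^sub>R w) - f (z + t *\<^sub>R v) - f (z + t *\<^sub>R w) + f z = t * (t * DD v w (z + a *\<^sub>R v + b *\<^sub>R w))"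
    if t: "0 < t" "t < \<delta>" and inS: "\<And>s t. \<bar>s\<bar> < \<delta> \<Longrightarrow> \<bar>t\<bar> < \<delta> \<Longrightarrow> z + s *\<^sub>R v + t *\<^sub>R w \<in> S" for t v w
  proof -
    define g where "g s = f (z + t *\<^sub>R v + s *\<^sub>R w) - f (z + s *\<^sub>R w)" for s
    have fline: "((\<lambda>s. f (z + c *\<^sub>R v + s *\<^sub>R w)) has_real_derivative Df w (z + c *\<^sub>R v + s *\<^sub>R w)) (at s)"
      if "\<bar>c\<bar> < \<delta>" "\<bar>s\<bar> < \<delta>" for c s
    proof -
      have "((\<lambda>s. z + c *\<^sub>R v + s *\<^sub>R w) has_derivative (\<lambda>h. h *\<^sub>R w)) (at s)"
        by (auto intro!: derivative_eq_intros)
      from has_derivative_compose[OF this df[OF inS[OF that]]]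
      have "((\<lambda>s. f (z + c *\<^sub>R v + s *\<^sub>R w)) has_derivative (\<lambda>h. Df (h *\<^sub>R w) (z + c *\<^sub>R v + s *\<^sub>R w))) (at s)" .
      moreover have "Df (h *\<^sub>R w) (z + c *\<^sub>R v + s *\<^sub>R w) = Df w (z + c *\<^sub>R v + s *\<^sub>R w) * h" for h
        using linear_cmul[OF has_derivative_linear[OF df[OF inS[OF that]]]] by simp
      ultimately show ?thesis by (simp add: has_field_derivative_def)
    qed
    have dfline: "((\<lambda>s. Df w (z + s *\<^sub>R v + c *\<^sub>R w)) has_real_derivative DD v w (z + s *\<^sub>R v + c *\<^sub>R w)) (at s)"
      if "\<bar>c\<bar> < \<delta>" "\<bar>s\<bar> < \<delta>" for c s
    proof -
      have "((\<lambda>s. z + s *\<^sub>R v + c *\<^sub>R w) has_derivative (\<lambda>h. h *\<^sub>R v)) (at s)"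
        by (auto intro!: derivative_eq_intros)
      from has_derivative_compose[OF this dd[OF inS[OF that(2,1)]]]
      have "((\<lambda>s. Df w (z + s *\<^sub>R v + c *\<^sub>R w)) has_derivative (\<lambda>h. DD (h *\<^sub>R v) w (z + s *\<^sub>R v + c *\<^sub>R w))) (at s)" .
      moreover have "DD (h *\<^sub>R v) w (z + s *\<^sub>R v + c *\<^sub>R w) = DD v w (z + s *\<^sub>R v + c *\<^sub>R w) * h" for h
        using linear_cmul[OF has_derivative_linear[OF dd[OF inS[OF that(2,1)]]]] by simp
      ultimately show ?thesis by (simp add: has_field_derivative_def)
    qed
    have "(g has_real_derivative (Df w (z + t *\<^sub>R v + s *\<^sub>R w) - Df w (z + s *\<^sub>R w))) (at s)"
      if "0 \<le> s" "s \<le> t" for s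
      unfolding g_def using fline[of t s] fline[of 0 s] that t by (auto intro!: DERIV_diff)
    from MVT2[OF t(1) this] obtain b where b: "0 < b" "b < t"
      "g t - g 0 = t * (Df w (z + t *\<^sub>R v + b *\<^sub>R w) - Df w (z + b *\<^sub>R w))" by auto
    have "((\<lambda>s. Df w (z + s *\<^sub>R v + b *\<^sub>R w)) has_real_derivative DD v w (z + s *\<^sub>R v + b *\<^sub>R w)) (at s)"
      if "0 \<le> s" "s \<le> t" for s using dfline[of b s] that b t by auto
    from MVT2[OF t(1) this] obtain a where a: "0 < a" "a < t"
      "Df w (z + t *\<^sub>R v + b *\<^sub>R w) - Df w (z + b *\<^sub>R w) = t * DD v w (z + a *\<^sub>R v + b *\<^sub>R w)" by auto
    show ?thesis using a b by (intro exI[of _ a] exI[of _ b]) (auto simp: g_def)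
  qed
  have \<delta>pos: "\<delta> > 0" using r Bpos by (simp add: \<delta>_def)
  have inS': "\<And>s t. \<bar>s\<bar> < \<delta> \<Longrightarrow> \<bar>t\<bar> < \<delta> \<Longrightarrow> z + s *\<^sub>R w + t *\<^sub>R v \<in> S"
  proof -
    fix s t assume "\<bar>s\<bar> < \<delta>" "\<bar>t\<bar> < \<delta>"
    then have "z + t *\<^sub>R v + s *\<^sub>R w \<in> S" by (intro inS)
    then show "z + s *\<^sub>R w + t *\<^sub>R v \<in> S" by (simp add: add.commute add.left_commute)
  qed
  define T where "T n = \<delta> / (real n + 2)" for n
  have T: "0 < T n" "T n < \<delta>" for n using \<delta>pos by (auto simp: T_def field_simps intro: add_pos_nonneg)
  have Tlim: "T \<longlonglongrightarrow> 0" unfolding T_def by real_asymp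
  have "\<forall>n. \<exists>a b. 0 < a \<and> a < T n \<and> 0 < b \<and> b < T n \<and>
     f (z + T n *\<^sub>R v + T n *\<^sub>R w) - f (z + T n *\<^sub>R v) - f (z + T n *\<^sub>R w) + f z = T n * (T n * DD v w (z + a *\<^sub>R v + b *\<^sub>R w))"
    using mv[OF T inS] by blast
  then obtain a b where ab: "\<And>n. 0 < a n \<and> a n < T n \<and> 0 < b n \<and> b n < T n"
     "\<And>n. f (z + T n *\<^sub>R v + T n *\<^sub>R w) - f (z + T n *\<^sub>R v) - f (z + T n *\<^sub>R w) + f z = T n * (T n * DD v w (z + a n *\<^sub>R v + b n *\<^sub>R w))"
    by metis
  have "\<forall>n. \<exists>a b. 0 < a \<and> a < T n \<and> 0 < b \<and> b < T n \<and>
     f (z + T n *\<^sub>R w + T n *\<^sub>R v) - f (z + T n *\<^sub>R w) - f (z + T n *\<^sub>R v) + f z = T n * (T n * DD w v (z + a *\<^sub>R w + b *\<^sub>R v))"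
    using mv[OF T inS'] by blast
  then obtain c d where cd: "\<And>n. 0 < c n \<and> c n < T n \<and> 0 < d n \<and> d n < T n"
     "\<And>n. f (z + T n *\<^sub>R w + T n *\<^sub>R v) - f (z + T n *\<^sub>R w) - f (z + T n *\<^sub>R v) + f z = T n * (T n * DD w v (z + c n *\<^sub>R w + d n *\<^sub>R v))"
    by metis
  have sq: "s \<longlonglongrightarrow> 0" if "\<And>n. 0 < s n \<and> s n < T n" for s
    by (rule tendsto_sandwich[OF _ _ tendsto_const Tlim]) (use that less_imp_le in \<open>auto intro!: always_eventually\<close>)
  have lim: "(\<lambda>n. DD u u' (z + p n *\<^sub>R x + q n *\<^sub>R y)) \<longlonglongrightarrow> DD u u' z" if "p \<longlonglongrightarrow> 0" "q \<longlonglongrightarrow> 0" for p q x y u u'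
  proof -
    have "isCont (DD u u') z" using cont assms(1,3) continuous_on_eq_continuous_at by blast
    moreover have "(\<lambda>n. z + p n *\<^sub>R x + q n *\<^sub>R y) \<longlonglongrightarrow> z + 0 *\<^sub>R x + 0 *\<^sub>R y"
      by (intro tendsto_intros that)
    ultimately show ?thesis using isCont_tendsto_compose by fastforce
  qed
  have "DD v w (z + a n *\<^sub>R v + b n *\<^sub>R w) = DD w v (z + c n *\<^sub>R w + d n *\<^sub>R v)" for n
    using ab(2)[of n] cd(2)[of n] T(1)[of n] by (simp add: algebra_simps)
  then have "(\<lambda>n. DD v w (z + a n *\<^sub>R v + b n *\<^sub>R w)) = (\<lambda>n. DD w v (z + c n *\<^sub>R w + d n *\<^sub>R v))" by auto
  moreover have "(\<lambda>n. DD v w (z + a n *\<^sub>R v + b n *\<^sub>R w)) \<longlonglongrightarrow> DD v w z"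
    using ab(1) by (intro lim sq) auto
  moreover have "(\<lambda>n. DD w v (z + c n *\<^sub>R w + d n *\<^sub>R v)) \<longlonglongrightarrow> DD w v z"
    using cd(1) by (intro lim sq) auto
  ultimately have "DD v w z = DD w v z" using LIMSEQ_unique by metis
  then show ?thesis by (simp add: DD_def Df_def [abs_def])
qed

section \<open>Integrals of compactly supported functions\<close>

lemma integrable_continuous_bounded_support:
  fixes f :: "'a::euclidean_space \<Rightarrow> 'b::{banach,second_countable_topology}"
  assumes "continuous_on UNIV f" "bounded {x. f x \<noteq> 0}"
  shows "integrable lborel f"
proof -
  have "integrable lborel (\<lambda>x. indicator (closure {x. f x \<noteq> 0}) x *\<^sub>R f x)"
    by (rule borel_integrable_compact)
      (use assms continuous_on_subset in \<open>auto simp: compact_closure\<close>)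
  moreover have "(\<lambda>x. indicator (closure {x. f x \<noteq> 0}) x *\<^sub>R f x) = f"
    using closure_subset[of "{x. f x \<noteq> 0}"] by (auto simp: indicator_def fun_eq_iff)
  ultimately show ?thesis by simp
qed

lemma continuous_bounded_support_bounded:
  fixes f :: "'a::euclidean_space \<Rightarrow> 'b::real_normed_vector"
  assumes "continuous_on UNIV f" "bounded {x. f x \<noteq> 0}"
  obtains M where "\<And>x. norm (f x) \<le> M" "M \<ge> 0"
proof -
  have "compact (f ` closure {x. f x \<noteq> 0})"
    using assms by (intro compact_continuous_image) (auto simp: compact_closure intro: continuous_on_subset)
  then obtain M where M: "\<And>x. x \<in> closure {x. f x \<noteq> 0} \<Longrightarrow> norm (f x) \<le> M"
    using compact_imp_bounded bounded_iff by (metis imageI)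
  have "norm (f x) \<le> max M 0" for x
  proof (cases "f x = 0")
    case False
    then have "x \<in> closure {x. f x \<noteq> 0}" using closure_subset by fastforce
    from M[OF this] show ?thesis by simp
  qed simp
  then show ?thesis using that by (metis max.cobounded2)
qed

lemma bounded_support_dirder:
  assumes "bounded {x. f x \<noteq> 0}"
  shows "bounded {x. dirder v f x \<noteq> 0}"
proof -
  have "dirder v f x = 0" if "x \<notin> closure {x. f x \<noteq> 0}" for x
  proof -
    have "dirder v f x = dirder v (\<lambda>_. 0) x"
      by (rule dirder_cong_open[of "- closure {x. f x \<noteq> 0}"])
        (use that closure_subset[of "{x. f x \<noteq> 0}"] in auto)
    then show ?thesis by simp
  qed
  then have "{x. dirder v f x \<noteq> 0} \<subseteq> closure {x. f x \<noteq> 0}" by auto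
  then show ?thesis using assms bounded_closure bounded_subset by blast
qed

lemma integral_lborel_translation:
  fixes f :: "'a::euclidean_space \<Rightarrow> 'b::{banach,second_countable_topology}"
  assumes [measurable]: "f \<in> borel_measurable borel"
  shows "(LINT x|lborel. f (c + x)) = (LINT x|lborel. f x)"
proof -
  have "(LINT x|lborel. f x) = (LINT x|distr lborel borel ((+) c). f x)" by (simp add: lborel_distr_plus)
  also have "\<dots> = (LINT x|lborel. f (c + x))" by (rule integral_distr) auto
  finally show ?thesis by simp
qed

lemma integral_lborel_reflect:
  fixes f :: "'a::euclidean_space \<Rightarrow> 'b::{banach,second_countable_topology}"
  assumes [measurable]: "f \<in> borel_measurable borel"
  shows "(LINT x|lborel. f (c - x)) = (LINT x|lborel. f x)"
proof -
  have "lborel = distr lborel borel (\<lambda>x::'a. c - x)"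
    using lborel_affine[of "-1" c] by (simp add: density_1)
  then have "(LINT x|lborel. f x) = (LINT x|distr lborel borel (\<lambda>x. c - x). f x)" by simp
  also have "\<dots> = (LINT x|lborel. f (c - x))" by (rule integral_distr) auto
  finally show ?thesis by simp
qed

text \<open>The difference quotients in direction \<open>v\<close> have integral 0 by translation
  invariance. They are dominated because \<open>f\<close> is Lipschitz along \<open>v\<close> and
  all the translates used live in one ball, so the integral of their limit vanishes as well.\<close>

lemma integral_dirder_eq_0:
  fixes f :: "'a::euclidean_space \<Rightarrow> 'b::{banach,second_countable_topology}"
  assumes "C_on 1 UNIV f" "bounded {x. f x \<noteq> 0}"
  shows "(LINT x|lborel. dirder v f x) = 0"
proof -
  have dif: "f differentiable (at x)" and cont': "continuous_on UNIV (dirder v f)" for x v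
    using assms(1) by auto
  have cont: "continuous_on UNIV f" using C_on_imp_continuous_on[OF assms(1)] .
  have [measurable]: "f \<in> borel_measurable borel" "dirder v f \<in> borel_measurable borel"
    using cont cont' borel_measurable_continuous_onI by blast+
  obtain M where M: "\<And>x. norm (dirder v f x) \<le> M" "M \<ge> 0"
    using continuous_bounded_support_bounded[OF cont' bounded_support_dirder[OF assms(2)]] by metis
  obtain R where R: "\<And>x. f x \<noteq> 0 \<Longrightarrow> norm x \<le> R" using assms(2) by (auto simp: bounded_iff)
  define q where "q n x = real (Suc n) *\<^sub>R (f ((1 / real (Suc n)) *\<^sub>R v + x) - f x)" for n x
  have line: "((\<lambda>t. f (t *\<^sub>R v + x)) has_derivative (\<lambda>h. h *\<^sub>R dirder v f (t *\<^sub>R v + x))) (at t)" for t x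
  proof -
    have "((\<lambda>s. s *\<^sub>R v + x) has_derivative (\<lambda>h. h *\<^sub>R v)) (at t)"
      by (auto intro!: derivative_eq_intros)
    from has_derivative_compose[OF this has_derivative_dirder[OF dif]]
    show ?thesis using linear_cmul[OF linear_frechet_derivative[OF dif]] by simp
  qed
  have lip: "norm (f (t *\<^sub>R v + x) - f x) \<le> M * \<bar>t\<bar>" for t x
  proof -
    have "norm (f (t *\<^sub>R v + x) - f (0 *\<^sub>R v + x)) \<le> M * norm (t - 0)"
      by (rule differentiable_bound[of UNIV "\<lambda>t. f (t *\<^sub>R v + x)" "\<lambda>t h. h *\<^sub>R dirder v f (t *\<^sub>R v + x)"])
        (use line in \<open>auto intro!: onorm_le simp: mult.commute[of M] mult_left_mono[OF M(1)]\<close>)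
    then show ?thesis by simp
  qed
  have vec: "((\<lambda>h. (g h - g 0) /\<^sub>R h) \<longlongrightarrow> D) (at 0)"
    if "(g has_vector_derivative D) (at 0)" for g :: "real \<Rightarrow> 'b" and D
  proof -
    have "((\<lambda>h. norm (g h - g 0 - h *\<^sub>R D) / norm h) \<longlongrightarrow> 0) (at 0)"
      using that by (simp add: has_vector_derivative_def has_derivative_at)
    then have "((\<lambda>h. norm ((g h - g 0) /\<^sub>R h - D)) \<longlongrightarrow> 0) (at 0)"
    proof (rule Lim_transform_eventually)
      have "norm (g h - g 0 - h *\<^sub>R D) / norm h = norm ((g h - g 0) /\<^sub>R h - D)" if "h \<noteq> 0" for h
      proof -
        have "(g h - g 0) /\<^sub>R h - D = inverse h *\<^sub>R (g h - g 0 - h *\<^sub>R D)"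
          using that by (simp add: scaleR_diff_right)
        then show ?thesis by (simp add: divide_inverse_commute)
      qed
      then show "\<forall>\<^sub>F h in at 0. norm (g h - g 0 - h *\<^sub>R D) / norm h = norm ((g h - g 0) /\<^sub>R h - D)"
        by (simp add: eventually_at_filter)
    qed
    from LIM_zero_cancel[OF tendsto_norm_zero_cancel[OF this]] show ?thesis .
  qed
  have "(\<lambda>n. LINT x|lborel. q n x) \<longlonglongrightarrow> (LINT x|lborel. dirder v f x)"
  proof (rule integral_dominated_convergence[where w = "\<lambda>x. M * indicator (cball 0 (R + norm v)) x"])
    show "integrable lborel (\<lambda>x::'a. M * indicator (cball 0 (R + norm v)) x)"
      by (intro integrable_mult_right integrable_real_indicator emeasure_lborel_cball_finite) auto
    show "AE x in lborel. (\<lambda>i. q i x) \<longlonglongrightarrow> dirder v f x"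
    proof (rule AE_I2)
      fix x
      have "((\<lambda>t. f (t *\<^sub>R v + x)) has_vector_derivative dirder v f x) (at 0)"
        using line[of x 0] by (simp add: has_vector_derivative_def)
      then have "((\<lambda>h. (f (h *\<^sub>R v + x) - f x) /\<^sub>R h) \<longlongrightarrow> dirder v f x) (at 0)"
        using vec[of "\<lambda>h. f (h *\<^sub>R v + x)"] by simp
      moreover have "filterlim (\<lambda>n. 1 / real (Suc n)) (at 0) sequentially"
        using LIMSEQ_Suc[OF lim_1_over_n[where 'a=real]] by (auto simp: filterlim_at)
      ultimately have "(\<lambda>n. (f ((1 / real (Suc n)) *\<^sub>R v + x) - f x) /\<^sub>R (1 / real (Suc n))) \<longlonglongrightarrow> dirder v f x"
        by (rule filterlim_compose)
      then show "(\<lambda>i. q i x) \<longlonglongrightarrow> dirder v f x" by (simp add: q_def)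
    qed
    show "AE x in lborel. norm (q i x) \<le> M * indicator (cball 0 (R + norm v)) x" for i
    proof (rule AE_I2)
      fix x
      have "norm (q i x) \<le> real (Suc i) * (M * (1 / real (Suc i)))"
        unfolding q_def norm_scaleR using lip[of "1 / real (Suc i)" x]
        by (intro mult_mono) auto
      then have b: "norm (q i x) \<le> M" by simp
      have "q i x = 0" if "norm x > R + norm v"
      proof -
        have "norm ((1 / real (Suc i)) *\<^sub>R v) \<le> norm v" by (simp add: field_simps mult_left_le)
        then have "norm ((1 / real (Suc i)) *\<^sub>R v + x) > R" using that
          using norm_triangle_ineq4[of "(1 / real (Suc i)) *\<^sub>R v + x" "(1 / real (Suc i)) *\<^sub>R v"] by simp
        moreover have "norm x > R" using that norm_ge_zero[of v] by linarith
        ultimately have "f ((1 / real (Suc i)) *\<^sub>R v + x) = 0" "f x = 0" using R by force+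
        then show ?thesis by (simp add: q_def)
      qed
      then show "norm (q i x) \<le> M * indicator (cball 0 (R + norm v)) x"
        using b by (cases "norm x > R + norm v") auto
    qed
  qed (auto simp: q_def)
  moreover have "(LINT x|lborel. q n x) = 0" for n
  proof -
    have int: "integrable lborel f" using integrable_continuous_bounded_support[OF cont assms(2)] .
    have "integrable lborel (\<lambda>x. f (c + x))" for c
      using int integrable_distr_eq[of "(+) c" lborel borel f] lborel_distr_plus[of c] by simp
    then show ?thesis unfolding q_def using int
      by (simp add: integral_lborel_translation)
  qed
  ultimately have "(\<lambda>n::nat. 0) \<longlonglongrightarrow> (LINT x|lborel. dirder v f x)" by simp
  then show ?thesis using LIMSEQ_unique tendsto_const by blast
qed

section \<open>Convolution and mollifiers\<close>

definition conv :: "('a::euclidean_space \<Rightarrow> real) \<Rightarrow> ('a \<Rightarrow> 'b::euclidean_space) \<Rightarrow> 'a \<Rightarrow> 'b" where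
  "conv \<rho> f x = (LINT y|lborel. \<rho> (x - y) *\<^sub>R f y)"

lemma conv_integrable:
  fixes f :: "'a::euclidean_space \<Rightarrow> 'b::euclidean_space"
  assumes "continuous_on UNIV f" "bounded {x. f x \<noteq> 0}" "continuous_on UNIV \<rho>"
  shows "integrable lborel (\<lambda>y. \<rho> (x - y) *\<^sub>R f y)"
proof (rule integrable_continuous_bounded_support)
  have "continuous_on UNIV (\<lambda>y. \<rho> (x - y))"
    by (rule continuous_on_compose2[OF assms(3)]) (auto intro!: continuous_intros)
  then show "continuous_on UNIV (\<lambda>y. \<rho> (x - y) *\<^sub>R f y)"
    using assms by (intro continuous_intros) auto
  show "bounded {y. \<rho> (x - y) *\<^sub>R f y \<noteq> 0}"
    by (rule bounded_subset[OF assms(2)]) auto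
qed

text \<open>Differentiation under the integral sign over a box that contains the support of
  \<open>f\<close>. The derivative falls on the kernel, which is how a merely continuous
  \<open>f\<close> becomes smooth in \<open>C_on_conv\<close>.\<close>

lemma conv_has_derivative:
  fixes f :: "'a::euclidean_space \<Rightarrow> 'b::euclidean_space"
  assumes f: "continuous_on UNIV f" "bounded {x. f x \<noteq> 0}" and \<rho>: "C_on 1 UNIV \<rho>"
  shows "(conv \<rho> f has_derivative (\<lambda>v. conv (dirder v \<rho>) f x)) (at x)"
proof -
  obtain a where a: "{x. f x \<noteq> 0} \<subseteq> cbox (- a) a" using bounded_subset_cbox_symmetric[OF f(2)] by blast
  have dif: "\<rho> differentiable (at x)" and cont': "continuous_on UNIV (dirder v \<rho>)" for x v
    using \<rho> by auto
  have cont: "continuous_on UNIV \<rho>" using C_on_imp_continuous_on[OF \<rho>] .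
  have conv_eq: "conv r f x = integral (cbox (- a) a) (\<lambda>y. r (x - y) *\<^sub>R f y)"
    if "continuous_on UNIV r" for r x
  proof -
    have "conv r f x = integral UNIV (\<lambda>y. r (x - y) *\<^sub>R f y)"
      unfolding conv_def using integral_lborel[OF conv_integrable[OF f that]] by simp
    also have "\<dots> = integral UNIV (\<lambda>y. if y \<in> cbox (-a) a then r (x - y) *\<^sub>R f y else 0)"
      using a by (intro integral_cong) auto
    finally show ?thesis by (simp add: integral_restrict_UNIV)
  qed
  define f' where "f' x t = Blinfun (\<lambda>v. dirder v \<rho> (x - t) *\<^sub>R f t)" for x t
  have bl: "bounded_linear (\<lambda>v. dirder v \<rho> (x - t) *\<^sub>R f t)" for x t
    using has_derivative_bounded_linear[OF has_derivative_dirder[OF dif]]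
    by (intro bounded_linear_scaleR_const)
  have f': "blinfun_apply (f' x t) = (\<lambda>v. dirder v \<rho> (x - t) *\<^sub>R f t)" for x t
    unfolding f'_def using bl bounded_linear_Blinfun_apply by blast
  have der: "((\<lambda>x. \<rho> (x - t) *\<^sub>R f t) has_derivative blinfun_apply (f' x t)) (at x within UNIV)" for x t
  proof -
    have "((\<lambda>x. x - t) has_derivative (\<lambda>v. v)) (at x)" by (auto intro!: derivative_eq_intros)
    from has_derivative_compose[OF this has_derivative_dirder[OF dif]]
    show ?thesis unfolding f' by (auto intro: has_derivative_scaleR_left)
  qed
  have cf': "continuous_on (UNIV \<times> cbox (- a) a) (\<lambda>(x, t). f' x t)"
  proof (rule continuous_on_blinfun_componentwise)
    fix i :: 'a assume "i \<in> Basis"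
    have "continuous_on (UNIV \<times> cbox (- a) a) (\<lambda>p. dirder i \<rho> (fst p - snd p))"
      by (rule continuous_on_compose2[OF cont']) (auto intro!: continuous_intros)
    moreover have "continuous_on (UNIV \<times> cbox (- a) a) (\<lambda>p. f (snd p))"
      by (rule continuous_on_compose2[OF f(1)]) (auto intro!: continuous_intros)
    ultimately show "continuous_on (UNIV \<times> cbox (- a) a) (\<lambda>p. blinfun_apply (case p of (x, t) \<Rightarrow> f' x t) i)"
      by (auto simp: split_beta f' intro!: continuous_intros)
  qed
  have cont1: "continuous_on (cbox (-a) a) (\<lambda>t. \<rho> (x - t) *\<^sub>R f t)" for x
  proof -
    have "continuous_on (cbox (- a) a) (\<lambda>p. \<rho> (x - p))"
      by (rule continuous_on_compose2[OF cont]) (auto intro!: continuous_intros)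
    then show ?thesis using continuous_on_subset[OF f(1)] by (intro continuous_intros) auto
  qed
  have "((\<lambda>x. integral (cbox (- a) a) (\<lambda>t. \<rho> (x - t) *\<^sub>R f t)) has_derivative
     blinfun_apply (integral (cbox (- a) a) (f' x))) (at x within UNIV)"
    by (rule leibniz_rule[OF der _ cf']) (auto intro: integrable_continuous cont1)
  moreover have "blinfun_apply (integral (cbox (- a) a) (f' x)) v = conv (dirder v \<rho>) f x" for v
  proof -
    have "continuous_on (cbox (-a) a) (f' x)"
      using continuous_on_compose2[OF cf', of "cbox (-a) a" "\<lambda>t. (x,t)"]
      by (auto simp: continuous_on_Pair continuous_on_const continuous_on_id)
    then have "blinfun_apply (integral (cbox (- a) a) (f' x)) v = integral (cbox (- a) a) (\<lambda>t. f' x t v)"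
      by (intro blinfun_apply_integral integrable_continuous)
    then show ?thesis by (simp add: f' conv_eq[OF cont'])
  qed
  moreover have "conv \<rho> f = (\<lambda>x. integral (cbox (- a) a) (\<lambda>t. \<rho> (x - t) *\<^sub>R f t))"
    using conv_eq[OF cont] by blast
  moreover have "blinfun_apply (integral (cbox (- a) a) (f' x)) = (\<lambda>v. conv (dirder v \<rho>) f x)"
    using calculation(2) by blast
  ultimately show ?thesis by simp
qed

lemma dirder_conv:
  fixes f :: "'a::euclidean_space \<Rightarrow> 'b::euclidean_space"
  assumes "continuous_on UNIV f" "bounded {x. f x \<noteq> 0}" "C_on 1 UNIV \<rho>"
  shows "dirder v (conv \<rho> f) x = conv (dirder v \<rho>) f x"
  using dirder_eq[OF conv_has_derivative[OF assms]] .

lemma C_on_conv: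
  fixes f :: "'a::euclidean_space \<Rightarrow> 'b::euclidean_space"
  assumes f: "continuous_on UNIV f" "bounded {x. f x \<noteq> 0}" and "\<And>k. C_on k UNIV \<rho>"
  shows "C_on k UNIV (conv \<rho> f)"
  using assms(3)
proof (induction k arbitrary: \<rho>)
  case 0
  show ?case using has_derivative_continuous[OF conv_has_derivative[OF f 0]]
    by (simp add: continuous_at_imp_continuous_on)
next
  case (Suc k)
  have "C_on k UNIV (dirder v \<rho>)" for k v using Suc.prems[of "Suc k"] by simp
  then have "C_on k UNIV (conv (dirder v \<rho>) f)" for v by (rule Suc.IH)
  moreover have "dirder v (conv \<rho> f) = conv (dirder v \<rho>) f" for v
    using dirder_conv[OF f Suc.prems] by blast
  ultimately show ?case using conv_has_derivative[OF f Suc.prems]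
    by (auto simp: differentiable_def simp del: C_on.simps(1))
qed

text \<open>Integration by parts: the derivative of y -> \<rho>(x - y) f(y) has integral 0, and the
  minus sign of the chain rule in x - y puts the two resulting integrals on opposite sides.\<close>

lemma conv_dirder:
  fixes f :: "'a::euclidean_space \<Rightarrow> 'b::euclidean_space"
  assumes f: "C_on 1 UNIV f" "bounded {x. f x \<noteq> 0}" and \<rho>: "C_on 1 UNIV \<rho>"
  shows "conv (dirder v \<rho>) f x = conv \<rho> (dirder v f) x"
proof -
  have cf: "continuous_on UNIV f" and c\<rho>: "continuous_on UNIV \<rho>"
    using f \<rho> C_on_imp_continuous_on by blast+
  have cf': "continuous_on UNIV (dirder v f)" and c\<rho>': "continuous_on UNIV (dirder v \<rho>)" for v
    using f \<rho> by auto
  define g where "g y = \<rho> (x - y) *\<^sub>R f y" for y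
  have der: "(g has_derivative (\<lambda>v. \<rho> (x - y) *\<^sub>R dirder v f y + (- dirder v \<rho> (x - y)) *\<^sub>R f y)) (at y)" for y
  proof -
    have "((\<lambda>y. x - y) has_derivative (\<lambda>v. - v)) (at y)" by (auto intro!: derivative_eq_intros)
    from has_derivative_compose[OF this has_derivative_dirder[of \<rho>]]
    have "((\<lambda>y. \<rho> (x - y)) has_derivative (\<lambda>v. dirder (- v) \<rho> (x - y))) (at y)" using \<rho> by simp
    moreover have "dirder (- v) \<rho> (x - y) = - dirder v \<rho> (x - y)" for v y
      using \<rho> linear_neg[OF linear_frechet_derivative] by auto
    ultimately show ?thesis unfolding g_def using f has_derivative_dirder[of f y]
      by (intro has_derivative_scaleR) auto
  qed
  have dg: "dirder v g y = \<rho> (x - y) *\<^sub>R dirder v f y + (- dirder v \<rho> (x - y)) *\<^sub>R f y" for y v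
    using dirder_eq[OF der] .
  have "C_on 1 UNIV g"
  proof -
    have "continuous_on UNIV (dirder v g)" for v
    proof -
      have c1: "continuous_on UNIV (\<lambda>y. \<rho> (x - y))"
        by (rule continuous_on_compose2[OF c\<rho>]) (auto intro!: continuous_intros)
      have c2: "continuous_on UNIV (\<lambda>y. dirder v \<rho> (x - y))"
        by (rule continuous_on_compose2[OF c\<rho>', where f="\<lambda>y. x - y"]) (auto intro!: continuous_intros)
      from continuous_on_add[OF continuous_on_scaleR[OF c1 cf'[of v]] continuous_on_scaleR[OF continuous_on_minus[OF c2] cf]]
      show ?thesis by (simp add: dg)
    qed
    then show ?thesis using der by (auto simp: differentiable_def)
  qed
  moreover have "bounded {y. g y \<noteq> 0}"
    by (rule bounded_subset[OF f(2)]) (auto simp: g_def)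
  ultimately have "(LINT y|lborel. dirder v g y) = 0" by (rule integral_dirder_eq_0)
  moreover have "(LINT y|lborel. dirder v g y) =
     (LINT y|lborel. \<rho> (x - y) *\<^sub>R dirder v f y) - (LINT y|lborel. dirder v \<rho> (x - y) *\<^sub>R f y)"
    unfolding dg using conv_integrable[OF cf' bounded_support_dirder[OF f(2)] c\<rho>, of x] conv_integrable[OF cf f(2) c\<rho>', of x]
    by simp
  ultimately show ?thesis by (simp add: conv_def)
qed

lemma mollifier_exists:
  assumes "\<delta> > 0"
  shows "\<exists>\<rho>::'a::euclidean_space \<Rightarrow> real. (\<forall>k. C_on k UNIV \<rho>) \<and> (\<forall>x. \<rho> x \<ge> 0) \<and>
    (\<forall>x. norm x \<ge> \<delta> \<longrightarrow> \<rho> x = 0) \<and> (LINT x|lborel. \<rho> x) = 1"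
proof -
  define r where "r x = flat (\<delta>\<^sup>2 - (norm x)\<^sup>2)" for x :: 'a
  have smooth: "C_on k UNIV r" for k
    unfolding r_def by (intro C_on_flat C_on_diff C_on_const C_on_norm_sq open_UNIV)
  have zero: "r x = 0" if "norm x \<ge> \<delta>" for x
  proof -
    have "\<delta>\<^sup>2 \<le> (norm x)\<^sup>2" using that assms by (intro power_mono) auto
    then show ?thesis by (simp add: r_def flat_eq)
  qed
  have pos: "r x > 0" if "norm x < \<delta>" for x
  proof -
    have "(norm x)\<^sup>2 < \<delta>\<^sup>2" using that assms by (intro power_strict_mono) auto
    then show ?thesis by (simp add: r_def flat_eq)
  qed
  have nn: "r x \<ge> 0" for x by (simp add: r_def flat_nonneg)
  have "bounded {x. r x \<noteq> 0}" unfolding bounded_iff using zero by (intro exI[of _ \<delta>]) force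
  then have int: "integrable lborel r"
    using integrable_continuous_bounded_support C_on_imp_continuous_on[OF smooth] by blast
  have "(LINT x|lborel. r x) \<noteq> 0"
  proof
    assume "(LINT x|lborel. r x) = 0"
    then have "AE x in lborel. r x = 0" using integral_nonneg_eq_0_iff_AE[OF int] nn by simp
    moreover have "r x = 0 \<longrightarrow> x \<notin> ball 0 \<delta>" for x using pos[of x] by auto
    ultimately have "AE x in lborel. x \<notin> ball (0::'a) \<delta>" by auto
    then have "emeasure lborel (ball (0::'a) \<delta>) = 0"
      by (subst (asm) AE_iff_measurable[OF _ refl]) (auto simp: ball_def)
    then show False using assms content_ball_pos[of \<delta> "0::'a"] by (simp add: measure_def)
  qed
  then have c: "(LINT x|lborel. r x) > 0" using nn by (simp add: integral_nonneg order_less_le)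
  have "C_on k UNIV (\<lambda>x. (1 / (LINT x|lborel. r x)) * r x)" for k
    by (intro C_on_cmult smooth open_UNIV)
  then show ?thesis
    using c zero nn by (intro exI[of _ "\<lambda>x. (1 / (LINT x|lborel. r x)) * r x"] conjI allI) auto
qed

definition mollifier :: "nat \<Rightarrow> 'a::euclidean_space \<Rightarrow> real" where
  "mollifier n = (SOME \<rho>. (\<forall>k. C_on k UNIV \<rho>) \<and> (\<forall>x. \<rho> x \<ge> 0) \<and>
    (\<forall>x. norm x \<ge> 1 / real (Suc n) \<longrightarrow> \<rho> x = 0) \<and> (LINT x|lborel. \<rho> x) = 1)"

lemma mollifier:
  shows "C_on k UNIV (mollifier n)" "mollifier n x \<ge> 0"
    "norm x \<ge> 1 / real (Suc n) \<Longrightarrow> mollifier n x = 0" "(LINT x|lborel. mollifier n x) = 1"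
  using someI_ex[OF mollifier_exists[of "1 / real (Suc n)"], folded mollifier_def] by auto

abbreviation mollify :: "nat \<Rightarrow> ('a::euclidean_space \<Rightarrow> 'b::euclidean_space) \<Rightarrow> 'a \<Rightarrow> 'b" where
  "mollify n \<equiv> conv (mollifier n)"

lemma mollify_dirder:
  fixes f :: "'a::euclidean_space \<Rightarrow> 'b::euclidean_space"
  assumes f: "C_on 1 UNIV f" "bounded {x. f x \<noteq> 0}"
  shows "dirder v (mollify n f) x = mollify n (dirder v f) x"
  using conv_dirder[OF assms mollifier(1)] dirder_conv[OF C_on_imp_continuous_on[OF f(1)] f(2) mollifier(1)] by metis

lemma mollify_eq_0:
  assumes "\<And>y. dist x y < 1 / real (Suc n) \<Longrightarrow> f y = 0"
  shows "mollify n f x = 0"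
proof -
  have "mollifier n (x - y) *\<^sub>R f y = 0" for y
    using mollifier(3)[of n "x - y"] assms[of y] by (cases "dist x y < 1 / real (Suc n)") (auto simp: dist_norm)
  then have "(\<lambda>y. mollifier n (x - y) *\<^sub>R f y) = (\<lambda>_. 0)" by blast
  then show ?thesis unfolding conv_def by simp
qed

lemma bounded_support_mollify:
  assumes "bounded {x. f x \<noteq> 0}"
  shows "bounded {x. mollify n f x \<noteq> 0}"
proof -
  obtain R where R: "\<And>x. f x \<noteq> 0 \<Longrightarrow> norm x \<le> R" using assms by (auto simp: bounded_iff)
  have "norm x \<le> R + 1" if ne: "mollify n f x \<noteq> 0" for x
  proof -
    obtain y where y: "dist x y < 1 / real (Suc n)" "f y \<noteq> 0" using mollify_eq_0 ne by blast
    have "1 / real (Suc n) \<le> 1" by simp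
    then show ?thesis using y(1) R[OF y(2)] norm_triangle_ineq2[of x y] unfolding dist_norm by linarith
  qed
  then show ?thesis unfolding bounded_iff by blast
qed

lemma mollify_uniform_limit:
  fixes f :: "'a::euclidean_space \<Rightarrow> 'b::euclidean_space"
  assumes f: "continuous_on UNIV f" "bounded {x. f x \<noteq> 0}"
  shows "uniform_limit UNIV (\<lambda>n. mollify n f) f sequentially"
proof (rule uniform_limitI)
  fix e :: real assume e: "e > 0"
  obtain R where R: "\<And>x. f x \<noteq> 0 \<Longrightarrow> norm x \<le> R" using assms by (auto simp: bounded_iff)
  have "uniformly_continuous_on (cball 0 (R + 1)) f"
    using f by (intro compact_uniformly_continuous) (auto intro: continuous_on_subset)
  then obtain d where d: "d > 0" "\<And>x y. x \<in> cball 0 (R+1) \<Longrightarrow> y \<in> cball 0 (R+1) \<Longrightarrow> dist y x < d \<Longrightarrow> dist (f y) (f x) < e/2"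
    using e unfolding uniformly_continuous_on_def by (metis half_gt_zero)
  \<comment> \<open>Distances are capped at 1 so that a point close to the ball of radius
    \<open>R\<close> stays in the ball of radius \<open>R + 1\<close>, where uniform continuity is
    known; two points outside radius \<open>R\<close> both have value 0.\<close>
  have d': "dist (f y) (f x) < e/2" if "dist y x < min d 1" for x y
  proof (cases "norm x \<le> R \<or> norm y \<le> R")
    case True
    then have "norm x \<le> R + 1" "norm y \<le> R + 1"
      using that norm_triangle_ineq2[of x y] norm_triangle_ineq2[of y x]
      by (auto simp: dist_norm norm_minus_commute)
    then show ?thesis using d that by auto
  next
    case False
    then have "f x = 0" "f y = 0" using R by blast+
    then show ?thesis using e by simp
  qed
  obtain N where N: "1 / real (Suc N) < min d 1" using d(1) nat_approx_posE[of "min d 1"] by auto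
  have "dist (mollify n f x) (f x) < e" if "n \<ge> N" for n x
  proof -
    have n: "1 / real (Suc n) < min d 1" using N that
      by (smt (verit) Suc_le_mono frac_le of_nat_0_less_iff of_nat_mono zero_less_Suc)
    have cm: "continuous_on UNIV (mollifier n :: 'a \<Rightarrow> real)" using mollifier(1)[of 0] by simp
    have [measurable]: "(mollifier n :: 'a \<Rightarrow> real) \<in> borel_measurable borel"
      using cm borel_measurable_continuous_onI by blast
    have bm: "bounded {x. mollifier n x \<noteq> (0::real)}"
      unfolding bounded_iff using mollifier(3)[where n=n] by (intro exI[of _ "1 / real (Suc n)"]) force
    have i0: "integrable lborel (mollifier n :: 'a \<Rightarrow> real)"
      using integrable_continuous_bounded_support[OF cm bm] .
    have i1: "integrable lborel (\<lambda>y. mollifier n (x - y))"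
    proof (rule integrable_continuous_bounded_support)
      show "continuous_on UNIV (\<lambda>y. mollifier n (x - y))"
        by (rule continuous_on_compose2[OF cm]) (auto intro!: continuous_intros)
      have "norm y \<le> norm x + 1 / real (Suc n)" if "mollifier n (x - y) \<noteq> 0" for y
        using mollifier(3)[of n "x - y"] that norm_triangle_ineq2[of y x] norm_minus_commute[of x y] by force
      then show "bounded {y. mollifier n (x - y) \<noteq> 0}" unfolding bounded_iff by blast
    qed
    have one: "(LINT y|lborel. mollifier n (x - y)) = 1"
      using integral_lborel_reflect[of "mollifier n" x] mollifier(4) by simp
    have i2: "integrable lborel (\<lambda>y. mollifier n (x - y) *\<^sub>R f y)" by (rule conv_integrable[OF f cm])
    have "mollify n f x - f x = (LINT y|lborel. mollifier n (x - y) *\<^sub>R f y) - (LINT y|lborel. mollifier n (x - y) *\<^sub>R f x)"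
      using i1 one by (simp add: conv_def)
    also have "\<dots> = (LINT y|lborel. mollifier n (x - y) *\<^sub>R (f y - f x))"
      using i1 i2 by (simp add: scaleR_diff_right)
    finally have eq: "mollify n f x - f x = (LINT y|lborel. mollifier n (x - y) *\<^sub>R (f y - f x))" .
    have "norm (LINT y|lborel. mollifier n (x - y) *\<^sub>R (f y - f x)) \<le> (LINT y|lborel. mollifier n (x - y) * (e/2))"
    proof (rule Bochner_Integration.integral_norm_bound_integral)
      show "integrable lborel (\<lambda>y. mollifier n (x - y) *\<^sub>R (f y - f x))"
        using i1 i2 by (simp add: scaleR_diff_right)
      show "norm (mollifier n (x - y) *\<^sub>R (f y - f x)) \<le> mollifier n (x - y) * (e/2)" for y
      proof (cases "dist y x < 1 / real (Suc n)")
        case True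
        then have "dist y x < min d 1" using n by linarith
        then have "norm (f y - f x) \<le> e/2" using d'[of y x] by (simp add: dist_norm)
        then have "mollifier n (x - y) * norm (f y - f x) \<le> mollifier n (x - y) * (e/2)"
          using mollifier(2)[of n "x - y"] by (intro mult_left_mono)
        then show ?thesis using mollifier(2)[of n "x - y"] by simp
      next
        case False
        then have "mollifier n (x - y) = 0" using mollifier(3)[of n "x - y"] by (simp add: dist_norm norm_minus_commute)
        then show ?thesis by simp
      qed
    qed (use i1 in auto)
    also have "\<dots> = e/2" using one by simp
    finally show ?thesis using e eq by (simp add: dist_norm)
  qed
  then show "\<forall>\<^sub>F n in sequentially. \<forall>x\<in>UNIV. dist (mollify n f x) (f x) < e"
    unfolding eventually_sequentially by blast
qed

section \<open>Polar coordinates\<close>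

lemma lborel_scale_emeasure:
  fixes X :: "'a::euclidean_space set"
  assumes [measurable]: "X \<in> sets borel" and "t > 0"
  shows "emeasure lborel {x. (1 / t) *\<^sub>R x \<in> X} = ennreal (t ^ DIM('a)) * emeasure lborel X"
proof -
  have "emeasure lborel X = emeasure (density (distr lborel borel (\<lambda>x. 0 + (1/t) *\<^sub>R x)) (\<lambda>_. ennreal (\<bar>1 / t\<bar> ^ DIM('a)))) X"
    using lborel_affine[of "1/t" "0::'a"] \<open>t > 0\<close> by simp
  also have "\<dots> = ennreal ((1 / t) ^ DIM('a)) * emeasure lborel {x. (1 / t) *\<^sub>R x \<in> X}"
    using \<open>t > 0\<close> by (subst emeasure_density)
      (auto simp: nn_integral_cmult_indicator emeasure_distr vimage_def)
  finally have "ennreal (t ^ DIM('a)) * emeasure lborel X =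
      ennreal (t ^ DIM('a)) * ennreal ((1 / t) ^ DIM('a)) * emeasure lborel {x. (1 / t) *\<^sub>R x \<in> X}"
    by (simp add: mult.assoc)
  also have "ennreal (t ^ DIM('a)) * ennreal ((1 / t) ^ DIM('a)) = 1"
    using \<open>t > 0\<close> by (subst ennreal_mult[symmetric]) (auto simp: power_one_over)
  finally show ?thesis by simp
qed

lemma sets_sphere_measure [simp, measurable_cong]: "sets (sphere_measure :: 'a::euclidean_space measure) = sets borel"
  by (simp add: sphere_measure_def)

lemma space_sphere_measure [simp]: "space (sphere_measure :: 'a::euclidean_space measure) = UNIV"
  using sets_eq_imp_space_eq[OF sets_sphere_measure] by simp

lemma norm_sgn_scaleR: "norm x *\<^sub>R sgn x = (x :: 'a::real_normed_vector)"
  by (cases "x = 0") (simp_all add: sgn_div_norm)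

lemma emeasure_sphere_measure:
  fixes E :: "'a::euclidean_space set"
  assumes [measurable]: "E \<in> sets borel"
  shows "emeasure sphere_measure E = of_nat DIM('a) * emeasure lborel {x. norm x \<le> 1 \<and> sgn x \<in> E}"
proof -
  have "emeasure sphere_measure E = of_nat DIM('a) * emeasure (distr (restrict_space lborel (cball 0 1)) borel sgn) E"
    by (simp add: sphere_measure_def emeasure_scale_measure)
  also have "emeasure (distr (restrict_space lborel (cball (0::'a) 1)) borel sgn) E
     = emeasure (restrict_space lborel (cball (0::'a) 1)) (sgn -` E \<inter> cball 0 1)"
    by (subst emeasure_distr) (auto simp: space_restrict_space measurable_restrict_space1)
  also have "\<dots> = emeasure lborel (sgn -` E \<inter> cball (0::'a) 1)"
    by (rule emeasure_restrict_space) auto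
  also have "sgn -` E \<inter> cball (0::'a) 1 = {x. norm x \<le> 1 \<and> sgn x \<in> E}" by auto
  finally show ?thesis .
qed

lemma finite_measure_sphere_measure: "finite_measure (sphere_measure :: 'a::euclidean_space measure)"
proof (rule finite_measureI)
  have "emeasure lborel {x::'a. norm x \<le> 1} < \<infinity>"
    using emeasure_lborel_cball_finite[of "0::'a" 1] by (simp add: cball_def)
  then have "emeasure (sphere_measure :: 'a measure) UNIV < \<infinity>"
    by (subst emeasure_sphere_measure) (auto simp: ennreal_mult_less_top of_nat_less_top)
  then show "emeasure (sphere_measure :: 'a measure) (space sphere_measure) \<noteq> \<infinity>" by simp
qed

interpretation sphere_measure: finite_measure "sphere_measure :: 'a::euclidean_space measure"
  by (rule finite_measure_sphere_measure)

text \<open>Dilation by r multiplies Lebesgue measure by r^N, and the factor 1/N undoes the N in the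
  definition of \<open>sphere_measure\<close>.\<close>

lemma emeasure_cone_ball:
  fixes E :: "'a::euclidean_space set"
  assumes [measurable]: "E \<in> sets borel" and "r > 0"
  shows "emeasure lborel {x. norm x \<le> r \<and> sgn x \<in> E} = ennreal (r ^ DIM('a) / DIM('a)) * emeasure sphere_measure E"
proof -
  have m: "{x::'a. norm x \<le> 1 \<and> sgn x \<in> E} \<in> sets borel" by measurable
  have "{x. norm x \<le> r \<and> sgn x \<in> E} = {x. (1 / r) *\<^sub>R x \<in> {x. norm x \<le> 1 \<and> sgn x \<in> E}}"
    using \<open>r > 0\<close> by (auto simp: sgn_scaleR field_simps)
  then have "emeasure lborel {x. norm x \<le> r \<and> sgn x \<in> E} = ennreal (r ^ DIM('a)) * emeasure lborel {x. norm x \<le> 1 \<and> sgn x \<in> E}"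
    using lborel_scale_emeasure[OF m \<open>r > 0\<close>] by simp
  also have "\<dots> = ennreal (r ^ DIM('a)) * (ennreal (1 / DIM('a)) * of_nat DIM('a)) * emeasure lborel {x. norm x \<le> 1 \<and> sgn x \<in> E}"
  proof -
    have "ennreal (1 / DIM('a)) * of_nat DIM('a) = 1"
      by (simp add: ennreal_of_nat_eq_real_of_nat ennreal_mult[symmetric])
    then show ?thesis by simp
  qed
  also have "\<dots> = ennreal (r ^ DIM('a) / DIM('a)) * emeasure sphere_measure E"
  proof -
    have "ennreal (r ^ DIM('a) / DIM('a)) = ennreal (r ^ DIM('a)) * ennreal (1 / DIM('a))"
      using \<open>r > 0\<close> by (subst ennreal_mult[symmetric]) auto
    then show ?thesis by (simp add: emeasure_sphere_measure mult.assoc)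
  qed
  finally show ?thesis .
qed

text \<open>The radial factor r^(N-1) dr of Lebesgue measure in polar coordinates.\<close>

definition radial_measure :: "nat \<Rightarrow> real measure" where
  "radial_measure N = density lborel (\<lambda>r. ennreal (indicator {0<..} r * r ^ (N - 1)))"

lemma sets_radial_measure [simp, measurable_cong]: "sets (radial_measure N) = sets borel"
  by (simp add: radial_measure_def)

lemma space_radial_measure [simp]: "space (radial_measure N) = UNIV"
  by (simp add: radial_measure_def)

lemma emeasure_radial_measure_atMost:
  assumes "N > 0"
  shows "emeasure (radial_measure N) {..t} = ennreal (if t > 0 then t ^ N / N else 0)"
proof (cases "t > 0")
  case True
  have "emeasure (radial_measure N) {..t} = (\<integral>\<^sup>+ r. ennreal (r ^ (N - 1)) * indicator {0..t} r \<partial>lborel)"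
  proof -
    have "emeasure (radial_measure N) {..t} = (\<integral>\<^sup>+ r. ennreal (indicator {0<..} r * r ^ (N - 1)) * indicator {..t} r \<partial>lborel)"
      unfolding radial_measure_def by (rule emeasure_density) auto
    also have "\<dots> = (\<integral>\<^sup>+ r. ennreal (r ^ (N - 1)) * indicator {0..t} r \<partial>lborel)"
    proof (rule nn_integral_cong_AE)
      have "AE r in lborel. r \<noteq> (0::real)" by (rule AE_lborel_singleton)
      then show "AE r in lborel. ennreal (indicator {0<..} r * r ^ (N - 1)) * indicator {..t} r =
          ennreal (r ^ (N - 1)) * indicator {0..t} r"
        by eventually_elim (simp split: split_indicator)
    qed
    finally show ?thesis .
  qed
  also have "\<dots> = ennreal (t ^ N / N - 0 ^ N / N)"
    using True assms
    by (intro nn_integral_FTC_Icc) (auto intro!: derivative_eq_intros simp: field_simps)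
  finally show ?thesis using True assms by (simp add: power_0_left)
next
  case False
  have "emeasure (radial_measure N) {..t} = (\<integral>\<^sup>+ r. 0 \<partial>(lborel :: real measure))"
    unfolding radial_measure_def
    by (subst emeasure_density) (use False in \<open>auto intro!: nn_integral_cong split: split_indicator simp del: nn_integral_const\<close>)
  then show ?thesis using False by simp
qed

lemma sigma_finite_radial_measure:
  assumes "N > 0" shows "sigma_finite_measure (radial_measure N)"
proof
  show "\<exists>A. countable A \<and> A \<subseteq> sets (radial_measure N) \<and> \<Union>A = space (radial_measure N) \<and> (\<forall>a\<in>A. emeasure (radial_measure N) a \<noteq> \<infinity>)"
  proof (intro exI conjI)
    show "\<Union>(range (\<lambda>n. {..real n})) = space (radial_measure N)"
      using real_arch_simple by auto
  qed (auto simp: emeasure_radial_measure_atMost[OF assms])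
qed

text \<open>For fixed \<open>E\<close> both sides are measures in \<open>A\<close>. They agree on
  the half-lines \<open>{..t}\<close> by the volume of cones, and half-lines form a generator stable
  under intersection on which the measures are finite.\<close>

lemma distr_norm_cone:
  fixes E :: "'a::euclidean_space set"
  assumes [measurable]: "E \<in> sets borel" and A: "A \<in> sets borel"
  shows "emeasure lborel {x::'a. norm x \<in> A \<and> x \<noteq> 0 \<and> sgn x \<in> E} = emeasure (radial_measure DIM('a)) A * emeasure sphere_measure E"
proof -
  define \<mu> where "\<mu> = distr (restrict_space lborel {x::'a. x \<noteq> 0 \<and> sgn x \<in> E}) borel norm"
  define \<nu> where "\<nu> = scale_measure (emeasure sphere_measure E) (radial_measure DIM('a))"
  have \<mu>: "emeasure \<mu> B = emeasure lborel {x::'a. norm x \<in> B \<and> x \<noteq> 0 \<and> sgn x \<in> E}" if [measurable]: "B \<in> sets borel" for B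
  proof -
    have "emeasure \<mu> B = emeasure (restrict_space lborel {x::'a. x \<noteq> 0 \<and> sgn x \<in> E}) (norm -` B \<inter> {x::'a. x \<noteq> 0 \<and> sgn x \<in> E})"
      unfolding \<mu>_def by (subst emeasure_distr) (auto simp: space_restrict_space measurable_restrict_space1)
    also have "\<dots> = emeasure lborel (norm -` B \<inter> {x::'a. x \<noteq> 0 \<and> sgn x \<in> E})"
      by (rule emeasure_restrict_space) auto
    finally show ?thesis by (simp add: vimage_def Int_def conj_ac)
  qed
  have \<nu>: "emeasure \<nu> B = emeasure (radial_measure DIM('a)) B * emeasure sphere_measure E" for B
    by (simp add: \<nu>_def emeasure_scale_measure mult.commute)
  have atMost: "emeasure \<mu> {..t} = emeasure \<nu> {..t}" for t
  proof (cases "t > 0")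
    case True
    have "emeasure \<mu> {..t} = emeasure lborel {x::'a. norm x \<le> t \<and> sgn x \<in> E}"
    proof -
      have "AE x in lborel. x \<noteq> (0::'a)" by (rule AE_lborel_singleton)
      then show ?thesis unfolding \<mu>[OF borel_closed[OF closed_atMost]]
        by (intro emeasure_eq_AE) (auto elim: eventually_mono)
    qed
    then show ?thesis using True emeasure_cone_ball[OF assms(1) True]
      by (simp add: \<nu> emeasure_radial_measure_atMost)
  next
    case False
    then have "{x::'a. norm x \<in> {..t} \<and> x \<noteq> 0 \<and> sgn x \<in> E} = {}"
      by (auto simp flip: zero_less_norm_iff)
    then have "emeasure \<mu> {..t} = 0" using \<mu>[of "{..t}"] by (metis borel_closed closed_atMost emeasure_empty)
    then show ?thesis using False by (simp add: \<nu> emeasure_radial_measure_atMost)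
  qed
  have "\<mu> = \<nu>"
  proof (rule measure_eqI_generator_eq[where E = "range atMost" and \<Omega> = UNIV and A = "\<lambda>n. {..real n}"])
    show "Int_stable (range (atMost :: real \<Rightarrow> _))" by (auto simp: Int_stable_def)
    show "sets \<mu> = sigma_sets UNIV (range atMost)" "sets \<nu> = sigma_sets UNIV (range atMost)"
      by (auto simp: \<mu>_def \<nu>_def borel_eq_atMost)
    show "(\<Union>i. {..real i}) = (UNIV :: real set)" using real_arch_simple by auto
    show "emeasure \<mu> {..real i} \<noteq> \<infinity>" for i
      using sphere_measure.emeasure_finite[of E]
      by (auto simp: atMost \<nu> emeasure_radial_measure_atMost ennreal_mult_eq_top_iff)
  qed (auto simp: atMost)
  then show ?thesis using \<mu>[OF A] \<nu> by simp
qed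

text \<open>On the punctured space x -> (norm x, sgn x) carries Lebesgue measure to the product
  measure, by comparison on rectangles, and (r, u) -> r u inverts this map. The removed origin is a
  null set.\<close>

theorem polar_coordinates:
  "distr (radial_measure DIM('a) \<Otimes>\<^sub>M sphere_measure) borel (\<lambda>(r, u). r *\<^sub>R u) = (lborel :: 'a::euclidean_space measure)"
proof -
  have prod: "radial_measure DIM('a) \<Otimes>\<^sub>M (sphere_measure :: 'a measure) =
     distr (restrict_space lborel (- {0})) (borel \<Otimes>\<^sub>M borel) (\<lambda>x. (norm x, sgn x))"
  proof (rule pair_measure_eqI)
    show "sigma_finite_measure (radial_measure DIM('a))" by (rule sigma_finite_radial_measure) simp
    show "sigma_finite_measure (sphere_measure :: 'a measure)" by (rule sphere_measure.sigma_finite_measure_axioms)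
    show "sets (radial_measure DIM('a) \<Otimes>\<^sub>M (sphere_measure :: 'a measure)) =
       sets (distr (restrict_space lborel (- {0})) (borel \<Otimes>\<^sub>M borel) (\<lambda>x::'a. (norm x, sgn x)))"
      using sets_pair_measure_cong[OF sets_radial_measure sets_sphere_measure] by simp
    fix A and E :: "'a set" assume "A \<in> sets (radial_measure DIM('a))" "E \<in> sets sphere_measure"
    then have [measurable]: "A \<in> sets borel" "E \<in> sets borel" by auto
    have "emeasure (distr (restrict_space lborel (- {0})) (borel \<Otimes>\<^sub>M borel) (\<lambda>x. (norm x, sgn x))) (A \<times> E)
      = emeasure (restrict_space lborel (- {0})) ((\<lambda>x::'a. (norm x, sgn x)) -` (A \<times> E) \<inter> - {0})"
      by (subst emeasure_distr) (auto simp: space_restrict_space intro!: measurable_restrict_space1 measurable_Pair)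
    also have "\<dots> = emeasure lborel ((\<lambda>x::'a. (norm x, sgn x)) -` (A \<times> E) \<inter> - {0})"
      by (rule emeasure_restrict_space) auto
    also have "(\<lambda>x::'a. (norm x, sgn x)) -` (A \<times> E) \<inter> - {0} = {x. norm x \<in> A \<and> x \<noteq> 0 \<and> sgn x \<in> E}" by auto
    also have "emeasure lborel \<dots> = emeasure (radial_measure DIM('a)) A * emeasure sphere_measure E"
      by (rule distr_norm_cone) auto
    finally show "emeasure (radial_measure DIM('a)) A * emeasure sphere_measure E =
        emeasure (distr (restrict_space lborel (- {0})) (borel \<Otimes>\<^sub>M borel) (\<lambda>x. (norm x, sgn x))) (A \<times> E)" by simp
  qed
  have "distr (radial_measure DIM('a) \<Otimes>\<^sub>M sphere_measure) borel (\<lambda>(r, u). r *\<^sub>R u) =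
     distr (restrict_space lborel (- {0})) borel ((\<lambda>(r, u). r *\<^sub>R u) \<circ> (\<lambda>x::'a. (norm x, sgn x)))"
    unfolding prod by (rule distr_distr) (auto intro!: measurable_restrict_space1 measurable_Pair)
  also have "(\<lambda>(r, u). r *\<^sub>R u) \<circ> (\<lambda>x::'a. (norm x, sgn x)) = (\<lambda>x. x)"
    by (simp add: fun_eq_iff norm_sgn_scaleR)
  also have "distr (restrict_space lborel (- {0})) borel (\<lambda>x::'a. x) = lborel"
  proof (rule measure_eqI)
    fix X :: "'a set" assume "X \<in> sets (distr (restrict_space lborel (- {0})) borel (\<lambda>x::'a. x))"
    then have [measurable]: "X \<in> sets borel" by simp
    have "emeasure (distr (restrict_space lborel (- {0})) borel (\<lambda>x::'a. x)) X = emeasure (restrict_space lborel (- {0})) (X \<inter> - {0})"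
      by (subst emeasure_distr) (auto simp: space_restrict_space intro!: measurable_restrict_space1 )
    also have "\<dots> = emeasure lborel (X \<inter> - {0})" by (rule emeasure_restrict_space) auto
    also have "\<dots> = emeasure lborel X"
      using AE_lborel_singleton[of 0] by (intro emeasure_eq_AE) (auto elim: eventually_mono)
    finally show "emeasure (distr (restrict_space lborel (- {0})) borel (\<lambda>x::'a. x)) X = emeasure lborel X" .
  qed simp
  finally show ?thesis .
qed

section \<open>Integration in polar coordinates\<close>

lemma AE_sphere_measure: "AE u in (sphere_measure :: 'a::euclidean_space measure). norm u = 1"
proof -
  have "emeasure sphere_measure {u::'a. norm u \<noteq> 1} = of_nat DIM('a) * emeasure lborel {x::'a. norm x \<le> 1 \<and> norm (sgn x) \<noteq> 1}"
    by (subst emeasure_sphere_measure) auto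
  \<comment> \<open>Since \<open>sgn 0 = 0\<close>, the origin is the one point of the ball that is
    not sent to the unit sphere.\<close>
  also have "{x::'a. norm x \<le> 1 \<and> norm (sgn x) \<noteq> 1} = {0}" by (auto simp: norm_sgn split: if_splits)
  finally have "emeasure sphere_measure {u::'a. norm u \<noteq> 1} = 0" by simp
  then show ?thesis by (subst AE_iff_measurable[OF _ refl]) auto
qed

lemma AE_radial_measure: "AE r in radial_measure N. r > 0"
  unfolding radial_measure_def by (subst AE_density) (auto simp: indicator_def)

lemma integral_radial_measure:
  fixes w :: "real \<Rightarrow> 'b::{banach,second_countable_topology}"
  assumes [measurable]: "w \<in> borel_measurable borel"
  shows "integrable (radial_measure N) w \<longleftrightarrow> integrable lborel (\<lambda>r. (indicator {0<..} r * r ^ (N - 1)) *\<^sub>R w r)"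
    "(LINT r|radial_measure N. w r) = (LINT r|lborel. (indicator {0<..} r * r ^ (N - 1)) *\<^sub>R w r)"
  unfolding radial_measure_def
  by (auto simp: integrable_density integral_density split: split_indicator)

text \<open>Fubini for a product of a radial and an angular function. Every integrand to which it is
  applied is a function of |z| times a homogeneous function, so the variables separate.\<close>

lemma polar_integral_product:
  fixes g :: "'a::euclidean_space \<Rightarrow> complex" and w :: "real \<Rightarrow> real"
  assumes [measurable]: "f \<in> borel_measurable borel" "g \<in> borel_measurable borel" "w \<in> borel_measurable borel"
    and w: "integrable (radial_measure DIM('a)) w"
    and g: "integrable sphere_measure g"
    and f: "\<And>r u. r > 0 \<Longrightarrow> norm u = 1 \<Longrightarrow> f (r *\<^sub>R u) = w r *\<^sub>R g u"
  shows "integrable lborel f" "(LINT x|lborel. f x) = (LINT r|radial_measure DIM('a). w r) *\<^sub>R (LINT u|sphere_measure. g u)"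
proof -
  let ?R = "radial_measure DIM('a)" and ?S = "sphere_measure :: 'a measure"
  interpret R: sigma_finite_measure ?R by (rule sigma_finite_radial_measure) simp
  interpret P: pair_sigma_finite ?R ?S
    by (intro pair_sigma_finite.intro R.sigma_finite_measure_axioms sphere_measure.sigma_finite_measure_axioms)
  have ae: "AE p in ?R \<Otimes>\<^sub>M ?S. f (fst p *\<^sub>R snd p) = w (fst p) *\<^sub>R g (snd p)"
  proof (rule P.AE_pair_measure)
    show "AE x in ?R. AE y in ?S. f (fst (x, y) *\<^sub>R snd (x, y)) = w (fst (x, y)) *\<^sub>R g (snd (x, y))"
      using AE_radial_measure
    proof eventually_elim
      case (elim x)
      show ?case using AE_sphere_measure by eventually_elim (use f[OF elim] in auto)
    qed
  qed measurable
  have int: "integrable (?R \<Otimes>\<^sub>M ?S) (\<lambda>p. w (fst p) *\<^sub>R g (snd p))"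
  proof (rule P.Fubini_integrable)
    show "integrable ?R (\<lambda>x. LINT y|(?S). norm (w (fst (x, y)) *\<^sub>R g (snd (x, y))))"
      using w by (auto intro!: integrable_mult_left)
    show "AE x in ?R. integrable ?S (\<lambda>y. w (fst (x, y)) *\<^sub>R g (snd (x, y)))"
      using g by auto
  qed measurable
  have int2: "integrable (?R \<Otimes>\<^sub>M ?S) (\<lambda>p. f (fst p *\<^sub>R snd p))"
    using ae int by (subst integrable_cong_AE[OF _ _ ae]) auto
  have distr_meas: "(\<lambda>(r, u). r *\<^sub>R u) \<in> ?R \<Otimes>\<^sub>M ?S \<rightarrow>\<^sub>M borel" by measurable
  have "integrable (distr (?R \<Otimes>\<^sub>M ?S) borel (\<lambda>(r, u). r *\<^sub>R u)) f"
    using int2 by (subst integrable_distr_eq[OF distr_meas]) (auto simp: split_beta)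
  then show "integrable lborel f" by (simp add: polar_coordinates)
  have "(LINT x|lborel. f x) = (LINT x|distr (?R \<Otimes>\<^sub>M ?S) borel (\<lambda>(r, u). r *\<^sub>R u). f x)"
    by (simp add: polar_coordinates)
  also have "\<dots> = (LINT p|(?R \<Otimes>\<^sub>M ?S). f (fst p *\<^sub>R snd p))"
    by (subst integral_distr[OF distr_meas]) (auto simp: split_beta)
  also have "\<dots> = (LINT p|(?R \<Otimes>\<^sub>M ?S). w (fst p) *\<^sub>R g (snd p))"
    using ae by (intro integral_cong_AE) auto
  also have "\<dots> = (LINT x|(?R). LINT y|(?S). w x *\<^sub>R g y)"
    using P.integral_fst'[OF int] by simp
  also have "\<dots> = (LINT r|(?R). w r) *\<^sub>R (LINT u|(?S). g u)"
    using w g by simp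
  finally show "(LINT x|lborel. f x) = (LINT r|(?R). w r) *\<^sub>R (LINT u|(?S). g u)" .
qed

section \<open>Wedge products of (1,1)-forms and mixed discriminants\<close>

text \<open>The value of a form at a single point: wedge products are treated pointwise, apart from
  any differentiation.\<close>

type_synonym 'n coeffs = "'n set \<Rightarrow> 'n set \<Rightarrow> complex"

definition wedge_dz :: "'n::{finite,wellorder} \<Rightarrow> 'n coeffs \<Rightarrow> 'n coeffs" where
  "wedge_dz j w I J = (if j \<in> I then insert_sign j (I - {j}) * w (I - {j}) J else 0)"

definition wedge_dzbar :: "'n::{finite,wellorder} \<Rightarrow> 'n coeffs \<Rightarrow> 'n coeffs" where
  "wedge_dzbar k w I J = (if k \<in> J then (-1) ^ card I * insert_sign k (J - {k}) * w I (J - {k}) else 0)"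

text \<open>Deleting a larger index leaves the number of smaller ones unchanged, deleting a smaller
  one lowers it by one. This asymmetry is the source of anticommutativity.\<close>

lemma insert_sign_less:
  assumes "i < j" "i \<in> I" "j \<in> I"
  shows "insert_sign i (I - {i} - {j}) = insert_sign i (I - {i})"
    "insert_sign j (I - {j} - {i}) = - insert_sign j (I - {j})"
proof -
  have "{l \<in> I - {i} - {j}. l < i} = {l \<in> I - {i}. l < i}" using assms by auto
  then show "insert_sign i (I - {i} - {j}) = insert_sign i (I - {i})" by (simp add: insert_sign_def)
  have "{l \<in> I - {j}. l < j} = insert i {l \<in> I - {j} - {i}. l < j}" using assms by auto
  then have "card {l \<in> I - {j}. l < j} = Suc (card {l \<in> I - {j} - {i}. l < j})" by simp
  then show "insert_sign j (I - {j} - {i}) = - insert_sign j (I - {j})" by (simp add: insert_sign_def)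
qed

lemma insert_sign_anticommute:
  assumes "i \<noteq> j" "i \<in> I" "j \<in> I"
  shows "insert_sign i (I - {i}) * insert_sign j (I - {i} - {j}) = - (insert_sign j (I - {j}) * insert_sign i (I - {j} - {i}))"
proof -
  have *: "I - {i} - {j} = I - {j} - {i}" by auto
  consider "i < j" | "j < i" using assms(1) by fastforce
  then show ?thesis using insert_sign_less[of i j I] insert_sign_less[of j i I] assms * by cases auto
qed

lemma wedge_dz_dz: "wedge_dz i (wedge_dz j w) = (\<lambda>I J. - wedge_dz j (wedge_dz i w) I J)"
proof (intro ext)
  fix I J
  show "wedge_dz i (wedge_dz j w) I J = - wedge_dz j (wedge_dz i w) I J"
  proof (cases "i \<noteq> j \<and> i \<in> I \<and> j \<in> I")
    case True
    then have "I - {i} - {j} = I - {j} - {i}" by auto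
    then show ?thesis using True insert_sign_anticommute[of i j I]
      by (auto simp: wedge_dz_def simp flip: mult.assoc)
  qed (auto simp: wedge_dz_def)
qed

lemma wedge_dzbar_dzbar: "wedge_dzbar i (wedge_dzbar j w) = (\<lambda>I J. - wedge_dzbar j (wedge_dzbar i w) I J)"
proof (intro ext)
  fix I J
  show "wedge_dzbar i (wedge_dzbar j w) I J = - wedge_dzbar j (wedge_dzbar i w) I J"
  proof (cases "i \<noteq> j \<and> i \<in> J \<and> j \<in> J")
    case True
    then have "J - {i} - {j} = J - {j} - {i}" by auto
    moreover from this have "insert_sign i (J - {i}) * insert_sign j (J - {j} - {i}) = - (insert_sign j (J - {j}) * insert_sign i (J - {j} - {i}))"
      using True insert_sign_anticommute[of i j J] by auto
    then have "c * insert_sign i (J - {i}) * (c * insert_sign j (J - {j} - {i}) * y) =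
        - (c * insert_sign j (J - {j}) * (c * insert_sign i (J - {j} - {i}) * y))" for c y
      by algebra
    ultimately show ?thesis using True by (auto simp: wedge_dzbar_def)
  qed (auto simp: wedge_dzbar_def)
qed

lemma wedge_dzbar_dz: "wedge_dzbar k (wedge_dz j w) = (\<lambda>I J. - wedge_dz j (wedge_dzbar k w) I J)"
proof (intro ext)
  fix I J
  show "wedge_dzbar k (wedge_dz j w) I J = - wedge_dz j (wedge_dzbar k w) I J"
  proof (cases "j \<in> I")
    case True
    \<comment> \<open>Wedging with dz_j changes the parity of \<open>card I\<close>, and
      \<open>wedge_dzbar\<close> carries exactly the sign given by that parity.\<close>
    then have "card I = Suc (card (I - {j}))" using card_Suc_Diff1[of I j] by simp
    then have "(-1) ^ card I = - ((-1) ^ card (I - {j}) :: complex)" by (simp only: power_Suc) simp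
    then show ?thesis using True by (simp add: wedge_dz_def wedge_dzbar_def del: card_Diff_insert)
  qed (auto simp: wedge_dz_def wedge_dzbar_def)
qed

lemma wedge_linear:
  "wedge_dz j (\<lambda>I J. v I J + w I J) I J = wedge_dz j v I J + wedge_dz j w I J"
  "wedge_dz j (\<lambda>I J. - w I J) I J = - wedge_dz j w I J"
  "wedge_dz j (\<lambda>I J. c * w I J) I J = c * wedge_dz j w I J"
  "wedge_dz j (\<lambda>I J. 0) I J = 0"
  "wedge_dz j (\<lambda>I J. \<Sum>x\<in>S. u x I J) I J = (\<Sum>x\<in>S. wedge_dz j (u x) I J)"
  "wedge_dzbar j (\<lambda>I J. v I J + w I J) I J = wedge_dzbar j v I J + wedge_dzbar j w I J"
  "wedge_dzbar j (\<lambda>I J. - w I J) I J = - wedge_dzbar j w I J"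
  "wedge_dzbar j (\<lambda>I J. c * w I J) I J = c * wedge_dzbar j w I J"
  "wedge_dzbar j (\<lambda>I J. 0) I J = 0"
  "wedge_dzbar j (\<lambda>I J. \<Sum>x\<in>S. u x I J) I J = (\<Sum>x\<in>S. wedge_dzbar j (u x) I J)"
  by (auto simp: wedge_dz_def wedge_dzbar_def algebra_simps sum_distrib_left)

section \<open>Products of elementary (1,1)-forms\<close>

definition wedge_pair :: "'n::{finite,wellorder} \<times> 'n \<Rightarrow> 'n coeffs \<Rightarrow> 'n coeffs" where
  "wedge_pair p w = wedge_dz (fst p) (wedge_dzbar (snd p) w)"

lemma wedge_pair_linear:
  "wedge_pair p (\<lambda>I J. v I J + w I J) I J = wedge_pair p v I J + wedge_pair p w I J"
  "wedge_pair p (\<lambda>I J. - w I J) I J = - wedge_pair p w I J"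
  "wedge_pair p (\<lambda>I J. c * w I J) I J = c * wedge_pair p w I J"
  "wedge_pair p (\<lambda>I J. 0) I J = 0"
  "wedge_pair p (\<lambda>I J. \<Sum>x\<in>S. u x I J) I J = (\<Sum>x\<in>S. wedge_pair p (u x) I J)"
  by (simp_all add: wedge_pair_def wedge_linear(6-10)[abs_def] wedge_linear(1-5))

text \<open>Moving the barred factor \<open>c\<close> to the right past dz_b brings the product to
  the order dz_a, dz_b, dz-bar_c, dz-bar_d, where exchanging \<open>a\<close> and \<open>b\<close>
  costs one sign. \<open>wedge_pair_swap'\<close> does the same with the barred indices.\<close>

lemma wedge_pair_swap:
  "wedge_pair (a, c) (wedge_pair (b, d) w) = (\<lambda>I J. - wedge_pair (b, c) (wedge_pair (a, d) w) I J)"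
proof -
  have "wedge_pair (a, c) (wedge_pair (b, d) w) = (\<lambda>I J. - wedge_dz a (wedge_dz b (wedge_dzbar c (wedge_dzbar d w))) I J)" for a b
    by (simp add: wedge_pair_def wedge_dzbar_dz[of c b] wedge_linear(2)[abs_def])
  then show ?thesis by (simp add: wedge_dz_dz[of a b] wedge_linear)
qed

lemma wedge_pair_swap':
  "wedge_pair (a, c) (wedge_pair (b, d) w) = (\<lambda>I J. - wedge_pair (a, d) (wedge_pair (b, c) w) I J)"
proof -
  have *: "wedge_pair (a, c) (wedge_pair (b, d) w) = (\<lambda>I J. - wedge_dz a (wedge_dz b (wedge_dzbar c (wedge_dzbar d w))) I J)" for c d
    by (simp add: wedge_pair_def wedge_dzbar_dz[of c b] wedge_linear(2)[abs_def])
  show ?thesis unfolding * by (simp add: wedge_dzbar_dzbar[of c d] wedge_linear(2)[abs_def] wedge_linear(7)[abs_def])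
qed

text \<open>Exchanging the unbarred and then the barred indices costs two signs, which cancel: forms
  of even degree commute.\<close>

lemma wedge_pair_commute: "wedge_pair p (wedge_pair q w) = wedge_pair q (wedge_pair p w)"
  using wedge_pair_swap[of "fst p" "snd p" "fst q" "snd q" w] wedge_pair_swap'[of "fst q" "snd p" "fst p" "snd q" w]
  by simp

definition wedge_pairs :: "('n::{finite,wellorder} \<times> 'n) list \<Rightarrow> 'n coeffs \<Rightarrow> 'n coeffs" where
  "wedge_pairs ps = fold wedge_pair ps"

lemma wedge_pairs_mset:
  assumes "mset ps = mset qs" shows "wedge_pairs ps = wedge_pairs qs"
  unfolding wedge_pairs_def using assms
  by (rule fold_multiset_equiv[rotated]) (auto simp: fun_eq_iff wedge_pair_commute)

lemma wedge_pairs_linear: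
  "wedge_pairs ps (\<lambda>I J. v I J + w I J) I J = wedge_pairs ps v I J + wedge_pairs ps w I J"
  "wedge_pairs ps (\<lambda>I J. - w I J) I J = - wedge_pairs ps w I J"
  "wedge_pairs ps (\<lambda>I J. c * w I J) I J = c * wedge_pairs ps w I J"
  "wedge_pairs ps (\<lambda>I J. 0) I J = 0"
  "wedge_pairs ps (\<lambda>I J. \<Sum>x\<in>S. u x I J) I J = (\<Sum>x\<in>S. wedge_pairs ps (u x) I J)"
proof -
  have "wedge_pairs ps (\<lambda>I J. v I J + w I J) = (\<lambda>I J. wedge_pairs ps v I J + wedge_pairs ps w I J)"
    by (induction ps arbitrary: v w) (auto simp: wedge_pairs_def wedge_pair_linear(1)[abs_def])
  then show "wedge_pairs ps (\<lambda>I J. v I J + w I J) I J = wedge_pairs ps v I J + wedge_pairs ps w I J" by simp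
  have *: "wedge_pairs ps (\<lambda>I J. c * w I J) = (\<lambda>I J. c * wedge_pairs ps w I J)" for c
    by (induction ps arbitrary: w) (auto simp: wedge_pairs_def wedge_pair_linear(3)[abs_def])
  then show "wedge_pairs ps (\<lambda>I J. c * w I J) I J = c * wedge_pairs ps w I J" by simp
  show "wedge_pairs ps (\<lambda>I J. - w I J) I J = - wedge_pairs ps w I J" using *[of "-1"] by simp
  show "wedge_pairs ps (\<lambda>I J. 0) I J = 0" using *[of 0] by simp
  have "wedge_pairs ps (\<lambda>I J. \<Sum>x\<in>S. u x I J) = (\<lambda>I J. \<Sum>x\<in>S. wedge_pairs ps (u x) I J)"
    by (induction ps arbitrary: u) (auto simp: wedge_pairs_def wedge_pair_linear(5)[abs_def])
  then show "wedge_pairs ps (\<lambda>I J. \<Sum>x\<in>S. u x I J) I J = (\<Sum>x\<in>S. wedge_pairs ps (u x) I J)" by simp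
qed

definition coeffs_one :: "'n coeffs" where
  "coeffs_one I J = (if I = {} \<and> J = {} then 1 else 0)"

text \<open>The coefficient of the top form in a product of \<open>n\<close> elementary (1,1)-forms.
  As a function of the pairs it alternates separately in the first and in the second indices, like a
  product of two determinants.\<close>

definition pairs_coeff :: "nat \<Rightarrow> (nat \<Rightarrow> 'n::{finite,wellorder} \<times> 'n) \<Rightarrow> complex" where
  "pairs_coeff n f = wedge_pairs (map f [1..<n + 1]) coeffs_one UNIV UNIV"

text \<open>Commutativity allows the factors to be multiplied in any order; it is used to bring two
  chosen positions to the front, where the exchange rules apply.\<close>

lemma pairs_coeff_list:
  assumes "distinct xs" "set xs = {1..n}"
  shows "pairs_coeff n f = wedge_pairs (map f xs) coeffs_one UNIV UNIV"
proof -
  have "set xs = set [1..<n + 1]" unfolding assms(2) set_upt by (rule set_eqI) (simp add: less_Suc_eq_le)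
  then have "mset xs = mset [1..<n + 1]"
    using set_eq_iff_mset_eq_distinct[OF assms(1) distinct_upt] by blast
  then have "mset (map f [1..<n + 1]) = mset (map f xs)" by (simp only: mset_map)
  from wedge_pairs_mset[OF this] show ?thesis unfolding pairs_coeff_def by (rule fun_cong[THEN fun_cong, THEN fun_cong])
qed

lemma two_first_list:
  assumes "x \<noteq> y" "x \<in> {1..n}" "y \<in> {1..n}"
  obtains xs where "distinct (x # y # xs)" "set (x # y # xs) = {1..n::nat}"
proof
  define xs where "xs = sorted_list_of_set ({1..n} - {x, y})"
  show "distinct (x # y # xs)" "set (x # y # xs) = {1..n::nat}"
    using assms by (auto simp: xs_def)
qed

lemma pairs_coeff_swap_fst:
  assumes "x \<noteq> y" "x \<in> {1..n}" "y \<in> {1..n}" "f x = (a, c)" "f y = (b, d)"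
  shows "pairs_coeff n (f(x := (b, c), y := (a, d))) = - pairs_coeff n f"
proof -
  obtain xs where xs: "distinct (x # y # xs)" "set (x # y # xs) = {1..n}" using two_first_list assms by metis
  have "map (f(x := (b, c), y := (a, d))) xs = map f xs" using xs by auto
  then show ?thesis unfolding pairs_coeff_list[OF xs] using assms xs
    by (simp add: wedge_pairs_def wedge_pair_swap[of a d b c] wedge_pairs_linear(2)[unfolded wedge_pairs_def])
qed

lemma pairs_coeff_swap_snd:
  assumes "x \<noteq> y" "x \<in> {1..n}" "y \<in> {1..n}" "f x = (a, c)" "f y = (b, d)"
  shows "pairs_coeff n (f(x := (a, d), y := (b, c))) = - pairs_coeff n f"
proof -
  obtain xs where xs: "distinct (x # y # xs)" "set (x # y # xs) = {1..n}" using two_first_list assms by metis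
  have "map (f(x := (a, d), y := (b, c))) xs = map f xs" using xs by auto
  then show ?thesis unfolding pairs_coeff_list[OF xs] using assms xs
    by (simp add: wedge_pairs_def wedge_pair_swap'[of b c a d] wedge_pairs_linear(2)[unfolded wedge_pairs_def])
qed

text \<open>Each permutation is built from transpositions composed on the right, so that one
  induction step exchanges the entries at two positions and changes the sign once. First and second
  indices are permuted independently.\<close>

lemma pairs_coeff_permute:
  assumes "\<sigma> permutes {1..n}" "\<tau> permutes {1..n}"
  shows "pairs_coeff n (\<lambda>l. (g (\<sigma> l), h (\<tau> l))) = of_int (sign (\<sigma> \<circ> \<tau>)) * pairs_coeff n (\<lambda>l. (g l, h l))"
proof -
  have 1: "pairs_coeff n (\<lambda>l. (g (\<sigma> l), h l)) = of_int (sign \<sigma>) * pairs_coeff n (\<lambda>l. (g l, h l))" for h :: "nat \<Rightarrow> 'a"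
    using finite_atLeastAtMost assms(1)
  proof (induction rule: permutes_rev_induct)
    case id
    then show ?case by (simp add: sign_id)
  next
    case (swap a b p)
    show ?case
    proof (cases "a = b")
      case True
      then show ?thesis using swap by simp
    next
      case False
      have "(\<lambda>l. (g ((p \<circ> Transposition.transpose a b) l), h l)) = (\<lambda>l. (g (p l), h l))(a := (g (p b), h a), b := (g (p a), h b))"
        using False by (auto simp: fun_eq_iff Transposition.transpose_def)
      then have "pairs_coeff n (\<lambda>l. (g ((p \<circ> Transposition.transpose a b) l), h l)) = pairs_coeff n ((\<lambda>l. (g (p l), h l))(a := (g (p b), h a), b := (g (p a), h b)))"
        by (rule arg_cong)
      also have "\<dots> = - pairs_coeff n (\<lambda>l. (g (p l), h l))"
        by (rule pairs_coeff_swap_fst[OF False swap.hyps(1,2)]) (rule refl)+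
      finally have "pairs_coeff n (\<lambda>l. (g ((p \<circ> Transposition.transpose a b) l), h l)) = - pairs_coeff n (\<lambda>l. (g (p l), h l))" .
      moreover have "sign (p \<circ> Transposition.transpose a b) = - sign p"
      proof -
        have "permutation p" by (rule permutes_imp_permutation[OF finite_atLeastAtMost swap.hyps(4)])
        then show ?thesis using False by (simp add: sign_compose permutation_swap_id sign_swap_id)
      qed
      ultimately show ?thesis using swap.IH by (simp only: of_int_minus mult_minus_left)
    qed
  qed
  have 2: "pairs_coeff n (\<lambda>l. (g l, h (\<tau> l))) = of_int (sign \<tau>) * pairs_coeff n (\<lambda>l. (g l, h l))" for g :: "nat \<Rightarrow> 'a"
    using finite_atLeastAtMost assms(2)
  proof (induction rule: permutes_rev_induct)
    case id
    then show ?case by (simp add: sign_id)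
  next
    case (swap a b p)
    show ?case
    proof (cases "a = b")
      case True
      then show ?thesis using swap by simp
    next
      case False
      have "(\<lambda>l. (g l, h ((p \<circ> Transposition.transpose a b) l))) = (\<lambda>l. (g l, h (p l)))(a := (g a, h (p b)), b := (g b, h (p a)))"
        using False by (auto simp: fun_eq_iff Transposition.transpose_def)
      then have "pairs_coeff n (\<lambda>l. (g l, h ((p \<circ> Transposition.transpose a b) l))) = pairs_coeff n ((\<lambda>l. (g l, h (p l)))(a := (g a, h (p b)), b := (g b, h (p a))))"
        by (rule arg_cong)
      also have "\<dots> = - pairs_coeff n (\<lambda>l. (g l, h (p l)))"
        by (rule pairs_coeff_swap_snd[OF False swap.hyps(1,2)]) (rule refl)+
      finally have "pairs_coeff n (\<lambda>l. (g l, h ((p \<circ> Transposition.transpose a b) l))) = - pairs_coeff n (\<lambda>l. (g l, h (p l)))" .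
      moreover have "sign (p \<circ> Transposition.transpose a b) = - sign p"
      proof -
        have "permutation p" by (rule permutes_imp_permutation[OF finite_atLeastAtMost swap.hyps(4)])
        then show ?thesis using False by (simp add: sign_compose permutation_swap_id sign_swap_id)
      qed
      ultimately show ?thesis using swap.IH by (simp only: of_int_minus mult_minus_left)
    qed
  qed
  have "sign (\<sigma> \<circ> \<tau>) = sign \<sigma> * sign \<tau>"
    using assms
    by (intro sign_compose permutes_imp_permutation[OF finite_atLeastAtMost])
  then show ?thesis using 1[of "\<lambda>l. h (\<tau> l)"] 2[of g] by simp
qed

text \<open>Exchanging two equal indices changes nothing, yet reverses the sign.\<close>

lemma pairs_coeff_eq_0:
  assumes "\<not> inj_on (fst \<circ> f) {1..n} \<or> \<not> inj_on (snd \<circ> f) {1..n}"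
  shows "pairs_coeff n f = 0"
proof -
  have 0: "x = - x \<Longrightarrow> x = 0" for x :: complex by (simp add: eq_neg_iff_add_eq_0)
  consider x y where "x \<noteq> y" "x \<in> {1..n}" "y \<in> {1..n}" "fst (f x) = fst (f y)" |
    x y where "x \<noteq> y" "x \<in> {1..n}" "y \<in> {1..n}" "snd (f x) = snd (f y)"
    using assms by (auto simp: inj_on_def)
  then show ?thesis
  proof cases
    case 1
    have "f(x := (fst (f y), snd (f x)), y := (fst (f x), snd (f y))) = f" using 1 by (metis fun_upd_triv prod.collapse)
    then show ?thesis using pairs_coeff_swap_fst[OF 1(1-3), of f "fst (f x)" "snd (f x)" "fst (f y)" "snd (f y)"] 0 by simp
  next
    case 2
    have "f(x := (fst (f x), snd (f y)), y := (fst (f y), snd (f x))) = f" using 2 by (metis fun_upd_triv prod.collapse)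
    then show ?thesis using pairs_coeff_swap_snd[OF 2(1-3), of f "fst (f x)" "snd (f x)" "fst (f y)" "snd (f y)"] 0 by simp
  qed
qed

section \<open>The numbering of the index type\<close>

lemma pos_bij: "bij_betw (pos :: 'n::{finite,wellorder} \<Rightarrow> nat) UNIV {1..CARD('n)}"
proof -
  have "inj (pos :: 'n \<Rightarrow> nat)"
  proof (rule injI)
    fix i j :: 'n assume "pos i = pos j"
    show "i = j"
    proof (rule ccontr)
      assume "i \<noteq> j"
      then consider "i < j" | "j < i" by fastforce
      then show False using psubset_card_mono[of "{..j}" "{..i}"] psubset_card_mono[of "{..i}" "{..j}"] \<open>pos i = pos j\<close>
        by cases (fastforce simp: pos_def psubset_eq)+
    qed
  qed
  moreover have "pos ` (UNIV :: 'n set) \<subseteq> {1..CARD('n)}"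
  proof -
    have "card {..j} \<le> CARD('n)" for j :: 'n by (rule card_mono) auto
    then show ?thesis by (auto simp: pos_def Suc_le_eq card_gt_0_iff)
  qed
  moreover have "card (pos ` (UNIV :: 'n set)) = CARD('n)" using calculation(1) by (simp add: card_image)
  ultimately show ?thesis unfolding bij_betw_def using card_subset_eq[of "{1..CARD('n)}"] by simp
qed

lemma idx_pos [simp]: "idx (pos j) = j"
  unfolding idx_def using pos_bij by (auto simp: bij_betw_def dest: injD)

lemma pos_idx: "r \<in> {1..CARD('n)} \<Longrightarrow> pos (idx r :: 'n::{finite,wellorder}) = r"
  using pos_bij by (metis bij_betw_def idx_pos imageE)

lemma idx_bij: "bij_betw (idx :: nat \<Rightarrow> 'n::{finite,wellorder}) {1..CARD('n)} UNIV"
  by (rule bij_betw_byWitness[where f' = pos])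
    (use pos_bij[where 'n='n] pos_idx[where 'n='n] in \<open>auto simp: bij_betw_def\<close>)

lemma pos_less_iff: "pos i < pos j \<longleftrightarrow> i < (j :: 'n::{finite,wellorder})"
proof -
  have mono: "i < j \<Longrightarrow> pos i < pos j" for i j :: 'n
    unfolding pos_def by (intro psubset_card_mono) (auto simp: psubset_eq)
  show ?thesis using mono[of i j] mono[of j i] by (cases i j rule: linorder_cases) auto
qed

text \<open>The largest index is wedged in last. Inserting it after the m unbarred indices, after
  the m barred ones, and passing its barred factor across the m unbarred factors costs (-1)^m each,
  hence (-1)^m in total. The exponents 0, 1, ..., m - 1 add up to m(m-1)/2.\<close>

lemma wedge_pairs_diag:
  assumes "m \<le> CARD('n)"
  shows "wedge_pairs (map (\<lambda>l. (idx l, idx l)) [1..<m + 1]) coeffs_one =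
    (\<lambda>I J. if I = idx ` {1..m} \<and> J = (idx ` {1..m} :: 'n::{finite,wellorder} set) then (-1) ^ (m * (m - 1) div 2) else 0)"
  using assms
proof (induction m)
  case 0
  then show ?case by (auto simp: wedge_pairs_def coeffs_one_def fun_eq_iff)
next
  case (Suc m)
  define S where "S = (idx ` {1..m} :: 'n set)"
  define j where "j = (idx (Suc m) :: 'n)"
  have inj: "inj_on (idx :: nat \<Rightarrow> 'n) {1..CARD('n)}" using idx_bij[where 'n='n] by (simp add: bij_betw_def)
  have jS: "j \<notin> S" using inj_onD[OF inj] Suc.prems by (force simp: S_def j_def)
  have less: "i < j" if "i \<in> S" for i
    using that Suc.prems pos_idx[where 'n='n] by (auto simp: S_def j_def simp flip: pos_less_iff)
  have cardS: "card S = m" using inj Suc.prems by (simp add: S_def card_image inj_on_subset)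
  have sgn: "insert_sign j S = (-1) ^ m"
  proof -
    have "{i \<in> S. i < j} = S" using less by auto
    then show ?thesis using cardS by (simp add: insert_sign_def)
  qed
  have S': "idx ` {1..Suc m} = insert j S" by (auto simp: S_def j_def atLeastAtMostSuc_conv)
  have "wedge_pairs (map (\<lambda>l. (idx l, idx l)) [1..<Suc m + 1]) coeffs_one =
     wedge_pair (j, j) (wedge_pairs (map (\<lambda>l. (idx l, idx l)) [1..<m + 1]) coeffs_one)"
    by (simp add: wedge_pairs_def j_def)
  also have "\<dots> = wedge_pair (j, j) (\<lambda>I J. if I = S \<and> J = S then (-1) ^ (m * (m - 1) div 2) else 0)"
    using Suc by (simp add: S_def)
  also have "\<dots> = (\<lambda>I J. if I = insert j S \<and> J = insert j S then (-1) ^ (Suc m * (Suc m - 1) div 2) else 0)"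
  proof (intro ext)
    fix I J
    have eqI: "(j \<in> I \<and> I - {j} = S) \<longleftrightarrow> I = insert j S" for I using jS by auto
    have "Suc m * m div 2 = m * (m - 1) div 2 + m"
    proof (cases m)
      case (Suc k)
      have "Suc (Suc k) * Suc k = (Suc k * k) + Suc k * 2" by simp
      then show ?thesis unfolding Suc by (metis diff_Suc_1 div_mult_self1 mult.commute zero_neq_numeral add.commute)
    qed simp
    moreover have "(-1) ^ m * ((-1) ^ m * (-1) ^ m) = ((-1) ^ m :: complex)" by (simp flip: power_mult_distrib)
    ultimately show "wedge_pair (j, j) (\<lambda>I J. if I = S \<and> J = S then (-1) ^ (m * (m - 1) div 2) else 0) I J
       = (if I = insert j S \<and> J = insert j S then (-1) ^ (Suc m * (Suc m - 1) div 2) else 0)"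
      using eqI[of I] eqI[of J] sgn cardS
      by (auto simp: wedge_pair_def wedge_dz_def wedge_dzbar_def power_add)
  qed
  finally show ?case by (simp only: S')
qed

section \<open>Products of general (1,1)-forms and mixed discriminants\<close>

definition wedge_mat :: "('n::{finite,wellorder} \<Rightarrow> 'n \<Rightarrow> complex) \<Rightarrow> 'n coeffs \<Rightarrow> 'n coeffs" where
  "wedge_mat M w I J = (\<Sum>j\<in>UNIV. \<Sum>k\<in>UNIV. M j k * wedge_pair (j, k) w I J)"

primrec wedge_mats :: "('n::{finite,wellorder} \<Rightarrow> 'n \<Rightarrow> complex) list \<Rightarrow> 'n coeffs \<Rightarrow> 'n coeffs" where
  "wedge_mats [] w = w"
| "wedge_mats (M # Ms) w = wedge_mats Ms (wedge_mat M w)"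

lemma wedge_mat_expand: "wedge_mat M w I J = (\<Sum>p\<in>UNIV. M (fst p) (snd p) * wedge_pair p w I J)"
  by (simp add: wedge_mat_def sum.cartesian_product split_beta flip: UNIV_Times_UNIV)

lemma lists_length_Suc: "{ps :: 'a list. length ps = Suc m} = (\<lambda>(p, ps). p # ps) ` (UNIV \<times> {ps. length ps = m})"
  by (auto simp: length_Suc_conv image_iff)

lemma wedge_mats_expand:
  fixes w :: "'n::{finite,wellorder} coeffs"
  shows "wedge_mats Ms w I J = (\<Sum>ps | length ps = length Ms.
    (\<Prod>l<length Ms. (Ms ! l) (fst (ps ! l)) (snd (ps ! l))) * wedge_pairs ps w I J)"
proof (induction Ms arbitrary: w)
  case Nil
  then show ?case by (simp add: wedge_pairs_def)
next
  case (Cons M Ms)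
  let ?P = "\<lambda>ps. \<Prod>l<length Ms. (Ms ! l) (fst (ps ! l)) (snd (ps ! l))"
  have w: "wedge_pairs ps (wedge_mat M w) I J = (\<Sum>p\<in>UNIV. M (fst p) (snd p) * wedge_pairs (p # ps) w I J)" for ps
    unfolding wedge_mat_expand[abs_def] by (simp add: wedge_pairs_linear) (simp add: wedge_pairs_def)
  have "wedge_mats (M # Ms) w I J = (\<Sum>ps | length ps = length Ms. ?P ps * wedge_pairs ps (wedge_mat M w) I J)"
    using Cons by simp
  also have "\<dots> = (\<Sum>ps | length ps = length Ms. \<Sum>p\<in>UNIV. M (fst p) (snd p) * ?P ps * wedge_pairs (p # ps) w I J)"
    unfolding w sum_distrib_left by (intro sum.cong refl) (simp add: mult_ac)
  also have "\<dots> = (\<Sum>p\<in>UNIV. \<Sum>ps | length ps = length Ms. M (fst p) (snd p) * ?P ps * wedge_pairs (p # ps) w I J)"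
    by (rule sum.swap)
  also have "\<dots> = (\<Sum>(p, ps) \<in> UNIV \<times> {ps. length ps = length Ms}. M (fst p) (snd p) * ?P ps * wedge_pairs (p # ps) w I J)"
    by (simp add: sum.cartesian_product)
  also have "\<dots> = (\<Sum>ps | length ps = Suc (length Ms).
      (\<Prod>l<Suc (length Ms). ((M # Ms) ! l) (fst (ps ! l)) (snd (ps ! l))) * wedge_pairs ps w I J)"
    unfolding lists_length_Suc
    by (subst sum.reindex) (auto simp: inj_on_def split_beta prod.lessThan_Suc_shift simp del: prod.lessThan_Suc intro!: sum.cong)
  finally show ?case by simp
qed

text \<open>Multilinear expansion leaves one term for each list of index pairs. Lists with a
  repeated first or second index contribute 0; the others come from a pair of permutations and
  contribute its sign times the diagonal value. The factor n! offsets the 1/n! in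
  \<open>mixed_disc\<close>.\<close>

theorem wedge_mats_mixed_disc:
  fixes M :: "nat \<Rightarrow> 'n::{finite,wellorder} \<Rightarrow> 'n \<Rightarrow> complex"
  defines "n \<equiv> CARD('n)"
  shows "wedge_mats (map M [1..<n + 1]) coeffs_one UNIV UNIV =
    (-1) ^ (n * (n - 1) div 2) * (fact n * mixed_disc n (\<lambda>l r s. M l (idx r) (idx s)))"
proof -
  define P where "P = {p. p permutes {1..n}}"
  define F where "F = (\<lambda>(\<sigma>, \<tau>). map (\<lambda>l. (idx (\<sigma> l) :: 'n, idx (\<tau> l) :: 'n)) [1..<n + 1])"
  define G where "G ps = (\<Prod>l<n. M (Suc l) (fst (ps ! l)) (snd (ps ! l))) * wedge_pairs ps coeffs_one UNIV UNIV" for ps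
  have bijidx: "bij_betw (idx :: nat \<Rightarrow> 'n) {1..n} UNIV" using idx_bij[where 'n='n] by (simp add: n_def)
  have nth: "map f [1..<n + 1] ! l = f (Suc l)" if "l < n" for l and f :: "nat \<Rightarrow> 'z"
    using that by (simp add: nth_append del: upt_Suc)
  have "wedge_mats (map M [1..<n + 1]) coeffs_one UNIV UNIV = (\<Sum>ps | length ps = n. G ps)"
  proof -
    have len: "length (map M [1..<n + 1]) = n" by (simp del: upt_Suc)
    show ?thesis unfolding wedge_mats_expand G_def len
      by (intro sum.cong prod.cong refl arg_cong2[of _ _ _ _ "(*)"]) (simp add: nth del: upt_Suc map_upt_Suc)
  qed
  also have "\<dots> = (\<Sum>ps\<in>F ` (P \<times> P). G ps)"
  proof (rule sum.mono_neutral_right)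
    show "finite {ps :: ('n \<times> 'n) list. length ps = n}"
      using finite_lists_length_eq[of "UNIV :: ('n \<times> 'n) set" n] by simp
    show "F ` (P \<times> P) \<subseteq> {ps. length ps = n}" by (auto simp: F_def)
    show "\<forall>ps\<in>{ps. length ps = n} - F ` (P \<times> P). G ps = 0"
    proof
      fix ps :: "('n \<times> 'n) list" assume ps: "ps \<in> {ps. length ps = n} - F ` (P \<times> P)"
      then have len: "length ps = n" by simp
      define f where "f l = ps ! (l - 1)" for l
      have psf: "ps = map f [1..<n + 1]"
        by (rule nth_equalityI) (use len in \<open>auto simp: nth f_def simp del: upt_Suc\<close>)
      have "\<not> inj_on (fst \<circ> f) {1..n} \<or> \<not> inj_on (snd \<circ> f) {1..n}"
      proof (rule ccontr)
        assume "\<not> (\<not> inj_on (fst \<circ> f) {1..n} \<or> \<not> inj_on (snd \<circ> f) {1..n})"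
        then have inj: "inj_on (fst \<circ> f) {1..n}" "inj_on (snd \<circ> f) {1..n}" by auto
        \<comment> \<open>Read through \<open>pos\<close>, an injective map from {1..n} to the index
          type is an injective self-map of a finite set, hence a permutation once it is extended by
          the identity.\<close>
        have perm: "\<exists>\<sigma>\<in>P. \<forall>l\<in>{1..n}. idx (\<sigma> l) = g l" if g: "inj_on g {1..n}" for g :: "nat \<Rightarrow> 'n"
        proof -
          define \<sigma> where "\<sigma> l = (if l \<in> {1..n} then pos (g l) else l)" for l
          have "inj_on \<sigma> {1..n}"
          proof (rule inj_onI)
            fix x y assume xy: "x \<in> {1..n}" "y \<in> {1..n}" "\<sigma> x = \<sigma> y"
            then have "idx (pos (g x)) = (idx (pos (g y)) :: 'n)" unfolding \<sigma>_def by simp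
            then show "x = y" using inj_onD[OF g] xy by (metis idx_pos)
          qed
          moreover have "\<sigma> ` {1..n} \<subseteq> {1..n}"
          proof (rule image_subsetI)
            fix x assume "x \<in> {1..n}"
            then have "\<sigma> x = pos (g x)" by (simp add: \<sigma>_def)
            moreover have "pos (g x) \<in> {1..n}" using pos_bij[where 'n='n] n_def by (metis UNIV_I bij_betw_apply)
            ultimately show "\<sigma> x \<in> {1..n}" by (simp only:)
          qed
          ultimately have "bij_betw \<sigma> {1..n} {1..n}"
            unfolding bij_betw_def by (simp add: endo_inj_surj)
          then have "\<sigma> permutes {1..n}" by (intro bij_imp_permutes) (auto simp: \<sigma>_def)
          then show ?thesis by (intro bexI[of _ \<sigma>]) (auto simp: P_def \<sigma>_def)
        qed
        obtain \<sigma> \<tau> where st: "\<sigma> \<in> P" "\<tau> \<in> P" "\<forall>l\<in>{1..n}. idx (\<sigma> l) = fst (f l)" "\<forall>l\<in>{1..n}. idx (\<tau> l) = snd (f l)"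
          using perm[OF inj(1)] perm[OF inj(2)] by auto
        then have "ps = F (\<sigma>, \<tau>)" unfolding psf F_def by auto
        then show False using st ps by auto
      qed
      from pairs_coeff_eq_0[OF this] show "G ps = 0" by (simp add: G_def pairs_coeff_def psf)
    qed
  qed
  also have "\<dots> = (\<Sum>(\<sigma>, \<tau>)\<in>P \<times> P. G (F (\<sigma>, \<tau>)))"
  proof (subst sum.reindex)
    show "inj_on F (P \<times> P)"
    proof (rule inj_onI, clarify)
      fix \<sigma> \<tau> \<sigma>' \<tau>' assume a: "\<sigma> \<in> P" "\<tau> \<in> P" "\<sigma>' \<in> P" "\<tau>' \<in> P" "F (\<sigma>, \<tau>) = F (\<sigma>', \<tau>')"
      have "\<sigma> l = \<sigma>' l \<and> \<tau> l = \<tau>' l" for l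
      proof (cases "l \<in> {1..n}")
        case True
        then have "F (\<sigma>, \<tau>) ! (l - 1) = F (\<sigma>', \<tau>') ! (l - 1)" using a by simp
        then have "idx (\<sigma> l) = (idx (\<sigma>' l) :: 'n)" "idx (\<tau> l) = (idx (\<tau>' l) :: 'n)"
          using True by (auto simp: F_def nth simp del: upt_Suc)
        moreover have "\<sigma> l \<in> {1..n}" "\<tau> l \<in> {1..n}" "\<sigma>' l \<in> {1..n}" "\<tau>' l \<in> {1..n}"
          using a True by (auto simp: P_def permutes_in_image simp del: atLeastAtMost_iff)
        ultimately show ?thesis using bijidx by (auto simp: bij_betw_def dest: inj_onD)
      next
        case False
        then show ?thesis using a by (auto simp: P_def permutes_def)
      qed
      then show "\<sigma> = \<sigma>' \<and> \<tau> = \<tau>'" by auto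
    qed
  qed (simp add: split_beta)
  also have "\<dots> = (\<Sum>(\<sigma>, \<tau>)\<in>P \<times> P. (-1) ^ (n * (n - 1) div 2) *
      (of_int (sign (\<sigma> \<circ> \<tau>)) * (\<Prod>l=1..n. M l (idx (\<sigma> l)) (idx (\<tau> l)))))"
  proof (rule sum.cong[OF refl], clarify)
    fix \<sigma> \<tau> assume st: "\<sigma> \<in> P" "\<tau> \<in> P"
    have idxU: "idx ` {1..n} = (UNIV :: 'n set)" using bijidx by (simp add: bij_betw_def)
    have diag: "pairs_coeff n (\<lambda>l. (idx l :: 'n, idx l :: 'n)) = (-1) ^ (n * (n - 1) div 2)"
      unfolding pairs_coeff_def by (subst wedge_pairs_diag) (use idxU in \<open>auto simp: n_def simp del: upt_Suc\<close>)
    have "wedge_pairs (F (\<sigma>, \<tau>)) coeffs_one UNIV UNIV = of_int (sign (\<sigma> \<circ> \<tau>)) * (-1) ^ (n * (n - 1) div 2)"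
      using pairs_coeff_permute[of \<sigma> n \<tau> "idx :: nat \<Rightarrow> 'n" "idx :: nat \<Rightarrow> 'n"] st diag
      by (simp add: F_def P_def pairs_coeff_def)
    moreover have "(\<Prod>l<n. M (Suc l) (fst (F (\<sigma>, \<tau>) ! l)) (snd (F (\<sigma>, \<tau>) ! l))) = (\<Prod>l=1..n. M l (idx (\<sigma> l)) (idx (\<tau> l)))"
    proof -
      have "(\<Prod>l<n. M (Suc l) (fst (F (\<sigma>, \<tau>) ! l)) (snd (F (\<sigma>, \<tau>) ! l))) = (\<Prod>l<n. M (Suc l) (idx (\<sigma> (Suc l))) (idx (\<tau> (Suc l))))"
        by (rule prod.cong[OF refl]) (simp add: F_def nth del: upt_Suc map_upt_Suc)
      then show ?thesis by (simp add: prod.atLeast1_atMost_eq)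
    qed
    ultimately show "G (F (\<sigma>, \<tau>)) = (-1) ^ (n * (n - 1) div 2) *
      (of_int (sign (\<sigma> \<circ> \<tau>)) * (\<Prod>l=1..n. M l (idx (\<sigma> l)) (idx (\<tau> l))))"
      unfolding G_def by (simp only: mult_ac)
  qed
  also have "\<dots> = (-1) ^ (n * (n - 1) div 2) * (\<Sum>\<sigma>\<in>P. \<Sum>\<tau>\<in>P.
      of_int (sign (\<sigma> \<circ> \<tau>)) * (\<Prod>l=1..n. M l (idx (\<sigma> l)) (idx (\<tau> l))))"
    by (simp only: sum_distrib_left flip: sum.cartesian_product)
  also have "\<dots> = (-1) ^ (n * (n - 1) div 2) * (fact n * mixed_disc n (\<lambda>l r s. M l (idx r) (idx s)))"
  proof -
    have "fact n * ((1 / fact n) * S) = S" for S :: complex by simp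
    then show ?thesis by (simp only: mixed_disc_def P_def)
  qed
  finally show ?thesis .
qed

section \<open>Positivity and Laplace expansion of mixed discriminants\<close>

lemma mixed_disc_cong:
  assumes "\<And>l r s. l \<in> {1..n} \<Longrightarrow> r \<in> {1..n} \<Longrightarrow> s \<in> {1..n} \<Longrightarrow> M l r s = N l r s"
  shows "mixed_disc n M = mixed_disc n N"
proof -
  have "(\<Prod>l=1..n. M l (\<sigma> l) (\<tau> l)) = (\<Prod>l=1..n. N l (\<sigma> l) (\<tau> l))"
    if "\<sigma> permutes {1..n}" "\<tau> permutes {1..n}" for \<sigma> \<tau>
    by (rule prod.cong[OF refl], rule assms) (use permutes_in_image[OF that(1)] permutes_in_image[OF that(2)] in blast)+
  then show ?thesis unfolding mixed_disc_def by (intro arg_cong2[of _ _ _ _ "(*)"] sum.cong refl) auto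
qed

lemma mixed_disc_sum_slot:
  assumes "k \<in> {1..n}"
  shows "mixed_disc n (M(k := (\<lambda>r s. \<Sum>i\<in>I. X i r s))) = (\<Sum>i\<in>I. mixed_disc n (M(k := X i)))"
proof -
  have split: "(\<Prod>l=1..n. (M(k := Y)) l (\<sigma> l) (\<tau> l)) = Y (\<sigma> k) (\<tau> k) * (\<Prod>l\<in>{1..n} - {k}. M l (\<sigma> l) (\<tau> l))" for Y \<sigma> \<tau>
    by (subst prod.remove[OF _ assms]) (auto intro!: prod.cong)
  let ?S = "{p. p permutes {1..n}}"
  let ?R = "\<lambda>\<sigma> \<tau>. \<Prod>l\<in>{1..n} - {k}. M l (\<sigma> l) (\<tau> l)"
  have "(\<Sum>\<sigma>\<in>?S. \<Sum>\<tau>\<in>?S. of_int (sign (\<sigma> \<circ> \<tau>)) * ((\<Sum>i\<in>I. X i (\<sigma> k) (\<tau> k)) * ?R \<sigma> \<tau>))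
      = (\<Sum>\<sigma>\<in>?S. \<Sum>\<tau>\<in>?S. \<Sum>i\<in>I. of_int (sign (\<sigma> \<circ> \<tau>)) * (X i (\<sigma> k) (\<tau> k) * ?R \<sigma> \<tau>))"
    by (simp only: sum_distrib_left sum_distrib_right)
  also have "\<dots> = (\<Sum>\<sigma>\<in>?S. \<Sum>i\<in>I. \<Sum>\<tau>\<in>?S. of_int (sign (\<sigma> \<circ> \<tau>)) * (X i (\<sigma> k) (\<tau> k) * ?R \<sigma> \<tau>))"
    by (intro sum.cong refl sum.swap)
  also have "\<dots> = (\<Sum>i\<in>I. \<Sum>\<sigma>\<in>?S. \<Sum>\<tau>\<in>?S. of_int (sign (\<sigma> \<circ> \<tau>)) * (X i (\<sigma> k) (\<tau> k) * ?R \<sigma> \<tau>))"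
    by (rule sum.swap)
  finally show ?thesis unfolding mixed_disc_def split by (simp only: sum_distrib_left)
qed

lemma mixed_disc_scale:
  "mixed_disc n (\<lambda>l r s. c l * M l r s) = (\<Prod>l=1..n. c l) * mixed_disc n M"
  unfolding mixed_disc_def by (simp add: prod.distrib sum_distrib_left mult_ac)

lemma mixed_disc_cnj:
  "mixed_disc n (\<lambda>l r s. cnj (M l s r)) = cnj (mixed_disc n M)"
proof -
  let ?S = "{p. p permutes {1..n}}"
  have sgn: "sign (\<sigma> \<circ> \<tau>) = sign (\<tau> \<circ> \<sigma>)" if "\<sigma> \<in> ?S" "\<tau> \<in> ?S" for \<sigma> \<tau>
  proof -
    have "permutation \<sigma>" "permutation \<tau>" using that permutes_imp_permutation[OF finite_atLeastAtMost] by auto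
    then show ?thesis by (simp add: sign_compose)
  qed
  have "(\<Sum>\<sigma>\<in>?S. \<Sum>\<tau>\<in>?S. of_int (sign (\<sigma> \<circ> \<tau>)) * (\<Prod>l=1..n. cnj (M l (\<tau> l) (\<sigma> l))))
     = (\<Sum>\<tau>\<in>?S. \<Sum>\<sigma>\<in>?S. of_int (sign (\<sigma> \<circ> \<tau>)) * (\<Prod>l=1..n. cnj (M l (\<tau> l) (\<sigma> l))))"
    by (rule sum.swap)
  also have "\<dots> = (\<Sum>\<sigma>\<in>?S. \<Sum>\<tau>\<in>?S. of_int (sign (\<sigma> \<circ> \<tau>)) * (\<Prod>l=1..n. cnj (M l (\<sigma> l) (\<tau> l))))"
    by (intro sum.cong refl) (simp only: sgn)
  finally show ?thesis unfolding mixed_disc_def by (simp add: cnj_sum cnj_prod)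
qed

text \<open>For rank-one Hermitian matrices the double sum over permutations factors into the
  determinant of the vectors \<open>v l\<close> and its complex conjugate.\<close>

lemma mixed_disc_rank_one:
  "mixed_disc n (\<lambda>l r s. v l r * cnj (v l s)) =
     of_real ((cmod (\<Sum>\<sigma> | \<sigma> permutes {1..n}. of_int (sign \<sigma>) * (\<Prod>l=1..n. v l (\<sigma> l))))\<^sup>2 / fact n)"
proof -
  let ?S = "{p. p permutes {1..n}}"
  let ?d = "\<Sum>\<sigma>\<in>?S. of_int (sign \<sigma>) * (\<Prod>l=1..n. v l (\<sigma> l))"
  have "?d * cnj ?d = (\<Sum>\<sigma>\<in>?S. \<Sum>\<tau>\<in>?S. (of_int (sign \<sigma>) * (\<Prod>l=1..n. v l (\<sigma> l))) * (of_int (sign \<tau>) * (\<Prod>l=1..n. cnj (v l (\<tau> l)))))"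
    by (simp add: sum_product)
  also have "\<dots> = (\<Sum>\<sigma>\<in>?S. \<Sum>\<tau>\<in>?S. of_int (sign (\<sigma> \<circ> \<tau>)) * (\<Prod>l=1..n. v l (\<sigma> l) * cnj (v l (\<tau> l))))"
  proof (intro sum.cong refl)
    fix \<sigma> \<tau> assume "\<sigma> \<in> ?S" "\<tau> \<in> ?S"
    then have "permutation \<sigma>" "permutation \<tau>" using permutes_imp_permutation[OF finite_atLeastAtMost] by auto
    then have "sign (\<sigma> \<circ> \<tau>) = sign \<sigma> * sign \<tau>" by (rule sign_compose)
    then show "(of_int (sign \<sigma>) * (\<Prod>l=1..n. v l (\<sigma> l))) * (of_int (sign \<tau>) * (\<Prod>l=1..n. cnj (v l (\<tau> l)))) =
      of_int (sign (\<sigma> \<circ> \<tau>)) * (\<Prod>l=1..n. v l (\<sigma> l) * cnj (v l (\<tau> l)))"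
      by (simp add: prod.distrib)
  qed
  finally have "mixed_disc n (\<lambda>l r s. v l r * cnj (v l s)) = ?d * cnj ?d / fact n"
    unfolding mixed_disc_def by simp
  also have "\<dots> = of_real ((cmod ?d)\<^sup>2 / fact n)"
    by (simp only: of_real_divide complex_norm_square of_real_fact)
  finally show ?thesis .
qed

text \<open>Positive semidefiniteness of a Hermitian matrix, relative to a set of indices because
  the decomposition below is an induction on that set.\<close>

definition psd_on :: "'a set \<Rightarrow> ('a \<Rightarrow> 'a \<Rightarrow> complex) \<Rightarrow> bool" where
  "psd_on S A \<longleftrightarrow> (\<forall>r\<in>S. \<forall>s\<in>S. A s r = cnj (A r s)) \<and>
     (\<forall>\<xi>. Re (\<Sum>r\<in>S. \<Sum>s\<in>S. A r s * \<xi> r * cnj (\<xi> s)) \<ge> 0)"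

lemma quadratic_form_insert:
  assumes "finite S" "x \<notin> S"
  shows "(\<Sum>r\<in>insert x S. \<Sum>s\<in>insert x S. A r s * \<xi> r * cnj (\<xi> s)) =
    (\<Sum>r\<in>S. \<Sum>s\<in>S. A r s * \<xi> r * cnj (\<xi> s)) + A x x * \<xi> x * cnj (\<xi> x)
     + (\<Sum>r\<in>S. A r x * \<xi> r) * cnj (\<xi> x) + \<xi> x * (\<Sum>s\<in>S. A x s * cnj (\<xi> s))"
  using assms by (simp add: sum.distrib sum_distrib_left sum_distrib_right algebra_simps)

lemma psd_on_pair:
  assumes "psd_on S A" "finite S" "x \<in> S" "y \<in> S" "x \<noteq> y"
  shows "Re (A y y * a * cnj a) + Re (A x x * b * cnj b) + Re (A y x * a * cnj b) + Re (A x y * b * cnj a) \<ge> 0"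
proof -
  define \<xi> where "\<xi> = (\<lambda>_. 0)(y := a, x := b)"
  have "(\<Sum>r\<in>S. \<Sum>s\<in>S. A r s * \<xi> r * cnj (\<xi> s)) = (\<Sum>r\<in>{x,y}. \<Sum>s\<in>S. A r s * \<xi> r * cnj (\<xi> s))"
    using assms by (intro sum.mono_neutral_right) (auto simp: \<xi>_def)
  also have "\<dots> = (\<Sum>r\<in>{x,y}. \<Sum>s\<in>{x,y}. A r s * \<xi> r * cnj (\<xi> s))"
    using assms by (intro sum.cong refl sum.mono_neutral_right) (auto simp: \<xi>_def)
  also have "\<dots> = A y y * a * cnj a + A x x * b * cnj b + A y x * a * cnj b + A x y * b * cnj a"
    using assms by (simp add: \<xi>_def)
  moreover have "Re (\<Sum>r\<in>S. \<Sum>s\<in>S. A r s * \<xi> r * cnj (\<xi> s)) \<ge> 0" using assms(1) unfolding psd_on_def by blast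
  ultimately show ?thesis by simp
qed

lemma psd_on_diag:
  assumes "psd_on S A" "finite S" "x \<in> S"
  shows "A x x = of_real (Re (A x x))" "Re (A x x) \<ge> 0"
proof -
  show "A x x = of_real (Re (A x x))"
  proof -
    have "A x x = cnj (A x x)" using assms unfolding psd_on_def by blast
    from arg_cong[OF this, of Im] show ?thesis by (simp add: complex_eq_iff)
  qed
  define \<xi> where "\<xi> = (\<lambda>_. 0)(x := 1::complex)"
  have "(\<Sum>r\<in>S. \<Sum>s\<in>S. A r s * \<xi> r * cnj (\<xi> s)) = (\<Sum>r\<in>{x}. \<Sum>s\<in>S. A r s * \<xi> r * cnj (\<xi> s))"
    using assms by (intro sum.mono_neutral_right) (auto simp: \<xi>_def)
  also have "\<dots> = (\<Sum>r\<in>{x}. \<Sum>s\<in>{x}. A r s * \<xi> r * cnj (\<xi> s))"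
    using assms by (intro sum.cong refl sum.mono_neutral_right) (auto simp: \<xi>_def)
  finally have "(\<Sum>r\<in>S. \<Sum>s\<in>S. A r s * \<xi> r * cnj (\<xi> s)) = A x x" by (simp add: \<xi>_def)
  moreover have "Re (\<Sum>r\<in>S. \<Sum>s\<in>S. A r s * \<xi> r * cnj (\<xi> s)) \<ge> 0" using assms(1) unfolding psd_on_def by blast
  ultimately show "Re (A x x) \<ge> 0" by simp
qed

text \<open>Cholesky elimination of one index at a time.\<close>

lemma psd_on_decomposition:
  assumes "finite S" "psd_on S A"
  shows "\<exists>v. \<forall>r\<in>S. \<forall>s\<in>S. A r s = (\<Sum>i\<in>S. v i r * cnj (v i s))"
  using assms
proof (induction S arbitrary: A rule: finite_induct)
  case empty
  then show ?case by simp
next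
  case (insert x S)
  let ?T = "insert x S"
  have fin: "finite ?T" using insert by simp
  have herm: "A s r = cnj (A r s)" if "r \<in> ?T" "s \<in> ?T" for r s using insert.prems that unfolding psd_on_def by blast
  define a where "a = Re (A x x)"
  have a: "A x x = of_real a" "a \<ge> 0" using psd_on_diag[OF insert.prems fin, of x] by (auto simp: a_def)
  \<comment> \<open>The Schur complement of the pivot \<open>a\<close>. For \<open>a = 0\<close> the
    convention x / 0 = 0 makes the correction vanish.\<close>
  define B where "B r s = A r s - A r x * A x s / of_real a" for r s
  have Ax: "A x s = cnj (A s x)" if "s \<in> S" for s using herm[of s x] that by simp
  \<comment> \<open>With a zero pivot the quadratic form is affine in the coordinate at
    \<open>x\<close> once the one at \<open>s\<close> is 1. The value -K A(s,x) there, with K large,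
    would make the form negative unless A(s,x) = 0.\<close>
  have zero: "A s x = 0" if "a = 0" "s \<in> S" for s
  proof (rule ccontr)
    assume ne: "A s x \<noteq> 0"
    have ge: "Re (A s s) - 2 * K * (cmod (A s x))\<^sup>2 \<ge> 0" for K :: real
    proof -
      have "s \<noteq> x" using that insert by auto
      with psd_on_pair[OF insert.prems fin, of x s 1 "- of_real K * A s x"] that a
      have "Re (A s s) + Re (A s x * (- of_real K * cnj (A s x))) + Re (A x s * (- of_real K * A s x)) \<ge> 0" by simp
      moreover have "z * (- of_real K * cnj z) = of_real (- K * (cmod z)\<^sup>2)"
        "cnj z * (- of_real K * z) = of_real (- K * (cmod z)\<^sup>2)" for z
        unfolding of_real_mult of_real_minus complex_norm_square by (simp_all add: mult_ac)
      then have "Re (A s x * (- of_real K * cnj (A s x))) = - K * (cmod (A s x))\<^sup>2"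
        "Re (A x s * (- of_real K * A s x)) = - K * (cmod (A s x))\<^sup>2"
        unfolding Ax[OF that(2)] by (simp_all only: Re_complex_of_real)
      ultimately show ?thesis by simp
    qed
    have "(cmod (A s x))\<^sup>2 > 0" using ne by simp
    then show False using ge[of "(Re (A s s) + 1) / (2 * (cmod (A s x))\<^sup>2)"] by simp
  qed
  have "psd_on S B" unfolding psd_on_def
  proof (intro conjI ballI allI)
    fix r s assume "r \<in> S" "s \<in> S"
    then show "B s r = cnj (B r s)" using herm[of r s] Ax[of r] Ax[of s] by (simp add: B_def)
  next
    fix \<xi> :: "'a \<Rightarrow> complex"
    define u where "u = (\<Sum>r\<in>S. A r x * \<xi> r)"
    \<comment> \<open>For a nonzero pivot this value at \<open>x\<close> completes the square: it
      minimises the form over the coordinate at \<open>x\<close>, and the minimum is the form of the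
      Schur complement.\<close>
    define \<eta> where "\<eta> = \<xi>(x := - u / of_real a)"
    have \<eta>: "\<eta> r = \<xi> r" if "r \<in> S" for r using that insert by (auto simp: \<eta>_def)
    have cu: "(\<Sum>s\<in>S. A x s * cnj (\<xi> s)) = cnj u" unfolding u_def cnj_sum by (rule sum.cong) (simp_all add: Ax)
    have "0 \<le> Re (\<Sum>r\<in>?T. \<Sum>s\<in>?T. A r s * \<eta> r * cnj (\<eta> s))"
      using insert.prems unfolding psd_on_def by blast
    also have "(\<Sum>r\<in>?T. \<Sum>s\<in>?T. A r s * \<eta> r * cnj (\<eta> s)) =
      (\<Sum>r\<in>S. \<Sum>s\<in>S. A r s * \<xi> r * cnj (\<xi> s)) + A x x * \<eta> x * cnj (\<eta> x) + u * cnj (\<eta> x) + \<eta> x * cnj u"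
      unfolding quadratic_form_insert[OF insert.hyps] by (simp add: \<eta> cu u_def cong: sum.cong)
    also have "\<dots> = (\<Sum>r\<in>S. \<Sum>s\<in>S. A r s * \<xi> r * cnj (\<xi> s)) - u * cnj u / of_real a"
      by (cases "a = 0") (simp_all add: \<eta>_def a field_simps)
    also have "u * cnj u / of_real a = (\<Sum>r\<in>S. \<Sum>s\<in>S. (A r x * A x s / of_real a) * \<xi> r * cnj (\<xi> s))"
    proof -
      have "u * cnj u = (\<Sum>r\<in>S. A r x * \<xi> r) * (\<Sum>s\<in>S. A x s * cnj (\<xi> s))" by (simp only: cu) (simp only: u_def)
      then show ?thesis by (simp add: sum_product sum_divide_distrib mult_ac)
    qed
    also have "(\<Sum>r\<in>S. \<Sum>s\<in>S. A r s * \<xi> r * cnj (\<xi> s)) - \<dots> = (\<Sum>r\<in>S. \<Sum>s\<in>S. B r s * \<xi> r * cnj (\<xi> s))"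
      by (simp add: B_def sum_subtractf[symmetric] algebra_simps)
    finally show "0 \<le> Re (\<Sum>r\<in>S. \<Sum>s\<in>S. B r s * \<xi> r * cnj (\<xi> s))" .
  qed
  then obtain v where v: "\<And>r s. r \<in> S \<Longrightarrow> s \<in> S \<Longrightarrow> B r s = (\<Sum>i\<in>S. v i r * cnj (v i s))"
    using insert.IH by metis
  \<comment> \<open>The new vector is the column of the pivot divided by \<open>sqrt a\<close>; it
    produces row and column \<open>x\<close> together with the correction term of \<open>B\<close>.
    The old vectors are extended by 0 at \<open>x\<close>.\<close>
  define w where "w i r = (if i = x then (if r = x then of_real (sqrt a) else A r x / of_real (sqrt a))
     else if r = x then 0 else v i r)" for i r
  have "A r s = (\<Sum>i\<in>?T. w i r * cnj (w i s))" if rs: "r \<in> ?T" "s \<in> ?T" for r s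
  proof -
    have sq: "complex_of_real (sqrt a) * complex_of_real (sqrt a) = of_real a"
      using a by (simp flip: of_real_mult)
    have sum: "(\<Sum>i\<in>?T. w i r * cnj (w i s)) = w x r * cnj (w x s) + (\<Sum>i\<in>S. w i r * cnj (w i s))"
      using insert by simp
    consider "r = x" "s = x" | "r = x" "s \<in> S" | "r \<in> S" "s = x" | "r \<in> S" "s \<in> S" using rs by blast
    then show ?thesis
    proof cases
      case 1
      have "(\<Sum>i\<in>S. w i r * cnj (w i s)) = 0" using 1 insert by (intro sum.neutral) (auto simp: w_def)
      then show ?thesis using 1 sum a sq by (simp add: w_def)
    next
      case 2
      have "(\<Sum>i\<in>S. w i r * cnj (w i s)) = 0" using 2 insert by (intro sum.neutral) (auto simp: w_def)
      moreover have "w x r * cnj (w x s) = A r s"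
        using 2 insert zero[of s] Ax[of s] by (cases "a = 0") (auto simp: w_def)
      ultimately show ?thesis using sum by simp
    next
      case 3
      have "(\<Sum>i\<in>S. w i r * cnj (w i s)) = 0" using 3 insert by (intro sum.neutral) (auto simp: w_def)
      moreover have "w x r * cnj (w x s) = A r s"
        using 3 insert zero[of r] by (cases "a = 0") (auto simp: w_def)
      ultimately show ?thesis using sum by simp
    next
      case 4
      have "(\<Sum>i\<in>S. w i r * cnj (w i s)) = (\<Sum>i\<in>S. v i r * cnj (v i s))"
        using 4 insert by (intro sum.cong) (auto simp: w_def)
      moreover have "w x r * cnj (w x s) = A r x * A x s / of_real a"
        using 4 insert zero[of s] Ax[of s] sq by (cases "a = 0") (auto simp: w_def)
      ultimately show ?thesis using sum v[OF 4] by (simp add: B_def diff_eq_eq)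
    qed
  qed
  then show ?case by blast
qed

text \<open>Each semidefinite matrix is a sum of rank-one matrices, so multilinearity reduces the
  claim to \<open>mixed_disc_rank_one\<close>. The slots are decomposed one at a time:
  \<open>k\<close> counts those that are still general, the slots beyond \<open>k\<close> being of
  rank one.\<close>

lemma mixed_disc_psd:
  assumes "\<And>l. l \<in> {1..n} \<Longrightarrow> psd_on {1..n} (M l)"
  shows "\<exists>c\<ge>0. mixed_disc n M = of_real c"
proof -
  have "\<exists>c\<ge>0. mixed_disc n M = of_real c"
    if "k \<le> n" "\<And>l. l \<in> {1..k} \<Longrightarrow> psd_on {1..n} (M l)"
      "\<And>l. l \<in> {k<..n} \<Longrightarrow> \<exists>v. \<forall>r\<in>{1..n}. \<forall>s\<in>{1..n}. M l r s = v r * cnj (v s)" for k M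
    using that
  proof (induction k arbitrary: M)
    case 0
    then have "\<forall>l\<in>{1..n}. \<exists>v. \<forall>r\<in>{1..n}. \<forall>s\<in>{1..n}. M l r s = v r * cnj (v s)" by auto
    then obtain v where "\<forall>l\<in>{1..n}. \<forall>r\<in>{1..n}. \<forall>s\<in>{1..n}. M l r s = v l r * cnj (v l s)"
      using bchoice[of "{1..n}" "\<lambda>l v. \<forall>r\<in>{1..n}. \<forall>s\<in>{1..n}. M l r s = v r * cnj (v s)"] by blast
    then have v: "\<And>l r s. l \<in> {1..n} \<Longrightarrow> r \<in> {1..n} \<Longrightarrow> s \<in> {1..n} \<Longrightarrow> M l r s = v l r * cnj (v l s)"
      by blast
    have "mixed_disc n M = mixed_disc n (\<lambda>l r s. v l r * cnj (v l s))" by (rule mixed_disc_cong) (rule v)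
    then show ?case unfolding mixed_disc_rank_one by (metis divide_nonneg_nonneg fact_ge_zero zero_le_power2)
  next
    case (Suc k)
    have "psd_on {1..n} (M (Suc k))" using Suc.prems(2)[of "Suc k"] by simp
    from psd_on_decomposition[OF finite_atLeastAtMost this] obtain v where
      v: "\<And>r s. r \<in> {1..n} \<Longrightarrow> s \<in> {1..n} \<Longrightarrow> M (Suc k) r s = (\<Sum>i=1..n. v i r * cnj (v i s))" by blast
    have "mixed_disc n M = mixed_disc n (M(Suc k := (\<lambda>r s. \<Sum>i=1..n. v i r * cnj (v i s))))"
      by (rule mixed_disc_cong) (simp add: v)
    also have "\<dots> = (\<Sum>i=1..n. mixed_disc n (M(Suc k := (\<lambda>r s. v i r * cnj (v i s)))))"
      using Suc.prems(1) by (intro mixed_disc_sum_slot) auto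
    finally have eq: "mixed_disc n M = (\<Sum>i=1..n. mixed_disc n (M(Suc k := (\<lambda>r s. v i r * cnj (v i s)))))" .
    have "\<exists>c\<ge>0. mixed_disc n (M(Suc k := (\<lambda>r s. v i r * cnj (v i s)))) = of_real c" for i
    proof (rule Suc.IH)
      fix l assume l: "l \<in> {k<..n}"
      show "\<exists>v'. \<forall>r\<in>{1..n}. \<forall>s\<in>{1..n}. (M(Suc k := (\<lambda>r s. v i r * cnj (v i s)))) l r s = v' r * cnj (v' s)"
      proof (cases "l = Suc k")
        case True
        then show ?thesis by auto
      next
        case False
        then show ?thesis using Suc.prems(3)[of l] l by auto
      qed
    qed (use Suc.prems in auto)
    then obtain c where c: "\<And>i. c i \<ge> 0" "\<And>i. mixed_disc n (M(Suc k := (\<lambda>r s. v i r * cnj (v i s)))) = complex_of_real (c i)"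
      by metis
    show ?case by (rule exI[of _ "\<Sum>i=1..n. c i"]) (simp add: eq c sum_nonneg)
  qed
  from this[of n M] show ?thesis using assms by auto
qed

text \<open>The permutation that sends 1 to \<open>j\<close> and acts as \<open>p\<close> on the
  rest, after {2..m+1} and {1..m+1} - {j} are both identified with {1..m} in increasing order. The
  shift skipping \<open>j\<close> is the one used in \<open>delete_row_col\<close>.\<close>

definition perm_insert :: "nat \<Rightarrow> nat \<Rightarrow> (nat \<Rightarrow> nat) \<Rightarrow> nat \<Rightarrow> nat" where
  "perm_insert m j p i = (if i = 1 then j else if i \<in> {2..Suc m} then (if p (i - 1) < j then p (i - 1) else p (i - 1) + 1) else i)"

lemma perm_insert_permutes:
  assumes "p permutes {1..m}" "j \<in> {1..Suc m}"
  shows "perm_insert m j p permutes {1..Suc m}"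
proof (rule bij_imp_permutes)
  have p: "p l \<in> {1..m}" if "l \<in> {1..m}" for l using assms(1) that permutes_in_image by metis
  have pinj: "p l = p l' \<Longrightarrow> l = l'" for l l' using permutes_inj[OF assms(1)] by (simp add: inj_def)
  have sub: "perm_insert m j p ` {1..Suc m} \<subseteq> {1..Suc m}"
  proof (rule image_subsetI)
    fix i assume "i \<in> {1..Suc m}"
    then consider "i = 1" | "i \<in> {2..Suc m}" by force
    then show "perm_insert m j p i \<in> {1..Suc m}"
    proof cases
      case 2
      then have "p (i - 1) \<in> {1..m}" by (intro p) auto
      then show ?thesis using assms(2) 2 by (auto simp: perm_insert_def)
    qed (use assms(2) in \<open>auto simp: perm_insert_def\<close>)
  qed
  moreover have "inj_on (perm_insert m j p) {1..Suc m}"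
  proof (rule inj_onI)
    fix i i' assume i: "i \<in> {1..Suc m}" "i' \<in> {1..Suc m}" and eq: "perm_insert m j p i = perm_insert m j p i'"
    show "i = i'"
    proof (cases "i = 1 \<or> i' = 1")
      case True
      then show ?thesis using i eq by (auto simp: perm_insert_def split: if_splits)
    next
      case False
      then have "p (i - 1) = p (i' - 1)" using i eq by (auto simp: perm_insert_def split: if_splits)
      then show ?thesis using pinj False i by force
    qed
  qed
  ultimately show "bij_betw (perm_insert m j p) {1..Suc m} {1..Suc m}"
    unfolding bij_betw_def using endo_inj_surj[of "{1..Suc m}"] by blast
  show "perm_insert m j p x = x" if "x \<notin> {1..Suc m}" for x using that by (auto simp: perm_insert_def)
qed

text \<open>Passing from j to j + 1 composes with the transposition of these two values and so
  reverses the sign. For j = 1 the permutation is \<open>p\<close> transported by the successor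
  map.\<close>

lemma sign_perm_insert:
  assumes "p permutes {1..m}" "1 \<le> j" "j \<le> Suc m"
  shows "sign (perm_insert m j p) = (-1) ^ (j + 1) * sign p"
  using assms(2,3)
proof (induction j rule: nat_induct_at_least)
  case base
  have p: "p l \<in> {1..m}" if "l \<in> {1..m}" for l using assms(1) that permutes_in_image by metis
  have "perm_insert m 1 p = map_permutation {1..m} Suc p"
  proof
    fix i
    show "perm_insert m 1 p i = map_permutation {1..m} Suc p i"
    proof (cases "i \<in> {2..Suc m}")
      case True
      then obtain l where l: "i = Suc l" "l \<in> {1..m}" by (cases i) auto
      have "inv_into {1..m} Suc (Suc l) = l" using l by (intro inv_into_f_f) auto
      then show ?thesis using l p[of l] by (auto simp: perm_insert_def map_permutation_def restrict_id_def image_iff)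
    next
      case False
      then show ?thesis by (auto simp: perm_insert_def map_permutation_def restrict_id_def image_iff)
    qed
  qed
  then show ?case using sign_map_permutation[of Suc "{1..m}" p] assms(1) by simp
next
  case (Suc j)
  have p: "p l \<in> {1..m}" if "l \<in> {1..m}" for l using assms(1) that permutes_in_image by metis
  have "perm_insert m (Suc j) p = Transposition.transpose j (Suc j) \<circ> perm_insert m j p"
  proof
    fix i
    show "perm_insert m (Suc j) p i = (Transposition.transpose j (Suc j) \<circ> perm_insert m j p) i"
      using Suc by (cases "i \<in> {1..Suc m}") (auto simp: perm_insert_def Transposition.transpose_def)
  qed
  moreover have "permutation (perm_insert m j p)"
    using Suc by (intro permutes_imp_permutation[OF finite_atLeastAtMost perm_insert_permutes[OF assms(1)]]) auto
  ultimately have "sign (perm_insert m (Suc j) p) = sign (Transposition.transpose j (Suc j)) * sign (perm_insert m j p)"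
    by (simp only: sign_compose permutation_swap_id)
  then show ?case using Suc by (simp add: sign_swap_id)
qed

text \<open>\<open>perm_insert\<close> is injective since \<open>j\<close> and \<open>p\<close> can
  be read off its values, and surjective by counting: (m + 1) m! = (m + 1)!.\<close>

lemma sum_permutes_Suc:
  fixes f :: "(nat \<Rightarrow> nat) \<Rightarrow> 'b::comm_monoid_add"
  shows "(\<Sum>\<sigma> | \<sigma> permutes {1..Suc m}. f \<sigma>) = (\<Sum>j=1..Suc m. \<Sum>p | p permutes {1..m}. f (perm_insert m j p))"
proof -
  let ?P = "{p. p permutes {1..m}}" and ?F = "\<lambda>(j, p). perm_insert m j p"
  have inj: "inj_on ?F ({1..Suc m} \<times> ?P)"
  proof (rule inj_onI, clarify)
    fix j p j' p' assume jp: "j \<in> {1..Suc m}" "j' \<in> {1..Suc m}" and p: "p permutes {1..m}" "p' permutes {1..m}"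
      and eq: "perm_insert m j p = perm_insert m j' p'"
    have j: "j = j'" using fun_cong[OF eq, of 1] by (simp add: perm_insert_def)
    have "p l = p' l" for l
    proof (cases "l \<in> {1..m}")
      case True
      then show ?thesis using fun_cong[OF eq, of "Suc l"] j by (auto simp: perm_insert_def split: if_splits)
    next
      case False
      then show ?thesis using p by (metis permutes_def)
    qed
    then show "j = j' \<and> p = p'" using j by auto
  qed
  have "?F ` ({1..Suc m} \<times> ?P) = {\<sigma>. \<sigma> permutes {1..Suc m}}"
  proof (rule card_subset_eq)
    show "?F ` ({1..Suc m} \<times> ?P) \<subseteq> {\<sigma>. \<sigma> permutes {1..Suc m}}" using perm_insert_permutes by auto
    have c1: "card ?P = fact m" and c2: "card {\<sigma>. \<sigma> permutes {1..Suc m}} = fact (Suc m)"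
      by (rule card_permutations; simp)+
    have "card (?F ` ({1..Suc m} \<times> ?P)) = Suc m * fact m"
      unfolding card_image[OF inj] card_cartesian_product c1 by simp
    then show "card (?F ` ({1..Suc m} \<times> ?P)) = card {\<sigma>. \<sigma> permutes {1..Suc m}}"
      unfolding c2 by simp
  qed (simp add: finite_permutations)
  then have "(\<Sum>\<sigma> | \<sigma> permutes {1..Suc m}. f \<sigma>) = (\<Sum>x\<in>{1..Suc m} \<times> ?P. f (?F x))"
    using sum.reindex[OF inj, of f] by (simp add: o_def)
  then show ?thesis by (simp add: sum.cartesian_product split_beta)
qed

text \<open>Both permutations are split according to their value at 1, which selects the entry of
  the first matrix. The quotient m!/(m+1)! is the 1/n that appears in \<open>Zcoef\<close>.\<close>

theorem mixed_disc_Laplace: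
  "mixed_disc (Suc m) M = (\<Sum>j=1..Suc m. \<Sum>k=1..Suc m. M 1 j k *
     ((-1) ^ (j + k) / of_nat (Suc m) * mixed_disc m (\<lambda>l. delete_row_col j k (M (l + 1)))))"
proof -
  let ?P = "{p. p permutes {1..m}}"
  let ?T = "\<lambda>j k p q. \<Prod>l=1..m. delete_row_col j k (M (l + 1)) (p l) (q l)"
  have "(\<Sum>\<sigma> | \<sigma> permutes {1..Suc m}. \<Sum>\<tau> | \<tau> permutes {1..Suc m}.
        of_int (sign (\<sigma> \<circ> \<tau>)) * (\<Prod>l=1..Suc m. M l (\<sigma> l) (\<tau> l))) =
     (\<Sum>j=1..Suc m. \<Sum>p\<in>?P. \<Sum>k=1..Suc m. \<Sum>q\<in>?P.
       of_int (sign (perm_insert m j p \<circ> perm_insert m k q)) * (\<Prod>l=1..Suc m. M l (perm_insert m j p l) (perm_insert m k q l)))"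
    by (simp only: sum_permutes_Suc)
  also have "\<dots> = (\<Sum>j=1..Suc m. \<Sum>p\<in>?P. \<Sum>k=1..Suc m. \<Sum>q\<in>?P.
       M 1 j k * ((-1) ^ (j + k) * (of_int (sign (p \<circ> q)) * ?T j k p q)))"
  proof (intro sum.cong refl)
    fix j p k q assume jk: "j \<in> {1..Suc m}" "k \<in> {1..Suc m}" and pq: "p \<in> ?P" "q \<in> ?P"
    have perm: "permutation p" "permutation q" "permutation (perm_insert m j p)" "permutation (perm_insert m k q)"
      using pq permutes_imp_permutation[OF finite_atLeastAtMost]
        permutes_imp_permutation[OF finite_atLeastAtMost perm_insert_permutes[OF _ jk(1)], of p]
        permutes_imp_permutation[OF finite_atLeastAtMost perm_insert_permutes[OF _ jk(2)], of q]
      by blast+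
    have sgn: "(of_int (sign (perm_insert m j p \<circ> perm_insert m k q)) :: complex) = (-1) ^ (j + k) * of_int (sign (p \<circ> q))"
      using perm jk pq by (simp add: sign_compose sign_perm_insert power_add)
    have "{1..Suc m} = insert 1 (Suc ` {1..m})" by (auto simp: image_Suc_atLeastAtMost)
    then have "(\<Prod>l=1..Suc m. M l (perm_insert m j p l) (perm_insert m k q l)) =
      M 1 j k * (\<Prod>l\<in>Suc ` {1..m}. M l (perm_insert m j p l) (perm_insert m k q l))"
      by (subst \<open>{1..Suc m} = _\<close>, subst prod.insert) (auto simp: perm_insert_def)
    also have "(\<Prod>l\<in>Suc ` {1..m}. M l (perm_insert m j p l) (perm_insert m k q l)) = ?T j k p q"
      by (subst prod.reindex) (auto simp: perm_insert_def delete_row_col_def intro!: prod.cong)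
    finally show "of_int (sign (perm_insert m j p \<circ> perm_insert m k q)) * (\<Prod>l=1..Suc m. M l (perm_insert m j p l) (perm_insert m k q l))
      = M 1 j k * ((-1) ^ (j + k) * (of_int (sign (p \<circ> q)) * ?T j k p q))"
      unfolding sgn by (simp only: mult_ac)
  qed
  also have "\<dots> = (\<Sum>j=1..Suc m. \<Sum>k=1..Suc m. \<Sum>p\<in>?P. \<Sum>q\<in>?P.
       M 1 j k * ((-1) ^ (j + k) * (of_int (sign (p \<circ> q)) * ?T j k p q)))"
    by (intro sum.cong refl sum.swap)
  also have "\<dots> = (\<Sum>j=1..Suc m. \<Sum>k=1..Suc m. M 1 j k * ((-1) ^ (j + k) * (fact m * mixed_disc m (\<lambda>l. delete_row_col j k (M (l + 1))))))"
    unfolding mixed_disc_def by (simp add: sum_distrib_left)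
  finally have "mixed_disc (Suc m) M = 1 / fact (Suc m) * (\<Sum>j=1..Suc m. \<Sum>k=1..Suc m. M 1 j k * ((-1) ^ (j + k) * (fact m * mixed_disc m (\<lambda>l. delete_row_col j k (M (l + 1))))))"
    by (simp only: mixed_disc_def[of "Suc m"])
  also have "\<dots> = (\<Sum>j=1..Suc m. \<Sum>k=1..Suc m. M 1 j k *
     ((-1) ^ (j + k) / of_nat (Suc m) * mixed_disc m (\<lambda>l. delete_row_col j k (M (l + 1)))))"
    unfolding sum_distrib_left
  proof (intro sum.cong refl)
    fix j k
    have "1 / fact (Suc m) * (x * (y * (fact m * z))) = x * (y / of_nat (Suc m) * z)" for x y z :: complex
    proof -
      have "f \<noteq> 0 \<Longrightarrow> 1 / (a * f) * (x * (y * (f * z))) = x * (y / a * z)" for a f :: complex by simp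
      from this[of "fact m" "of_nat (Suc m)"] show ?thesis by (simp only: fact_Suc fact_nonzero not_False_eq_True)
    qed
    then show "1 / fact (Suc m) * (M 1 j k * ((-1) ^ (j + k) * (fact m * mixed_disc m (\<lambda>l. delete_row_col j k (M (l + 1)))))) =
       M 1 j k * ((-1) ^ (j + k) / of_nat (Suc m) * mixed_disc m (\<lambda>l. delete_row_col j k (M (l + 1))))" .
  qed
  finally show ?thesis .
qed

section \<open>Wirtinger derivatives and support functions\<close>

text \<open>Both Wirtinger derivatives at once: the parameter is -i for the derivative in z_j and i
  for the one in its conjugate, so each calculus rule is proved for both together.\<close>

definition wirt :: "complex \<Rightarrow> 'n \<Rightarrow> (complex^'n \<Rightarrow> complex) \<Rightarrow> complex^'n \<Rightarrow> complex" where
  "wirt c j f z = (dirder (axis j 1) f z + c * dirder (axis j \<i>) f z) / 2"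

lemma dz_eq_wirt: "dz j = wirt (- \<i>) j" and dzbar_eq_wirt: "dzbar j = wirt \<i> j"
  by (auto simp: fun_eq_iff dz_def dzbar_def wirt_def)

lemma wirt_cong_open:
  assumes "open S" "z \<in> S" "\<And>x. x \<in> S \<Longrightarrow> f x = g x"
  shows "wirt c j f z = wirt c j g z"
  unfolding wirt_def using dirder_cong_open[OF assms] by simp

lemma wirt_const [simp]: "wirt c j (\<lambda>_. a) z = 0"
  by (simp add: wirt_def)

lemma wirt_mult:
  assumes "f differentiable (at z)" "g differentiable (at z)"
  shows "wirt c j (\<lambda>w. f w * g w) z = f z * wirt c j g z + wirt c j f z * g z"
proof -
  have "dirder v (\<lambda>w. f w * g w) z = f z * dirder v g z + dirder v f z * g z" for v
    by (rule dirder_eq) (intro has_derivative_mult has_derivative_dirder assms)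
  then show ?thesis by (simp add: wirt_def algebra_simps add_divide_distrib)
qed

lemma wirt_add:
  assumes "f differentiable (at z)" "g differentiable (at z)"
  shows "wirt c j (\<lambda>w. f w + g w) z = wirt c j f z + wirt c j g z"
proof -
  have "dirder v (\<lambda>w. f w + g w) z = dirder v f z + dirder v g z" for v
    by (rule dirder_eq) (intro has_derivative_add has_derivative_dirder assms)
  then show ?thesis by (simp add: wirt_def algebra_simps add_divide_distrib)
qed

lemma differentiable_cmult [intro]:
  fixes f :: "_ \<Rightarrow> complex"
  shows "f differentiable (at z) \<Longrightarrow> (\<lambda>w. a * f w) differentiable (at z)"
  by (intro differentiable_mult) auto

lemma wirt_cmult:
  assumes "f differentiable (at z)"
  shows "wirt c j (\<lambda>w. a * f w) z = a * wirt c j f z"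
  using wirt_mult[of "\<lambda>_. a" z f c j] assms by simp

lemma wirt_cnj:
  assumes "f differentiable (at z)"
  shows "wirt c j (\<lambda>w. cnj (f w)) z = cnj (wirt (cnj c) j f z)"
proof -
  have "dirder v (\<lambda>w. cnj (f w)) z = cnj (dirder v f z)" for v
    by (rule dirder_eq) (intro bounded_linear.has_derivative[OF bounded_linear_cnj] has_derivative_dirder assms)
  then show ?thesis by (simp add: wirt_def)
qed

lemma wirt_sum:
  assumes "\<And>i. i \<in> I \<Longrightarrow> f i differentiable (at z)"
  shows "wirt c j (\<lambda>w. \<Sum>i\<in>I. f i w) z = (\<Sum>i\<in>I. wirt c j (f i) z)"
  using assms
proof (induction I rule: infinite_finite_induct)
  case (insert x I)
  have "(\<lambda>w. \<Sum>i\<in>I. f i w) differentiable (at z)"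
    using insert by (intro differentiable_sum) auto
  then show ?case using insert by (simp add: wirt_add)
qed auto

lemma C_on_wirt:
  assumes "open S" "C_on (Suc k) S f"
  shows "C_on k S (wirt c j f)"
proof -
  have "C_on k S (\<lambda>z. (1/2) * (dirder (axis j 1) f z + c * dirder (axis j \<i>) f z))"
    by (intro C_on_cmult C_on_add assms(1)) (use assms(2) in auto)
  then show ?thesis by (simp add: wirt_def[abs_def])
qed

lemma bounded_support_wirt:
  assumes "bounded {z. f z \<noteq> 0}" shows "bounded {z. wirt c j f z \<noteq> 0}"
proof (rule bounded_subset)
  show "bounded ({z. dirder (axis j 1) f z \<noteq> 0} \<union> {z. dirder (axis j \<i>) f z \<noteq> 0})"
    using bounded_support_dirder[OF assms] by simp
qed (auto simp: wirt_def)

lemma wirt_eq_0_open: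
  assumes "open S" "z \<in> S" "\<And>x. x \<in> S \<Longrightarrow> f x = 0"
  shows "wirt c j f z = 0"
  using wirt_cong_open[of S z f "\<lambda>_. 0"] assms by simp

lemma second_derivative_symmetric_complex:
  fixes f :: "'a::real_normed_vector \<Rightarrow> complex"
  assumes "open S" "C_on 2 S f" "z \<in> S"
  shows "dirder v (dirder w f) z = dirder w (dirder v f) z"
proof -
  have c: "C_on (Suc (Suc 0)) S f" using assms(2) by (simp add: numeral_2_eq_2)
  have T: "T (dirder v (dirder w f) z) = dirder v (dirder w (\<lambda>x. T (f x))) z" if T: "bounded_linear T" for T :: "complex \<Rightarrow> real" and v w
  proof -
    have d1: "dirder w (\<lambda>x. T (f x)) x = T (dirder w f x)" if "x \<in> S" for x
      by (rule dirder_eq) (intro bounded_linear.has_derivative[OF T] has_derivative_dirder, use c that in auto)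
    have "dirder v (dirder w (\<lambda>x. T (f x))) z = dirder v (\<lambda>x. T (dirder w f x)) z"
      by (rule dirder_cong_open[OF assms(1,3) d1])
    also have "\<dots> = T (dirder v (dirder w f) z)"
      by (rule dirder_eq) (intro bounded_linear.has_derivative[OF T] has_derivative_dirder, use c assms(3) in auto)
    finally show ?thesis by simp
  qed
  have "T (dirder v (dirder w f) z) = T (dirder w (dirder v f) z)" if "bounded_linear T" for T :: "complex \<Rightarrow> real"
    unfolding T[OF that] by (rule second_derivative_symmetric[OF assms(1) C_on_bounded_linear_compose[OF assms(1) that assms(2)] assms(3)])
  from this[OF bounded_linear_Re] this[OF bounded_linear_Im] show ?thesis by (simp add: complex_eq_iff)
qed

lemma wirt_commute:
  assumes "open S" "C_on 2 S f" "z \<in> S"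
  shows "wirt c j (wirt d k f) z = wirt d k (wirt c j f) z"
proof -
  have c: "C_on (Suc (Suc 0)) S f" using assms(2) by (simp add: numeral_2_eq_2)
  have dd: "dirder v f differentiable (at z)" for v using c assms(3) by auto
  have e: "dirder v (wirt d k f) z = (dirder v (dirder (axis k 1) f) z + d * dirder v (dirder (axis k \<i>) f) z) / 2" for v d k
  proof -
    have "((\<lambda>z. (1/2) * (dirder (axis k 1) f z + d * dirder (axis k \<i>) f z)) has_derivative
      (\<lambda>v. (1/2) * (dirder v (dirder (axis k 1) f) z + d * dirder v (dirder (axis k \<i>) f) z))) (at z)"
      by (intro has_derivative_add has_derivative_mult_right has_derivative_dirder dd)
    from dirder_eq[OF this] show ?thesis by (simp add: wirt_def[abs_def])
  qed
  show ?thesis unfolding wirt_def[of c j "wirt d k f"] wirt_def[of d k "wirt c j f"] e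
    using second_derivative_symmetric_complex[OF assms]
    by (simp add: algebra_simps add_divide_distrib)
qed

lemma open_punctured: "open (- {0 :: 'a::{t1_space,zero}})"
  by auto

text \<open>The three properties of support functions on which the analysis rests: convexity gives
  positivity of the Hessian, homogeneity gives growth at the origin and separation in polar
  coordinates, and \<open>C_on 2\<close> gives the Hessian off the origin.\<close>

definition sublinear_C2 :: "('a::euclidean_space \<Rightarrow> real) \<Rightarrow> bool" where
  "sublinear_C2 h \<longleftrightarrow> convex_on UNIV h \<and> (\<forall>t z. t \<ge> 0 \<longrightarrow> h (t *\<^sub>R z) = t * h z) \<and> C_on 2 (UNIV - {0}) h"

lemma Re_herm: "Re (herm z w) = z \<bullet> (w :: complex^'n)"
  by (simp add: herm_def inner_vec_def inner_complex_def Re_sum)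

lemma support_fun_sublinear:
  assumes "A \<in> K2"
  shows "sublinear_C2 (support_fun A)"
proof -
  have A: "A \<noteq> {}" "compact A" "C_on 2 (UNIV - {0}) (support_fun A)" using assms by (auto simp: K2_def)
  have sup: "support_fun A z = (SUP v\<in>A. z \<bullet> v)" for z by (simp add: support_fun_def Re_herm)
  have bdd: "bdd_above ((\<lambda>v. z \<bullet> v) ` A)" for z
    by (intro bounded_imp_bdd_above compact_imp_bounded compact_continuous_image A continuous_intros)
  have ub: "z \<bullet> v \<le> support_fun A z" if "v \<in> A" for z v
    unfolding sup using that bdd by (intro cSUP_upper)
  have least: "support_fun A z \<le> c" if "\<And>v. v \<in> A \<Longrightarrow> z \<bullet> v \<le> c" for z c
    unfolding sup using that A by (intro cSUP_least)
  have "convex_on UNIV (support_fun A)"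
  proof (rule convex_onI)
    fix t :: real and x y :: "complex^'a" assume t: "0 < t" "t < 1"
    show "support_fun A ((1 - t) *\<^sub>R x + t *\<^sub>R y) \<le> (1 - t) * support_fun A x + t * support_fun A y"
    proof (rule least)
      fix v assume "v \<in> A"
      then show "((1 - t) *\<^sub>R x + t *\<^sub>R y) \<bullet> v \<le> (1 - t) * support_fun A x + t * support_fun A y"
        using t by (simp add: inner_add_left add_mono mult_left_mono ub)
    qed
  qed simp
  moreover have "support_fun A (t *\<^sub>R z) = t * support_fun A z" if "t \<ge> 0" for t z
  proof (cases "t = 0")
    case True
    then show ?thesis using A by (simp add: sup)
  next
    case False
    then have t: "t > 0" using that by simp
    \<comment> \<open>Equality follows from this inequality alone, applied also to the factor 1/t
      and the point t z.\<close>
    have le: "support_fun A (t *\<^sub>R z) \<le> t * support_fun A z" if "t > 0" for t z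
      by (rule least) (use that in \<open>simp add: mult_left_mono ub\<close>)
    have "support_fun A ((1 / t) *\<^sub>R (t *\<^sub>R z)) \<le> (1 / t) * support_fun A (t *\<^sub>R z)" by (rule le) (use t in simp)
    then show ?thesis using le[OF t, of z] t by (simp add: field_simps)
  qed
  ultimately show ?thesis using A by (auto simp: sublinear_C2_def)
qed

section \<open>Homogeneity, growth and positivity of the complex Hessian\<close>

context
  fixes h :: "complex^'n::{finite,wellorder} \<Rightarrow> real"
  assumes h: "sublinear_C2 h"
begin

lemma sublinear_homogeneous: "t \<ge> 0 \<Longrightarrow> h (t *\<^sub>R z) = t * h z"
  using h by (auto simp: sublinear_C2_def)

lemma sublinear_continuous: "continuous_on UNIV h"
  using h convex_on_continuous[of UNIV h] by (auto simp: sublinear_C2_def)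

lemma sublinear_C_on: "C_on 2 (- {0}) h"
  using h by (simp add: sublinear_C2_def Compl_eq_Diff_UNIV)

lemma sublinear_C_on': "C_on 2 (- {0}) (\<lambda>w. complex_of_real (h w))"
  by (rule C_on_bounded_linear_compose[OF _ bounded_linear_of_real sublinear_C_on]) auto

lemma sublinear_C_on_wirt: "C_on 1 (- {0}) (wirt c j (\<lambda>w. complex_of_real (h w)))"
  by (rule C_on_wirt[OF open_punctured]) (use sublinear_C_on' in \<open>simp add: numeral_2_eq_2\<close>)

lemma HessC_eq_wirt: "HessC h z $ j $ k = wirt (- \<i>) j (wirt \<i> k (\<lambda>w. complex_of_real (h w))) z"
  by (simp add: HessC_def dz_eq_wirt dzbar_eq_wirt)

lemma continuous_on_HessC: "continuous_on (- {0}) (\<lambda>z. HessC h z $ j $ k)"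
  unfolding HessC_eq_wirt
  by (rule C_on_imp_continuous_on[OF C_on_wirt[OF open_punctured, of 0]]) (use sublinear_C_on_wirt in simp)

text \<open>Off the origin f(w) = a f(w/r), and the chain rule produces a/r. The rule is used twice,
  with a = r for the function itself and with a = 1 for its first derivatives.\<close>

lemma dirder_scale:
  fixes f :: "(complex, 'n) vec \<Rightarrow> complex"
  assumes "r > 0" "f differentiable (at z)" "z \<noteq> 0" "\<And>w. w \<noteq> 0 \<Longrightarrow> f (r *\<^sub>R w) = a * f w"
  shows "dirder v f (r *\<^sub>R z) = (a / of_real r) * dirder v f z"
proof (rule dirder_eq)
  have "((\<lambda>w. (1/r) *\<^sub>R w) has_derivative (\<lambda>v. (1/r) *\<^sub>R v)) (at (r *\<^sub>R z))"
    by (auto intro!: derivative_eq_intros)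
  moreover have "(f has_derivative (\<lambda>v. dirder v f z)) (at ((1/r) *\<^sub>R (r *\<^sub>R z)))"
    using has_derivative_dirder[OF assms(2)] assms(1) by simp
  ultimately have "((\<lambda>w. f ((1/r) *\<^sub>R w)) has_derivative (\<lambda>v. dirder ((1/r) *\<^sub>R v) f z)) (at (r *\<^sub>R z))"
    by (rule has_derivative_compose)
  then have "((\<lambda>w. a * f ((1/r) *\<^sub>R w)) has_derivative (\<lambda>v. a * dirder ((1/r) *\<^sub>R v) f z)) (at (r *\<^sub>R z))"
    by (rule has_derivative_mult_right)
  moreover have "a * f ((1/r) *\<^sub>R w) = f w" if "w \<in> - {0}" for w
    using assms(4)[of "(1/r) *\<^sub>R w"] that assms(1) by simp
  ultimately have "(f has_derivative (\<lambda>v. a * dirder ((1/r) *\<^sub>R v) f z)) (at (r *\<^sub>R z))"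
    using has_derivative_transform_within_open[OF _ open_punctured, of "\<lambda>w. a * f ((1/r) *\<^sub>R w)" _ "r *\<^sub>R z" UNIV f] assms
    by simp
  moreover have "a * dirder ((1/r) *\<^sub>R v) f z = a / of_real r * dirder v f z" for v
    using linear_cmul[OF linear_frechet_derivative[OF assms(2)], of "1/r" v] by (simp add: scaleR_conv_of_real)
  ultimately show "(f has_derivative (\<lambda>v. a / of_real r * dirder v f z)) (at (r *\<^sub>R z))" by simp
qed

lemma wirt_scale:
  fixes f :: "(complex, 'n) vec \<Rightarrow> complex"
  assumes "r > 0" "f differentiable (at z)" "z \<noteq> 0" "\<And>w. w \<noteq> 0 \<Longrightarrow> f (r *\<^sub>R w) = a * f w"
  shows "wirt c j f (r *\<^sub>R z) = (a / of_real r) * wirt c j f z"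
proof -
  have "dirder v f (r *\<^sub>R z) = (a / of_real r) * dirder v f z" for v by (rule dirder_scale[OF assms])
  then show ?thesis unfolding wirt_def by (simp add: algebra_simps add_divide_distrib)
qed

lemma wirt_sublinear_scale:
  assumes "r > 0" "z \<noteq> 0"
  shows "wirt c j (\<lambda>w. complex_of_real (h w)) (r *\<^sub>R z) = wirt c j (\<lambda>w. complex_of_real (h w)) z"
proof -
  have "(\<lambda>w. complex_of_real (h w)) differentiable (at z)"
    using sublinear_C_on' assms(2) by (simp add: numeral_2_eq_2)
  then show ?thesis
    using assms by (subst wirt_scale[where a = "of_real r"]) (simp_all add: sublinear_homogeneous)
qed

lemma HessC_scale:
  assumes "r > 0" "z \<noteq> 0"
  shows "HessC h (r *\<^sub>R z) $ j $ k = (1 / of_real r) * HessC h z $ j $ k"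
  unfolding HessC_eq_wirt
proof (rule wirt_scale)
  show "wirt \<i> k (\<lambda>w. complex_of_real (h w)) differentiable at z"
    using sublinear_C_on_wirt assms by simp
qed (use assms wirt_sublinear_scale in auto)

lemma homogeneous_bound:
  fixes f :: "(complex, 'n) vec \<Rightarrow> 'b::real_normed_vector"
  assumes "continuous_on (- {0}) f"
  obtains C where "C \<ge> 0" "\<And>z. norm z = 1 \<Longrightarrow> norm (f z) \<le> C"
proof -
  have "compact (f ` sphere 0 1)"
    by (intro compact_continuous_image continuous_on_subset[OF assms]) auto
  from compact_imp_bounded[OF this] obtain C where "\<forall>x\<in>f ` sphere 0 1. norm x \<le> C"
    unfolding bounded_iff by blast
  then have "norm (f z) \<le> max C 0" if "norm z = 1" for z using that by (auto simp: le_max_iff_disj)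
  from that[OF max.cobounded2 this] show ?thesis .
qed

lemma sublinear_bound: obtains C where "C \<ge> 0" "\<And>z. \<bar>h z\<bar> \<le> C * norm z"
proof -
  obtain C where C: "C \<ge> 0" "\<And>z. norm z = 1 \<Longrightarrow> norm (h z) \<le> C"
    using homogeneous_bound[OF continuous_on_subset[OF sublinear_continuous]] by auto
  have "\<bar>h z\<bar> \<le> C * norm z" for z
  proof (cases "z = 0")
    case True
    then show ?thesis using sublinear_homogeneous[of 0 0] by simp
  next
    case False
    have "h z = norm z * h (sgn z)"
      using sublinear_homogeneous[of "norm z" "sgn z"] False by (simp add: sgn_div_norm)
    then show ?thesis using C(2)[of "sgn z"] False by (simp add: norm_sgn abs_mult mult.commute mult_left_mono)
  qed
  then show ?thesis using that C by blast
qed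

lemma HessC_bound: obtains C where "C \<ge> 0" "\<And>z j k. z \<noteq> 0 \<Longrightarrow> norm (HessC h z $ j $ k) \<le> C / norm z"
proof -
  have "HessC h = (\<lambda>z. \<chi> j k. HessC h z $ j $ k)" by (simp add: fun_eq_iff vec_eq_iff)
  moreover have "continuous_on (- {0}) (\<lambda>z. \<chi> j k. HessC h z $ j $ k)"
    by (intro continuous_on_vec_lambda continuous_on_HessC)
  ultimately have "continuous_on (- {0}) (HessC h)" by simp
  then obtain C where C: "C \<ge> 0" "\<And>z. norm z = 1 \<Longrightarrow> norm (HessC h z) \<le> C" using homogeneous_bound by metis
  have "norm (HessC h z $ j $ k) \<le> C / norm z" if "z \<noteq> 0" for z j k
  proof -
    have "HessC h z $ j $ k = (1 / of_real (norm z)) * HessC h (sgn z) $ j $ k"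
      using HessC_scale[of "norm z" "sgn z" j k] that by (simp add: sgn_div_norm)
    moreover have "norm (HessC h (sgn z) $ j $ k) \<le> C"
      using C(2)[of "sgn z"] that Finite_Cartesian_Product.norm_nth_le[of "HessC h (sgn z)" j] Finite_Cartesian_Product.norm_nth_le[of "HessC h (sgn z) $ j" k]
      by (simp add: norm_sgn)
    ultimately show ?thesis using that by (simp add: norm_mult norm_divide divide_right_mono)
  qed
  then show ?thesis using that C by blast
qed

text \<open>Since \<open>h\<close> is real, conjugation exchanges the two kinds of Wirtinger
  derivative; these commute by Schwarz's theorem.\<close>

lemma HessC_hermitian:
  assumes "z \<noteq> 0" shows "HessC h z $ k $ j = cnj (HessC h z $ j $ k)"
proof -
  let ?h = "\<lambda>w. complex_of_real (h w)"
  have cw: "cnj (wirt \<i> k ?h w) = wirt (- \<i>) k ?h w" if "w \<noteq> 0" for w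
  proof -
    have "?h differentiable (at w)" using sublinear_C_on' that by (simp add: numeral_2_eq_2)
    from wirt_cnj[OF this, of "- \<i>" k] show ?thesis by simp
  qed
  have dif: "wirt \<i> k ?h differentiable (at z)" using sublinear_C_on_wirt assms by simp
  have "cnj (HessC h z $ j $ k) = wirt \<i> j (\<lambda>w. cnj (wirt \<i> k ?h w)) z"
    unfolding HessC_eq_wirt using wirt_cnj[OF dif, of \<i> j] by simp
  also have "\<dots> = wirt \<i> j (wirt (- \<i>) k ?h) z"
    by (rule wirt_cong_open[OF open_punctured]) (use assms cw in auto)
  also have "\<dots> = HessC h z $ k $ j"
    unfolding HessC_eq_wirt using wirt_commute[OF open_punctured sublinear_C_on', of z] assms by simp
  finally show ?thesis by simp
qed

text \<open>A negative second derivative would make the slope along \<open>v\<close> strictly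
  smaller just after 0 than at 0, while the tangent inequalities of a convex function at the two
  points force the slope to increase.\<close>

lemma sublinear_second_dirder_nonneg:
  assumes "z \<noteq> 0" shows "dirder v (dirder v h) z \<ge> 0"
proof (rule ccontr)
  assume neg: "\<not> dirder v (dirder v h) z \<ge> 0"
  have c: "C_on (Suc (Suc 0)) (- {0}) h" using sublinear_C_on by (simp add: numeral_2_eq_2)
  define \<phi> where "\<phi> t = h (z + t *\<^sub>R v)" for t
  define g where "g t = dirder v h (z + t *\<^sub>R v)" for t
  have conv: "convex_on UNIV \<phi>"
  proof (rule convex_onI)
    fix t x y :: real assume t: "0 < t" "t < 1"
    have "z + ((1 - t) *\<^sub>R x + t *\<^sub>R y) *\<^sub>R v = (1 - t) *\<^sub>R (z + x *\<^sub>R v) + t *\<^sub>R (z + y *\<^sub>R v)"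
      by (simp add: algebra_simps)
    then show "\<phi> ((1 - t) *\<^sub>R x + t *\<^sub>R y) \<le> (1 - t) * \<phi> x + t * \<phi> y"
      unfolding \<phi>_def using h t convex_onD[of UNIV h t] by (auto simp: sublinear_C2_def)
  qed simp
  have line: "((\<lambda>t. z + t *\<^sub>R v) has_derivative (\<lambda>s. s *\<^sub>R v)) (at t)" for t
    by (auto intro!: derivative_eq_intros)
  have d\<phi>: "(\<phi> has_real_derivative g t) (at t)" if "z + t *\<^sub>R v \<noteq> 0" for t
  proof -
    have dif: "h differentiable (at (z + t *\<^sub>R v))" using c that by simp
    from has_derivative_compose[OF line has_derivative_dirder[OF this]] show ?thesis
      using linear_cmul[OF linear_frechet_derivative[OF dif]]
      by (simp add: \<phi>_def[abs_def] g_def has_field_derivative_def mult_commute_abs)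
  qed
  have dg: "(g has_real_derivative dirder v (dirder v h) z) (at 0)"
  proof -
    have dif: "dirder v h differentiable (at z)" using c assms by simp
    have "(dirder v h has_derivative (\<lambda>s. dirder s (dirder v h) z)) (at (z + 0 *\<^sub>R v))"
      using has_derivative_dirder[OF dif] by simp
    from has_derivative_compose[OF line this] show ?thesis
      using linear_cmul[OF linear_frechet_derivative[OF dif]]
      by (simp add: g_def[abs_def] has_field_derivative_def mult_commute_abs)
  qed
  from DERIV_neg_dec_right[OF dg] neg obtain d where d: "d > 0" "\<And>t. 0 < t \<Longrightarrow> t < d \<Longrightarrow> g t < g 0" by force
  \<comment> \<open>Besides t < d this ensures t |v| < |z|, so the line has not reached the origin
    and \<open>h\<close> is differentiable at the endpoint.\<close>
  define t where "t = min (d / 2) (norm z / (2 * (norm v + 1)))"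
  have v1: "norm v + 1 > 0" by (simp add: add_nonneg_pos)
  have t: "0 < t" "t < d" using d(1) assms v1 by (auto simp: t_def)
  have "t * norm v < norm z"
  proof -
    have "t * norm v \<le> norm z / (2 * (norm v + 1)) * (norm v + 1)"
      using t by (intro mult_mono) (auto simp: t_def)
    also have "\<dots> = norm z / 2" using v1 by (simp add: field_simps)
    finally show ?thesis using assms by (smt (verit) field_sum_of_halves zero_less_norm_iff)
  qed
  then have ne: "z + t *\<^sub>R v \<noteq> 0" using t by (metis add_eq_0_iff abs_of_pos less_irrefl norm_minus_cancel norm_scaleR)
  have "\<phi> t - \<phi> 0 \<ge> g 0 * (t - 0)"
    by (rule convex_on_imp_above_tangent[OF conv]) (use d\<phi>[of 0] assms in auto)
  moreover have "\<phi> 0 - \<phi> t \<ge> g t * (0 - t)"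
    by (rule convex_on_imp_above_tangent[OF conv]) (use d\<phi>[of t] ne in auto)
  ultimately have "(g t - g 0) * t \<ge> 0" by (simp add: algebra_simps)
  then have "g t \<ge> g 0" using t by (simp add: zero_le_mult_iff)
  then show False using d(2)[OF t] by simp
qed

lemma vec_decomposition:
  "\<xi> = (\<Sum>j\<in>UNIV. Re (\<xi> $ j) *\<^sub>R axis j 1 + Im (\<xi> $ j) *\<^sub>R axis j \<i>)" for \<xi> :: "(complex, 'n) vec"
proof -
  have "(\<Sum>j\<in>UNIV. Re (\<xi> $ j) *\<^sub>R axis j 1 + Im (\<xi> $ j) *\<^sub>R axis j \<i>) $ i = \<xi> $ i" for i
  proof -
    have "(\<Sum>j\<in>UNIV. Re (\<xi> $ j) *\<^sub>R axis j 1 + Im (\<xi> $ j) *\<^sub>R axis j \<i>) $ i =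
       (\<Sum>j\<in>UNIV. if j = i then \<xi> $ j else 0)"
      unfolding sum_component by (intro sum.cong refl) (auto simp: axis_def complex_eq_iff)
    then show ?thesis by simp
  qed
  then show ?thesis by (simp add: vec_eq_iff)
qed

lemma linear_decomposition:
  fixes L :: "(complex, 'n) vec \<Rightarrow> real"
  assumes "linear L"
  shows "L \<xi> = (\<Sum>j\<in>UNIV. Re (\<xi> $ j) * L (axis j 1) + Im (\<xi> $ j) * L (axis j \<i>))"
  by (subst vec_decomposition) (simp add: linear_sum[OF assms] linear_add[OF assms] linear_cmul[OF assms])

text \<open>The Levi form in direction \<xi> is a quarter of the sum of the real second derivatives
  in the directions \<xi> and i \<xi>, the vectors \<open>X\<close> and \<open>Y\<close>; both are
  nonnegative by convexity.\<close>

lemma HessC_psd: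
  assumes z: "z \<noteq> 0" shows "psd_on UNIV (\<lambda>j k. HessC h z $ j $ k)"
  unfolding psd_on_def
proof (intro conjI ballI allI)
  show "HessC h z $ s $ r = cnj (HessC h z $ r $ s)" for r s by (rule HessC_hermitian[OF z])
  fix \<xi> :: "'n \<Rightarrow> complex"
  let ?h = "\<lambda>w. complex_of_real (h w)"
  define D where "D v w = dirder v (dirder w h) z" for v w
  define X Y :: "(complex, 'n) vec" where "X = (\<chi> j. \<xi> j)" and "Y = (\<chi> j. \<i> * \<xi> j)"
  have c: "C_on (Suc (Suc 0)) (- {0}) h" using sublinear_C_on by (simp add: numeral_2_eq_2)
  have dh: "dirder w ?h x = of_real (dirder w h x)" if "x \<noteq> 0" for w x
    by (rule dirder_eq) (intro bounded_linear.has_derivative[OF bounded_linear_of_real] has_derivative_dirder, use c that in auto)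
  have ddh: "(dirder w h has_derivative (\<lambda>v. D v w)) (at z)" for w
    unfolding D_def using c z by (intro has_derivative_dirder) auto
  have wh: "wirt \<i> k ?h x = of_real (dirder (axis k 1) h x) * (1/2) + of_real (dirder (axis k \<i>) h x) * (\<i>/2)" if "x \<noteq> 0" for k x
    using that by (simp add: wirt_def dh field_simps)
  have Hw: "dirder v (wirt \<i> k ?h) z = of_real (D v (axis k 1)) * (1/2) + of_real (D v (axis k \<i>)) * (\<i>/2)" for v k
  proof -
    have "dirder v (wirt \<i> k ?h) z = dirder v (\<lambda>x. of_real (dirder (axis k 1) h x) * (1/2) + of_real (dirder (axis k \<i>) h x) * (\<i>/2)) z"
      by (rule dirder_cong_open[OF open_punctured]) (use z wh in auto)
    also have "\<dots> = of_real (D v (axis k 1)) * (1/2) + of_real (D v (axis k \<i>)) * (\<i>/2)"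
      by (rule dirder_eq) (intro has_derivative_add has_derivative_mult_left bounded_linear.has_derivative[OF bounded_linear_of_real] ddh)
    finally show ?thesis .
  qed
  have H: "HessC h z $ j $ k = (1/4) * (of_real (D (axis j 1) (axis k 1) + D (axis j \<i>) (axis k \<i>)) +
      \<i> * of_real (D (axis j 1) (axis k \<i>) - D (axis j \<i>) (axis k 1)))" for j k
    unfolding HessC_eq_wirt wirt_def[of "- \<i>"] Hw by (simp add: field_simps)
  have lin: "linear (\<lambda>v. D v w)" for w using has_derivative_linear[OF ddh] .
  have sym: "D v w = D w v" for v w
    unfolding D_def using second_derivative_symmetric[OF open_punctured sublinear_C_on] z by simp
  have exp: "D v w = (\<Sum>j\<in>UNIV. \<Sum>k\<in>UNIV. Re (v $ j) * (Re (w $ k) * D (axis j 1) (axis k 1) + Im (w $ k) * D (axis j 1) (axis k \<i>))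
     + Im (v $ j) * (Re (w $ k) * D (axis j \<i>) (axis k 1) + Im (w $ k) * D (axis j \<i>) (axis k \<i>)))" for v w
  proof -
    have 2: "D u w = (\<Sum>k\<in>UNIV. Re (w $ k) * D u (axis k 1) + Im (w $ k) * D u (axis k \<i>))" for u
      using linear_decomposition[OF lin[of u], of w] by (simp only: sym[of _ u])
    show ?thesis
      unfolding linear_decomposition[OF lin[of w], of v] 2[of "axis _ _"] sum_distrib_left sum.distrib[symmetric]
      by (rule refl)
  qed
  have "Re (\<Sum>r\<in>UNIV. \<Sum>s\<in>UNIV. HessC h z $ r $ s * \<xi> r * cnj (\<xi> s)) = (D X X + D Y Y) / 4"
  proof -
    have aux: "Re ((1/4) * (of_real (P + Q) + \<i> * of_real (R - S)) * x * cnj y) =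
      ((Re x * (Re y * P + Im y * R) + Im x * (Re y * S + Im y * Q))
        + (- Im x * (- Im y * P + Re y * R) + Re x * (- Im y * S + Re y * Q))) / 4" for P Q R S x y
    proof -
      have "Re ((1/4) * w * x * cnj y) = Re (w * (x * cnj y)) / 4" for w
        by (simp only: mult.assoc Re_divide_numeral[symmetric]) simp
      moreover have "Re ((of_real (P + Q) + \<i> * of_real (R - S)) * (x * cnj y)) =
        (Re x * (Re y * P + Im y * R) + Im x * (Re y * S + Im y * Q))
        + (- Im x * (- Im y * P + Re y * R) + Re x * (- Im y * S + Re y * Q))"
        by (simp add: algebra_simps)
      ultimately show ?thesis by (simp only:)
    qed
    have nth: "X $ r = \<xi> r" "Re (Y $ r) = - Im (\<xi> r)" "Im (Y $ r) = Re (\<xi> r)" for r by (simp_all add: X_def Y_def)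
    show ?thesis unfolding exp[of X X] exp[of Y Y] Re_sum sum.distrib[symmetric] sum_divide_distrib H aux nth by (rule refl)
  qed
  also have "\<dots> \<ge> 0"
    using sublinear_second_dirder_nonneg[OF z, of X] sublinear_second_dirder_nonneg[OF z, of Y] by (simp add: D_def)
  finally show "0 \<le> Re (\<Sum>r\<in>UNIV. \<Sum>s\<in>UNIV. HessC h z $ r $ s * \<xi> r * cnj (\<xi> s))" .
qed

lemma sublinear_Euler:
  assumes z: "z \<noteq> 0" shows "Re (herm (grad h z) z) = h z"
proof -
  let ?h = "\<lambda>w. complex_of_real (h w)"
  have dif: "h differentiable (at z)" using sublinear_C_on z by (simp add: numeral_2_eq_2)
  have dh: "dirder w ?h z = of_real (dirder w h z)" for w
    by (rule dirder_eq) (intro bounded_linear.has_derivative[OF bounded_linear_of_real] has_derivative_dirder dif)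
  have "Re (herm (grad h z) z) = (\<Sum>j\<in>UNIV. Re (z $ j) * dirder (axis j 1) h z + Im (z $ j) * dirder (axis j \<i>) h z)"
    unfolding herm_def grad_def dzbar_def dh Re_sum by (intro sum.cong refl) (simp add: field_simps)
  also have "\<dots> = dirder z h z"
    by (rule linear_decomposition[OF linear_frechet_derivative[OF dif], symmetric])
  \<comment> \<open>The derivative of t -> h(t z) at 1 is computed once by the chain rule and once
    from h(t z) = t h(z).\<close>
  also have "dirder z h z = h z"
  proof -
    have "((\<lambda>t. t *\<^sub>R z) has_derivative (\<lambda>s. s *\<^sub>R z)) (at 1)" by (auto intro!: derivative_eq_intros)
    moreover have "(h has_derivative (\<lambda>v. dirder v h z)) (at (1 *\<^sub>R z))" using has_derivative_dirder[OF dif] by simp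
    ultimately have "((\<lambda>t. h (t *\<^sub>R z)) has_derivative (\<lambda>s. dirder (s *\<^sub>R z) h z)) (at 1)"
      by (rule has_derivative_compose)
    then have "((\<lambda>t. h (t *\<^sub>R z)) has_real_derivative dirder z h z) (at 1)"
      using linear_cmul[OF linear_frechet_derivative[OF dif]] by (simp add: has_field_derivative_def mult_commute_abs)
    moreover have "((\<lambda>t. h (t *\<^sub>R z)) has_real_derivative h z) (at 1)"
    proof (rule has_field_derivative_transform_within_open[of "\<lambda>t. t * h z" _ _ "{0<..}"])
      show "((\<lambda>t. t * h z) has_real_derivative h z) (at 1)" by (auto intro!: derivative_eq_intros)
    qed (auto simp: sublinear_homogeneous)
    ultimately show ?thesis by (rule DERIV_unique)
  qed
  finally show ?thesis .
qed

end

section \<open>Differential forms\<close>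

text \<open>Wedging with a basis form only permutes the coefficients and multiplies them by constants, so
  that derivatives, regularity and supports can be treated coefficientwise.\<close>

definition monomial_op :: "('n coeffs \<Rightarrow> 'n coeffs) \<Rightarrow> bool" where
  "monomial_op E \<longleftrightarrow> (\<exists>a p q. \<forall>w I J. E w I J = a I J * w (p I J) (q I J))"

lemma monomial_opE:
  assumes "monomial_op E"
  obtains a p q where "\<And>w I J. E w I J = a I J * w (p I J) (q I J)"
  using assms unfolding monomial_op_def by blast

lemma monomial_op_wedge_dz: "monomial_op (wedge_dz j)"
  unfolding monomial_op_def
  by (intro exI[of _ "\<lambda>I J. if j \<in> I then insert_sign j (I - {j}) else 0"] exI[of _ "\<lambda>I J. I - {j}"] exI[of _ "\<lambda>I J. J"])
     (auto simp: wedge_dz_def)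

lemma monomial_op_wedge_dzbar: "monomial_op (wedge_dzbar k)"
  unfolding monomial_op_def
  by (intro exI[of _ "\<lambda>I J. if k \<in> J then (-1) ^ card I * insert_sign k (J - {k}) else 0"] exI[of _ "\<lambda>I J. I"] exI[of _ "\<lambda>I J. J - {k}"])
     (auto simp: wedge_dzbar_def)

lemma monomial_op_compose:
  assumes "monomial_op E" "monomial_op F"
  shows "monomial_op (\<lambda>w. E (F w))"
proof -
  obtain a p q where E: "\<And>w I J. E w I J = a I J * w (p I J) (q I J)" using monomial_opE[OF assms(1)] by metis
  obtain b r s where F: "\<And>w I J. F w I J = b I J * w (r I J) (s I J)" using monomial_opE[OF assms(2)] by metis
  show ?thesis unfolding monomial_op_def
    by (intro exI[of _ "\<lambda>I J. a I J * b (p I J) (q I J)"] exI[of _ "\<lambda>I J. r (p I J) (q I J)"]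
      exI[of _ "\<lambda>I J. s (p I J) (q I J)"]) (simp add: E F)
qed

lemma monomial_op_wedge_pair: "monomial_op (wedge_pair p)"
  unfolding wedge_pair_def[abs_def]
  by (rule monomial_op_compose[OF monomial_op_wedge_dz monomial_op_wedge_dzbar])

lemma monomial_op_linear:
  assumes "monomial_op E"
  shows "E (\<lambda>I J. v I J + w I J) I J = E v I J + E w I J" "E (\<lambda>I J. c * w I J) I J = c * E w I J"
    "E (\<lambda>I J. \<Sum>x\<in>S. u x I J) I J = (\<Sum>x\<in>S. E (u x) I J)"
  using assms by (auto elim!: monomial_opE simp: algebra_simps sum_distrib_left)

lemma monomial_op_wirt:
  assumes "monomial_op E" "\<And>I J. \<phi> I J differentiable (at z)"
  shows "wirt c i (\<lambda>z. E (\<lambda>I J. \<phi> I J z) I J) z = E (\<lambda>I J. wirt c i (\<phi> I J) z) I J"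
proof -
  obtain a p q where E: "\<And>w I J. E w I J = a I J * w (p I J) (q I J)" using monomial_opE[OF assms(1)] by metis
  show ?thesis unfolding E by (rule wirt_cmult[OF assms(2)])
qed

lemma monomial_op_C_on:
  assumes "monomial_op E" "open S" "\<And>I J. C_on k S (\<phi> I J)"
  shows "C_on k S (\<lambda>z. E (\<lambda>I J. \<phi> I J z) I J)"
proof -
  obtain a p q where E: "\<And>w I J. E w I J = a I J * w (p I J) (q I J)" using monomial_opE[OF assms(1)] by metis
  show ?thesis unfolding E by (rule C_on_cmult[OF assms(2,3)])
qed

lemma monomial_op_bounded_support:
  assumes "monomial_op E" "\<And>I J. bounded {z. \<phi> I J z \<noteq> 0}"
  shows "bounded {z. E (\<lambda>I J. \<phi> I J z) I J \<noteq> 0}"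
proof -
  obtain a p q where E: "\<And>w I J. E w I J = a I J * w (p I J) (q I J)" using monomial_opE[OF assms(1)] by metis
  show ?thesis unfolding E by (rule bounded_subset[OF assms(2)]) auto
qed

lemma monomial_op_differentiable:
  assumes "monomial_op E" "\<And>I J. \<phi> I J differentiable (at z)"
  shows "(\<lambda>z. E (\<lambda>I J. \<phi> I J z) I J) differentiable (at z)"
proof -
  obtain a p q where E: "\<And>w I J. E w I J = a I J * w (p I J) (q I J)" using monomial_opE[OF assms(1)] by metis
  show ?thesis unfolding E by (rule differentiable_cmult[OF assms(2)])
qed

lemma monomial_op_zero:
  assumes "monomial_op E" "\<And>I J. w I J = 0"
  shows "E w I J = 0"
  using assms by (auto elim!: monomial_opE)

text \<open>The common shape of \<partial> and dbar: \<open>E j\<close> wedges with the j-th basis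
  form and \<open>c\<close> selects the derivative. Regularity, supports, mollification and
  anticommutation are proved once for this operator.\<close>

definition dform :: "('n::{finite,wellorder} \<Rightarrow> 'n coeffs \<Rightarrow> 'n coeffs) \<Rightarrow> complex \<Rightarrow> 'n form \<Rightarrow> 'n form" where
  "dform E c \<omega> I J z = (\<Sum>j\<in>UNIV. E j (\<lambda>I J. wirt c j (\<omega> I J) z) I J)"

lemma del_eq_dform: "del \<omega> = dform wedge_dz (- \<i>) \<omega>"
proof (intro ext)
  fix I J z
  have "del \<omega> I J z = (\<Sum>j\<in>I. wedge_dz j (\<lambda>I J. wirt (- \<i>) j (\<omega> I J) z) I J)"
    unfolding del_def dz_eq_wirt by (intro sum.cong refl) (simp add: wedge_dz_def)
  also have "\<dots> = dform wedge_dz (- \<i>) \<omega> I J z"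
    unfolding dform_def by (rule sum.mono_neutral_left) (simp_all add: wedge_dz_def)
  finally show "del \<omega> I J z = dform wedge_dz (- \<i>) \<omega> I J z" .
qed

lemma delbar_eq_dform: "delbar \<omega> = dform wedge_dzbar \<i> \<omega>"
proof (intro ext)
  fix I J z
  have "delbar \<omega> I J z = (\<Sum>j\<in>J. wedge_dzbar j (\<lambda>I J. wirt \<i> j (\<omega> I J) z) I J)"
    unfolding delbar_def dzbar_eq_wirt sum_distrib_left by (intro sum.cong refl) (simp add: wedge_dzbar_def)
  also have "\<dots> = dform wedge_dzbar \<i> \<omega> I J z"
    unfolding dform_def by (rule sum.mono_neutral_left) (simp_all add: wedge_dzbar_def)
  finally show "delbar \<omega> I J z = dform wedge_dzbar \<i> \<omega> I J z" .
qed

lemma dform_C_on: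
  assumes "\<And>j. monomial_op (E j)" "open S" "\<And>I J. C_on (Suc k) S (\<omega> I J)"
  shows "C_on k S (dform E c \<omega> I J)"
  unfolding dform_def[abs_def]
  by (rule C_on_sum[OF assms(2)], rule monomial_op_C_on[OF assms(1,2)], rule C_on_wirt[OF assms(2,3)])

lemma dform_bounded_support:
  assumes "\<And>j. monomial_op (E j)" "\<And>I J. bounded {z. \<omega> I J z \<noteq> 0}"
  shows "bounded {z. dform E c \<omega> I J z \<noteq> 0}"
proof (rule bounded_subset)
  show "bounded (\<Union>j. {z. E j (\<lambda>I J. wirt c j (\<omega> I J) z) I J \<noteq> 0})"
    using monomial_op_bounded_support[OF assms(1) bounded_support_wirt[OF assms(2)]] by (intro bounded_UN) auto
  show "{z. dform E c \<omega> I J z \<noteq> 0} \<subseteq> (\<Union>j. {z. E j (\<lambda>I J. wirt c j (\<omega> I J) z) I J \<noteq> 0})"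
    unfolding dform_def by (auto intro: ccontr dest: sum.not_neutral_contains_not_neutral)
qed

lemma dform_eq_0:
  assumes "\<And>j. monomial_op (E j)" "open S" "z \<in> S" "\<And>I J z. z \<in> S \<Longrightarrow> \<omega> I J z = 0"
  shows "dform E c \<omega> I J z = 0"
proof -
  have "E j (\<lambda>I J. wirt c j (\<omega> I J) z) I J = 0" for j
    by (rule monomial_op_zero[OF assms(1)]) (rule wirt_eq_0_open[OF assms(2,3,4)])
  then show ?thesis by (simp add: dform_def)
qed

lemma dform_dform:
  assumes E: "\<And>j. monomial_op (E j)" and F: "\<And>j. monomial_op (F j)" and \<omega>: "open S" "z \<in> S" "\<And>I J. C_on 2 S (\<omega> I J)"
  shows "dform E c (dform F d \<omega>) I J z = (\<Sum>j\<in>UNIV. \<Sum>k\<in>UNIV. E j (F k (\<lambda>I J. wirt c j (wirt d k (\<omega> I J)) z)) I J)"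
proof -
  have dif: "wirt d k (\<omega> I J) differentiable (at z)" for k I J
    using C_on_wirt[OF \<omega>(1), of 1 "\<omega> I J" d k] \<omega> by (simp add: numeral_2_eq_2)
  have "wirt c j (dform F d \<omega> I J) z = (\<Sum>k\<in>UNIV. F k (\<lambda>I J. wirt c j (wirt d k (\<omega> I J)) z) I J)" for j I J
    unfolding dform_def[abs_def]
    by (simp add: wirt_sum monomial_op_differentiable[OF F] monomial_op_wirt[OF F] dif)
  then show ?thesis unfolding dform_def[of E] by (simp add: monomial_op_linear(3)[OF E])
qed

text \<open>Second derivatives commute whereas wedging with two basis forms anticommutes; this one
  argument yields \<partial>\<partial> = 0, dbar dbar = 0 and \<partial> dbar = - dbar
  \<partial>.\<close>

lemma dform_anticommute:
  assumes E: "\<And>j. monomial_op (E j)" and F: "\<And>j. monomial_op (F j)"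
    and anti: "\<And>j k w I J. E j (F k w) I J = - F k (E j w) I J"
    and \<omega>: "open S" "z \<in> S" "\<And>I J. C_on 2 S (\<omega> I J)"
  shows "dform E c (dform F d \<omega>) I J z = - dform F d (dform E c \<omega>) I J z"
proof -
  have "dform E c (dform F d \<omega>) I J z = (\<Sum>j\<in>UNIV. \<Sum>k\<in>UNIV. E j (F k (\<lambda>I J. wirt c j (wirt d k (\<omega> I J)) z)) I J)"
    by (rule dform_dform[OF E F \<omega>])
  also have "\<dots> = (\<Sum>j\<in>UNIV. \<Sum>k\<in>UNIV. - F k (E j (\<lambda>I J. wirt d k (wirt c j (\<omega> I J)) z)) I J)"
    by (simp add: anti wirt_commute[OF \<omega>(1,3,2)])
  also have "\<dots> = - (\<Sum>j\<in>UNIV. \<Sum>k\<in>UNIV. F k (E j (\<lambda>I J. wirt d k (wirt c j (\<omega> I J)) z)) I J)"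
    by (simp add: sum_negf)
  also have "(\<Sum>j\<in>UNIV. \<Sum>k\<in>UNIV. F k (E j (\<lambda>I J. wirt d k (wirt c j (\<omega> I J)) z)) I J) =
     (\<Sum>k\<in>UNIV. \<Sum>j\<in>UNIV. F k (E j (\<lambda>I J. wirt d k (wirt c j (\<omega> I J)) z)) I J)"
    by (rule sum.swap)
  also have "\<dots> = dform F d (dform E c \<omega>) I J z" by (rule dform_dform[OF F E \<omega>, symmetric])
  finally show ?thesis .
qed

lemma dform_dform_same:
  assumes E: "\<And>j. monomial_op (E j)"
    and anti: "\<And>j k w I J. E j (E k w) I J = - E k (E j w) I J"
    and \<omega>: "open S" "z \<in> S" "\<And>I J. C_on 2 S (\<omega> I J)"
  shows "dform E c (dform E c \<omega>) I J z = 0"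
  using dform_anticommute[where c = c and d = c and E=E and F=E, OF E E anti \<omega>] by (simp add: eq_neg_iff_add_eq_0)

context
  fixes \<omega> :: "'n::{finite,wellorder} form" and S z
  assumes \<omega>: "open S" "z \<in> S" "\<And>I J. C_on 2 S (\<omega> I J)"
begin

lemma del_del: "del (del \<omega>) I J z = 0"
  unfolding del_eq_dform by (rule dform_dform_same[where E = wedge_dz, OF monomial_op_wedge_dz _ \<omega>]) (subst wedge_dz_dz, rule refl)

lemma delbar_delbar: "delbar (delbar \<omega>) I J z = 0"
  unfolding delbar_eq_dform by (rule dform_dform_same[where E = wedge_dzbar, OF monomial_op_wedge_dzbar _ \<omega>]) (subst wedge_dzbar_dzbar, rule refl)

lemma delbar_del: "delbar (del \<omega>) I J z = - del (delbar \<omega>) I J z"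
  unfolding del_eq_dform delbar_eq_dform
  by (rule dform_anticommute[where E = wedge_dzbar and F = wedge_dz, OF monomial_op_wedge_dzbar monomial_op_wedge_dz _ \<omega>]) (simp add: wedge_dzbar_dz)

text \<open>In (\<partial> + dbar) i (dbar - \<partial>) the squares vanish and the two mixed terms
  coincide, because dbar \<partial> = - \<partial> dbar.\<close>

lemma ext_d_ext_dc: "ext_d (ext_dc \<omega>) I J z = 2 * \<i> * del (delbar \<omega>) I J z"
proof -
  have dif: "del \<omega> I J differentiable (at z)" "delbar \<omega> I J differentiable (at z)" for I J
    using dform_C_on[OF monomial_op_wedge_dz \<omega>(1), of 1 \<omega>] dform_C_on[OF monomial_op_wedge_dzbar \<omega>(1), of 1 \<omega>] \<omega>
    by (auto simp: del_eq_dform delbar_eq_dform numeral_2_eq_2)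
  have w: "wirt c j (ext_dc \<omega> I J) z = \<i> * wirt c j (delbar \<omega> I J) z + (- \<i>) * wirt c j (del \<omega> I J) z" for c j I J
  proof -
    have "ext_dc \<omega> I J = (\<lambda>z. \<i> * delbar \<omega> I J z + (- \<i>) * del \<omega> I J z)"
      by (simp add: fun_eq_iff ext_dc_def algebra_simps)
    then show ?thesis
      by (simp only: wirt_add[OF differentiable_cmult[OF dif(2)] differentiable_cmult[OF dif(1)]] wirt_cmult[OF dif(1)] wirt_cmult[OF dif(2)])
  qed
  have lin: "dform E c (ext_dc \<omega>) I J z = \<i> * dform E c (delbar \<omega>) I J z + (- \<i>) * dform E c (del \<omega>) I J z"
    if "\<And>j. monomial_op (E j)" for E c I J
    unfolding dform_def w monomial_op_linear(1)[OF that] monomial_op_linear(2)[OF that] sum.distrib sum_distrib_left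
    by (rule refl)
  have "ext_d (ext_dc \<omega>) I J z = del (ext_dc \<omega>) I J z + delbar (ext_dc \<omega>) I J z" by (simp add: ext_d_def)
  also have "del (ext_dc \<omega>) I J z = \<i> * del (delbar \<omega>) I J z"
    using lin[where E = wedge_dz, OF monomial_op_wedge_dz, where c = "- \<i>"] del_del by (simp add: del_eq_dform[symmetric])
  also have "delbar (ext_dc \<omega>) I J z = \<i> * del (delbar \<omega>) I J z"
    using lin[where E = wedge_dzbar, OF monomial_op_wedge_dzbar, where c = "\<i>"] delbar_delbar delbar_del by (simp add: delbar_eq_dform[symmetric])
  finally show ?thesis by simp
qed

end

text \<open>The form dbar h \<and> \<omega>, one of the two primitives by which h \<partial> dbar
  \<omega> and \<partial> dbar h \<and> \<omega> differ.\<close>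

definition dbar_wedge :: "(complex^'n::{finite,wellorder} \<Rightarrow> real) \<Rightarrow> 'n form \<Rightarrow> 'n form" where
  "dbar_wedge h \<omega> I J z = (\<Sum>k\<in>UNIV. wirt \<i> k (\<lambda>w. complex_of_real (h w)) z * wedge_dzbar k (\<lambda>I J. \<omega> I J z) I J)"

text \<open>Product rule for \<partial>(dbar h \<and> \<omega>). The double sum is - dbar h \<and>
  \<partial>\<omega>, left expanded because the derivatives of a radial \<omega> are inserted into
  it later.\<close>

lemma del_dbar_wedge:
  fixes h :: "complex^'n::{finite,wellorder} \<Rightarrow> real"
  assumes S: "open S" "z \<in> S" and h: "C_on 2 S (\<lambda>w. complex_of_real (h w))" and \<omega>: "\<And>I J. \<omega> I J differentiable (at z)"
  shows "del (dbar_wedge h \<omega>) I J z = wedge_mat (\<lambda>j k. HessC h z $ j $ k) (\<lambda>I J. \<omega> I J z) I J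
     + (\<Sum>j\<in>UNIV. \<Sum>k\<in>UNIV. wirt \<i> k (\<lambda>w. complex_of_real (h w)) z * wedge_pair (j, k) (\<lambda>I J. wirt (- \<i>) j (\<omega> I J) z) I J)"
proof -
  let ?h = "\<lambda>w. complex_of_real (h w)"
  have db: "wirt c k ?h differentiable (at z)" for c k
    using C_on_wirt[OF S(1), of 1 ?h c k] h S by (simp add: numeral_2_eq_2)
  have H: "wirt (- \<i>) j (wirt \<i> k ?h) z = HessC h z $ j $ k" for j k
    by (simp add: HessC_def dz_eq_wirt dzbar_eq_wirt)
  have "wirt (- \<i>) j (dbar_wedge h \<omega> I J) z = (\<Sum>k\<in>UNIV. HessC h z $ j $ k * wedge_dzbar k (\<lambda>I J. \<omega> I J z) I J
     + wirt \<i> k ?h z * wedge_dzbar k (\<lambda>I J. wirt (- \<i>) j (\<omega> I J) z) I J)" for j I J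
    unfolding dbar_wedge_def[abs_def]
    by (simp add: wirt_sum wirt_mult differentiable_mult db \<omega> H
       monomial_op_differentiable[OF monomial_op_wedge_dzbar] monomial_op_wirt[OF monomial_op_wedge_dzbar] add.commute)
  then have "del (dbar_wedge h \<omega>) I J z = (\<Sum>j\<in>UNIV. \<Sum>k\<in>UNIV. HessC h z $ j $ k * wedge_dz j (wedge_dzbar k (\<lambda>I J. \<omega> I J z)) I J
     + wirt \<i> k ?h z * wedge_dz j (wedge_dzbar k (\<lambda>I J. wirt (- \<i>) j (\<omega> I J) z)) I J)"
    unfolding del_eq_dform dform_def
    by (simp add: monomial_op_linear[OF monomial_op_wedge_dz])
  then show ?thesis by (simp add: wedge_mat_def wedge_pair_def sum.distrib)
qed

text \<open>From \<partial>(dbar h \<and> \<omega>) = \<partial> dbar h \<and> \<omega> - dbar h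
  \<and> \<partial>\<omega> and dbar(h \<partial>\<omega>) = dbar h \<and> \<partial>\<omega> - h
  \<partial> dbar \<omega> the cross terms cancel in the sum. Moving \<partial> dbar from \<omega>
  to \<open>h\<close> thus changes the form only by terms that a closed current annihilates.\<close>

lemma del_dbar_wedge_identity:
  fixes h :: "complex^'n::{finite,wellorder} \<Rightarrow> real"
  assumes S: "open S" "z \<in> S" and h: "C_on 2 S (\<lambda>w. complex_of_real (h w))" and \<omega>: "\<And>I J. C_on 2 S (\<omega> I J)"
  shows "complex_of_real (h z) * del (delbar \<omega>) I J z - wedge_mat (\<lambda>j k. HessC h z $ j $ k) (\<lambda>I J. \<omega> I J z) I J =
    - (del (dbar_wedge h \<omega>) I J z + delbar (fun_times_form h (del \<omega>)) I J z)"
proof -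
  let ?h = "\<lambda>w. complex_of_real (h w)"
  let ?\<omega> = "\<lambda>I J. \<omega> I J z"
  have dh: "?h differentiable (at z)" using h S by (simp add: numeral_2_eq_2)
  have d\<omega>: "\<omega> I J differentiable (at z)" for I J using \<omega>[of I J] S by (simp add: numeral_2_eq_2)
  have dd: "del \<omega> I J differentiable (at z)" for I J
    using dform_C_on[OF monomial_op_wedge_dz S(1), of 1 \<omega>] \<omega> S by (auto simp: del_eq_dform numeral_2_eq_2)
  have 1: "del (dbar_wedge h \<omega>) I J z = wedge_mat (\<lambda>j k. HessC h z $ j $ k) ?\<omega> I J
     + (\<Sum>j\<in>UNIV. \<Sum>k\<in>UNIV. wirt \<i> k ?h z * wedge_dz j (wedge_dzbar k (\<lambda>I J. wirt (- \<i>) j (\<omega> I J) z)) I J)"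
    using del_dbar_wedge[OF S h d\<omega>] by (simp add: wedge_pair_def)
  have "wirt \<i> k (fun_times_form h (del \<omega>) I J) z = wirt \<i> k ?h z * del \<omega> I J z + ?h z * wirt \<i> k (del \<omega> I J) z" for k I J
    unfolding fun_times_form_def[abs_def] by (simp add: wirt_mult dh dd add.commute)
  then have "delbar (fun_times_form h (del \<omega>)) I J z = (\<Sum>k\<in>UNIV. wirt \<i> k ?h z * wedge_dzbar k (\<lambda>I J. del \<omega> I J z) I J)
      + ?h z * delbar (del \<omega>) I J z"
    unfolding delbar_eq_dform dform_def
    by (simp add: monomial_op_linear[OF monomial_op_wedge_dzbar] sum.distrib sum_distrib_left)
  also have "delbar (del \<omega>) I J z = - del (delbar \<omega>) I J z" by (rule delbar_del[OF S \<omega>])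
  also have "(\<Sum>k\<in>UNIV. wirt \<i> k ?h z * wedge_dzbar k (\<lambda>I J. del \<omega> I J z) I J) =
     (\<Sum>k\<in>UNIV. \<Sum>j\<in>UNIV. wirt \<i> k ?h z * wedge_dzbar k (wedge_dz j (\<lambda>I J. wirt (- \<i>) j (\<omega> I J) z)) I J)"
    unfolding del_eq_dform dform_def
    by (simp add: monomial_op_linear[OF monomial_op_wedge_dzbar] sum_distrib_left)
  also have "\<dots> = - (\<Sum>k\<in>UNIV. \<Sum>j\<in>UNIV. wirt \<i> k ?h z * wedge_dz j (wedge_dzbar k (\<lambda>I J. wirt (- \<i>) j (\<omega> I J) z)) I J)"
    by (simp add: wedge_dzbar_dz sum_negf)
  also have "(\<Sum>k\<in>UNIV. \<Sum>j\<in>UNIV. wirt \<i> k ?h z * wedge_dz j (wedge_dzbar k (\<lambda>I J. wirt (- \<i>) j (\<omega> I J) z)) I J) =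
     (\<Sum>j\<in>UNIV. \<Sum>k\<in>UNIV. wirt \<i> k ?h z * wedge_dz j (wedge_dzbar k (\<lambda>I J. wirt (- \<i>) j (\<omega> I J) z)) I J)"
    by (rule sum.swap)
  finally show ?thesis using 1 by simp
qed

section \<open>The current with density the wedge product of complex Hessians\<close>

lemma wedge_mats_linear:
  "wedge_mats Ms (\<lambda>I J. v I J + w I J) I J = wedge_mats Ms v I J + wedge_mats Ms w I J"
  "wedge_mats Ms (\<lambda>I J. c * w I J) I J = c * wedge_mats Ms w I J"
  "wedge_mats Ms (\<lambda>I J. \<Sum>x\<in>S. u x I J) I J = (\<Sum>x\<in>S. wedge_mats Ms (u x) I J)"
proof -
  show "wedge_mats Ms (\<lambda>I J. v I J + w I J) I J = wedge_mats Ms v I J + wedge_mats Ms w I J"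
    unfolding wedge_mats_expand wedge_pairs_linear by (simp only: distrib_left sum.distrib)
  show "wedge_mats Ms (\<lambda>I J. c * w I J) I J = c * wedge_mats Ms w I J"
    unfolding wedge_mats_expand wedge_pairs_linear sum_distrib_left by (simp only: mult_ac)
  have "wedge_mats Ms (\<lambda>I J. \<Sum>x\<in>S. u x I J) I J = (\<Sum>ps | length ps = length Ms. \<Sum>x\<in>S.
    (\<Prod>l<length Ms. (Ms ! l) (fst (ps ! l)) (snd (ps ! l))) * wedge_pairs ps (u x) I J)"
    unfolding wedge_mats_expand wedge_pairs_linear sum_distrib_left by (rule refl)
  then show "wedge_mats Ms (\<lambda>I J. \<Sum>x\<in>S. u x I J) I J = (\<Sum>x\<in>S. wedge_mats Ms (u x) I J)"
    by (simp only: sum.swap[of _ S] wedge_mats_expand)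
qed

text \<open>The coefficient of \<open>dz\<^bsub>UNIV\<^esub> \<and> dz\<^sup>*\<^bsub>UNIV\<^esub>\<close> in the wedge product of \<open>w\<close> with the forms
  \<open>\<partial>\<partial>\<^sup>* h = (\<Sum>j k. (Hess h)\<^sub>j\<^sub>k dz\<^sub>j \<and> dz\<^sup>*\<^sub>k)\<close>.\<close>

definition hess_top :: "(complex^'n::{finite,wellorder} \<Rightarrow> real) list \<Rightarrow> complex^'n::_ \<Rightarrow> 'n coeffs \<Rightarrow> complex" where
  "hess_top hs z w = wedge_mats (map (\<lambda>h j k. HessC h z $ j $ k) hs) w UNIV UNIV"

lemma hess_top_Nil [simp]: "hess_top [] z w = w UNIV UNIV"
  by (simp add: hess_top_def)

lemma hess_top_Cons: "hess_top (h # hs) z w = hess_top hs z (wedge_mat (\<lambda>j k. HessC h z $ j $ k) w)"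
  by (simp add: hess_top_def)

lemma hess_top_linear:
  "hess_top hs z (\<lambda>I J. v I J + w I J) = hess_top hs z v + hess_top hs z w"
  "hess_top hs z (\<lambda>I J. c * w I J) = c * hess_top hs z w"
  "hess_top hs z (\<lambda>I J. \<Sum>x\<in>S. u x I J) = (\<Sum>x\<in>S. hess_top hs z (u x))"
  unfolding hess_top_def by (rule wedge_mats_linear)+

lemma hess_top_Cons_expand:
  "hess_top (h # hs) z w = (\<Sum>j\<in>UNIV. \<Sum>k\<in>UNIV. HessC h z $ j $ k * hess_top hs z (wedge_pair (j, k) w))"
  unfolding hess_top_Cons wedge_mat_def[abs_def] hess_top_linear by (rule refl)

definition coeffs_unit :: "'n set \<Rightarrow> 'n set \<Rightarrow> 'n coeffs" where
  "coeffs_unit I J I' J' = (if I' = I \<and> J' = J then 1 else 0)"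

text \<open>By linearity the dependence on \<open>w\<close> is separated from that on
  \<open>z\<close>: measurability, limits and bounds reduce to the finitely many functions
  \<open>hess_top hs z (coeffs_unit I J)\<close>.\<close>

lemma hess_top_coeffs:
  "hess_top hs z w = (\<Sum>I\<in>UNIV. \<Sum>J\<in>UNIV. w I J * hess_top hs z (coeffs_unit I J))"
proof -
  have "w I' J' = (\<Sum>I\<in>UNIV. \<Sum>J\<in>UNIV. w I J * coeffs_unit I J I' J')" for I' J'
  proof -
    have "(\<Sum>I\<in>UNIV. \<Sum>J\<in>UNIV. w I J * coeffs_unit I J I' J') = (\<Sum>I\<in>UNIV. \<Sum>J\<in>UNIV. if J' = J then (if I' = I then w I J else 0) else 0)"
      by (intro sum.cong refl) (simp add: coeffs_unit_def)
    then show ?thesis by simp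
  qed
  then have "w = (\<lambda>I' J'. \<Sum>I\<in>UNIV. \<Sum>J\<in>UNIV. w I J * coeffs_unit I J I' J')" by blast
  then have "hess_top hs z w = hess_top hs z (\<lambda>I' J'. \<Sum>I\<in>UNIV. \<Sum>J\<in>UNIV. w I J * coeffs_unit I J I' J')" by simp
  then show ?thesis by (simp only: hess_top_linear)
qed

lemma continuous_on_hess_top:
  assumes "\<forall>h\<in>set hs. sublinear_C2 h"
  shows "continuous_on (- {0}) (\<lambda>z. hess_top hs z w)"
  using assms
proof (induction hs arbitrary: w)
  case (Cons h hs)
  then have "continuous_on (- {0}) (\<lambda>z. HessC h z $ j $ k)" for j k by (intro continuous_on_HessC) auto
  moreover have "continuous_on (- {0}) (\<lambda>z. hess_top hs z w)" for w using Cons by simp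
  ultimately show ?case unfolding hess_top_Cons_expand by (intro continuous_on_sum continuous_on_mult)
qed (simp add: continuous_on_const)

lemma hess_top_bound:
  assumes "\<forall>h\<in>set hs. sublinear_C2 h"
  shows "\<exists>C\<ge>0. \<forall>z. z \<noteq> 0 \<longrightarrow> norm (hess_top hs z w) \<le> C / norm z ^ length hs"
  using assms
proof (induction hs arbitrary: w)
  case Nil
  then show ?case by (intro exI[of _ "norm (w UNIV UNIV)"]) auto
next
  case (Cons h hs)
  then have "sublinear_C2 h" by simp
  then obtain B where B: "B \<ge> 0" "\<And>z j k. z \<noteq> 0 \<Longrightarrow> norm (HessC h z $ j $ k) \<le> B / norm z" using HessC_bound by blast
  have "\<exists>C\<ge>0. \<forall>z. z \<noteq> 0 \<longrightarrow> norm (hess_top hs z (wedge_pair p w)) \<le> C / norm z ^ length hs" for p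
    using Cons by auto
  then obtain C where C: "\<And>p. C p \<ge> 0"
    "\<And>p z. z \<noteq> 0 \<Longrightarrow> norm (hess_top hs z (wedge_pair p w)) \<le> C p / norm z ^ length hs" by metis
  show ?case
  proof (intro exI[of _ "\<Sum>j\<in>UNIV. \<Sum>k\<in>UNIV. B * C (j, k)"] conjI allI impI)
    show "0 \<le> (\<Sum>j\<in>UNIV. \<Sum>k\<in>UNIV. B * C (j, k))" using B C by (intro sum_nonneg mult_nonneg_nonneg) auto
    fix z :: "complex^'a::_" assume z: "z \<noteq> 0"
    have "norm (hess_top (h # hs) z w) \<le> (\<Sum>j\<in>UNIV. \<Sum>k\<in>UNIV. norm (HessC h z $ j $ k * hess_top hs z (wedge_pair (j, k) w)))"
      unfolding hess_top_Cons_expand by (intro order_trans[OF norm_sum] sum_mono norm_sum)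
    also have "\<dots> \<le> (\<Sum>j\<in>UNIV. \<Sum>k\<in>UNIV. (B / norm z) * (C (j, k) / norm z ^ length hs))"
      unfolding norm_mult using B C z by (intro sum_mono mult_mono) auto
    also have "\<dots> = (\<Sum>j\<in>UNIV. \<Sum>k\<in>UNIV. B * C (j, k)) / norm z ^ length (h # hs)"
      by (simp add: sum_divide_distrib)
    finally show "norm (hess_top (h # hs) z w) \<le> (\<Sum>j\<in>UNIV. \<Sum>k\<in>UNIV. B * C (j, k)) / norm z ^ length (h # hs)" .
  qed
qed

section \<open>Measurability and integrability of functions singular at the origin\<close>

lemma borel_measurable_continuous_on_punctured:
  fixes f :: "'a::euclidean_space \<Rightarrow> 'b::{second_countable_topology,real_normed_vector}"
  assumes "continuous_on (- {0}) f"
  shows "f \<in> borel_measurable borel"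
proof -
  have "(\<lambda>x. indicator (- {0}) x *\<^sub>R f x) \<in> borel_measurable borel"
    by (rule borel_measurable_continuous_on_indicator[OF _ assms]) auto
  then have "(\<lambda>x. indicator (- {0}) x *\<^sub>R f x + indicator {0} x *\<^sub>R f 0) \<in> borel_measurable borel" by measurable
  moreover have "(\<lambda>x. indicator (- {0}) x *\<^sub>R f x + indicator {0} x *\<^sub>R f 0) = f"
    by (auto simp: fun_eq_iff indicator_def)
  ultimately show ?thesis by simp
qed

lemma integrable_radial_power:
  assumes "k < N" shows "integrable (radial_measure N) (\<lambda>r. indicator {..R} r / r ^ k)"
proof -
  have "integrable lborel (\<lambda>r::real. indicator {0..R} r *\<^sub>R r ^ (N - 1 - k))"
    by (rule borel_integrable_compact) (auto intro!: continuous_intros)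
  then have "integrable lborel (\<lambda>r::real. indicator {0<..} r *\<^sub>R (indicator {0..R} r *\<^sub>R r ^ (N - 1 - k)))"
    by (rule integrable_mult_indicator[rotated]) auto
  moreover have "(indicator {0<..} r * r ^ (N - 1)) *\<^sub>R (indicator {..R} r / r ^ k) =
     indicator {0<..} r *\<^sub>R (indicator {0..R} r *\<^sub>R r ^ (N - 1 - k))" for r :: real
  proof (cases "0 < r \<and> r \<le> R")
    case True
    have "r ^ (N - 1) = r ^ (N - 1 - k) * r ^ k" using assms by (simp flip: power_add)
    then show ?thesis using True by simp
  qed (auto simp: indicator_def)
  ultimately show ?thesis by (subst integral_radial_measure(1)) simp_all
qed

lemma integrable_inverse_norm_power:
  assumes "k < DIM('a::euclidean_space)"
  shows "integrable lborel (\<lambda>z::'a. indicator (cball 0 R) z / norm z ^ k)"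
proof -
  have m1: "(\<lambda>z::'a. indicator (cball 0 R) z / norm z ^ k :: real) \<in> borel_measurable borel"
    by (intro borel_measurable_divide borel_measurable_indicator borel_measurable_power) auto
  have m2: "(\<lambda>r::real. indicator {..R} r / r ^ k :: real) \<in> borel_measurable borel"
    by (intro borel_measurable_divide borel_measurable_indicator borel_measurable_power) auto
  have m3: "complex_of_real \<in> borel_measurable borel"
    by (intro borel_measurable_continuous_onI continuous_intros)
  have "integrable lborel (\<lambda>z::'a. complex_of_real (indicator (cball 0 R) z / norm z ^ k))"
  proof (rule polar_integral_product(1)[OF _ _ _ integrable_radial_power[OF assms, of R], where g = "\<lambda>_. 1"])
    show "integrable (sphere_measure :: 'a measure) (\<lambda>_. 1 :: complex)"
      using finite_measure.integrable_const[OF finite_measure_sphere_measure] by blast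
    fix r :: real and u :: 'a assume "r > 0" "norm u = 1"
    then show "complex_of_real (indicator (cball 0 R) (r *\<^sub>R u) / norm (r *\<^sub>R u) ^ k) = (indicator {..R} r / r ^ k) *\<^sub>R 1"
      by (simp add: indicator_def scaleR_conv_of_real)
  qed (use m2 measurable_compose[OF m1 m3] in auto)
  from integrable_Re[OF this] show ?thesis by simp
qed

section \<open>Compactly supported forms and bounds for their integrals\<close>

lemma cc_form_iff: "cc_form \<omega> \<longleftrightarrow> (\<forall>I J. continuous_on UNIV (\<omega> I J) \<and> bounded {z. \<omega> I J z \<noteq> 0})"
  unfolding cc_form_def compact_closure by blast

lemma test_form_iff: "test_form \<omega> \<longleftrightarrow> (\<forall>I J. (\<forall>k. C_on k UNIV (\<omega> I J)) \<and> bounded {z. \<omega> I J z \<noteq> 0})"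
  unfolding test_form_def compact_closure by blast

lemma test_form_imp_cc_form: "test_form \<omega> \<Longrightarrow> cc_form \<omega>"
  unfolding test_form_iff cc_form_iff using C_on_imp_continuous_on by blast

lemma bounded_supports:
  fixes \<omega> :: "'n::finite form"
  assumes "\<And>I J. bounded {z. \<omega> I J z \<noteq> 0}"
  obtains R where "\<And>I J z. norm z > R \<Longrightarrow> \<omega> I J z = 0"
proof -
  have "bounded (\<Union>I. \<Union>J. {z. \<omega> I J z \<noteq> 0})" using assms by (intro bounded_UN) auto
  then obtain R where R: "\<And>z. z \<in> (\<Union>I. \<Union>J. {z. \<omega> I J z \<noteq> 0}) \<Longrightarrow> norm z \<le> R" unfolding bounded_iff by blast
  have "\<omega> I J z = 0" if "norm z > R" for I J z using R[of z] that by fastforce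
  then show ?thesis using that by blast
qed

lemma cc_form_bounds:
  fixes \<omega> :: "'n::finite form"
  assumes "cc_form \<omega>"
  obtains M where "M \<ge> 0" "\<And>I J z. norm (\<omega> I J z) \<le> M"
proof -
  have "\<exists>M\<ge>0. \<forall>z. norm (\<omega> I J z) \<le> M" for I J
    using assms continuous_bounded_support_bounded[of "\<omega> I J"] unfolding cc_form_iff by metis
  then obtain M where M: "\<And>I J. M I J \<ge> 0" "\<And>I J z. norm (\<omega> I J z) \<le> M I J" by metis
  have "norm (\<omega> I J z) \<le> (\<Sum>I\<in>UNIV. \<Sum>J\<in>UNIV. M I J)" for I J z
  proof -
    have "M I J \<le> (\<Sum>J\<in>UNIV. M I J)" using M(1) by (intro member_le_sum) auto
    also have "\<dots> \<le> (\<Sum>I\<in>UNIV. \<Sum>J\<in>UNIV. M I J)" using M(1) by (intro member_le_sum sum_nonneg) auto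
    finally show ?thesis using M(2) order_trans by blast
  qed
  moreover have "0 \<le> (\<Sum>I\<in>UNIV. \<Sum>J\<in>UNIV. M I J)" using M(1) by (intro sum_nonneg) auto
  ultimately show ?thesis using that by blast
qed

lemma measurable_hess_top:
  assumes hs: "\<forall>h\<in>set hs. sublinear_C2 h" and [measurable]: "\<And>I J. \<omega> I J \<in> borel_measurable borel"
  shows "(\<lambda>z. hess_top hs z (\<lambda>I J. \<omega> I J z)) \<in> borel_measurable borel"
proof -
  have [measurable]: "(\<lambda>z. hess_top hs z w) \<in> borel_measurable borel" for w
    by (rule borel_measurable_continuous_on_punctured[OF continuous_on_hess_top[OF hs]])
  show ?thesis unfolding hess_top_coeffs[of hs _ "\<lambda>I J. \<omega> I J _"] by measurable
qed

lemma hess_top_form_bound: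
  fixes hs :: "(complex^'n::{finite,wellorder} \<Rightarrow> real) list"
  assumes hs: "\<forall>h\<in>set hs. sublinear_C2 h"
  obtains C where "C \<ge> 0" "\<And>z M w. z \<noteq> 0 \<Longrightarrow> (\<And>I J. norm (w I J) \<le> M) \<Longrightarrow> norm (hess_top hs z w) \<le> C * M / norm z ^ length hs"
proof -
  obtain C where C: "\<And>w. C w \<ge> 0" "\<And>z w. z \<noteq> 0 \<Longrightarrow> norm (hess_top hs z w) \<le> C w / norm z ^ length hs"
    using hess_top_bound[OF hs] by metis
  have "norm (hess_top hs z w) \<le> (\<Sum>I\<in>UNIV. \<Sum>J\<in>UNIV. C (coeffs_unit I J)) * M / norm z ^ length hs"
    if z: "z \<noteq> 0" and M: "\<And>I J. norm (w I J) \<le> M" for z M w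
  proof -
    have M0: "M \<ge> 0" using M[of "{}" "{}"] norm_ge_zero order_trans by blast
    have "norm (hess_top hs z w) \<le> (\<Sum>I\<in>UNIV. \<Sum>J\<in>UNIV. norm (w I J * hess_top hs z (coeffs_unit I J)))"
      unfolding hess_top_coeffs[of hs z w] by (intro order_trans[OF norm_sum] sum_mono norm_sum)
    also have "\<dots> \<le> (\<Sum>I\<in>UNIV. \<Sum>J\<in>UNIV. M * (C (coeffs_unit I J) / norm z ^ length hs))"
      unfolding norm_mult using M0 M C z by (intro sum_mono mult_mono) auto
    also have "\<dots> = (\<Sum>I\<in>UNIV. \<Sum>J\<in>UNIV. C (coeffs_unit I J)) * M / norm z ^ length hs"
      unfolding sum_distrib_right sum_divide_distrib by (intro sum.cong refl) (simp add: mult.commute)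
    finally show ?thesis .
  qed
  moreover have "0 \<le> (\<Sum>I\<in>UNIV. \<Sum>J\<in>UNIV. C (coeffs_unit I J))" using C(1) by (intro sum_nonneg) auto
  ultimately show ?thesis using that by blast
qed

lemma hess_top_integrable:
  fixes hs :: "(complex^'n::{finite,wellorder} \<Rightarrow> real) list"
  assumes hs: "\<forall>h\<in>set hs. sublinear_C2 h" and len: "length hs < DIM((complex, 'n) vec)"
    and m: "\<And>I J. \<omega> I J \<in> borel_measurable borel"
    and M: "\<And>I J z. norm (\<omega> I J z) \<le> M" and R: "\<And>I J z. norm z > R \<Longrightarrow> \<omega> I J z = 0"
  shows "integrable lborel (\<lambda>z. hess_top hs z (\<lambda>I J. \<omega> I J z))"
proof -
  obtain C where C: "C \<ge> 0" "\<And>z M w. z \<noteq> 0 \<Longrightarrow> (\<And>I J. norm (w I J) \<le> M) \<Longrightarrow> norm (hess_top hs z w) \<le> C * M / norm z ^ length hs"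
    using hess_top_form_bound[OF hs] by metis
  show ?thesis
  proof (rule Bochner_Integration.integrable_bound)
    show "integrable lborel (\<lambda>z::(complex, 'n) vec. C * M * (indicator (cball 0 R) z / norm z ^ length hs))"
      by (intro integrable_mult_right integrable_inverse_norm_power len)
    show "(\<lambda>z. hess_top hs z (\<lambda>I J. \<omega> I J z)) \<in> borel_measurable lborel"
      using measurable_hess_top[OF hs m] by simp
    have "AE z in lborel. z \<noteq> (0 :: (complex, 'n) vec)" by (rule AE_lborel_singleton)
    then show "AE z in lborel. norm (hess_top hs z (\<lambda>I J. \<omega> I J z)) \<le> norm (C * M * (indicator (cball 0 R) z / norm z ^ length hs))"
    proof eventually_elim
      case (elim z)
      show ?case
      proof (cases "norm z \<le> R")
        case True
        have "norm (hess_top hs z (\<lambda>I J. \<omega> I J z)) \<le> C * M / norm z ^ length hs" by (rule C(2)[OF elim M])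
        also have "\<dots> = C * M * (indicator (cball 0 R) z / norm z ^ length hs)" using True by simp
        also have "\<dots> \<le> norm (C * M * (indicator (cball 0 R) z / norm z ^ length hs))" unfolding real_norm_def by (rule abs_ge_self)
        finally show ?thesis .
      next
        case False
        \<comment> \<open>Outside the common support the pointwise estimate is applied with the
          bound M = 0.\<close>
        then have "norm (hess_top hs z (\<lambda>I J. \<omega> I J z)) \<le> C * 0 / norm z ^ length hs" by (intro C(2)[OF elim]) (simp add: R)
        then show ?thesis by simp
      qed
    qed
  qed
qed

text \<open>The constant depends only on the radius \<open>R\<close> and not on the form: this is
  the order-zero estimate. It is finite because a pole of order \<open>length hs\<close>, less than
  the real dimension, is integrable.\<close>

lemma hess_top_integral_bound:
  fixes hs :: "(complex^'n::{finite,wellorder} \<Rightarrow> real) list"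
  assumes hs: "\<forall>h\<in>set hs. sublinear_C2 h" and len: "length hs < DIM((complex, 'n) vec)"
  shows "\<exists>C. \<forall>\<omega> M. (\<forall>I J. \<omega> I J \<in> borel_measurable borel) \<and> (\<forall>I J z. norm (\<omega> I J z) \<le> M) \<and>
    (\<forall>I J z. norm z > R \<longrightarrow> \<omega> I J z = 0) \<longrightarrow> norm (LINT z|lborel. hess_top hs z (\<lambda>I J. \<omega> I J z)) \<le> C * M"
proof -
  obtain C where C: "C \<ge> 0" "\<And>z M w. z \<noteq> 0 \<Longrightarrow> (\<And>I J. norm (w I J) \<le> M) \<Longrightarrow> norm (hess_top hs z w) \<le> C * M / norm z ^ length hs"
    using hess_top_form_bound[OF hs] by metis
  let ?g = "\<lambda>z::(complex, 'n) vec. indicator (cball 0 R) z / norm z ^ length hs"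
  have int: "integrable lborel ?g" by (rule integrable_inverse_norm_power[OF len])
  have "norm (LINT z|lborel. hess_top hs z (\<lambda>I J. \<omega> I J z)) \<le> (C * (LINT z|lborel. ?g z)) * M"
    if m: "\<And>I J. \<omega> I J \<in> borel_measurable borel" and M: "\<And>I J z. norm (\<omega> I J z) \<le> M" and R: "\<And>I J z. norm z > R \<Longrightarrow> \<omega> I J z = 0" for \<omega> M
  proof -
    have i: "integrable lborel (\<lambda>z. hess_top hs z (\<lambda>I J. \<omega> I J z))" by (rule hess_top_integrable[OF hs len m M R])
    have "norm (LINT z|lborel. hess_top hs z (\<lambda>I J. \<omega> I J z)) \<le> (LINT z|lborel. norm (hess_top hs z (\<lambda>I J. \<omega> I J z)))" by (rule integral_norm_bound)
    also have "\<dots> \<le> (LINT z|lborel. C * M * ?g z)"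
    proof (rule integral_mono_AE)
      have "AE z in lborel. z \<noteq> (0 :: (complex, 'n) vec)" by (rule AE_lborel_singleton)
      then show "AE z in lborel. norm (hess_top hs z (\<lambda>I J. \<omega> I J z)) \<le> C * M * ?g z"
      proof eventually_elim
        case (elim z)
        show ?case
        proof (cases "norm z \<le> R")
          case True
          then show ?thesis using C(2)[OF elim M] by simp
        next
          case False
          then have "norm (hess_top hs z (\<lambda>I J. \<omega> I J z)) \<le> C * 0 / norm z ^ length hs" by (intro C(2)[OF elim]) (simp add: R)
          then show ?thesis using False by simp
        qed
      qed
      show "integrable lborel (\<lambda>z. C * M * ?g z)" by (rule integrable_mult_right[OF int])
    qed (rule integrable_norm[OF i])
    also have "\<dots> = C * M * (LINT z|lborel. ?g z)" by (rule integral_mult_right_zero)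
    also have "\<dots> = (C * (LINT z|lborel. ?g z)) * M" by (simp only: mult_ac)
    finally show ?thesis .
  qed
  then show ?thesis by (intro exI[of _ "C * (LINT z|lborel. ?g z)"] allI impI, elim conjE) blast
qed

text \<open>The factor \<open>(2 \<i>)\<^bsup>length hs\<^esup>\<close> comes from \<open>dd\<^sup>c = 2 \<i> \<partial>\<partial>\<^sup>*\<close>, the others from \<open>current_one\<close>.\<close>

definition ddc_current :: "(complex^'n::{finite,wellorder} \<Rightarrow> real) list \<Rightarrow> 'n current" where
  "ddc_current hs \<omega> = (if cc_form \<omega>
      then (-1) ^ (CARD('n) * (CARD('n) - 1) div 2) * (- 2 * \<i>) ^ CARD('n) * (2 * \<i>) ^ length hs *
           (LINT z|lborel. hess_top hs z (\<lambda>I J. \<omega> I J z))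
      else 0)"

lemma ddc_current_Nil: "ddc_current [] = current_one"
  by (simp add: fun_eq_iff ddc_current_def current_one_def)

lemma cc_form_measurable: "cc_form \<omega> \<Longrightarrow> \<omega> I J \<in> borel_measurable borel"
  unfolding cc_form_iff using borel_measurable_continuous_onI by blast

lemma cc_form_add: "cc_form \<omega> \<Longrightarrow> cc_form \<eta> \<Longrightarrow> cc_form (\<lambda>I J z. \<omega> I J z + \<eta> I J z)"
  unfolding cc_form_iff
proof (intro allI conjI)
  fix I J assume a: "\<forall>I J. continuous_on UNIV (\<omega> I J) \<and> bounded {z. \<omega> I J z \<noteq> 0}" "\<forall>I J. continuous_on UNIV (\<eta> I J) \<and> bounded {z. \<eta> I J z \<noteq> 0}"
  then show "continuous_on UNIV (\<lambda>z. \<omega> I J z + \<eta> I J z)" by (intro continuous_on_add) auto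
  have "bounded ({z. \<omega> I J z \<noteq> 0} \<union> {z. \<eta> I J z \<noteq> 0})" using a by simp
  then show "bounded {z. \<omega> I J z + \<eta> I J z \<noteq> 0}" by (rule bounded_subset) auto
qed

lemma cc_form_cmult: "cc_form \<omega> \<Longrightarrow> cc_form (\<lambda>I J z. c * \<omega> I J z)"
  unfolding cc_form_iff
proof (intro allI conjI)
  fix I J assume a: "\<forall>I J. continuous_on UNIV (\<omega> I J) \<and> bounded {z. \<omega> I J z \<noteq> 0}"
  then show "continuous_on UNIV (\<lambda>z. c * \<omega> I J z)" by (intro continuous_on_mult) auto
  have "bounded {z. \<omega> I J z \<noteq> 0}" using a by blast
  then show "bounded {z. c * \<omega> I J z \<noteq> 0}" by (rule bounded_subset) auto
qed

context
  fixes hs :: "(complex^'n::{finite,wellorder} \<Rightarrow> real) list"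
  assumes hs: "\<forall>h\<in>set hs. sublinear_C2 h" and len: "length hs < DIM((complex, 'n) vec)"
begin

lemma cc_form_hess_top_integrable:
  assumes "cc_form \<omega>" shows "integrable lborel (\<lambda>z. hess_top hs z (\<lambda>I J. \<omega> I J z))"
proof -
  obtain M where M: "\<And>I J z. norm (\<omega> I J z) \<le> M" using cc_form_bounds[OF assms] by metis
  obtain R where R: "\<And>I J z. norm z > R \<Longrightarrow> \<omega> I J z = 0"
    using bounded_supports[of \<omega>] assms unfolding cc_form_iff by blast
  show ?thesis by (rule hess_top_integrable[OF hs len cc_form_measurable[OF assms] M R])
qed

lemma ddc_current_add:
  assumes "cc_form \<omega>" "cc_form \<eta>"
  shows "ddc_current hs (\<lambda>I J z. \<omega> I J z + \<eta> I J z) = ddc_current hs \<omega> + ddc_current hs \<eta>"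
  using assms cc_form_add[OF assms]
  by (simp add: ddc_current_def hess_top_linear cc_form_hess_top_integrable distrib_left)

lemma ddc_current_cmult:
  assumes "cc_form \<omega>"
  shows "ddc_current hs (\<lambda>I J z. c * \<omega> I J z) = c * ddc_current hs \<omega>"
  using assms cc_form_cmult[OF assms] by (simp add: ddc_current_def hess_top_linear)

lemma order0_ddc_current: "order0_current (ddc_current hs)"
  unfolding order0_current_def
proof (intro conjI allI impI)
  fix K :: "(complex, 'n) vec set" assume "compact K"
  from compact_imp_bounded[OF this] obtain R where R: "\<forall>z\<in>K. norm z \<le> R" unfolding bounded_iff by blast
  from hess_top_integral_bound[OF hs len, of R] obtain C where
    C: "\<forall>\<omega> M. (\<forall>I J. \<omega> I J \<in> borel_measurable borel) \<and> (\<forall>I J z. norm (\<omega> I J z) \<le> M) \<and>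
    (\<forall>I J z. norm z > R \<longrightarrow> \<omega> I J z = 0) \<longrightarrow> norm (LINT z|lborel. hess_top hs z (\<lambda>I J. \<omega> I J z)) \<le> C * M" ..
  define c where "c = (-1) ^ (CARD('n) * (CARD('n) - 1) div 2) * (- 2 * \<i>) ^ CARD('n) * (2 * \<i>) ^ length hs"
  show "\<exists>C. \<forall>\<omega> M. cc_form \<omega> \<and> (\<forall>I J z. norm (\<omega> I J z) \<le> M) \<and> (\<forall>I J z. z \<notin> K \<longrightarrow> \<omega> I J z = 0) \<longrightarrow>
      norm (ddc_current hs \<omega>) \<le> C * M"
  proof (intro exI[of _ "norm c * C"] allI impI, elim conjE)
    fix \<omega> :: "'n form" and M assume a: "cc_form \<omega>" "\<forall>I J z. norm (\<omega> I J z) \<le> M" "\<forall>I J z. z \<notin> K \<longrightarrow> \<omega> I J z = 0"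
    have "norm (LINT z|lborel. hess_top hs z (\<lambda>I J. \<omega> I J z)) \<le> C * M"
    proof (rule C[rule_format], intro conjI allI impI)
      show "\<omega> I J z = 0" if "norm z > R" for I J z
      proof -
        have "z \<notin> K" using that bspec[OF R, of z] by (metis not_le)
        then show ?thesis by (rule a(3)[THEN spec, THEN spec, THEN spec, THEN mp])
      qed
    qed (use a(2) cc_form_measurable[OF a(1)] in auto)
    then have "norm c * norm (LINT z|lborel. hess_top hs z (\<lambda>I J. \<omega> I J z)) \<le> norm c * (C * M)"
      by (rule mult_left_mono) simp
    moreover have "norm (ddc_current hs \<omega>) = norm c * norm (LINT z|lborel. hess_top hs z (\<lambda>I J. \<omega> I J z))"
      using a(1) by (simp only: ddc_current_def c_def[symmetric] norm_mult if_True)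
    ultimately show "norm (ddc_current hs \<omega>) \<le> norm c * C * M" by (simp add: mult.assoc)
  qed
qed (auto simp: ddc_current_add ddc_current_cmult, simp add: ddc_current_def)

end

section \<open>Continuity and uniqueness of currents of order zero\<close>

lemma order0_current_zero: "order0_current T \<Longrightarrow> \<not> cc_form \<omega> \<Longrightarrow> T \<omega> = 0"
  unfolding order0_current_def by (elim conjE) (erule allE, erule mp)

lemma order0_current_add:
  "order0_current T \<Longrightarrow> cc_form \<omega> \<Longrightarrow> cc_form \<eta> \<Longrightarrow> T (\<lambda>I J z. \<omega> I J z + \<eta> I J z) = T \<omega> + T \<eta>"
  unfolding order0_current_def by (elim conjE) (erule allE[of _ \<omega>], erule allE[of _ \<eta>], erule mp, rule conjI)

lemma order0_current_cmult:
  "order0_current T \<Longrightarrow> cc_form \<omega> \<Longrightarrow> T (\<lambda>I J z. c * \<omega> I J z) = c * T \<omega>"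
  unfolding order0_current_def by (elim conjE) (erule allE[of _ c], erule allE[of _ \<omega>], erule mp)

lemma order0_current_bound:
  "order0_current T \<Longrightarrow> compact K \<Longrightarrow> \<exists>C. \<forall>\<omega> M. cc_form \<omega> \<and> (\<forall>I J z. norm (\<omega> I J z) \<le> M) \<and>
        (\<forall>I J z. z \<notin> K \<longrightarrow> \<omega> I J z = 0) \<longrightarrow> norm (T \<omega>) \<le> C * M"
  unfolding order0_current_def by (elim conjE) (erule allE[of _ K], erule mp)

text \<open>All forms are supported in one ball, so a single constant of the order-zero estimate
  controls the values on the differences.\<close>

lemma order0_current_uniform_limit:
  fixes S :: "'n::finite current"
  assumes S: "order0_current S" and cc: "\<And>n. cc_form (\<omega>s n)" "cc_form \<omega>"
    and R: "\<And>n I J z. norm z > R \<Longrightarrow> \<omega>s n I J z = 0" "\<And>I J z. norm z > R \<Longrightarrow> \<omega> I J z = 0"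
    and lim: "\<And>I J. uniform_limit UNIV (\<lambda>n. \<omega>s n I J) (\<omega> I J) sequentially"
  shows "(\<lambda>n. S (\<omega>s n)) \<longlonglongrightarrow> S \<omega>"
proof -
  from order0_current_bound[OF S compact_cball[of 0 R]] obtain C where
    C: "\<forall>\<omega> M. cc_form \<omega> \<and> (\<forall>I J z. norm (\<omega> I J z) \<le> M) \<and> (\<forall>I J z. z \<notin> cball 0 R \<longrightarrow> \<omega> I J z = 0) \<longrightarrow> norm (S \<omega>) \<le> C * M" ..
  define \<delta> where "\<delta> n = (\<lambda>I J z. \<omega>s n I J z + (- 1) * \<omega> I J z)" for n
  have S\<delta>: "S (\<delta> n) = S (\<omega>s n) - S \<omega>" for n
  proof -
    have "S (\<delta> n) = S (\<omega>s n) + S (\<lambda>I J z. (- 1) * \<omega> I J z)"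
      unfolding \<delta>_def by (rule order0_current_add[OF S cc(1) cc_form_cmult[OF cc(2)]])
    moreover have "S (\<lambda>I J z. (- 1) * \<omega> I J z) = (- 1) * S \<omega>" by (rule order0_current_cmult[OF S cc(2)])
    ultimately show ?thesis by simp
  qed
  show ?thesis
  proof (rule LIMSEQ_I)
    fix e :: real assume e: "e > 0"
    \<comment> \<open>\<open>C\<close> comes without a sign; \<bar>C\<bar> + 1 dominates it and is
      positive.\<close>
    define d where "d = e / (2 * (\<bar>C\<bar> + 1))"
    have d: "d > 0" using e by (simp add: d_def add_nonneg_pos)
    have "\<forall>\<^sub>F n in sequentially. \<forall>I. \<forall>J. \<forall>z\<in>UNIV. dist (\<omega>s n I J z) (\<omega> I J z) < d"
      using lim d by (intro eventually_all_finite) (simp add: uniform_limit_iff)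
    then obtain N where N: "\<And>n I J z. n \<ge> N \<Longrightarrow> dist (\<omega>s n I J z) (\<omega> I J z) < d" unfolding eventually_sequentially by blast
    have "norm (S (\<omega>s n) - S \<omega>) < e" if "n \<ge> N" for n
    proof -
      have "norm (S (\<delta> n)) \<le> C * d"
      proof (rule C[rule_format], intro conjI allI impI)
        show "cc_form (\<delta> n)" unfolding \<delta>_def by (intro cc_form_add cc_form_cmult cc)
        show "norm (\<delta> n I J z) \<le> d" for I J z using N[OF that, of I J z] by (simp add: \<delta>_def dist_norm less_imp_le)
        show "\<delta> n I J z = 0" if "z \<notin> cball 0 R" for I J z using that R by (simp add: \<delta>_def)
      qed
      also have "C * d \<le> (\<bar>C\<bar> + 1) * d" using d by (intro mult_right_mono) auto
      also have "\<dots> = e / 2"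
      proof -
        have "a > 0 \<Longrightarrow> a * (e / (2 * a)) = e / 2" for a :: real by simp
        from this[of "\<bar>C\<bar> + 1"] show ?thesis by (simp only: d_def)
      qed
      finally show ?thesis using e S\<delta> by simp
    qed
    then show "\<exists>N. \<forall>n\<ge>N. norm (S (\<omega>s n) - S \<omega>) < e" by blast
  qed
qed

abbreviation mollify_form :: "nat \<Rightarrow> 'n::finite form \<Rightarrow> 'n form" where
  "mollify_form n \<omega> \<equiv> \<lambda>I J. mollify n (\<omega> I J)"

lemma test_form_mollify:
  assumes "cc_form \<omega>" shows "test_form (mollify_form n \<omega>)"
  using assms unfolding cc_form_iff test_form_iff
  by (intro allI conjI C_on_conv bounded_support_mollify mollifier(1)) auto

lemma mollify_support:
  assumes "\<And>y. norm y > R \<Longrightarrow> f y = 0" "norm z > R + 1"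
  shows "mollify n f z = 0"
proof (rule mollify_eq_0)
  fix y assume "dist z y < 1 / real (Suc n)"
  moreover have "1 / real (Suc n) \<le> 1" by simp
  ultimately have "norm (z - y) < 1" unfolding dist_norm by linarith
  then have "norm y > R" using assms(2) norm_triangle_ineq2[of z y] by linarith
  then show "f y = 0" by (rule assms(1))
qed

lemma order0_current_mollify_limit:
  fixes S :: "'n::finite current"
  assumes S: "order0_current S" and \<omega>: "cc_form \<omega>"
  shows "(\<lambda>n. S (mollify_form n \<omega>)) \<longlonglongrightarrow> S \<omega>"
proof -
  obtain R where R: "\<And>I J z. norm z > R \<Longrightarrow> \<omega> I J z = 0"
    using bounded_supports[of \<omega>] \<omega> unfolding cc_form_iff by blast
  show ?thesis
  proof (rule order0_current_uniform_limit[OF S _ \<omega>, where R = "R + 1"])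
    show "cc_form (mollify_form n \<omega>)" for n by (rule test_form_imp_cc_form[OF test_form_mollify[OF \<omega>]])
    show "mollify n (\<omega> I J) z = 0" if "norm z > R + 1" for n I J z by (rule mollify_support[OF R that])
    show "\<omega> I J z = 0" if "norm z > R + 1" for I J z using R[of z] that by simp
    show "uniform_limit UNIV (\<lambda>n. mollify n (\<omega> I J)) (\<omega> I J) sequentially" for I J
      using \<omega> unfolding cc_form_iff by (intro mollify_uniform_limit) auto
  qed
qed

text \<open>The mollified forms are test forms that converge uniformly with supports in a common
  ball. This is the uniqueness part of the definite description in \<open>ddc_wedge\<close>.\<close>

lemma order0_current_unique:
  fixes S T :: "'n::finite current"
  assumes "order0_current S" "order0_current T" "\<And>\<phi>. test_form \<phi> \<Longrightarrow> S \<phi> = T \<phi>"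
  shows "S = T"
proof
  fix \<omega>
  show "S \<omega> = T \<omega>"
  proof (cases "cc_form \<omega>")
    case True
    have "(\<lambda>n. S (mollify_form n \<omega>)) \<longlonglongrightarrow> S \<omega>" by (rule order0_current_mollify_limit[OF assms(1) True])
    moreover have "(\<lambda>n. S (mollify_form n \<omega>)) \<longlonglongrightarrow> T \<omega>"
      using order0_current_mollify_limit[OF assms(2) True] assms(3)[OF test_form_mollify[OF True]] by simp
    ultimately show ?thesis by (rule LIMSEQ_unique)
  next
    case False
    then show ?thesis using order0_current_zero[OF assms(1)] order0_current_zero[OF assms(2)] by simp
  qed
qed

section \<open>Closedness of the current\<close>

lemma bounded_support_sum:
  fixes f :: "'i::finite \<Rightarrow> 'a::metric_space \<Rightarrow> 'b::comm_monoid_add"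
  assumes "\<And>i. bounded {z. f i z \<noteq> 0}"
  shows "bounded {z. (\<Sum>i\<in>UNIV. f i z) \<noteq> 0}"
proof (rule bounded_subset)
  show "bounded (\<Union>i. {z. f i z \<noteq> 0})" using assms by (intro bounded_UN) auto
  show "{z. (\<Sum>i\<in>UNIV. f i z) \<noteq> 0} \<subseteq> (\<Union>i. {z. f i z \<noteq> 0})"
  proof
    fix z assume "z \<in> {z. (\<Sum>i\<in>UNIV. f i z) \<noteq> 0}"
    then have "(\<Sum>i\<in>UNIV. f i z) \<noteq> 0" by simp
    then obtain i where "f i z \<noteq> 0" by (rule sum.not_neutral_contains_not_neutral)
    then show "z \<in> (\<Union>i. {z. f i z \<noteq> 0})" by blast
  qed
qed

lemma bounded_support_mult:
  fixes f g :: "'a::metric_space \<Rightarrow> 'b::mult_zero"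
  assumes "bounded {z. g z \<noteq> 0}"
  shows "bounded {z. f z * g z \<noteq> 0}"
  by (rule bounded_subset[OF assms]) auto

lemma conv_add:
  fixes f g :: "'a::euclidean_space \<Rightarrow> complex"
  assumes "continuous_on UNIV f" "bounded {x. f x \<noteq> 0}" "continuous_on UNIV g" "bounded {x. g x \<noteq> 0}" "continuous_on UNIV \<rho>"
  shows "conv \<rho> (\<lambda>x. f x + g x) x = conv \<rho> f x + conv \<rho> g x"
  unfolding conv_def using conv_integrable[OF assms(1,2,5)] conv_integrable[OF assms(3,4,5)]
  by (simp add: scaleR_add_right)

lemma conv_cmult:
  fixes f :: "'a::euclidean_space \<Rightarrow> complex"
  shows "conv \<rho> (\<lambda>x. c * f x) x = c * conv \<rho> f x"
  unfolding conv_def by (simp flip: mult_scaleR_right)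

lemma conv_sum:
  fixes f :: "'i \<Rightarrow> 'a::euclidean_space \<Rightarrow> complex"
  assumes "\<And>i. continuous_on UNIV (f i)" "\<And>i. bounded {x. f i x \<noteq> 0}" "continuous_on UNIV \<rho>"
  shows "conv \<rho> (\<lambda>x. \<Sum>i\<in>S. f i x) x = (\<Sum>i\<in>S. conv \<rho> (f i) x)"
  unfolding conv_def using conv_integrable[OF assms(1,2,3)] by (simp add: scaleR_sum_right)

lemma continuous_on_mollifier: "continuous_on UNIV (mollifier n :: 'a::euclidean_space \<Rightarrow> real)"
  using mollifier(1)[of 0] by simp

lemma mollify_wirt:
  assumes f: "C_on 1 UNIV f" "bounded {x. f x \<noteq> 0}"
  shows "wirt c j (mollify n f) z = mollify n (wirt c j f) z"
proof -
  have cont: "continuous_on UNIV (dirder v f)" for v using f by simp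
  have bdd: "bounded {x. dirder v f x \<noteq> 0}" for v by (rule bounded_support_dirder[OF f(2)])
  have c1: "continuous_on UNIV (\<lambda>z. a * dirder v f z)" for a v
    using cont by (intro continuous_on_mult continuous_on_const)
  have b1: "bounded {z. a * dirder v f z \<noteq> 0}" for a v by (rule bounded_subset[OF bdd[of v]]) auto
  have "wirt c j f = (\<lambda>z. (1/2) * dirder (axis j 1) f z + (c/2) * dirder (axis j \<i>) f z)"
    by (simp add: fun_eq_iff wirt_def field_simps)
  then have "mollify n (wirt c j f) z = mollify n (\<lambda>z. (1/2) * dirder (axis j 1) f z + (c/2) * dirder (axis j \<i>) f z) z"
    by simp
  also have "\<dots> = mollify n (\<lambda>z. (1/2) * dirder (axis j 1) f z) z + mollify n (\<lambda>z. (c/2) * dirder (axis j \<i>) f z) z"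
    by (rule conv_add[OF c1 b1 c1 b1 continuous_on_mollifier])
  also have "\<dots> = wirt c j (mollify n f) z"
    unfolding conv_cmult wirt_def mollify_dirder[OF f] by (simp add: field_simps)
  finally show ?thesis by simp
qed

lemma mollify_dform:
  assumes E: "\<And>j. monomial_op (E j)" and \<psi>: "\<And>I J. C_on 1 UNIV (\<psi> I J)" "\<And>I J. bounded {z. \<psi> I J z \<noteq> 0}"
  shows "dform E c (mollify_form n \<psi>) I J = mollify n (dform E c \<psi> I J)"
proof
  fix z
  have cont: "continuous_on UNIV (wirt c j (\<psi> I J))" for j I J
    using C_on_wirt[OF open_UNIV, of 0 "\<psi> I J" c j] \<psi> by simp
  have bdd: "bounded {z. wirt c j (\<psi> I J) z \<noteq> 0}" for j I J by (rule bounded_support_wirt[OF \<psi>(2)])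
  have "mollify n (dform E c \<psi> I J) z = (\<Sum>j\<in>UNIV. mollify n (\<lambda>z. E j (\<lambda>I J. wirt c j (\<psi> I J) z) I J) z)"
    unfolding dform_def[abs_def]
  proof (rule conv_sum[OF _ _ continuous_on_mollifier])
    show "continuous_on UNIV (\<lambda>z. E j (\<lambda>I J. wirt c j (\<psi> I J) z) I J)" for j
      using monomial_op_C_on[where k=0 and E="E j" and S=UNIV, OF E open_UNIV, of "\<lambda>I J. wirt c j (\<psi> I J)"] cont by simp
    show "bounded {z. E j (\<lambda>I J. wirt c j (\<psi> I J) z) I J \<noteq> 0}" for j
      by (rule monomial_op_bounded_support[OF E bdd])
  qed
  also have "\<dots> = (\<Sum>j\<in>UNIV. E j (\<lambda>I J. mollify n (wirt c j (\<psi> I J)) z) I J)"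
  proof (rule sum.cong[OF refl])
    fix j
    obtain a p q where Ej: "\<And>w I J. E j w I J = a I J * w (p I J) (q I J)" using monomial_opE[OF E] by metis
    show "mollify n (\<lambda>z. E j (\<lambda>I J. wirt c j (\<psi> I J) z) I J) z = E j (\<lambda>I J. mollify n (wirt c j (\<psi> I J)) z) I J"
      unfolding Ej by (rule conv_cmult)
  qed
  also have "\<dots> = dform E c (mollify_form n \<psi>) I J z"
  proof -
    have "mollify n (wirt c j (\<psi> I J)) z = wirt c j (mollify n (\<psi> I J)) z" for j I J
      by (rule mollify_wirt[OF \<psi>, symmetric])
    then show ?thesis unfolding dform_def by (simp only:)
  qed
  finally show "dform E c (mollify_form n \<psi>) I J z = mollify n (dform E c \<psi> I J) z" by simp
qed

text \<open>Forms vanishing near the origin, the only point where support functions are not smooth.\<close>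

definition tame_form :: "'n::{finite,wellorder} form \<Rightarrow> bool" where
  "tame_form \<psi> \<longleftrightarrow> (\<forall>I J. C_on 1 UNIV (\<psi> I J) \<and> bounded {z. \<psi> I J z \<noteq> 0}) \<and>
     (\<exists>\<epsilon>>0. \<forall>I J z. norm z < \<epsilon> \<longrightarrow> \<psi> I J z = 0)"

lemma C_on_Un:
  assumes "open S" "open T" "C_on k S f" "C_on k T f"
  shows "C_on k (S \<union> T) f"
  using assms(3,4) by (induction k arbitrary: f) (auto intro: continuous_on_open_Un assms(1,2))

text \<open>The punctured space and a ball around 0 are open and cover everything. This lets a form
  that vanishes near the origin be multiplied by \<open>h\<close> or its derivatives without losing
  regularity there.\<close>

lemma C_on_punctured_vanishing:
  fixes f :: "'a::euclidean_space \<Rightarrow> 'b::real_normed_vector"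
  assumes "C_on k (- {0}) f" "\<epsilon> > 0" "\<And>z. norm z < \<epsilon> \<Longrightarrow> f z = 0"
  shows "C_on k UNIV f"
proof -
  have "C_on k (ball 0 \<epsilon>) f" by (rule C_on_cong[OF open_ball _ C_on_const[of k _ 0]]) (use assms(3) in \<open>auto simp: dist_norm\<close>)
  then have "C_on k (- {0} \<union> ball 0 \<epsilon>) f" by (intro C_on_Un assms(1)) auto
  moreover have "- {0} \<union> ball 0 \<epsilon> = (UNIV :: 'a set)" using assms(2) by auto
  ultimately show ?thesis by simp
qed

lemma dform_cc_form:
  assumes E: "\<And>j. monomial_op (E j)" and \<psi>: "\<And>I J. C_on 1 UNIV (\<psi> I J)" "\<And>I J. bounded {z. \<psi> I J z \<noteq> 0}"
  shows "cc_form (dform E c \<psi>)"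
proof -
  have "C_on 0 UNIV (dform E c \<psi> I J)" for I J
    by (rule dform_C_on[OF E open_UNIV]) (use \<psi> in simp)
  moreover have "bounded {z. dform E c \<psi> I J z \<noteq> 0}" for I J by (rule dform_bounded_support[OF E \<psi>(2)])
  ultimately show ?thesis unfolding cc_form_iff by simp
qed

lemma dform_test_form:
  assumes E: "\<And>j. monomial_op (E j)" and \<psi>: "test_form \<psi>"
  shows "test_form (dform E c \<psi>)"
proof -
  have "C_on k UNIV (dform E c \<psi> I J)" for k I J
    by (rule dform_C_on[OF E open_UNIV]) (use \<psi> test_form_iff in blast)
  moreover have "bounded {z. dform E c \<psi> I J z \<noteq> 0}" for I J
    by (rule dform_bounded_support[OF E]) (use \<psi> test_form_iff in blast)
  ultimately show ?thesis unfolding test_form_iff by simp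
qed

lemma dform_vanish:
  assumes E: "\<And>j. monomial_op (E j)" and "\<And>I J z. norm z < \<epsilon> \<Longrightarrow> \<psi> I J z = 0" "norm z < \<epsilon>"
  shows "dform E c \<psi> I J z = 0"
  by (rule dform_eq_0[OF E open_ball, of _ 0 \<epsilon>]) (use assms(2,3) in auto)

lemma dform_zero: "(\<And>j. monomial_op (E j)) \<Longrightarrow> dform E c (\<lambda>I J z. 0) I J z = 0"
  by (rule dform_eq_0[OF _ open_UNIV]) auto

lemma ext_d_ext_dc_test:
  assumes "test_form \<phi>"
  shows "ext_d (ext_dc \<phi>) = (\<lambda>I J z. 2 * \<i> * del (delbar \<phi>) I J z)"
  by (intro ext ext_d_ext_dc[OF open_UNIV]) (use assms test_form_iff in auto)

text \<open>Closedness is tested on forms vanishing near the origin that are only C^1: the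
  primitives dbar h \<and> \<phi> to which it is applied contain first derivatives of a C^2
  function.\<close>

definition current_closed :: "'n::{finite,wellorder} current \<Rightarrow> bool" where
  "current_closed T \<longleftrightarrow> (\<forall>\<psi>. tame_form \<psi> \<longrightarrow> T (del \<psi>) = 0 \<and> T (delbar \<psi>) = 0)"

lemma integral_wirt_eq_0:
  fixes f :: "complex^'n \<Rightarrow> complex"
  assumes "C_on 1 UNIV f" "bounded {z. f z \<noteq> 0}"
  shows "integrable lborel (wirt c j f)" "(LINT z|lborel. wirt c j f z) = 0"
proof -
  have i: "integrable lborel (dirder v f)" for v
    by (rule integrable_continuous_bounded_support[OF _ bounded_support_dirder[OF assms(2)]]) (use assms in simp)
  show "integrable lborel (wirt c j f)" unfolding wirt_def[abs_def] using i by simp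
  show "(LINT z|lborel. wirt c j f z) = 0" unfolding wirt_def using i integral_dirder_eq_0[OF assms] by simp
qed

text \<open>The top coefficient of \<partial>\<psi> or dbar \<psi> is a sum of constants times first
  derivatives of compactly supported functions, each of integral 0.\<close>

lemma current_closed_Nil: "current_closed (ddc_current [] :: 'n::{finite,wellorder} current)"
proof -
  have 0: "ddc_current [] (dform E c \<psi>) = 0" if "tame_form \<psi>" and E: "\<And>j. monomial_op (E j)" for E c and \<psi> :: "'n form"
  proof -
    have \<psi>: "\<And>I J. C_on 1 UNIV (\<psi> I J)" "\<And>I J. bounded {z. \<psi> I J z \<noteq> 0}" using that by (auto simp: tame_form_def)
    have "(LINT z|lborel. dform E c \<psi> UNIV UNIV z) = (\<Sum>j\<in>UNIV. LINT z|lborel. E j (\<lambda>I J. wirt c j (\<psi> I J) z) UNIV UNIV)"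
      unfolding dform_def
    proof (rule Bochner_Integration.integral_sum)
      fix j
      obtain a p q where Ej: "\<And>w I J. E j w I J = a I J * w (p I J) (q I J)" using monomial_opE[OF E] by metis
      show "integrable lborel (\<lambda>z. E j (\<lambda>I J. wirt c j (\<psi> I J) z) UNIV UNIV)"
        unfolding Ej by (intro integrable_mult_right integral_wirt_eq_0(1) \<psi>)
    qed
    also have "\<dots> = 0"
    proof (rule sum.neutral, rule ballI)
      fix j
      obtain a p q where Ej: "\<And>w I J. E j w I J = a I J * w (p I J) (q I J)" using monomial_opE[OF E] by metis
      show "(LINT z|lborel. E j (\<lambda>I J. wirt c j (\<psi> I J) z) UNIV UNIV) = 0"
        unfolding Ej integral_mult_right_zero integral_wirt_eq_0(2)[OF \<psi>] by simp
    qed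
    finally show ?thesis by (simp add: ddc_current_def)
  qed
  show ?thesis unfolding current_closed_def del_eq_dform delbar_eq_dform
    using 0 monomial_op_wedge_dz monomial_op_wedge_dzbar by blast
qed

lemma wedge_mat_vanish: "(\<And>I J. w I J = 0) \<Longrightarrow> wedge_mat M w I J = 0"
proof -
  assume "\<And>I J. w I J = 0"
  then have "wedge_pair p w I J = 0" for p by (rule monomial_op_zero[OF monomial_op_wedge_pair])
  then show ?thesis by (simp add: wedge_mat_def)
qed

lemma tame_form_dbar_wedge:
  assumes h: "sublinear_C2 h" and \<omega>: "\<And>I J. C_on 1 UNIV (\<omega> I J)" "\<And>I J. bounded {z. \<omega> I J z \<noteq> 0}"
    and \<epsilon>: "\<epsilon> > 0" "\<And>I J z. norm z < \<epsilon> \<Longrightarrow> \<omega> I J z = 0"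
  shows "tame_form (dbar_wedge h \<omega>)"
proof -
  have 0: "dbar_wedge h \<omega> I J z = 0" if "norm z < \<epsilon>" for I J z
    unfolding dbar_wedge_def using that by (intro sum.neutral ballI) (simp add: monomial_op_zero[OF monomial_op_wedge_dzbar] \<epsilon>)
  have C: "C_on 1 (- {0}) (\<omega> I J)" for I J by (rule C_on_subset[OF \<omega>(1)]) simp
  show ?thesis unfolding tame_form_def
  proof (intro conjI allI exI[of _ \<epsilon>] \<epsilon>(1) impI 0)
    fix I J
    have "C_on 1 (- {0}) (\<lambda>z. wedge_dzbar k (\<lambda>I J. \<omega> I J z) I J)" for k
      by (rule monomial_op_C_on[OF monomial_op_wedge_dzbar open_punctured C])
    then have "C_on 1 (- {0}) (dbar_wedge h \<omega> I J)"
      unfolding dbar_wedge_def[abs_def]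
      by (intro C_on_sum C_on_mult sublinear_C_on_wirt[OF h] open_punctured)
    then show "C_on 1 UNIV (dbar_wedge h \<omega> I J)" by (rule C_on_punctured_vanishing[OF _ \<epsilon>(1) 0])
    show "bounded {z. dbar_wedge h \<omega> I J z \<noteq> 0}"
      unfolding dbar_wedge_def
      by (intro bounded_support_sum bounded_support_mult monomial_op_bounded_support[OF monomial_op_wedge_dzbar \<omega>(2)])
  qed
qed

context
  fixes h :: "complex^'n::{finite,wellorder} \<Rightarrow> real" and hs :: "(complex^'n::_ \<Rightarrow> real) list"
  assumes h: "sublinear_C2 h" and hs: "\<forall>h\<in>set hs. sublinear_C2 h"
    and len: "Suc (length hs) < DIM((complex, 'n) vec)"
begin

text \<open>Where \<open>h\<close> is C^2, dd^c can be moved from \<phi> to \<open>h\<close> by the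
  product rule. The two error terms are \<partial> and dbar of forms vanishing near the origin, on
  which the closed current is 0.\<close>

lemma ddc_current_Cons_away:
  assumes closed: "current_closed (ddc_current hs)" and \<phi>: "test_form \<phi>"
    and \<epsilon>: "\<epsilon> > 0" "\<And>I J z. norm z < \<epsilon> \<Longrightarrow> \<phi> I J z = 0"
  shows "ddc_current hs (fun_times_form h (ext_d (ext_dc \<phi>))) = ddc_current (h # hs) \<phi>"
proof -
  let ?h = "\<lambda>w. complex_of_real (h w)"
  have len': "length hs < DIM((complex, 'n) vec)" using len by simp
  have C\<phi>: "C_on k UNIV (\<phi> I J)" and B\<phi>: "bounded {z. \<phi> I J z \<noteq> 0}" for k I J using \<phi> test_form_iff by blast+
  have C\<phi>': "C_on k (- {0}) (\<phi> I J)" for k I J by (rule C_on_subset[OF C\<phi>]) simp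
  have C1h: "C_on 1 (- {0}) ?h" using C_on_le[OF sublinear_C_on'[OF h], of 1] by simp
  define \<alpha> where "\<alpha> = dbar_wedge h \<phi>"
  define \<beta> where "\<beta> = fun_times_form h (del \<phi>)"
  have \<alpha>0: "\<alpha> I J z = 0" if "norm z < \<epsilon>" for I J z
    unfolding \<alpha>_def dbar_wedge_def using that by (intro sum.neutral ballI) (simp add: monomial_op_zero[OF monomial_op_wedge_dzbar] \<epsilon>)
  have \<beta>0: "\<beta> I J z = 0" if "norm z < \<epsilon>" for I J z
    unfolding \<beta>_def fun_times_form_def del_eq_dform using dform_vanish[where E = wedge_dz, OF monomial_op_wedge_dz \<epsilon>(2) that] by simp
  have "tame_form \<alpha>"
    unfolding \<alpha>_def by (rule tame_form_dbar_wedge[OF h C\<phi> B\<phi> \<epsilon>])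
  then have T\<alpha>: "ddc_current hs (del \<alpha>) = 0" and cc\<alpha>: "cc_form (del \<alpha>)"
    using closed dform_cc_form[where E = wedge_dz, OF monomial_op_wedge_dz, where \<psi> = \<alpha> and c = "- \<i>"]
    by (auto simp: current_closed_def tame_form_def del_eq_dform)
  have "tame_form \<beta>" unfolding tame_form_def
  proof (intro conjI allI exI[of _ \<epsilon>] \<epsilon>(1) impI \<beta>0)
    fix I J
    have "C_on 1 (- {0}) (del \<phi> I J)" unfolding del_eq_dform
      by (rule dform_C_on[where E = wedge_dz, OF monomial_op_wedge_dz open_punctured C\<phi>'])
    then have "C_on 1 (- {0}) (\<beta> I J)"
      unfolding \<beta>_def fun_times_form_def[abs_def] by (intro C_on_mult C1h open_punctured)
    then show "C_on 1 UNIV (\<beta> I J)" by (rule C_on_punctured_vanishing[OF _ \<epsilon>(1) \<beta>0])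
    have "bounded {z. del \<phi> I J z \<noteq> 0}" unfolding del_eq_dform by (rule dform_bounded_support[where E = wedge_dz, OF monomial_op_wedge_dz B\<phi>])
    then show "bounded {z. \<beta> I J z \<noteq> 0}" by (rule bounded_subset) (auto simp: \<beta>_def fun_times_form_def)
  qed
  then have T\<beta>: "ddc_current hs (delbar \<beta>) = 0" and cc\<beta>: "cc_form (delbar \<beta>)"
    using closed dform_cc_form[where E = wedge_dzbar, OF monomial_op_wedge_dzbar, where \<psi> = \<beta> and c = \<i>]
    by (auto simp: current_closed_def tame_form_def delbar_eq_dform)
  \<comment> \<open>The main term dd^c h \<and> \<phi>, its factor 2i coming from dd^c = 2i
    \<partial> dbar.\<close>
  define \<omega>1 where "\<omega>1 = (\<lambda>I J z. 2 * \<i> * wedge_mat (\<lambda>j k. HessC h z $ j $ k) (\<lambda>I J. \<phi> I J z) I J)"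
  have \<omega>10: "\<omega>1 I J z = 0" if "norm z < \<epsilon>" for I J z
    using wedge_mat_vanish[of "\<lambda>I J. \<phi> I J z"] \<epsilon>(2)[OF that] by (simp add: \<omega>1_def)
  have cc\<omega>1: "cc_form \<omega>1" unfolding cc_form_iff
  proof (intro allI conjI)
    fix I J
    have cw: "continuous_on (- {0}) (\<lambda>z. wedge_pair p (\<lambda>I J. \<phi> I J z) I J)" for p
    proof -
      have "C_on 0 (- {0}) (\<lambda>z. wedge_pair p (\<lambda>I J. \<phi> I J z) I J)"
        by (rule monomial_op_C_on[OF monomial_op_wedge_pair open_punctured C\<phi>'])
      then show ?thesis by simp
    qed
    have "continuous_on (- {0}) (\<omega>1 I J)"
      unfolding \<omega>1_def wedge_mat_def
      by (intro continuous_on_mult continuous_on_sum continuous_on_const continuous_on_HessC[OF h] cw)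
    then show "continuous_on UNIV (\<omega>1 I J)" using C_on_punctured_vanishing[of 0, OF _ \<epsilon>(1) \<omega>10] by simp
    show "bounded {z. \<omega>1 I J z \<noteq> 0}"
      unfolding \<omega>1_def wedge_mat_expand
      by (intro bounded_support_sum bounded_support_mult monomial_op_bounded_support[OF monomial_op_wedge_pair B\<phi>])
  qed
  \<comment> \<open>Off the origin this is the product-rule identity. At the origin, where
    \<open>h\<close> has no derivatives to speak of, every term vanishes together with
    \<phi>.\<close>
  have decomp: "fun_times_form h (ext_d (ext_dc \<phi>)) = (\<lambda>I J z. \<omega>1 I J z + ((- 2 * \<i>) * del \<alpha> I J z + (- 2 * \<i>) * delbar \<beta> I J z))"
  proof (intro ext)
    fix I J z
    have e: "fun_times_form h (ext_d (ext_dc \<phi>)) I J z = 2 * \<i> * (?h z * del (delbar \<phi>) I J z)"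
      by (simp add: fun_times_form_def ext_d_ext_dc_test[OF \<phi>])
    show "fun_times_form h (ext_d (ext_dc \<phi>)) I J z = \<omega>1 I J z + ((- 2 * \<i>) * del \<alpha> I J z + (- 2 * \<i>) * delbar \<beta> I J z)"
    proof (cases "z = 0")
      case False
      have "?h z * del (delbar \<phi>) I J z - wedge_mat (\<lambda>j k. HessC h z $ j $ k) (\<lambda>I J. \<phi> I J z) I J = - (del \<alpha> I J z + delbar \<beta> I J z)"
        unfolding \<alpha>_def \<beta>_def by (rule del_dbar_wedge_identity[OF open_punctured _ sublinear_C_on'[OF h] C\<phi>']) (use False in simp)
      then have eq: "?h z * del (delbar \<phi>) I J z = wedge_mat (\<lambda>j k. HessC h z $ j $ k) (\<lambda>I J. \<phi> I J z) I J - (del \<alpha> I J z + delbar \<beta> I J z)"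
        by (simp add: diff_eq_eq)
      show ?thesis unfolding e eq \<omega>1_def by (simp add: algebra_simps)
    next
      case True
      then have z: "norm z < \<epsilon>" using \<epsilon> by simp
      have "delbar \<phi> I J z = 0" if "norm z < \<epsilon>" for I J z
        unfolding delbar_eq_dform by (rule dform_vanish[where E = wedge_dzbar, OF monomial_op_wedge_dzbar \<epsilon>(2) that])
      then have "del (delbar \<phi>) I J z = 0"
        unfolding del_eq_dform by (rule dform_vanish[where E = wedge_dz, OF monomial_op_wedge_dz _ z])
      moreover have "del \<alpha> I J z = 0" unfolding del_eq_dform by (rule dform_vanish[where E = wedge_dz, OF monomial_op_wedge_dz \<alpha>0 z])
      moreover have "delbar \<beta> I J z = 0" unfolding delbar_eq_dform by (rule dform_vanish[where E = wedge_dzbar, OF monomial_op_wedge_dzbar \<beta>0 z])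
      ultimately show ?thesis unfolding e using \<omega>10[OF z] by simp
    qed
  qed
  have "ddc_current hs (fun_times_form h (ext_d (ext_dc \<phi>))) = ddc_current hs \<omega>1"
  proof -
    note add = ddc_current_add[OF hs len'] and cmult = ddc_current_cmult[OF hs len']
    have cc1: "cc_form (\<lambda>I J z. (- 2 * \<i>) * del \<alpha> I J z)" and cc2: "cc_form (\<lambda>I J z. (- 2 * \<i>) * delbar \<beta> I J z)"
      by (rule cc_form_cmult[OF cc\<alpha>], rule cc_form_cmult[OF cc\<beta>])
    show ?thesis
      unfolding decomp add[OF cc\<omega>1 cc_form_add[OF cc1 cc2]] add[OF cc1 cc2] cmult[OF cc\<alpha>] cmult[OF cc\<beta>] T\<alpha> T\<beta>
      by simp
  qed
  also have "\<dots> = ddc_current (h # hs) \<phi>"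
    unfolding ddc_current_def using cc\<omega>1 test_form_imp_cc_form[OF \<phi>]
    by (simp add: \<omega>1_def hess_top_linear hess_top_Cons)
  finally show ?thesis .
qed

text \<open>For smooth \<open>\<psi>\<close> the claim reduces to \<open>\<partial>\<partial>\<^sup>* \<partial>\<psi> = 0 = \<partial>\<partial>\<^sup>* \<partial>\<^sup>*\<psi>\<close> by \<open>ddc_current_Cons_away\<close>;
  the general case follows by mollification.\<close>

lemma current_closed_Cons:
  assumes closed: "current_closed (ddc_current hs)"
  shows "current_closed (ddc_current (h # hs))"
proof -
  have S: "order0_current (ddc_current (h # hs))" by (rule order0_ddc_current) (use h hs len in auto)
  have main: "ddc_current (h # hs) (dform E c \<psi>) = 0"
    if E: "\<And>j. monomial_op (E j)" and tame: "tame_form \<psi>"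
      and zero: "\<And>\<eta> I J z. test_form \<eta> \<Longrightarrow> del (delbar (dform E c \<eta>)) I J z = 0" for E c \<psi>
  proof -
    have \<psi>: "\<And>I J. C_on 1 UNIV (\<psi> I J)" "\<And>I J. bounded {z. \<psi> I J z \<noteq> 0}" using that by (auto simp: tame_form_def)
    obtain \<epsilon> where \<epsilon>: "\<epsilon> > 0" "\<And>I J z. norm z < \<epsilon> \<Longrightarrow> \<psi> I J z = 0"
      using tame unfolding tame_form_def by blast
    have cc: "cc_form \<psi>" using \<psi> C_on_imp_continuous_on unfolding cc_form_iff by blast
    have cc': "cc_form (dform E c \<psi>)" by (rule dform_cc_form[OF E \<psi>])
    \<comment> \<open>Mollification spreads supports by less than \<epsilon>/2, so the mollified
      forms still vanish on the ball of radius \<epsilon>/2.\<close>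
    obtain N where N: "1 / real (Suc N) < \<epsilon> / 2" using nat_approx_posE[of "\<epsilon>/2"] \<epsilon>(1) by auto
    have "ddc_current (h # hs) (mollify_form n (dform E c \<psi>)) = 0" if n: "n \<ge> N" for n
    proof -
      let ?\<eta> = "mollify_form n \<psi>"
      have \<eta>: "test_form ?\<eta>" by (rule test_form_mollify[OF cc])
      have "1 / real (Suc n) \<le> 1 / real (Suc N)" using n by (intro divide_left_mono) auto
      then have n2: "1 / real (Suc n) < \<epsilon> / 2" using N by simp
      have \<eta>0: "?\<eta> I J z = 0" if "norm z < \<epsilon> / 2" for I J z
      proof (rule mollify_eq_0)
        fix y assume "dist z y < 1 / real (Suc n)"
        then have "norm (z - y) < \<epsilon> / 2" using n2 unfolding dist_norm by linarith
        then have "norm y < \<epsilon>" using that norm_triangle_ineq2[of y z] norm_minus_commute[of y z] by linarith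
        then show "\<psi> I J y = 0" by (rule \<epsilon>(2))
      qed
      have d\<eta>: "test_form (dform E c ?\<eta>)" by (rule dform_test_form[OF E \<eta>])
      have "mollify_form n (dform E c \<psi>) = dform E c ?\<eta>" by (intro ext) (simp add: mollify_dform[OF E \<psi>])
      then have "ddc_current (h # hs) (mollify_form n (dform E c \<psi>)) = ddc_current (h # hs) (dform E c ?\<eta>)" by simp
      also have "\<dots> = ddc_current hs (fun_times_form h (ext_d (ext_dc (dform E c ?\<eta>))))"
      proof (rule ddc_current_Cons_away[OF closed d\<eta>, symmetric])
        show "\<epsilon> / 2 > 0" using \<epsilon>(1) by simp
        show "dform E c ?\<eta> I J z = 0" if "norm z < \<epsilon> / 2" for I J z
          by (rule dform_vanish[where E = E, OF E \<eta>0 that])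
      qed
      \<comment> \<open>The zero form is written as a multiple of \<psi> so that homogeneity of the
        current evaluates it.\<close>
      also have "fun_times_form h (ext_d (ext_dc (dform E c ?\<eta>))) = (\<lambda>I J z. 0 * \<psi> I J z)"
        by (intro ext) (simp add: fun_times_form_def ext_d_ext_dc_test[OF d\<eta>] zero[OF \<eta>])
      also have "ddc_current hs (\<lambda>I J z. 0 * \<psi> I J z) = 0 * ddc_current hs \<psi>"
        by (rule ddc_current_cmult[OF hs _ cc]) (use len in simp)
      finally show ?thesis by simp
    qed
    then have "(\<lambda>n. ddc_current (h # hs) (mollify_form n (dform E c \<psi>))) \<longlonglongrightarrow> 0"
      by (intro tendsto_eventually) (auto simp: eventually_sequentially)
    moreover have "(\<lambda>n. ddc_current (h # hs) (mollify_form n (dform E c \<psi>))) \<longlonglongrightarrow> ddc_current (h # hs) (dform E c \<psi>)"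
      by (rule order0_current_mollify_limit[OF S cc'])
    ultimately show ?thesis using LIMSEQ_unique by blast
  qed
  have C: "C_on k UNIV (\<eta> I J)" if "test_form \<eta>" for \<eta> :: "'n form" and k I J using that test_form_iff by blast
  have zero1: "del (delbar (dform wedge_dz (- \<i>) \<eta>)) I J z = 0" if \<eta>: "test_form \<eta>" for \<eta> :: "'n form" and I J z
  proof -
    have t: "test_form (del \<eta>)" unfolding del_eq_dform by (rule dform_test_form[where E = wedge_dz, OF monomial_op_wedge_dz \<eta>])
    have dd: "del (del \<eta>) = (\<lambda>I J z. 0)" by (intro ext del_del[OF open_UNIV UNIV_I C[OF \<eta>]])
    have "delbar (del (del \<eta>)) I J z = - del (delbar (del \<eta>)) I J z"
      by (rule delbar_del[OF open_UNIV UNIV_I C[OF t]])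
    moreover have "delbar (del (del \<eta>)) I J z = 0" unfolding dd unfolding delbar_eq_dform by (rule dform_zero[where E = wedge_dzbar, OF monomial_op_wedge_dzbar])
    ultimately show ?thesis by (simp add: del_eq_dform[symmetric])
  qed
  have zero2: "del (delbar (dform wedge_dzbar \<i> \<eta>)) I J z = 0" if \<eta>: "test_form \<eta>" for \<eta> :: "'n form" and I J z
  proof -
    have dd: "delbar (delbar \<eta>) = (\<lambda>I J z. 0)" by (intro ext delbar_delbar[OF open_UNIV UNIV_I C[OF \<eta>]])
    show ?thesis unfolding delbar_eq_dform[symmetric] dd unfolding del_eq_dform by (rule dform_zero[where E = wedge_dz, OF monomial_op_wedge_dz])
  qed
  show ?thesis unfolding current_closed_def del_eq_dform delbar_eq_dform
    using main[where E = wedge_dz and c = "- \<i>", OF monomial_op_wedge_dz _ zero1] main[where E = wedge_dzbar and c = \<i>, OF monomial_op_wedge_dzbar _ zero2]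
    by blast
qed

end

lemma current_closed_ddc_current:
  fixes hs :: "(complex^'n::{finite,wellorder} \<Rightarrow> real) list"
  assumes "\<forall>h\<in>set hs. sublinear_C2 h" "length hs < DIM((complex, 'n) vec)"
  shows "current_closed (ddc_current hs)"
  using assms
proof (induction hs)
  case Nil
  then show ?case by (simp add: current_closed_Nil)
next
  case (Cons h hs)
  then show ?case by (intro current_closed_Cons) auto
qed

section \<open>Bedford--Taylor products of support functions\<close>

lemma norm_wedge_pair_le:
  assumes "\<And>I J. norm (w I J) \<le> M"
  shows "norm (wedge_pair p w I J) \<le> M"
proof -
  have M: "M \<ge> 0" using assms[of "{}" "{}"] norm_ge_zero order_trans by blast
  have s: "norm (insert_sign j I) = 1" for j :: 'a and I by (simp add: insert_sign_def norm_power)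
  have "norm (wedge_dzbar k w I J) \<le> M" for k I J
    using assms M by (simp add: wedge_dzbar_def norm_mult norm_power s)
  then show ?thesis using M by (simp add: wedge_pair_def wedge_dz_def norm_mult s)
qed

section \<open>Cut-off functions at the origin and their derivatives\<close>

lemma wirt_of_real_compose:
  fixes q :: "complex^'n \<Rightarrow> real"
  assumes "(F has_real_derivative F') (at (q z))" "q differentiable (at z)"
  shows "wirt c j (\<lambda>w. complex_of_real (F (q w))) z = of_real F' * wirt c j (\<lambda>w. complex_of_real (q w)) z"
proof -
  have 1: "dirder v (\<lambda>w. complex_of_real (F (q w))) z = of_real (F' * dirder v q z)" for v
  proof (rule dirder_eq)
    have "((\<lambda>w. F (q w)) has_derivative (\<lambda>v. F' * dirder v q z)) (at z)"
      using has_derivative_compose[OF has_derivative_dirder[OF assms(2)] assms(1)[unfolded has_field_derivative_def]] .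
    then show "((\<lambda>w. complex_of_real (F (q w))) has_derivative (\<lambda>v. of_real (F' * dirder v q z))) (at z)"
      by (rule bounded_linear.has_derivative[OF bounded_linear_of_real])
  qed
  have 2: "dirder v (\<lambda>w. complex_of_real (q w)) z = of_real (dirder v q z)" for v
    by (rule dirder_eq) (intro bounded_linear.has_derivative[OF bounded_linear_of_real] has_derivative_dirder assms)
  show ?thesis unfolding wirt_def 1 2 by (simp add: algebra_simps add_divide_distrib)
qed

lemma inner_axis_complex:
  fixes z :: "complex^'n"
  shows "z \<bullet> axis j 1 = Re (z $ j)" "z \<bullet> axis j \<i> = Im (z $ j)"
  by (simp_all add: inner_axis inner_complex_def)

lemma wirt_norm_sq:
  fixes z :: "complex^'n"
  shows "wirt c j (\<lambda>w. complex_of_real ((norm w)\<^sup>2)) z = of_real (Re (z $ j)) + c * of_real (Im (z $ j))"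
proof -
  have "dirder v (\<lambda>w. complex_of_real ((norm w)\<^sup>2)) z = of_real (2 * (z \<bullet> v))" for v
  proof (rule dirder_eq)
    have "((\<lambda>w. w \<bullet> w) has_derivative (\<lambda>v. 2 * (z \<bullet> v))) (at z)"
      by (auto intro!: derivative_eq_intros simp: inner_commute)
    then have "((\<lambda>w. (norm w)\<^sup>2) has_derivative (\<lambda>v. 2 * (z \<bullet> v))) (at z)" by (simp add: power2_norm_eq_inner)
    then show "((\<lambda>w. complex_of_real ((norm w)\<^sup>2)) has_derivative (\<lambda>v. of_real (2 * (z \<bullet> v)))) (at z)"
      by (rule bounded_linear.has_derivative[OF bounded_linear_of_real])
  qed
  then show ?thesis by (simp add: wirt_def inner_axis_complex)
qed

text \<open>Zero for |z| <= 1/m and exp(-1/(m^2 |z|^2 - 1)) beyond. It is less than 1 everywhere, so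
  it converges to 1 off the origin without becoming constant. As a function of m|z| its derivatives
  of order k have size |z|^-k uniformly in m; squares keep it smooth in z.\<close>

definition cutoff :: "nat \<Rightarrow> complex^'n \<Rightarrow> complex" where
  "cutoff m z = of_real (flat ((real m)\<^sup>2 * (norm z)\<^sup>2 - 1))"

lemma C_on_scaled_norm_sq: "C_on k UNIV (\<lambda>z::complex^'n. (real m)\<^sup>2 * (norm z)\<^sup>2 - 1)"
  by (intro C_on_diff C_on_cmult C_on_norm_sq C_on_const open_UNIV)

lemma C_on_cutoff: "C_on k UNIV (cutoff m)"
  unfolding cutoff_def[abs_def]
  by (intro C_on_bounded_linear_compose[OF open_UNIV bounded_linear_of_real] C_on_flat open_UNIV C_on_scaled_norm_sq)

lemma cutoff_vanish:
  assumes "m > 0" "norm z < 1 / real m" shows "cutoff m z = 0"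
proof -
  have "real m * norm z < 1" using assms by (simp add: field_simps)
  then have "(real m * norm z)\<^sup>2 \<le> 1" using assms by (intro power_le_one) auto
  then show ?thesis by (simp add: cutoff_def flat_eq power_mult_distrib)
qed

lemma norm_cutoff_le: "norm (cutoff m z) \<le> 1"
  by (auto simp: cutoff_def flat_eq)

lemma scaled_norm_at_top:
  assumes "z \<noteq> (0::'a::real_normed_vector)" shows "filterlim (\<lambda>m. (real m)\<^sup>2 * (norm z)\<^sup>2) at_top sequentially"
proof -
  have "(norm z)\<^sup>2 > 0" using assms by simp
  then show ?thesis by real_asymp
qed

lemma cutoff_tendsto:
  assumes "z \<noteq> 0" shows "(\<lambda>m. cutoff m z) \<longlonglongrightarrow> 1"
proof -
  have "((\<lambda>t::real. exp (- (1 / (t - 1)))) \<longlongrightarrow> 1) at_top" by real_asymp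
  moreover have "\<forall>\<^sub>F t in at_top. exp (- (1 / (t - 1))) = flat (t - 1)"
    using eventually_gt_at_top[of 1] by eventually_elim (simp add: flat_eq)
  ultimately have "((\<lambda>t. flat (t - 1)) \<longlongrightarrow> 1) at_top" by (rule Lim_transform_eventually)
  from filterlim_compose[OF this scaled_norm_at_top[OF assms]]
  have "(\<lambda>m. flat ((real m)\<^sup>2 * (norm z)\<^sup>2 - 1)) \<longlonglongrightarrow> 1" .
  from tendsto_of_real[OF this] show ?thesis by (simp add: cutoff_def)
qed

text \<open>The first two derivatives of \<open>flat\<close>, by
  \<open>flat_poly_deriv\<close>.\<close>

abbreviation "flat1 \<equiv> flat_poly (flat_step 1)"
abbreviation "flat2 \<equiv> flat_poly (flat_step (flat_step 1))"

lemma flat12_eq: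
  "s > 0 \<Longrightarrow> flat1 s = (1 / s)\<^sup>2 * exp (- (1 / s))"
  "s > 0 \<Longrightarrow> flat2 s = ((1 / s)^4 - 2 * (1 / s)^3) * exp (- (1 / s))"
  by (simp_all add: flat_poly_def flat_step_def pderiv_pCons one_pCons power2_eq_square field_simps eval_nat_numeral)

text \<open>With t = m^2 |z|^2, a first derivative of the cut-off is flat1(t-1) t times a quantity
  of size at most 1/|z|, and a second derivative involves flat2(t-1) t^2 and flat1(t-1) t over
  |z|^2. Boundedness in t gives bounds uniform in m, and the limit 0 at infinity gives pointwise
  convergence.\<close>

lemma flat1_tendsto: "((\<lambda>t. flat1 (t - 1) * t) \<longlongrightarrow> 0) at_top"
proof -
  have "((\<lambda>t::real. (1 / (t - 1))\<^sup>2 * exp (- (1 / (t - 1))) * t) \<longlongrightarrow> 0) at_top" by real_asymp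
  moreover have "\<forall>\<^sub>F t in at_top. (1 / (t - 1))\<^sup>2 * exp (- (1 / (t - 1))) * t = flat1 (t - 1) * t"
    using eventually_gt_at_top[of 1] by eventually_elim (simp add: flat12_eq)
  ultimately show ?thesis by (rule Lim_transform_eventually)
qed

lemma flat2_tendsto: "((\<lambda>t. flat2 (t - 1) * t\<^sup>2) \<longlongrightarrow> 0) at_top"
proof -
  have "((\<lambda>t::real. ((1 / (t - 1))^4 - 2 * (1 / (t - 1))^3) * exp (- (1 / (t - 1))) * t\<^sup>2) \<longlongrightarrow> 0) at_top" by real_asymp
  moreover have "\<forall>\<^sub>F t in at_top. ((1 / (t - 1))^4 - 2 * (1 / (t - 1))^3) * exp (- (1 / (t - 1))) * t\<^sup>2 = flat2 (t - 1) * t\<^sup>2"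
    using eventually_gt_at_top[of 1] by eventually_elim (simp add: flat12_eq)
  ultimately show ?thesis by (rule Lim_transform_eventually)
qed

lemma bounded_half_line:
  fixes f :: "real \<Rightarrow> real"
  assumes "continuous_on UNIV f" "(f \<longlongrightarrow> 0) at_top"
  shows "\<exists>C\<ge>0. \<forall>t\<ge>0. \<bar>f t\<bar> \<le> C"
proof -
  have "\<forall>\<^sub>F t in at_top. \<bar>f t\<bar> < 1" using tendstoD[OF assms(2), of 1] by simp
  then obtain T where T: "\<And>t. t \<ge> T \<Longrightarrow> \<bar>f t\<bar> < 1" unfolding eventually_at_top_linorder by blast
  have "compact (f ` {0..T})" by (intro compact_continuous_image continuous_on_subset[OF assms(1)]) auto
  from compact_imp_bounded[OF this] obtain B where B: "\<forall>x\<in>f ` {0..T}. norm x \<le> B" unfolding bounded_iff by blast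
  have "\<bar>f t\<bar> \<le> max B 1" if "t \<ge> 0" for t
    using B T[of t] that by (cases "t \<le> T") (auto simp: le_max_iff_disj)
  then show ?thesis by (intro exI[of _ "max B 1"]) auto
qed

lemma continuous_on_flat_poly: "continuous_on UNIV (\<lambda>t. flat_poly p (t - 1))"
proof -
  have "continuous_on UNIV (flat_poly p)" using flat_poly_deriv DERIV_isCont by (blast intro: continuous_at_imp_continuous_on)
  then show ?thesis by (rule continuous_on_compose2) (auto intro!: continuous_intros)
qed

lemma flat1_bound: "\<exists>C\<ge>0. \<forall>t\<ge>0. \<bar>flat1 (t - 1) * t\<bar> \<le> C"
  by (rule bounded_half_line[OF _ flat1_tendsto]) (intro continuous_on_mult continuous_on_flat_poly continuous_on_id)

lemma flat2_bound: "\<exists>C\<ge>0. \<forall>t\<ge>0. \<bar>flat2 (t - 1) * t\<^sup>2\<bar> \<le> C"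
  by (rule bounded_half_line[OF _ flat2_tendsto]) (intro continuous_on_mult continuous_on_flat_poly continuous_on_power continuous_on_id)

lemma C_on_1_differentiable: "C_on 1 UNIV f \<Longrightarrow> f differentiable (at z)"
  by simp

lemma differentiable_scaled_norm_sq: "(\<lambda>z::complex^'n. (real m)\<^sup>2 * (norm z)\<^sup>2 - 1) differentiable (at z)"
  using C_on_scaled_norm_sq[of 1] by simp

lemma wirt_scaled_norm_sq:
  fixes z :: "complex^'n"
  shows "wirt c j (\<lambda>w. complex_of_real ((real m)\<^sup>2 * (norm w)\<^sup>2 - 1)) z = (of_nat m)\<^sup>2 * (of_real (Re (z $ j)) + c * of_real (Im (z $ j)))"
proof -
  have dif: "(\<lambda>w::complex^'n. complex_of_real ((norm w)\<^sup>2)) differentiable (at z)"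
    by (rule C_on_1_differentiable[OF C_on_bounded_linear_compose[OF open_UNIV bounded_linear_of_real C_on_norm_sq]])
  have "(\<lambda>w::complex^'n. complex_of_real ((real m)\<^sup>2 * (norm w)\<^sup>2 - 1)) = (\<lambda>w. (of_nat m)\<^sup>2 * complex_of_real ((norm w)\<^sup>2) + (- 1))" by simp
  then show ?thesis
    by (simp only: wirt_add[OF differentiable_cmult[OF dif] differentiable_const] wirt_cmult[OF dif] wirt_norm_sq wirt_const) simp
qed

text \<open>The Wirtinger derivative of |z|^2: it is \<open>z $ j\<close> for c = i and its
  conjugate for c = -i.\<close>

definition wirt_coord :: "complex \<Rightarrow> 'n \<Rightarrow> complex^'n \<Rightarrow> complex" where
  "wirt_coord c j z = of_real (Re (z $ j)) + c * of_real (Im (z $ j))"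

lemma wirt_flat_poly:
  fixes z :: "complex^'n"
  shows "wirt c j (\<lambda>w. complex_of_real (flat_poly p ((real m)\<^sup>2 * (norm w)\<^sup>2 - 1))) z =
    of_real (flat_poly (flat_step p) ((real m)\<^sup>2 * (norm z)\<^sup>2 - 1)) * ((of_nat m)\<^sup>2 * wirt_coord c j z)"
  unfolding wirt_of_real_compose[OF flat_poly_deriv differentiable_scaled_norm_sq] wirt_scaled_norm_sq wirt_coord_def
  by (rule refl)

lemma wirt_cutoff:
  "wirt c j (cutoff m) z = of_real (flat1 ((real m)\<^sup>2 * (norm z)\<^sup>2 - 1)) * (of_nat m)\<^sup>2 * wirt_coord c j z"
  unfolding cutoff_def[abs_def] flat_def wirt_flat_poly by (simp only: mult.assoc)

lemma wirt_coord_has_derivative: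
  fixes z :: "complex^'n"
  shows "(wirt_coord c j has_derivative wirt_coord c j) (at z)"
proof -
  have "bounded_linear (\<lambda>z::complex^'n. of_real (Re (z $ j)) + c * of_real (Im (z $ j)))"
    by (intro bounded_linear_add bounded_linear_const_mult
      bounded_linear_compose[OF bounded_linear_of_real] bounded_linear_compose[OF bounded_linear_Re]
      bounded_linear_compose[OF bounded_linear_Im] bounded_linear_vec_nth)
  then show ?thesis unfolding wirt_coord_def[abs_def] by (rule bounded_linear_imp_has_derivative)
qed

lemma wirt_wirt_cutoff:
  "wirt d k (wirt c j (cutoff m)) z =
     of_real (flat2 ((real m)\<^sup>2 * (norm z)\<^sup>2 - 1)) * (of_nat m) ^ 4 * wirt_coord d k z * wirt_coord c j z
     + of_real (flat1 ((real m)\<^sup>2 * (norm z)\<^sup>2 - 1)) * (of_nat m)\<^sup>2 * (if j = k then (1 + c * d) / 2 else 0)"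
proof -
  let ?q = "\<lambda>z::complex^'a. (real m)\<^sup>2 * (norm z)\<^sup>2 - 1"
  \<comment> \<open>With c and d equal to i or -i, (1 + c d)/2 is 0 for two derivatives of the same
    kind and 1 for one of each kind.\<close>
  have w1: "wirt d k (wirt_coord c j) z = (if j = k then (1 + c * d) / 2 else 0)"
    unfolding wirt_def dirder_eq[OF wirt_coord_has_derivative] by (simp add: wirt_coord_def axis_def mult.commute)
  have d1: "wirt_coord c j differentiable (at z)" using wirt_coord_has_derivative differentiable_def by blast
  have d2: "(\<lambda>z. complex_of_real (flat1 (?q z))) differentiable (at z)"
    by (rule C_on_1_differentiable[OF C_on_bounded_linear_compose[OF open_UNIV bounded_linear_of_real C_on_flat_poly[OF open_UNIV C_on_scaled_norm_sq]]])
  have w2: "wirt d k (\<lambda>z. complex_of_real (flat1 (?q z))) z = of_real (flat2 (?q z)) * ((of_nat m)\<^sup>2 * wirt_coord d k z)"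
    by (rule wirt_flat_poly)
  have "wirt c j (cutoff m) = (\<lambda>z. (of_nat m)\<^sup>2 * (complex_of_real (flat1 (?q z)) * wirt_coord c j z))"
    by (simp add: fun_eq_iff wirt_cutoff mult_ac)
  then have "wirt d k (wirt c j (cutoff m)) z = (of_nat m)\<^sup>2 * (complex_of_real (flat1 (?q z)) * wirt d k (wirt_coord c j) z
      + wirt d k (\<lambda>z. complex_of_real (flat1 (?q z))) z * wirt_coord c j z)"
    by (simp only: wirt_cmult[OF differentiable_mult[OF d2 d1]] wirt_mult[OF d2 d1])
  moreover have "(of_nat m :: complex) ^ 4 = (of_nat m)\<^sup>2 * (of_nat m)\<^sup>2" by (simp flip: power_add)
  moreover have "x = M2 * (F1 * e + F2 * (M2 * u) * v) \<Longrightarrow> M4 = M2 * M2 \<Longrightarrow> x = F2 * M4 * u * v + F1 * M2 * e"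
    for x M2 M4 F1 F2 e u v :: complex by (simp add: algebra_simps)
  ultimately show ?thesis unfolding w1 w2 by blast
qed

lemma norm_wirt_coord:
  assumes "c = \<i> \<or> c = - \<i>" shows "norm (wirt_coord c j z) \<le> norm z"
proof -
  have "norm (wirt_coord c j z) = norm (z $ j)"
    using assms by (auto simp: wirt_coord_def cmod_def)
  then show ?thesis using Finite_Cartesian_Product.norm_nth_le[of z j] by simp
qed

lemma wirt_cutoff_bound:
  obtains C where "C \<ge> 0" "\<And>m c j z. c = \<i> \<or> c = - \<i> \<Longrightarrow> z \<noteq> 0 \<Longrightarrow> norm (wirt c j (cutoff m :: complex^'n \<Rightarrow> complex) z) \<le> C / norm z"
proof -
  obtain C where C: "C \<ge> 0" "\<And>t. t \<ge> 0 \<Longrightarrow> \<bar>flat1 (t - 1) * t\<bar> \<le> C" using flat1_bound by blast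
  have "norm (wirt c j (cutoff m :: complex^'n \<Rightarrow> complex) z) \<le> C / norm z" if c: "c = \<i> \<or> c = - \<i>" and z: "z \<noteq> 0" for m c j z
  proof -
    let ?t = "(real m)\<^sup>2 * (norm z)\<^sup>2"
    have "norm (wirt c j (cutoff m :: complex^'n \<Rightarrow> complex) z) = \<bar>flat1 (?t - 1)\<bar> * (real m)\<^sup>2 * norm (wirt_coord c j z)"
      unfolding wirt_cutoff norm_mult by (simp add: norm_power)
    also have "\<dots> \<le> \<bar>flat1 (?t - 1)\<bar> * (real m)\<^sup>2 * norm z"
      by (intro mult_left_mono norm_wirt_coord c) auto
    also have "\<dots> = \<bar>flat1 (?t - 1) * ?t\<bar> / norm z" using z by (simp add: abs_mult power2_eq_square)
    also have "\<dots> \<le> C / norm z" by (intro divide_right_mono C) auto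
    finally show ?thesis .
  qed
  then show ?thesis using that C(1) by blast
qed

lemma wirt_wirt_cutoff_bound:
  obtains C where "C \<ge> 0" "\<And>m c d j k z. c = \<i> \<or> c = - \<i> \<Longrightarrow> d = \<i> \<or> d = - \<i> \<Longrightarrow> z \<noteq> 0 \<Longrightarrow>
    norm (wirt d k (wirt c j (cutoff m :: complex^'n \<Rightarrow> complex)) z) \<le> C / (norm z)\<^sup>2"
proof -
  obtain C1 where C1: "C1 \<ge> 0" "\<And>t. t \<ge> 0 \<Longrightarrow> \<bar>flat1 (t - 1) * t\<bar> \<le> C1" using flat1_bound by blast
  obtain C2 where C2: "C2 \<ge> 0" "\<And>t. t \<ge> 0 \<Longrightarrow> \<bar>flat2 (t - 1) * t\<^sup>2\<bar> \<le> C2" using flat2_bound by blast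
  have "norm (wirt d k (wirt c j (cutoff m :: complex^'n \<Rightarrow> complex)) z) \<le> (C2 + C1) / (norm z)\<^sup>2"
    if c: "c = \<i> \<or> c = - \<i>" and d: "d = \<i> \<or> d = - \<i>" and z: "z \<noteq> 0" for m c d j k z
  proof -
    let ?t = "(real m)\<^sup>2 * (norm z)\<^sup>2"
    have 1: "norm (of_real (flat2 (?t - 1)) * (of_nat m) ^ 4 * wirt_coord d k z * wirt_coord c j z) \<le> C2 / (norm z)\<^sup>2"
    proof -
      have "norm (of_real (flat2 (?t - 1)) * (of_nat m) ^ 4 * wirt_coord d k z * wirt_coord c j z)
         = \<bar>flat2 (?t - 1)\<bar> * (real m) ^ 4 * norm (wirt_coord d k z) * norm (wirt_coord c j z)"
        by (simp add: norm_mult norm_power)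
      also have "\<dots> \<le> \<bar>flat2 (?t - 1)\<bar> * (real m) ^ 4 * norm z * norm z"
        by (intro mult_mono mult_left_mono norm_wirt_coord c d mult_nonneg_nonneg) auto
      also have "\<dots> = \<bar>flat2 (?t - 1) * ?t\<^sup>2\<bar> / (norm z)\<^sup>2"
        using z by (simp add: abs_mult power2_eq_square eval_nat_numeral)
      also have "\<dots> \<le> C2 / (norm z)\<^sup>2" by (intro divide_right_mono C2) auto
      finally show ?thesis .
    qed
    have 2: "norm (of_real (flat1 (?t - 1)) * (of_nat m)\<^sup>2 * (if j = k then (1 + c * d) / 2 else 0)) \<le> C1 / (norm z)\<^sup>2"
    proof -
      have "norm (of_real (flat1 (?t - 1)) * (of_nat m)\<^sup>2 * (if j = k then (1 + c * d) / 2 else 0))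
        = \<bar>flat1 (?t - 1)\<bar> * (real m)\<^sup>2 * norm (if j = k then (1 + c * d) / 2 else 0)"
        unfolding norm_mult by (simp add: norm_power)
      also have "\<dots> \<le> \<bar>flat1 (?t - 1)\<bar> * (real m)\<^sup>2 * 1"
        using c d by (intro mult_left_mono) auto
      also have "\<dots> = \<bar>flat1 (?t - 1) * ?t\<bar> / (norm z)\<^sup>2" using z by (simp add: abs_mult)
      also have "\<dots> \<le> C1 / (norm z)\<^sup>2" by (intro divide_right_mono C1) auto
      finally show ?thesis .
    qed
    show ?thesis using norm_triangle_le[OF add_mono[OF 1 2]] unfolding wirt_wirt_cutoff by (simp only: add_divide_distrib)
  qed
  then show ?thesis using that C1(1) C2(1) by (metis add_nonneg_nonneg)
qed

lemma wirt_cutoff_tendsto: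
  assumes "z \<noteq> 0" shows "(\<lambda>m. wirt c j (cutoff m) z) \<longlonglongrightarrow> 0"
proof -
  have "(\<lambda>m. complex_of_real (flat1 ((real m)\<^sup>2 * (norm z)\<^sup>2 - 1) * ((real m)\<^sup>2 * (norm z)\<^sup>2)) * (wirt_coord c j z / of_real ((norm z)\<^sup>2))) \<longlonglongrightarrow> of_real 0 * (wirt_coord c j z / of_real ((norm z)\<^sup>2))"
    by (intro tendsto_mult tendsto_of_real tendsto_const filterlim_compose[OF flat1_tendsto scaled_norm_at_top[OF assms]])
  moreover have "wirt c j (cutoff m) z = complex_of_real (flat1 ((real m)\<^sup>2 * (norm z)\<^sup>2 - 1) * ((real m)\<^sup>2 * (norm z)\<^sup>2)) * (wirt_coord c j z / of_real ((norm z)\<^sup>2))" for m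
    using assms by (simp add: wirt_cutoff)
  ultimately show ?thesis by simp
qed

lemma wirt_wirt_cutoff_tendsto:
  assumes "z \<noteq> 0" shows "(\<lambda>m. wirt d k (wirt c j (cutoff m)) z) \<longlonglongrightarrow> 0"
proof -
  let ?t = "\<lambda>m. (real m)\<^sup>2 * (norm z)\<^sup>2"
  let ?e = "if j = k then (1 + c * d) / 2 else 0"
  have "(\<lambda>m. complex_of_real (flat2 (?t m - 1) * (?t m)\<^sup>2) * (wirt_coord d k z * wirt_coord c j z / of_real (((norm z)\<^sup>2)\<^sup>2))
     + complex_of_real (flat1 (?t m - 1) * (?t m)) * (?e / of_real ((norm z)\<^sup>2)))
    \<longlonglongrightarrow> of_real 0 * (wirt_coord d k z * wirt_coord c j z / of_real (((norm z)\<^sup>2)\<^sup>2)) + of_real 0 * (?e / of_real ((norm z)\<^sup>2))"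
    by (intro tendsto_add tendsto_mult tendsto_of_real tendsto_const filterlim_compose[OF flat1_tendsto scaled_norm_at_top[OF assms]]
       filterlim_compose[OF flat2_tendsto scaled_norm_at_top[OF assms]])
  moreover have "wirt d k (wirt c j (cutoff m)) z = complex_of_real (flat2 (?t m - 1) * (?t m)\<^sup>2) * (wirt_coord d k z * wirt_coord c j z / of_real (((norm z)\<^sup>2)\<^sup>2))
     + complex_of_real (flat1 (?t m - 1) * (?t m)) * (?e / of_real ((norm z)\<^sup>2))" for m
  proof -
    have "a * (x / b) = (a / b) * x" for a b x :: complex by simp
    moreover have "complex_of_real (flat2 (?t m - 1) * (?t m)\<^sup>2) / of_real (((norm z)\<^sup>2)\<^sup>2) = of_real (flat2 (?t m - 1)) * (of_nat m) ^ 4"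
      using assms by (simp add: power_mult_distrib flip: power_mult)
    moreover have "complex_of_real (flat1 (?t m - 1) * (?t m)) / of_real ((norm z)\<^sup>2) = of_real (flat1 (?t m - 1)) * (of_nat m)\<^sup>2"
      using assms by simp
    ultimately show ?thesis unfolding wirt_wirt_cutoff by (simp only: mult.assoc)
  qed
  ultimately show ?thesis by simp
qed

section \<open>Removing the cut-off\<close>

lemma wirt_wirt_mult:
  assumes f: "C_on 2 UNIV f" and g: "C_on 2 UNIV g"
  shows "wirt c j (wirt d k (\<lambda>w. f w * g w)) z = f z * wirt c j (wirt d k g) z + wirt c j f z * wirt d k g z
     + (wirt d k f z * wirt c j g z + wirt c j (wirt d k f) z * g z)"
proof -
  have c1: "C_on 1 UNIV u" if "C_on 2 UNIV u" for u :: "complex^'n \<Rightarrow> complex" using C_on_le[OF that, of 1] by simp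
  have dw: "wirt d k u differentiable (at z)" if "C_on 2 UNIV u" for u z
    using C_on_wirt[OF open_UNIV, of 1 u d k] that by (intro C_on_1_differentiable) (simp add: numeral_2_eq_2 del: C_on.simps)
  note df = C_on_1_differentiable[OF c1[OF f]] and dg = C_on_1_differentiable[OF c1[OF g]]
  have "wirt d k (\<lambda>w. f w * g w) = (\<lambda>z. f z * wirt d k g z + wirt d k f z * g z)"
    using wirt_mult[OF df dg] by blast
  then show ?thesis
    by (simp only: wirt_add[OF differentiable_mult[OF df dw[OF g]] differentiable_mult[OF dw[OF f] dg]]
      wirt_mult[OF df dw[OF g]] wirt_mult[OF dw[OF f] dg])
qed

lemma finite_family_bound:
  fixes F :: "'i::finite \<Rightarrow> 'z \<Rightarrow> 'b::real_normed_vector"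
  assumes "\<And>i. \<exists>B. \<forall>z. norm (F i z) \<le> B"
  shows "\<exists>B\<ge>0. \<forall>i z. norm (F i z) \<le> B"
proof -
  obtain B where B: "\<And>i z. norm (F i z) \<le> B i" using assms by metis
  have "norm (F i z) \<le> (\<Sum>i\<in>UNIV. \<bar>B i\<bar>)" for i z
  proof -
    have "\<bar>B i\<bar> \<le> (\<Sum>i\<in>UNIV. \<bar>B i\<bar>)" by (rule member_le_sum) auto
    then show ?thesis using B[of i z] by linarith
  qed
  then show ?thesis by (intro exI[of _ "\<Sum>i\<in>UNIV. \<bar>B i\<bar>"]) (auto intro: sum_nonneg)
qed

lemma test_form_derivative_bounds:
  fixes \<phi> :: "'n::{finite,wellorder} form"
  assumes "test_form \<phi>"
  obtains B where "B \<ge> 0" "\<And>I J z. norm (\<phi> I J z) \<le> B" "\<And>I J j z. norm (wirt c j (\<phi> I J) z) \<le> B"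
    "\<And>I J k z. norm (wirt d k (\<phi> I J) z) \<le> B" "\<And>I J j k z. norm (wirt c j (wirt d k (\<phi> I J)) z) \<le> B"
proof -
  have C: "C_on k UNIV (\<phi> I J)" and S: "bounded {z. \<phi> I J z \<noteq> 0}" for k I J using assms test_form_iff by blast+
  have bd: "\<exists>B. \<forall>z. norm (f z) \<le> B" if "continuous_on UNIV f" "bounded {z. f z \<noteq> 0}" for f :: "(complex, 'n) vec \<Rightarrow> complex"
    using continuous_bounded_support_bounded[OF that] by metis
  have Cw: "C_on l UNIV (wirt c j (\<phi> I J))" for l c j I J by (rule C_on_wirt[OF open_UNIV C])
  have Cww: "C_on l UNIV (wirt c j (wirt d k (\<phi> I J)))" for l c j d k I J by (rule C_on_wirt[OF open_UNIV Cw])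
  have "\<exists>B\<ge>0. \<forall>p z. norm ((case p of (I, J) \<Rightarrow> \<phi> I J) z) \<le> B"
    by (rule finite_family_bound) (auto intro!: bd C_on_imp_continuous_on[OF C] S)
  then obtain B1 where B1: "B1 \<ge> 0" "\<And>I J z. norm (\<phi> I J z) \<le> B1" by (auto simp: split_paired_All)
  have "\<exists>B\<ge>0. \<forall>p z. norm ((case p of (I, J, j) \<Rightarrow> wirt c j (\<phi> I J)) z) \<le> B" for c
    by (rule finite_family_bound) (auto intro!: bd C_on_imp_continuous_on[OF Cw] bounded_support_wirt S)
  then have w: "\<exists>B\<ge>0. \<forall>I J j z. norm (wirt c j (\<phi> I J) z) \<le> B" for c by (simp add: split_paired_All)
  obtain B2 where B2: "B2 \<ge> 0" "\<And>I J j z. norm (wirt c j (\<phi> I J) z) \<le> B2" using w[of c] by blast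
  obtain B3 where B3: "B3 \<ge> 0" "\<And>I J j z. norm (wirt d j (\<phi> I J) z) \<le> B3" using w[of d] by blast
  have "\<exists>B\<ge>0. \<forall>p z. norm ((case p of (I, J, j, k) \<Rightarrow> wirt c j (wirt d k (\<phi> I J))) z) \<le> B"
    by (rule finite_family_bound) (auto intro!: bd C_on_imp_continuous_on[OF Cww] bounded_support_wirt S)
  then obtain B4 where B4: "B4 \<ge> 0" "\<And>I J j k z. norm (wirt c j (wirt d k (\<phi> I J)) z) \<le> B4" by (auto simp: split_paired_All)
  show ?thesis
    by (rule that[of "B1 + B2 + B3 + B4"]) (use B1(1) B2(1) B3(1) B4(1) in \<open>auto intro: order_trans[OF B1(2)] order_trans[OF B2(2)] order_trans[OF B3(2)] order_trans[OF B4(2)]\<close>)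
qed

lemma del_delbar_expand:
  assumes "\<And>I J. C_on 2 UNIV (\<omega> I J)"
  shows "del (delbar \<omega>) I J z = (\<Sum>j\<in>UNIV. \<Sum>k\<in>UNIV. wedge_pair (j, k) (\<lambda>I J. wirt (- \<i>) j (wirt \<i> k (\<omega> I J)) z) I J)"
  unfolding del_eq_dform delbar_eq_dform wedge_pair_def fst_conv snd_conv
  by (rule dform_dform[where E = wedge_dz and F = wedge_dzbar, OF monomial_op_wedge_dz monomial_op_wedge_dzbar open_UNIV UNIV_I assms])

lemma monomial_op_tendsto:
  assumes "monomial_op E" "\<And>I J. ((\<lambda>m. u m I J) \<longlongrightarrow> v I J) F"
  shows "((\<lambda>m. E (u m) I J) \<longlongrightarrow> E v I J) F"
proof -
  obtain a p q where E: "\<And>w I J. E w I J = a I J * w (p I J) (q I J)" using monomial_opE[OF assms(1)] by metis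
  show ?thesis unfolding E by (intro tendsto_mult tendsto_const assms(2))
qed

lemma hess_top_tendsto:
  assumes "\<And>I J. ((\<lambda>m. u m I J) \<longlongrightarrow> v I J) F"
  shows "((\<lambda>m. hess_top hs z (u m)) \<longlongrightarrow> hess_top hs z v) F"
  unfolding hess_top_coeffs[of hs z "u _"] hess_top_coeffs[of hs z v]
  by (intro tendsto_sum tendsto_mult tendsto_const assms)

context
  fixes h :: "complex^'n::{finite,wellorder} \<Rightarrow> real" and hs :: "(complex^'n::_ \<Rightarrow> real) list" and \<phi> :: "'n form"
  assumes h: "sublinear_C2 h" and hs: "\<forall>h\<in>set hs. sublinear_C2 h"
    and len: "Suc (length hs) < DIM((complex, 'n) vec)" and \<phi>: "test_form \<phi>"
begin

abbreviation (input) cut_form :: "nat \<Rightarrow> 'n form" where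
  "cut_form m \<equiv> \<lambda>I J z. cutoff m z * \<phi> I J z"

lemma test_form_cut_form: "test_form (cut_form m)"
proof -
  have "C_on k UNIV (\<phi> I J)" and "bounded {z. \<phi> I J z \<noteq> 0}" for k I J using \<phi> test_form_iff by blast+
  then show ?thesis unfolding test_form_iff
    by (intro allI conjI C_on_mult C_on_cutoff open_UNIV bounded_support_mult)
qed

lemma C2_phi: "C_on 2 UNIV (\<phi> I J)" and C2_cut_form: "C_on 2 UNIV (cut_form m I J)"
  using \<phi> test_form_cut_form unfolding test_form_iff by blast+

lemma del_delbar_cut_form_tendsto:
  assumes z: "z \<noteq> 0"
  shows "(\<lambda>m. del (delbar (cut_form m)) I J z) \<longlonglongrightarrow> del (delbar \<phi>) I J z"
proof -
  have "(\<lambda>m. wirt (- \<i>) j (wirt \<i> k (cut_form m I J)) z) \<longlonglongrightarrow> wirt (- \<i>) j (wirt \<i> k (\<phi> I J)) z" for j k I J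
  proof -
    have "(\<lambda>m. cutoff m z * wirt (- \<i>) j (wirt \<i> k (\<phi> I J)) z + wirt (- \<i>) j (cutoff m) z * wirt \<i> k (\<phi> I J) z
       + (wirt \<i> k (cutoff m) z * wirt (- \<i>) j (\<phi> I J) z + wirt (- \<i>) j (wirt \<i> k (cutoff m)) z * \<phi> I J z))
       \<longlonglongrightarrow> 1 * wirt (- \<i>) j (wirt \<i> k (\<phi> I J)) z + 0 * wirt \<i> k (\<phi> I J) z
       + (0 * wirt (- \<i>) j (\<phi> I J) z + 0 * \<phi> I J z)"
      by (intro tendsto_add tendsto_mult tendsto_const cutoff_tendsto wirt_cutoff_tendsto wirt_wirt_cutoff_tendsto z)
    then show ?thesis unfolding wirt_wirt_mult[OF C_on_cutoff C2_phi] by simp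
  qed
  then show ?thesis
    unfolding del_delbar_expand[OF C2_phi] del_delbar_expand[OF C2_cut_form]
    by (intro tendsto_sum monomial_op_tendsto[OF monomial_op_wedge_pair])
qed

lemma del_delbar_cut_form_bound:
  obtains K R where "K \<ge> 0" "\<And>m I J z. z \<noteq> 0 \<Longrightarrow> norm (of_real (h z) * del (delbar (cut_form m)) I J z) \<le> K / norm z"
    "\<And>m I J z. norm z > R \<Longrightarrow> del (delbar (cut_form m)) I J z = 0"
proof -
  obtain R where R: "\<And>I J z. norm z > R \<Longrightarrow> \<phi> I J z = 0"
    using bounded_supports[of \<phi>] \<phi> unfolding test_form_iff by blast
  have far: "del (delbar (cut_form m)) I J z = 0" if "norm z > R" for m I J z
  proof -
    have op: "open {z::(complex, 'n) vec. norm z > R}" by (intro open_Collect_less continuous_intros)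
    have "delbar (cut_form m) I J z = 0" if "z \<in> {z. norm z > R}" for I J z
      unfolding delbar_eq_dform
      by (rule dform_eq_0[where E = wedge_dzbar, OF monomial_op_wedge_dzbar op that]) (simp add: R)
    then show ?thesis unfolding del_eq_dform
      by (intro dform_eq_0[where E = wedge_dz, OF monomial_op_wedge_dz op]) (use that in auto)
  qed
  obtain C0 where C0: "C0 \<ge> 0" "\<And>z. \<bar>h z\<bar> \<le> C0 * norm z" using sublinear_bound[OF h] by blast
  obtain C1 where C1: "C1 \<ge> 0" "\<And>m c j z. c = \<i> \<or> c = - \<i> \<Longrightarrow> z \<noteq> 0 \<Longrightarrow> norm (wirt c j (cutoff m :: (complex,'n) vec \<Rightarrow> complex) z) \<le> C1 / norm z"
    using wirt_cutoff_bound[where 'n='n] by blast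
  obtain C2 where C2: "C2 \<ge> 0" "\<And>m c d j k z. c = \<i> \<or> c = - \<i> \<Longrightarrow> d = \<i> \<or> d = - \<i> \<Longrightarrow> z \<noteq> 0 \<Longrightarrow>
    norm (wirt d k (wirt c j (cutoff m :: (complex,'n) vec \<Rightarrow> complex)) z) \<le> C2 / (norm z)\<^sup>2"
    using wirt_wirt_cutoff_bound[where 'n='n] by blast
  obtain B where B: "B \<ge> 0" "\<And>I J z. norm (\<phi> I J z) \<le> B" "\<And>I J j z. norm (wirt (- \<i>) j (\<phi> I J) z) \<le> B"
    "\<And>I J k z. norm (wirt \<i> k (\<phi> I J) z) \<le> B" "\<And>I J j k z. norm (wirt (- \<i>) j (wirt \<i> k (\<phi> I J)) z) \<le> B"
    using test_form_derivative_bounds[OF \<phi>, of "- \<i>" \<i>] by blast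
  \<comment> \<open>Leibniz's rule for two derivatives of cutoff times \<phi>: none, one or both
    fall on the cut-off, with 1, 2 C1/r and C2/r^2 as factors of the common bound
    \<open>B\<close>.\<close>
  define Q where "Q r = B * (1 + 2 * C1 / r + C2 / r\<^sup>2)" for r :: real
  have ww: "norm (wirt (- \<i>) j (wirt \<i> k (cut_form m I J)) z) \<le> Q (norm z)" if z: "z \<noteq> 0" for m j k I J z
  proof -
    have "norm (wirt (- \<i>) j (wirt \<i> k (cut_form m I J)) z) \<le> 1 * B + C1 / norm z * B + (C1 / norm z * B + C2 / (norm z)\<^sup>2 * B)"
      unfolding wirt_wirt_mult[OF C_on_cutoff C2_phi]
      by (intro norm_triangle_le add_mono order_trans[OF norm_triangle_ineq add_mono] norm_mult_ineq[THEN order_trans] mult_mono norm_cutoff_le B C1 C2 z divide_nonneg_nonneg norm_ge_zero) auto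
    also have "\<dots> = Q (norm z)" by (simp add: Q_def algebra_simps add_divide_distrib)
    finally show ?thesis .
  qed
  define N where "N = real (CARD('n) * CARD('n))"
  have dd: "norm (del (delbar (cut_form m)) I J z) \<le> N * Q (norm z)" if z: "z \<noteq> 0" for m I J z
  proof -
    have "norm (del (delbar (cut_form m)) I J z) \<le> (\<Sum>j\<in>(UNIV :: 'n set). \<Sum>k\<in>(UNIV :: 'n set). Q (norm z))"
      unfolding del_delbar_expand[OF C2_cut_form]
      by (rule order_trans[OF norm_sum], rule sum_mono, rule order_trans[OF norm_sum], rule sum_mono, rule norm_wedge_pair_le, rule ww[OF z])
    then show ?thesis by (simp add: N_def)
  qed
  \<comment> \<open>For |z| <= R the product of C0 |z| and Q(|z|) is C0 B (|z|^2 + 2 C1 |z| + C2) /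
    |z|. The absolute value of \<open>R\<close> keeps \<open>K\<close> nonnegative also when
    \<open>R\<close> is negative.\<close>
  define K where "K = C0 * N * B * (R\<^sup>2 + 2 * C1 * \<bar>R\<bar> + C2)"
  show ?thesis
  proof (rule that[of K R])
    show "K \<ge> 0" unfolding K_def N_def using C0(1) C1(1) C2(1) B(1) by simp
    show "norm (of_real (h z) * del (delbar (cut_form m)) I J z) \<le> K / norm z" if z: "z \<noteq> 0" for m I J z
    proof (cases "norm z > R")
      case True
      then show ?thesis using far[OF True] \<open>K \<ge> 0\<close> by simp
    next
      case False
      have "norm (of_real (h z) * del (delbar (cut_form m)) I J z) \<le> (C0 * norm z) * (N * Q (norm z))"
        unfolding norm_mult using C0 dd[OF z] by (intro mult_mono) auto
      also have "\<dots> = C0 * N * B * ((norm z)\<^sup>2 + 2 * C1 * norm z + C2) / norm z"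
        using z by (simp add: Q_def field_simps power2_eq_square)
      also have "\<dots> \<le> K / norm z"
        unfolding K_def using False C0(1) C1(1) C2(1) B(1)
        by (intro divide_right_mono mult_left_mono add_mono power_mono) (auto simp: N_def abs_if)
      finally show ?thesis .
    qed
  qed (rule far)
qed

text \<open>The second derivatives of the cut-off are \<open>O(1/|z|\<^sup>2)\<close> uniformly in \<open>m\<close> and \<open>h\<close> is \<open>O(|z|)\<close>, so that
  \<open>ddc_current_Cons_away\<close> passes to the limit by dominated convergence.\<close>

lemma ddc_current_Cons:
  "ddc_current hs (fun_times_form h (ext_d (ext_dc \<phi>))) = ddc_current (h # hs) \<phi>"
proof -
  have len': "length hs < DIM((complex, 'n) vec)" and hhs: "\<forall>h'\<in>set (h # hs). sublinear_C2 h'"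
    and len2: "length (h # hs) < DIM((complex, 'n) vec)" using len h hs by auto
  define c where "c = (-1) ^ (CARD('n) * (CARD('n) - 1) div 2) * (- 2 * \<i>) ^ CARD('n)"
  define W where "W \<omega> = fun_times_form h (ext_d (ext_dc \<omega>))" for \<omega> :: "'n form"
  have W_eq: "W \<omega> I J z = 2 * \<i> * (of_real (h z) * del (delbar \<omega>) I J z)" if "test_form \<omega>" for \<omega> I J z
    by (simp add: W_def fun_times_form_def ext_d_ext_dc_test[OF that])
  have W_cc: "cc_form (W \<omega>)" if \<omega>: "test_form \<omega>" for \<omega> unfolding cc_form_iff
  proof (intro allI conjI)
    fix I J
    have t: "test_form (del (delbar \<omega>))" unfolding del_eq_dform delbar_eq_dform
      by (rule dform_test_form[where E = wedge_dz, OF monomial_op_wedge_dz dform_test_form[where E = wedge_dzbar, OF monomial_op_wedge_dzbar \<omega>]])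
    then have c: "continuous_on UNIV (del (delbar \<omega>) I J)" and b: "bounded {z. del (delbar \<omega>) I J z \<noteq> 0}"
      using test_form_imp_cc_form cc_form_iff by blast+
    have e: "W \<omega> I J = (\<lambda>z. (2 * \<i> * of_real (h z)) * del (delbar \<omega>) I J z)" by (simp add: fun_eq_iff W_eq[OF \<omega>])
    show "continuous_on UNIV (W \<omega> I J)" unfolding e
      by (intro continuous_on_mult continuous_on_const continuous_on_of_real sublinear_continuous[OF h] c)
    show "bounded {z. W \<omega> I J z \<noteq> 0}" unfolding e by (rule bounded_support_mult[OF b])
  qed
  have T1: "ddc_current hs (W \<omega>) = c * (2 * \<i>) ^ length hs * (LINT z|lborel. hess_top hs z (\<lambda>I J. W \<omega> I J z))" if "test_form \<omega>" for \<omega>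
    using W_cc[OF that] by (simp add: ddc_current_def c_def)
  have T2: "ddc_current (h # hs) \<omega> = c * (2 * \<i>) ^ length (h # hs) * (LINT z|lborel. hess_top (h # hs) z (\<lambda>I J. \<omega> I J z))" if "test_form \<omega>" for \<omega>
    using test_form_imp_cc_form[OF that] by (simp add: ddc_current_def c_def)
  have eq: "\<forall>\<^sub>F m in sequentially. ddc_current (h # hs) (cut_form m) = ddc_current hs (W (cut_form m))"
    using eventually_gt_at_top[of 0]
  proof eventually_elim
    case (elim m)
    show ?case unfolding W_def
    proof (rule ddc_current_Cons_away[OF h hs len current_closed_ddc_current[OF hs len'] test_form_cut_form, symmetric])
      show "1 / real m > 0" using elim by simp
      show "cutoff m z * \<phi> I J z = 0" if "norm z < 1 / real m" for I J z using cutoff_vanish[OF elim that] by simp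
    qed
  qed
  have "(\<lambda>m. LINT z|lborel. hess_top hs z (\<lambda>I J. W (cut_form m) I J z)) \<longlonglongrightarrow> (LINT z|lborel. hess_top hs z (\<lambda>I J. W \<phi> I J z))"
  proof -
    obtain K R where K: "K \<ge> 0" "\<And>m I J z. z \<noteq> 0 \<Longrightarrow> norm (of_real (h z) * del (delbar (cut_form m)) I J z) \<le> K / norm z"
      and far: "\<And>m I J z. norm z > R \<Longrightarrow> del (delbar (cut_form m)) I J z = 0" using del_delbar_cut_form_bound by blast
    obtain C where C: "C \<ge> 0" "\<And>z M w. z \<noteq> 0 \<Longrightarrow> (\<And>I J. norm (w I J) \<le> M) \<Longrightarrow> norm (hess_top hs z w) \<le> C * M / norm z ^ length hs"
      using hess_top_form_bound[OF hs] by metis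
    have AE0: "AE z in lborel. z \<noteq> (0 :: (complex, 'n) vec)" by (rule AE_lborel_singleton)
    \<comment> \<open>The exponent in the dominating function is \<open>length hs\<close> from the
      Hessians plus one from h \<partial> dbar of the cut-off form; \<open>len\<close> is exactly
      its integrability in real dimension 2n.\<close>
    show ?thesis
    proof (rule integral_dominated_convergence[where w = "\<lambda>z. (C * (2 * K)) * (indicator (cball 0 R) z / norm z ^ Suc (length hs))"])
      show "(\<lambda>z. hess_top hs z (\<lambda>I J. W \<phi> I J z)) \<in> borel_measurable lborel"
        "(\<lambda>z. hess_top hs z (\<lambda>I J. W (cut_form m) I J z)) \<in> borel_measurable lborel" for m
        using measurable_hess_top[OF hs cc_form_measurable[OF W_cc[OF \<phi>]]] measurable_hess_top[OF hs cc_form_measurable[OF W_cc[OF test_form_cut_form]]]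
        by simp_all
      show "integrable lborel (\<lambda>z::(complex, 'n) vec. (C * (2 * K)) * (indicator (cball 0 R) z / norm z ^ Suc (length hs)))"
        by (intro integrable_mult_right integrable_inverse_norm_power len)
      show "AE z in lborel. (\<lambda>m. hess_top hs z (\<lambda>I J. W (cut_form m) I J z)) \<longlonglongrightarrow> hess_top hs z (\<lambda>I J. W \<phi> I J z)"
        using AE0
      proof eventually_elim
        case (elim z)
        show ?case unfolding W_eq[OF \<phi>] W_eq[OF test_form_cut_form]
          by (intro hess_top_tendsto tendsto_mult tendsto_const del_delbar_cut_form_tendsto elim)
      qed
      show "AE z in lborel. norm (hess_top hs z (\<lambda>I J. W (cut_form m) I J z)) \<le> (C * (2 * K)) * (indicator (cball 0 R) z / norm z ^ Suc (length hs))" for m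
        using AE0
      proof eventually_elim
        case (elim z)
        show ?case
        proof (cases "norm z \<le> R")
          case True
          have "norm (W (cut_form m) I J z) \<le> 2 * K / norm z" for I J
            using K(2)[OF elim, of m I J] unfolding W_eq[OF test_form_cut_form] norm_mult[of "2 * \<i>"] by simp
          then have "norm (hess_top hs z (\<lambda>I J. W (cut_form m) I J z)) \<le> C * (2 * K / norm z) / norm z ^ length hs"
            by (rule C(2)[OF elim])
          then show ?thesis using True by (simp add: mult_ac)
        next
          case False
          then have "norm (hess_top hs z (\<lambda>I J. W (cut_form m) I J z)) \<le> C * 0 / norm z ^ length hs"
            by (intro C(2)[OF elim]) (simp add: W_eq[OF test_form_cut_form] far)
          then show ?thesis using False by simp
        qed
      qed
    qed
  qed
  then have L1: "(\<lambda>m. ddc_current hs (W (cut_form m))) \<longlonglongrightarrow> ddc_current hs (W \<phi>)"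
    unfolding T1[OF \<phi>] T1[OF test_form_cut_form] by (intro tendsto_mult tendsto_const)
  \<comment> \<open>On this side the cut-off is not differentiated. Being at most 1 in modulus, it
    leaves the uncut integrand itself as a dominating function.\<close>
  have "(\<lambda>m. LINT z|lborel. hess_top (h # hs) z (\<lambda>I J. cut_form m I J z)) \<longlonglongrightarrow> (LINT z|lborel. hess_top (h # hs) z (\<lambda>I J. \<phi> I J z))"
  proof (rule integral_dominated_convergence[where w = "\<lambda>z. norm (hess_top (h # hs) z (\<lambda>I J. \<phi> I J z))"])
    show "(\<lambda>z. hess_top (h # hs) z (\<lambda>I J. \<phi> I J z)) \<in> borel_measurable lborel"
      "(\<lambda>z. hess_top (h # hs) z (\<lambda>I J. cut_form m I J z)) \<in> borel_measurable lborel" for m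
      using measurable_hess_top[OF hhs cc_form_measurable[OF test_form_imp_cc_form[OF \<phi>]]]
        measurable_hess_top[OF hhs cc_form_measurable[OF test_form_imp_cc_form[OF test_form_cut_form]]]
      by simp_all
    show "integrable lborel (\<lambda>z. norm (hess_top (h # hs) z (\<lambda>I J. \<phi> I J z)))"
      by (intro integrable_norm cc_form_hess_top_integrable[OF hhs len2] test_form_imp_cc_form \<phi>)
    have AE0: "AE z in lborel. z \<noteq> (0 :: (complex, 'n) vec)" by (rule AE_lborel_singleton)
    then show "AE z in lborel. (\<lambda>m. hess_top (h # hs) z (\<lambda>I J. cut_form m I J z)) \<longlonglongrightarrow> hess_top (h # hs) z (\<lambda>I J. \<phi> I J z)"
    proof eventually_elim
      case (elim z)
      have "(\<lambda>m. cutoff m z * \<phi> I J z) \<longlonglongrightarrow> 1 * \<phi> I J z" for I J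
        by (intro tendsto_mult tendsto_const cutoff_tendsto elim)
      then show ?case by (intro hess_top_tendsto) simp
    qed
    show "AE z in lborel. norm (hess_top (h # hs) z (\<lambda>I J. cut_form m I J z)) \<le> norm (hess_top (h # hs) z (\<lambda>I J. \<phi> I J z))" for m
      unfolding hess_top_linear norm_mult by (intro AE_I2 mult_left_le_one_le norm_cutoff_le) auto
  qed
  then have L2: "(\<lambda>m. ddc_current (h # hs) (cut_form m)) \<longlonglongrightarrow> ddc_current (h # hs) \<phi>"
    unfolding T2[OF \<phi>] T2[OF test_form_cut_form] by (intro tendsto_mult tendsto_const)
  from Lim_transform_eventually[OF L2 eq] have "(\<lambda>m. ddc_current hs (W (cut_form m))) \<longlonglongrightarrow> ddc_current (h # hs) \<phi>" .
  from LIMSEQ_unique[OF L1 this] show ?thesis by (simp add: W_def)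
qed

end

theorem ddc_wedge_ddc_current:
  fixes h :: "complex^'n::{finite,wellorder} \<Rightarrow> real"
  assumes h: "sublinear_C2 h" and hs: "\<forall>h\<in>set hs. sublinear_C2 h"
    and len: "Suc (length hs) < DIM((complex, 'n) vec)"
  shows "ddc_wedge h (ddc_current hs) = ddc_current (h # hs)"
  unfolding ddc_wedge_def
proof (rule the_equality)
  have S: "order0_current (ddc_current (h # hs))" by (rule order0_ddc_current) (use h hs len in auto)
  show "order0_current (ddc_current (h # hs)) \<and>
     (\<forall>\<phi>. test_form \<phi> \<longrightarrow> ddc_current (h # hs) \<phi> = ddc_current hs (fun_times_form h (ext_d (ext_dc \<phi>))))"
    using S ddc_current_Cons[OF h hs len] by simp
  fix T assume "order0_current T \<and> (\<forall>\<phi>. test_form \<phi> \<longrightarrow> T \<phi> = ddc_current hs (fun_times_form h (ext_d (ext_dc \<phi>))))"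
  then show "T = ddc_current (h # hs)"
    using ddc_current_Cons[OF h hs len] by (intro order0_current_unique[OF _ S]) auto
qed

theorem BT_product_eq_ddc_current:
  fixes hs :: "(complex^'n::{finite,wellorder} \<Rightarrow> real) list"
  assumes "\<forall>h\<in>set hs. sublinear_C2 h" "length hs < DIM((complex, 'n) vec)"
  shows "BT_product hs = ddc_current hs"
  using assms
proof (induction hs)
  case Nil
  then show ?case by (simp add: BT_product_def ddc_current_Nil)
next
  case (Cons h hs)
  then have "BT_product hs = ddc_current hs" by simp
  then have "BT_product (h # hs) = ddc_wedge h (ddc_current hs)" by (simp add: BT_product_def)
  also have "\<dots> = ddc_current (h # hs)" by (rule ddc_wedge_ddc_current) (use Cons in auto)
  finally show ?case .
qed

section \<open>The total mass on the ball\<close>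

text \<open>The indicator of a nonempty compact \<open>K\<close> is the limit of the continuous
  functions max(0, 1 - m dist(x, K)), so both measures agree on compact sets, which generate the
  Borel sets and are stable under intersection. This is the uniqueness part of
  \<open>current_measure\<close>.\<close>

lemma radon_measure_eqI:
  fixes \<mu> \<nu> :: "'a::euclidean_space measure"
  assumes sets: "sets \<mu> = sets borel" "sets \<nu> = sets borel"
    and fin: "\<And>K. compact K \<Longrightarrow> emeasure \<mu> K < \<infinity>" "\<And>K. compact K \<Longrightarrow> emeasure \<nu> K < \<infinity>"
    and int: "\<And>f :: 'a \<Rightarrow> real. continuous_on UNIV f \<Longrightarrow> bounded {x. f x \<noteq> 0} \<Longrightarrow> (LINT x|\<mu>. f x) = (LINT x|\<nu>. f x)"
  shows "\<mu> = \<nu>"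
proof -
  have lim: "(\<lambda>m. LINT x|M. max 0 (1 - real m * infdist x K)) \<longlonglongrightarrow> measure M K"
    if M: "sets M = sets borel" "\<And>K. compact K \<Longrightarrow> emeasure M K < \<infinity>" and K: "compact K" "K \<noteq> {}" for M and K :: "'a set"
  proof -
    have clK: "closed K" using K compact_imp_closed by blast
    have [measurable_cong]: "sets M = sets borel" by (rule M)
    have [measurable]: "(\<lambda>x. max 0 (1 - real m * infdist x K)) \<in> borel_measurable borel" for m
      by (intro borel_measurable_continuous_onI continuous_intros)
    have Kb: "K \<in> sets borel" using clK by simp
    define K1 where "K1 = {x. infdist x K \<le> 1}"
    have cK1: "compact K1" unfolding K1_def by (rule compact_infdist_le[OF K(2,1)]) simp
    have K1b: "K1 \<in> sets borel" by (rule borel_closed[OF compact_imp_closed[OF cK1]])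
    \<comment> \<open>The index is shifted because for m = 0 the function is constantly 1; from 1 on
      its support lies in the compact neighbourhood \<open>K1\<close>.\<close>
    have "(\<lambda>m. LINT x|M. max 0 (1 - real (Suc m) * infdist x K)) \<longlonglongrightarrow> (LINT x|M. indicator K x)"
    proof (rule integral_dominated_convergence[where w = "indicator K1"])
      show "integrable M (indicator K1 :: 'a \<Rightarrow> real)"
        using M(2)[OF cK1] K1b by (intro integrable_real_indicator) (auto simp: M(1))
      show "(indicator K :: 'a \<Rightarrow> real) \<in> borel_measurable M"
        using Kb by (intro borel_measurable_indicator) (simp add: M(1))
      show "(\<lambda>x. max 0 (1 - real (Suc m) * infdist x K)) \<in> borel_measurable M" for m by measurable
      show "AE x in M. (\<lambda>m. max 0 (1 - real (Suc m) * infdist x K)) \<longlonglongrightarrow> indicator K x"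
      proof (rule AE_I2)
        fix x
        show "(\<lambda>m. max 0 (1 - real (Suc m) * infdist x K)) \<longlonglongrightarrow> indicator K x"
        proof (cases "x \<in> K")
          case False
          then have pos: "infdist x K > 0" using in_closed_iff_infdist_zero[OF clK K(2)] infdist_nonneg[of x K] by (metis less_eq_real_def)
          then obtain N where N: "1 / real (Suc N) < infdist x K" using nat_approx_posE by blast
          have "max 0 (1 - real (Suc m) * infdist x K) = 0" if "m \<ge> N" for m
          proof -
            have "1 \<le> real (Suc N) * infdist x K" using N by (simp add: field_simps)
            also have "\<dots> \<le> real (Suc m) * infdist x K" using that infdist_nonneg by (intro mult_right_mono) auto
            finally show ?thesis by simp
          qed
          then have "\<forall>\<^sub>F m in sequentially. max 0 (1 - real (Suc m) * infdist x K) = 0" unfolding eventually_sequentially by blast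
          then show ?thesis using False by (simp add: tendsto_eventually)
        qed (simp add: infdist_zero)
      qed
      show "AE x in M. norm (max 0 (1 - real (Suc m) * infdist x K)) \<le> indicator K1 x" for m
      proof (rule AE_I2)
        fix x
        show "norm (max 0 (1 - real (Suc m) * infdist x K)) \<le> indicator K1 x"
        proof (cases "infdist x K \<le> 1")
          case True
          then show ?thesis using infdist_nonneg[of x K] by (simp add: K1_def)
        next
          case False
          have "1 * 1 \<le> real (Suc m) * infdist x K" using False by (intro mult_mono) auto
          then show ?thesis by simp
        qed
      qed
    qed
    then have "(\<lambda>m. LINT x|M. max 0 (1 - real (Suc m) * infdist x K)) \<longlonglongrightarrow> measure M K"
      using sets_eq_imp_space_eq[OF M(1)] by simp
    then show ?thesis by (rule LIMSEQ_imp_Suc)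
  qed
  have compact_eq: "emeasure \<mu> K = emeasure \<nu> K" if K: "compact K" for K
  proof (cases "K = {}")
    case False
    have "(LINT x|\<mu>. max 0 (1 - real (Suc m) * infdist x K)) = (LINT x|\<nu>. max 0 (1 - real (Suc m) * infdist x K))" for m
    proof (rule int)
      show "continuous_on UNIV (\<lambda>x. max 0 (1 - real (Suc m) * infdist x K))" by (intro continuous_intros)
      have "bounded {x. infdist x K \<le> 1}" using compact_infdist_le[OF False K, of 1] compact_imp_bounded by auto
      then show "bounded {x. max 0 (1 - real (Suc m) * infdist x K) \<noteq> 0}"
      proof (rule bounded_subset, safe)
        fix x assume "max 0 (1 - real (Suc m) * infdist x K) \<noteq> 0"
        then have "real (Suc m) * infdist x K < 1" by (auto simp: max_def split: if_splits)
        moreover have "1 * infdist x K \<le> real (Suc m) * infdist x K" using infdist_nonneg by (intro mult_right_mono) auto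
        ultimately show "infdist x K \<le> 1" by simp
      qed
    qed
    then have "measure \<mu> K = measure \<nu> K"
      using LIMSEQ_unique[OF LIMSEQ_Suc[OF lim[OF sets(1) fin(1) K False]]] LIMSEQ_Suc[OF lim[OF sets(2) fin(2) K False]] by simp
    then show ?thesis using fin(1)[OF K] fin(2)[OF K] by (simp add: emeasure_eq_ennreal_measure)
  qed simp
  show ?thesis
  proof (rule measure_eqI_generator_eq[where E = "Collect compact" and \<Omega> = UNIV and A = "\<lambda>n. cball 0 (real n)"])
    show "Int_stable (Collect compact :: 'a set set)" by (auto simp: Int_stable_def compact_Int)
    have gen: "sets borel = sigma_sets UNIV (Collect compact :: 'a set set)"
    proof
      have "S \<in> sigma_sets UNIV (Collect compact)" if "closed S" for S :: "'a set"
      proof -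
        have "S = (\<Union>n. S \<inter> cball 0 (real n))" using real_arch_simple by (auto simp: set_eq_iff)
        moreover have "(\<Union>n. S \<inter> cball 0 (real n)) \<in> sigma_sets UNIV (Collect compact)"
          using that by (intro sigma_sets.Union sigma_sets.Basic) (auto intro: closed_Int_compact)
        ultimately show ?thesis by simp
      qed
      then have "sigma_sets UNIV (Collect closed) \<subseteq> sigma_sets UNIV (Collect compact :: 'a set set)"
        by (intro sigma_sets_mono) auto
      then show "sets borel \<subseteq> sigma_sets UNIV (Collect compact :: 'a set set)" by (simp add: borel_eq_closed)
      show "sigma_sets UNIV (Collect compact :: 'a set set) \<subseteq> sets borel"
        by (rule sigma_sets_le_sets_iff[of borel, simplified, THEN iffD2]) (auto intro: borel_closed compact_imp_closed)
    qed
    show "sets \<mu> = sigma_sets UNIV (Collect compact)" "sets \<nu> = sigma_sets UNIV (Collect compact)" using sets gen by auto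
    show "(\<Union>i. cball (0::'a) (real i)) = UNIV" using real_arch_simple by (auto simp: set_eq_iff)
    show "emeasure \<mu> (cball 0 (real i)) \<noteq> \<infinity>" for i using fin(1)[OF compact_cball[of 0 "real i"]] by simp
  qed (auto simp: compact_eq)
qed

text \<open>Nonnegativity makes \<rho> a density and \<open>loc\<close> makes the resulting measure
  finite on compact sets, so it is a candidate for the description in
  \<open>current_measure\<close>.\<close>

lemma current_measure_eq_density:
  fixes T :: "'n::finite current" and \<rho> :: "complex^'n \<Rightarrow> real"
  assumes [measurable]: "\<rho> \<in> borel_measurable borel" and nn: "\<And>z. \<rho> z \<ge> 0"
    and loc: "\<And>R. integrable lborel (\<lambda>z. indicator (cball 0 R) z * \<rho> z)"
    and T: "\<And>f. continuous_on UNIV f \<Longrightarrow> bounded {z. f z \<noteq> 0} \<Longrightarrow> T (form_of_fun f) = of_real (LINT z|lborel. \<rho> z * f z)"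
  shows "current_measure T = density lborel (\<lambda>z. ennreal (\<rho> z))"
proof -
  let ?\<mu> = "density lborel (\<lambda>z. ennreal (\<rho> z))"
  have fin: "emeasure ?\<mu> K < \<infinity>" if K: "compact K" for K
  proof -
    obtain R where R: "\<forall>z\<in>K. norm z \<le> R" using compact_imp_bounded[OF K] unfolding bounded_iff by blast
    have "emeasure ?\<mu> K \<le> emeasure ?\<mu> (cball 0 R)" using R by (intro emeasure_mono) auto
    also have "\<dots> = (\<integral>\<^sup>+ z. ennreal (\<rho> z) * indicator (cball 0 R) z \<partial>lborel)" by (rule emeasure_density) auto
    also have "\<dots> = (\<integral>\<^sup>+ z. ennreal (norm (indicator (cball 0 R) z * \<rho> z)) \<partial>lborel)"
      using nn by (intro nn_integral_cong) (auto simp: indicator_def)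
    also have "\<dots> < \<infinity>" using loc[of R] unfolding integrable_iff_bounded by blast
    finally show ?thesis .
  qed
  have int: "(LINT z|?\<mu>. f z) = (LINT z|lborel. \<rho> z * f z)" if "continuous_on UNIV f" for f :: "complex^'n \<Rightarrow> real"
  proof -
    have [measurable]: "f \<in> borel_measurable borel" using that by (rule borel_measurable_continuous_onI)
    show ?thesis by (subst integral_density) (auto simp: nn)
  qed
  show ?thesis unfolding current_measure_def
  proof (rule the_equality)
    show "sets ?\<mu> = sets borel \<and> (\<forall>K. compact K \<longrightarrow> emeasure ?\<mu> K < \<infinity>) \<and>
     (\<forall>f :: complex^'n \<Rightarrow> real. continuous_on UNIV f \<and> compact (closure {z. f z \<noteq> 0}) \<longrightarrow>
        T (form_of_fun f) = complex_of_real (LINT z|?\<mu>. f z))"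
      using fin int T by simp
    fix \<nu> :: "(complex^'n) measure"
    assume \<nu>: "sets \<nu> = sets borel \<and> (\<forall>K. compact K \<longrightarrow> emeasure \<nu> K < \<infinity>) \<and>
     (\<forall>f :: complex^'n \<Rightarrow> real. continuous_on UNIV f \<and> compact (closure {z. f z \<noteq> 0}) \<longrightarrow>
        T (form_of_fun f) = complex_of_real (LINT z|\<nu>. f z))"
    show "\<nu> = ?\<mu>"
    proof (rule radon_measure_eqI)
      fix f :: "complex^'n \<Rightarrow> real" assume f: "continuous_on UNIV f" "bounded {x. f x \<noteq> 0}"
      have "T (form_of_fun f) = complex_of_real (LINT z|\<nu>. f z)" using \<nu> f compact_closure by blast
      moreover have "T (form_of_fun f) = complex_of_real (LINT z|?\<mu>. f z)" using T[OF f] int[OF f(1)] by simp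
      ultimately show "(LINT x|\<nu>. f x) = (LINT x|?\<mu>. f x)" by simp
    qed (use \<nu> fin in auto)
  qed
qed

section \<open>Mixed discriminants over the index type\<close>

lemma sum_idx_pos:
  fixes g :: "nat \<Rightarrow> 'b::comm_monoid_add"
  shows "(\<Sum>j\<in>(UNIV :: 'n::{finite,wellorder} set). g (pos j)) = (\<Sum>r=1..CARD('n). g r)"
  by (rule sum.reindex_bij_betw[OF pos_bij])

text \<open>Laplace expansion along a free first slot. It is used with \<open>X\<close> the Hessian
  of the first support function, with the identity matrix, and through \<open>hess_top_tail\<close>
  with a matrix unit.\<close>

lemma mixed_disc_Zcoef:
  fixes X :: "complex^'n::{finite,wellorder}^'n::_"
  shows "mixed_disc CARD('n) (\<lambda>l. nat_mat (if l = 1 then X else HessC (support_fun (A l)) u)) =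
    (\<Sum>j\<in>UNIV. \<Sum>k\<in>UNIV. X $ j $ k * Zcoef A j k u)"
proof -
  define m where "m = CARD('n) - 1"
  have n: "CARD('n) = Suc m" by (simp add: m_def)
  let ?M = "\<lambda>l. nat_mat (if l = 1 then X else HessC (support_fun (A l)) u)"
  let ?f = "\<lambda>j k. ?M 1 j k * ((-1) ^ (j + k) / of_nat (Suc m) * mixed_disc m (\<lambda>l. delete_row_col j k (?M (l + 1))))"
  have "mixed_disc CARD('n) ?M = (\<Sum>j=1..CARD('n). \<Sum>k=1..CARD('n). ?f j k)"
    unfolding n by (rule mixed_disc_Laplace)
  also have "\<dots> = (\<Sum>j\<in>(UNIV :: 'n set). \<Sum>k\<in>(UNIV :: 'n set). ?f (pos j) (pos k))"
    by (simp only: sum_idx_pos[symmetric])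
  also have "\<dots> = (\<Sum>j\<in>UNIV. \<Sum>k\<in>UNIV. X $ j $ k * Zcoef A j k u)"
  proof (intro sum.cong refl)
    fix j k :: 'n
    have "mixed_disc m (\<lambda>l. delete_row_col (pos j) (pos k) (?M (l + 1))) =
      mixed_disc m (\<lambda>l. delete_row_col (pos j) (pos k) (nat_mat (HessC (support_fun (A (l + 1))) u)))"
      by (rule mixed_disc_cong) simp
    then show "?f (pos j) (pos k) = X $ j $ k * Zcoef A j k u"
      unfolding Zcoef_def n by (simp add: nat_mat_def)
  qed
  finally show ?thesis .
qed

lemma psd_on_nat_mat:
  fixes M :: "complex^'n::{finite,wellorder}^'n::_"
  assumes "psd_on UNIV (\<lambda>j k. M $ j $ k)"
  shows "psd_on {1..CARD('n)} (nat_mat M)"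
  unfolding psd_on_def
proof (intro conjI ballI allI)
  show "nat_mat M s r = cnj (nat_mat M r s)" for r s
    using assms unfolding psd_on_def nat_mat_def by blast
  fix \<xi> :: "nat \<Rightarrow> complex"
  have "0 \<le> Re (\<Sum>j\<in>UNIV. \<Sum>k\<in>UNIV. M $ j $ k * \<xi> (pos j) * cnj (\<xi> (pos k)))"
    by (rule assms[unfolded psd_on_def, THEN conjunct2, THEN spec])
  also have "(\<Sum>j\<in>UNIV. \<Sum>k\<in>UNIV. M $ j $ k * \<xi> (pos j) * cnj (\<xi> (pos k))) =
     (\<Sum>j\<in>(UNIV :: 'n set). \<Sum>k\<in>(UNIV :: 'n set). nat_mat M (pos j) (pos k) * \<xi> (pos j) * cnj (\<xi> (pos k)))"
    by (simp add: nat_mat_def)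
  also have "\<dots> = (\<Sum>r=1..CARD('n). \<Sum>s=1..CARD('n). nat_mat M r s * \<xi> r * cnj (\<xi> s))"
    by (simp only: sum_idx_pos[of "\<lambda>s. nat_mat M r s * \<xi> r * cnj (\<xi> s)" for r] sum_idx_pos[of "\<lambda>r. \<Sum>s=1..CARD('n). nat_mat M r s * \<xi> r * cnj (\<xi> s)"])
  finally show "0 \<le> Re (\<Sum>r=1..CARD('n). \<Sum>s=1..CARD('n). nat_mat M r s * \<xi> r * cnj (\<xi> s))" .
qed

lemma continuous_on_mixed_disc:
  assumes "\<And>l r s. l \<in> {1..n} \<Longrightarrow> continuous_on S (\<lambda>z. M z l r s)"
  shows "continuous_on S (\<lambda>z. mixed_disc n (M z))"
  unfolding mixed_disc_def
  by (intro continuous_on_mult continuous_on_const continuous_on_sum continuous_on_prod assms)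

lemma DIM_complex_vec: "DIM((complex, 'n::finite) vec) = 2 * CARD('n)"
  by (simp add: mult.commute)

text \<open>A smooth bump in the variable s = |z|^2, positive for 1 < s < 4, that is, on the annulus
  1 < |z| < 2; the squared norm keeps its derivatives polynomial in the coordinates.\<close>

definition annulus_bump :: "real \<Rightarrow> real" where "annulus_bump s = flat (s - 1) * flat (4 - s)"

definition annulus_bump' :: "real \<Rightarrow> real" where
  "annulus_bump' s = flat1 (s - 1) * flat (4 - s) - flat (s - 1) * flat1 (4 - s)"

lemma annulus_bump_deriv: "(annulus_bump has_real_derivative annulus_bump' s) (at s)"
  unfolding annulus_bump_def[abs_def] annulus_bump'_def flat_def
  by (auto intro!: derivative_eq_intros DERIV_chain'[OF _ flat_poly_deriv])

lemma annulus_bump_eq_0: "s \<le> 1 \<or> s \<ge> 4 \<Longrightarrow> annulus_bump s = 0" "s \<le> 1 \<or> s \<ge> 4 \<Longrightarrow> annulus_bump' s = 0"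
  by (auto simp: annulus_bump_def annulus_bump'_def flat_eq flat_poly_def)

lemma annulus_bump_nonneg: "annulus_bump s \<ge> 0"
  by (simp add: annulus_bump_def flat_nonneg)

lemma annulus_bump_pos: "1 < s \<Longrightarrow> s < 4 \<Longrightarrow> annulus_bump s > 0"
  by (simp add: annulus_bump_def flat_eq)

lemma continuous_on_annulus_bump: "continuous_on UNIV annulus_bump" "continuous_on UNIV annulus_bump'"
proof -
  have f: "continuous_on UNIV (flat_poly p)" for p
    using flat_poly_deriv DERIV_isCont by (blast intro: continuous_at_imp_continuous_on)
  have "continuous_on UNIV (\<lambda>s. flat_poly p (s - 1))" "continuous_on UNIV (\<lambda>s. flat_poly p (4 - s))" for p
    by (auto intro!: continuous_on_compose2[OF f] continuous_intros)
  then show "continuous_on UNIV annulus_bump" "continuous_on UNIV annulus_bump'"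
    unfolding annulus_bump_def[abs_def] annulus_bump'_def[abs_def] flat_def
    by (intro continuous_on_mult continuous_on_diff; simp)+
qed

text \<open>The powers match the two homogeneous integrands below: p = 0, q = n for the mixed
  discriminant of degree -n, and p = 2, q = n for \<open>bdry\<close> of degree 2 - n.\<close>

lemma radial_annulus:
  fixes b :: "real \<Rightarrow> real"
  assumes b: "continuous_on UNIV b" "\<And>s. s \<le> 1 \<or> s \<ge> 4 \<Longrightarrow> b s = 0" and q: "q \<le> p + (N - 1)"
  shows "integrable (radial_measure N) (\<lambda>r. b (r\<^sup>2) * r ^ p / r ^ q)"
    "(LINT r|radial_measure N. b (r\<^sup>2) * r ^ p / r ^ q) = (LINT r|lborel. indicator {1..2} r *\<^sub>R (b (r\<^sup>2) * r ^ (p + (N - 1) - q)))"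
proof -
  have cb: "continuous_on S (\<lambda>r. b (r\<^sup>2))" for S
    by (rule continuous_on_compose2[OF b(1)]) (auto intro!: continuous_intros)
  have eq: "(indicator {0<..} r * r ^ (N - 1)) *\<^sub>R (b (r\<^sup>2) * r ^ p / r ^ q) =
     indicator {1..2} r *\<^sub>R (b (r\<^sup>2) * r ^ (p + (N - 1) - q))" for r :: real
  proof -
    consider "r \<le> 0" | "0 < r" "r < 1" | "1 \<le> r" "r \<le> 2" | "2 < r" by linarith
    then show ?thesis
    proof cases
      case 2
      then have "r\<^sup>2 \<le> 1" by (simp add: power_le_one)
      then show ?thesis using b(2) 2 by simp
    next
      case 3
      have "r ^ (p + (N - 1)) = r ^ (p + (N - 1) - q) * r ^ q" using q by (simp flip: power_add)
      then have "r ^ (N - 1) * r ^ p = r ^ (p + (N - 1) - q) * r ^ q" by (simp add: power_add mult.commute)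
      then have "r ^ (N - 1) * (x * r ^ p / r ^ q) = x * r ^ (p + (N - 1) - q)" for x
        using 3 by (simp add: field_simps)
      then show ?thesis using 3 by simp
    next
      case 4
      then have "r\<^sup>2 \<ge> 2\<^sup>2" by (intro power_mono) auto
      then show ?thesis using b(2) 4 by simp
    qed auto
  qed
  have [measurable]: "(\<lambda>r. b (r\<^sup>2)) \<in> borel_measurable borel" by (rule borel_measurable_continuous_onI[OF cb])
  have meas: "(\<lambda>r. b (r\<^sup>2) * r ^ p / r ^ q) \<in> borel_measurable borel" by measurable
  have "integrable lborel (\<lambda>r::real. indicator {1..2} r *\<^sub>R (b (r\<^sup>2) * r ^ (p + (N - 1) - q)))"
    by (rule borel_integrable_compact) (auto intro!: continuous_on_mult cb continuous_intros)
  then show "integrable (radial_measure N) (\<lambda>r. b (r\<^sup>2) * r ^ p / r ^ q)"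
    unfolding integral_radial_measure(1)[OF meas] eq .
  show "(LINT r|radial_measure N. b (r\<^sup>2) * r ^ p / r ^ q) = (LINT r|lborel. indicator {1..2} r *\<^sub>R (b (r\<^sup>2) * r ^ (p + (N - 1) - q)))"
    unfolding integral_radial_measure(2)[OF meas] eq ..
qed

lemma annulus_integral_pos:
  "(LINT r|lborel. indicator {1..2} r *\<^sub>R (annulus_bump (r\<^sup>2) * r ^ k)) > 0"
proof -
  have cb: "continuous_on S (\<lambda>r. annulus_bump (r\<^sup>2))" for S
    by (rule continuous_on_compose2[OF continuous_on_annulus_bump(1)]) (auto intro!: continuous_intros)
  let ?f = "\<lambda>r::real. indicator {1..2} r *\<^sub>R (annulus_bump (r\<^sup>2) * r ^ k)"
  have int: "integrable lborel ?f"
    by (rule borel_integrable_compact) (auto intro!: continuous_on_mult cb continuous_intros)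
  have nn: "?f r \<ge> 0" for r by (simp add: indicator_def annulus_bump_nonneg)
  have "(LINT r|lborel. ?f r) \<noteq> 0"
  proof
    assume "(LINT r|lborel. ?f r) = 0"
    then have "AE r in lborel. ?f r = 0" using integral_nonneg_eq_0_iff_AE[OF int] nn by simp
    moreover have "?f r = 0 \<longrightarrow> r \<notin> {1<..<2}" for r
    proof
      assume f0: "?f r = 0"
      show "r \<notin> {1<..<2}"
      proof
        assume r: "r \<in> {1<..<2}"
        then have "annulus_bump (r\<^sup>2) > 0"
          using power_strict_mono[of 1 r 2] power_strict_mono[of r 2 2] by (intro annulus_bump_pos) auto
        then show False using f0 r by simp
      qed
    qed
    ultimately have "AE r in lborel. r \<notin> {1<..<2::real}" by auto
    then have "emeasure lborel {1<..<2::real} = 0" by (subst (asm) AE_iff_measurable[OF _ refl]) (auto simp: greaterThanLessThan_def greaterThan_def lessThan_def Int_def)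
    then show False by simp
  qed
  then show ?thesis using nn by (simp add: integral_nonneg order_less_le)
qed

text \<open>The function b(r^2) r^(k+1) vanishes at both ends of the annulus and has derivative 2
  b'(r^2) r^(k+2) + (k+1) b(r^2) r^k. For k = n - 1 this is the origin of the factor n/2 in
  \<open>sphere_Stokes\<close>.\<close>

lemma annulus_integral_by_parts:
  "2 * (LINT r|lborel. indicator {1..2} r *\<^sub>R (annulus_bump' (r\<^sup>2) * r ^ (k + 2))) +
     real (Suc k) * (LINT r|lborel. indicator {1..2} r *\<^sub>R (annulus_bump (r\<^sup>2) * r ^ k)) = 0"
proof -
  have cb: "continuous_on S (\<lambda>r. annulus_bump (r\<^sup>2))" "continuous_on S (\<lambda>r. annulus_bump' (r\<^sup>2))" for S
    by (auto intro!: continuous_on_compose2[OF continuous_on_annulus_bump(1)] continuous_on_compose2[OF continuous_on_annulus_bump(2)] continuous_intros)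
  have int: "integrable lborel (\<lambda>r::real. indicator {1..2} r *\<^sub>R (annulus_bump (r\<^sup>2) * r ^ k))"
    "integrable lborel (\<lambda>r::real. indicator {1..2} r *\<^sub>R (annulus_bump' (r\<^sup>2) * r ^ (k + 2)))"
    by (rule borel_integrable_compact; auto intro!: continuous_on_mult cb continuous_intros)+
  let ?F = "\<lambda>r. annulus_bump (r\<^sup>2) * r ^ Suc k"
  let ?f = "\<lambda>r. 2 * (annulus_bump' (r\<^sup>2) * r ^ (k + 2)) + real (Suc k) * (annulus_bump (r\<^sup>2) * r ^ k)"
  have "(?F has_real_derivative (annulus_bump' (r\<^sup>2) * (2 * r)) * r ^ Suc k + (real (Suc k) * r ^ k) * annulus_bump (r\<^sup>2)) (at r)" for r
  proof (rule DERIV_mult)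
    have "((\<lambda>r. r\<^sup>2) has_real_derivative 2 * r) (at r)" by (auto intro!: derivative_eq_intros)
    from DERIV_chain2[OF annulus_bump_deriv this]
    show "((\<lambda>r. annulus_bump (r\<^sup>2)) has_real_derivative annulus_bump' (r\<^sup>2) * (2 * r)) (at r)" .
    show "((\<lambda>r. r ^ Suc k) has_real_derivative real (Suc k) * r ^ k) (at r)"
      using DERIV_pow[of "Suc k" r] by simp
  qed
  then have der: "(?F has_real_derivative ?f r) (at r)" for r
    by (rule DERIV_cong) (simp add: algebra_simps power2_eq_square)
  have "(LINT r|lborel. ?f r * indicator {1..2} r) = ?F 2 - ?F 1"
  proof (rule integral_FTC_Icc_real)
    show "isCont ?f r" for r
    proof -
      have "continuous_on UNIV ?f" by (intro continuous_on_add continuous_on_mult continuous_on_const continuous_on_power continuous_on_id cb)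
      then show ?thesis by (simp add: continuous_on_eq_continuous_at)
    qed
  qed (simp, rule der)
  also have "\<dots> = 0" by (simp add: annulus_bump_eq_0)
  finally have "(LINT r|lborel. ?f r * indicator {1..2} r) = 0" .
  moreover have "?f r * indicator {1..2} r = 2 * (indicator {1..2} r *\<^sub>R (annulus_bump' (r\<^sup>2) * r ^ (k + 2)))
     + real (Suc k) * (indicator {1..2} r *\<^sub>R (annulus_bump (r\<^sup>2) * r ^ k))" for r
    by (simp add: indicator_def)
  ultimately have "(LINT r|lborel. 2 * (indicator {1..2} r *\<^sub>R (annulus_bump' (r\<^sup>2) * r ^ (k + 2)))
     + real (Suc k) * (indicator {1..2} r *\<^sub>R (annulus_bump (r\<^sup>2) * r ^ k))) = 0" by (simp only:)
  then show ?thesis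
    by (simp only: Bochner_Integration.integral_add[OF integrable_mult_right[OF int(2)] integrable_mult_right[OF int(1)]] integral_mult_right_zero)
qed

text \<open>\<open>sphere_measure\<close> lives on the whole space but is finite and concentrated on
  the unit sphere, where a function continuous off the origin is bounded.\<close>

lemma LINT_sphere:
  fixes g :: "'a::euclidean_space \<Rightarrow> 'b::{banach,second_countable_topology}"
  assumes g: "continuous_on (- {0}) g"
  shows "integrable sphere_measure g" "(LINT u:sphere 0 1|sphere_measure. g u) = (LINT u|sphere_measure. g u)"
proof -
  have m: "g \<in> borel_measurable sphere_measure"
    using borel_measurable_continuous_on_punctured[OF g] by simp
  have ind: "(\<lambda>u. indicator (sphere 0 1) u *\<^sub>R g u) \<in> borel_measurable sphere_measure"
    using m by (intro borel_measurable_scaleR borel_measurable_indicator) auto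
  have ae: "AE u in sphere_measure. indicator (sphere 0 1) u *\<^sub>R g u = g u"
    using AE_sphere_measure by eventually_elim simp
  show "(LINT u:sphere 0 1|sphere_measure. g u) = (LINT u|sphere_measure. g u)"
    unfolding set_lebesgue_integral_def by (rule integral_cong_AE[OF ind m ae])
  have "compact (g ` sphere 0 1)"
    by (intro compact_continuous_image continuous_on_subset[OF g]) auto
  from compact_imp_bounded[OF this] obtain C where C: "\<forall>x\<in>g ` sphere 0 1. norm x \<le> C" unfolding bounded_iff by blast
  have "AE u in sphere_measure. norm (g u) \<le> C" using AE_sphere_measure by eventually_elim (use C in auto)
  then show "integrable sphere_measure g"
    by (rule finite_measure.integrable_const_bound[OF finite_measure_sphere_measure _ m])
qed

section \<open>Density, cofactors and boundary integrand of the given bodies\<close>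

context
  fixes A :: "nat \<Rightarrow> (complex^'n::{finite,wellorder}) set"
  assumes n2: "CARD('n) \<ge> 2" and K2: "\<forall>l\<in>{1..CARD('n)}. A l \<in> K2"
begin

abbreviation (input) sfun :: "nat \<Rightarrow> (complex, 'n) vec \<Rightarrow> real" where
  "sfun l \<equiv> support_fun (A l)"

abbreviation (input) hdisc :: "(complex, 'n) vec \<Rightarrow> complex" where
  "hdisc z \<equiv> mixed_disc CARD('n) (\<lambda>l. nat_mat (HessC (sfun l) z))"

abbreviation (input) dbar1 :: "'n \<Rightarrow> (complex, 'n) vec \<Rightarrow> complex" where
  "dbar1 k \<equiv> wirt \<i> k (\<lambda>w. complex_of_real (sfun 1 w))"

text \<open>The function b of the overview, taken on the whole space so that its degree of
  homogeneity, 1 + 0 - (n - 1) = 2 - n, can be used in polar coordinates.\<close>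

definition bdry :: "(complex, 'n) vec \<Rightarrow> complex" where
  "bdry z = (\<Sum>j\<in>UNIV. \<Sum>k\<in>UNIV. cnj (z $ j) * dbar1 k z * Zcoef A j k z)"

lemma sublin: "l \<in> {1..CARD('n)} \<Longrightarrow> sublinear_C2 (sfun l)"
  using K2 support_fun_sublinear by blast

lemma one_in: "1 \<in> {1..CARD('n)}" using n2 by simp

lemma continuous_on_nat_mat: "l \<in> {1..CARD('n)} \<Longrightarrow> continuous_on (- {0}) (\<lambda>z. nat_mat (HessC (sfun l) z) r s)"
  unfolding nat_mat_def by (rule continuous_on_HessC[OF sublin])

lemma nat_mat_scale:
  assumes "l \<in> {1..CARD('n)}" "r > 0" "z \<noteq> 0"
  shows "nat_mat (HessC (sfun l) (r *\<^sub>R z)) i j = (1 / of_real r) * nat_mat (HessC (sfun l) z) i j"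
  unfolding nat_mat_def by (rule HessC_scale[OF sublin[OF assms(1)] assms(2,3)])

lemma continuous_on_hdisc: "continuous_on (- {0}) hdisc"
  by (rule continuous_on_mixed_disc[OF continuous_on_nat_mat])

lemma hdisc_scale:
  assumes "r > 0" "z \<noteq> 0"
  shows "hdisc (r *\<^sub>R z) = (1 / of_real r) ^ CARD('n) * hdisc z"
proof -
  have "hdisc (r *\<^sub>R z) = mixed_disc CARD('n) (\<lambda>l i j. (1 / of_real r) * nat_mat (HessC (sfun l) z) i j)"
    by (rule mixed_disc_cong) (rule nat_mat_scale[OF _ assms])
  then show ?thesis unfolding mixed_disc_scale by simp
qed

lemma Zcoef_arg: "l \<in> {1..CARD('n) - 1} \<Longrightarrow> l + 1 \<in> {1..CARD('n)}" by auto

lemma continuous_on_Zcoef: "continuous_on (- {0}) (Zcoef A j k)"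
  unfolding Zcoef_def[abs_def] delete_row_col_def
  by (intro continuous_on_mult continuous_on_const continuous_on_mixed_disc continuous_on_nat_mat Zcoef_arg)

lemma Zcoef_scale:
  assumes "r > 0" "z \<noteq> 0"
  shows "Zcoef A j k (r *\<^sub>R z) = (1 / of_real r) ^ (CARD('n) - 1) * Zcoef A j k z"
proof -
  have "mixed_disc (CARD('n) - 1) (\<lambda>l. delete_row_col (pos j) (pos k) (nat_mat (HessC (sfun (l + 1)) (r *\<^sub>R z)))) =
    mixed_disc (CARD('n) - 1) (\<lambda>l p q. (1 / of_real r) * delete_row_col (pos j) (pos k) (nat_mat (HessC (sfun (l + 1)) z)) p q)"
    unfolding delete_row_col_def by (rule mixed_disc_cong) (rule nat_mat_scale[OF Zcoef_arg assms])
  then show ?thesis unfolding Zcoef_def mixed_disc_scale by simp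
qed

lemma Zcoef_hermitian:
  assumes "z \<noteq> 0" shows "Zcoef A k j z = cnj (Zcoef A j k z)"
proof -
  have "mixed_disc (CARD('n) - 1) (\<lambda>l. delete_row_col (pos k) (pos j) (nat_mat (HessC (sfun (l + 1)) z))) =
    mixed_disc (CARD('n) - 1) (\<lambda>l p q. cnj (delete_row_col (pos j) (pos k) (nat_mat (HessC (sfun (l + 1)) z)) q p))"
    unfolding delete_row_col_def nat_mat_def
    by (rule mixed_disc_cong) (rule HessC_hermitian[OF sublin[OF Zcoef_arg] assms])
  then show ?thesis unfolding Zcoef_def mixed_disc_cnj by (simp add: add.commute)
qed

lemma hdisc_nonneg:
  assumes "z \<noteq> 0" shows "hdisc z = of_real (Re (hdisc z))" "Re (hdisc z) \<ge> 0"
proof -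
  have "\<exists>c\<ge>0. hdisc z = of_real c"
    by (rule mixed_disc_psd) (rule psd_on_nat_mat[OF HessC_psd[OF sublin assms]])
  then obtain c where "c \<ge> 0" "hdisc z = of_real c" by blast
  then show "hdisc z = of_real (Re (hdisc z))" "Re (hdisc z) \<ge> 0" by simp_all
qed

lemma dbar1_scale: "r > 0 \<Longrightarrow> z \<noteq> 0 \<Longrightarrow> dbar1 k (r *\<^sub>R z) = dbar1 k z"
  by (rule wirt_sublinear_scale[OF sublin[OF one_in]])

lemma continuous_on_bdry: "continuous_on (- {0}) bdry"
  unfolding bdry_def[abs_def]
  by (intro continuous_on_sum continuous_on_mult continuous_on_cnj continuous_on_component continuous_on_id
     continuous_on_Zcoef C_on_imp_continuous_on[OF sublinear_C_on_wirt[OF sublin[OF one_in]]])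

lemma bdry_scale:
  assumes "r > 0" "z \<noteq> 0"
  shows "bdry (r *\<^sub>R z) = of_real (r\<^sup>2 / r ^ CARD('n)) * bdry z"
proof -
  obtain m where m: "CARD('n) = Suc m" using n2 by (cases "CARD('n)") auto
  have "of_real r * (1 / of_real r) ^ (CARD('n) - 1) = complex_of_real (r\<^sup>2 / r ^ CARD('n))"
    using assms by (simp add: m power2_eq_square power_one_over field_simps)
  then have "cnj ((r *\<^sub>R z) $ j) * dbar1 k (r *\<^sub>R z) * Zcoef A j k (r *\<^sub>R z) =
     complex_of_real (r\<^sup>2 / r ^ CARD('n)) * (cnj (z $ j) * dbar1 k z * Zcoef A j k z)" for j k
  proof -
    have c: "cnj ((r *\<^sub>R z) $ j) = of_real r * cnj (z $ j)"
      unfolding vector_scaleR_component by (simp add: scaleR_conv_of_real)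
    have "a * b = c \<Longrightarrow> (a * x) * y * (b * w) = c * (x * y * w)" for a b c x y w :: complex by (simp add: mult_ac)
    from this[OF \<open>of_real r * _ = _\<close>] show ?thesis unfolding dbar1_scale[OF assms] Zcoef_scale[OF assms] c .
  qed
  then show ?thesis unfolding bdry_def sum_distrib_left by (intro sum.cong refl)
qed

lemma upt_split: "[1..<CARD('n) + 1] = 1 # [2..<CARD('n) + 1]"
  using n2 by (simp add: upt_conv_Cons numeral_2_eq_2 del: upt_Suc)

lemma hess_top_tail:
  "hess_top (map sfun [2..<CARD('n) + 1]) z (wedge_mat (\<lambda>j k. X $ j $ k) coeffs_one) =
     (-1) ^ (CARD('n) * (CARD('n) - 1) div 2) * (fact CARD('n) * (\<Sum>j\<in>UNIV. \<Sum>k\<in>UNIV. X $ j $ k * Zcoef A j k z))"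
proof -
  define M where "M l = (\<lambda>j k. (if l = 1 then X else HessC (sfun l) z) $ j $ k)" for l
  have "map M [1..<CARD('n) + 1] = (\<lambda>j k. X $ j $ k) # map (\<lambda>h j k. HessC h z $ j $ k) (map sfun [2..<CARD('n) + 1])"
    unfolding upt_split by (auto simp: M_def simp del: upt_Suc)
  then have "hess_top (map sfun [2..<CARD('n) + 1]) z (wedge_mat (\<lambda>j k. X $ j $ k) coeffs_one) =
     wedge_mats (map M [1..<CARD('n) + 1]) coeffs_one UNIV UNIV"
    by (simp only: hess_top_def wedge_mats.simps)
  also have "\<dots> = (-1) ^ (CARD('n) * (CARD('n) - 1) div 2) * (fact CARD('n) * mixed_disc CARD('n) (\<lambda>l r s. M l (idx r) (idx s)))"
    by (rule wedge_mats_mixed_disc)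
  also have "(\<lambda>l r s. M l (idx r) (idx s)) = (\<lambda>l. nat_mat (if l = 1 then X else HessC (sfun l) z))"
    by (simp only: M_def nat_mat_def[abs_def])
  finally show ?thesis unfolding mixed_disc_Zcoef .
qed

lemma hdisc_Zcoef: "hdisc z = (\<Sum>j\<in>UNIV. \<Sum>k\<in>UNIV. HessC (sfun 1) z $ j $ k * Zcoef A j k z)"
proof -
  have "(\<lambda>l. nat_mat (HessC (sfun l) z)) = (\<lambda>l. nat_mat (if l = 1 then HessC (sfun 1) z else HessC (sfun l) z))" by auto
  then show ?thesis using mixed_disc_Zcoef[of "HessC (sfun 1) z" A z] by simp
qed

text \<open>With \<open>X\<close> the matrix unit at (j, k), the expansion identifies Z_jk as a
  cofactor: up to n! and the orientation sign it is the top coefficient of dz_j \<and> dz-bar_k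
  wedged with the remaining Hessian forms.\<close>

lemma hess_top_tail_pair:
  "hess_top (map sfun [2..<CARD('n) + 1]) z (wedge_pair (j, k) coeffs_one) =
     (-1) ^ (CARD('n) * (CARD('n) - 1) div 2) * (fact CARD('n) * Zcoef A j k z)"
proof -
  define X :: "((complex, 'n) vec, 'n) vec" where "X = (\<chi> a b. if b = k then (if a = j then 1 else 0) else 0)"
  have *: "(\<Sum>a\<in>UNIV. \<Sum>b\<in>UNIV. X $ a $ b * g a b) = g j k" for g :: "'n \<Rightarrow> 'n \<Rightarrow> complex"
  proof -
    have "(\<Sum>a\<in>UNIV. \<Sum>b\<in>UNIV. X $ a $ b * g a b) = (\<Sum>a\<in>UNIV. \<Sum>b\<in>UNIV. if b = k then (if a = j then g a b else 0) else 0)"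
      by (intro sum.cong refl) (simp add: X_def)
    then show ?thesis by simp
  qed
  have "wedge_mat (\<lambda>a b. X $ a $ b) coeffs_one = wedge_pair (j, k) coeffs_one"
    by (intro ext) (simp only: wedge_mat_def *)
  then show ?thesis using hess_top_tail[of z X] unfolding * by simp
qed

lemma hess_top_full:
  "hess_top (map sfun [1..<CARD('n) + 1]) z coeffs_one = (-1) ^ (CARD('n) * (CARD('n) - 1) div 2) * (fact CARD('n) * hdisc z)"
proof -
  have "map sfun [1..<CARD('n) + 1] = sfun 1 # map sfun [2..<CARD('n) + 1]" unfolding upt_split by simp
  then have "hess_top (map sfun [1..<CARD('n) + 1]) z coeffs_one =
      hess_top (map sfun [2..<CARD('n) + 1]) z (wedge_mat (\<lambda>j k. HessC (sfun 1) z $ j $ k) coeffs_one)"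
    by (simp only: hess_top_Cons)
  then show ?thesis unfolding hess_top_tail hdisc_Zcoef .
qed

text \<open>
  Stokes without a boundary: with \<open>b\<close> a bump function on an annulus, the current of \<open>h\<^sub>2, \<dots>, h\<^sub>n\<close> is
  closed and hence annihilates \<open>\<partial>(b(|z|\<^sup>2) \<partial>\<^sup>* h\<^sub>1)\<close>.  By homogeneity both terms of the product rule separate in
  polar coordinates.
\<close>

lemma sphere_Stokes:
  "(LINT u|sphere_measure. hdisc u) = of_nat CARD('n) / 2 * (LINT u|sphere_measure. bdry u)"
proof -
  let ?n = "CARD('n)"
  let ?hs = "map sfun [2..<?n + 1]"
  let ?N = "DIM((complex, 'n) vec)"
  \<comment> \<open>The sign and factorial common to \<open>hess_top_tail\<close> and
    \<open>hess_top_tail_pair\<close>.\<close>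
  define \<kappa> :: complex where "\<kappa> = (-1) ^ (?n * (?n - 1) div 2) * fact ?n"
  have \<kappa>: "\<kappa> \<noteq> 0" by (simp add: \<kappa>_def)
  have hs: "\<forall>h\<in>set ?hs. sublinear_C2 h" using sublin by auto
  have len: "length ?hs < ?N" using n2 unfolding DIM_complex_vec by simp
  have h1: "sublinear_C2 (sfun 1)" by (rule sublin[OF one_in])
  define \<omega> :: "'n form" where "\<omega> I J z = complex_of_real (annulus_bump ((norm z)\<^sup>2)) * coeffs_one I J" for I J z
  have Cb: "C_on k UNIV (\<lambda>z::(complex, 'n) vec. complex_of_real (annulus_bump ((norm z)\<^sup>2)))" for k
    unfolding annulus_bump_def
    by (intro C_on_bounded_linear_compose[OF open_UNIV bounded_linear_of_real] C_on_mult C_on_flat C_on_diff C_on_norm_sq C_on_const open_UNIV)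
  have C\<omega>: "C_on k UNIV (\<omega> I J)" for k I J
    unfolding \<omega>_def[abs_def] by (intro C_on_mult Cb C_on_const open_UNIV)
  have near0: "\<omega> I J z = 0" if "norm z < 1" for I J z
  proof -
    have "(norm z)\<^sup>2 \<le> 1" using that by (simp add: power_le_one)
    then show ?thesis by (simp add: \<omega>_def annulus_bump_eq_0)
  qed
  have bdd: "bounded {z. \<omega> I J z \<noteq> 0}" for I J
  proof -
    have "norm z \<le> 2" if "\<omega> I J z \<noteq> 0" for z
    proof (rule ccontr)
      assume "\<not> norm z \<le> 2"
      then have "2\<^sup>2 \<le> (norm z)\<^sup>2" by (intro power_mono) auto
      then show False using that by (simp add: \<omega>_def annulus_bump_eq_0)
    qed
    then show ?thesis unfolding bounded_iff by blast
  qed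
  define \<alpha> where "\<alpha> = dbar_wedge (sfun 1) \<omega>"
  have tame: "tame_form \<alpha>" unfolding \<alpha>_def
    by (rule tame_form_dbar_wedge[OF h1 C\<omega> bdd zero_less_one near0])
  have cc: "cc_form (del \<alpha>)" unfolding del_eq_dform
    by (rule dform_cc_form[where E = wedge_dz, OF monomial_op_wedge_dz]) (use tame tame_form_def in blast)+
  have "ddc_current ?hs (del \<alpha>) = 0"
    using current_closed_ddc_current[OF hs len] tame unfolding current_closed_def by blast
  then have zero: "(LINT z|lborel. hess_top ?hs z (\<lambda>I J. del \<alpha> I J z)) = 0"
    using cc by (simp add: ddc_current_def)
  \<comment> \<open>The two terms of the product rule: in \<open>f1\<close> the derivative falls on
    dbar h1 and completes the mixed discriminant, in \<open>f2\<close> it falls on the bump.\<close>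
  define f1 where "f1 z = complex_of_real (annulus_bump ((norm z)\<^sup>2)) * hdisc z" for z
  define f2 where "f2 z = complex_of_real (annulus_bump' ((norm z)\<^sup>2)) * bdry z" for z
  have integrand: "hess_top ?hs z (\<lambda>I J. del \<alpha> I J z) = \<kappa> * (f1 z + f2 z)" if z: "z \<noteq> 0" for z
  proof -
    let ?b = "complex_of_real (annulus_bump ((norm z)\<^sup>2))" and ?b' = "complex_of_real (annulus_bump' ((norm z)\<^sup>2))"
    \<comment> \<open>Differentiating the radial bump produces the conjugate coordinate that
      contracts Z into \<open>bdry\<close>.\<close>
    have wb: "wirt (- \<i>) j (\<lambda>z. complex_of_real (annulus_bump ((norm z)\<^sup>2))) z = ?b' * cnj (z $ j)" for j
    proof -
      have d: "(\<lambda>w::(complex, 'n) vec. (norm w)\<^sup>2) differentiable (at z)" by (rule C_on_1_differentiable[OF C_on_norm_sq])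
      have "cnj (z $ j) = of_real (Re (z $ j)) + (- \<i>) * of_real (Im (z $ j))" by (simp add: complex_eq_iff)
      then show ?thesis unfolding wirt_of_real_compose[OF annulus_bump_deriv d] wirt_norm_sq by simp
    qed
    have w\<omega>: "wirt (- \<i>) j (\<omega> I J) z = (?b' * cnj (z $ j)) * coeffs_one I J" for j I J
    proof -
      have "wirt (- \<i>) j (\<lambda>z. coeffs_one I J * complex_of_real (annulus_bump ((norm z)\<^sup>2))) z = coeffs_one I J * (?b' * cnj (z $ j))"
        unfolding wirt_cmult[OF C_on_1_differentiable[OF Cb]] wb ..
      then show ?thesis unfolding \<omega>_def[abs_def] by (simp add: mult.commute)
    qed
    have "del \<alpha> I J z = wedge_mat (\<lambda>j k. HessC (sfun 1) z $ j $ k) (\<lambda>I J. ?b * coeffs_one I J) I J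
       + (\<Sum>j\<in>UNIV. \<Sum>k\<in>UNIV. dbar1 k z * wedge_pair (j, k) (\<lambda>I J. (?b' * cnj (z $ j)) * coeffs_one I J) I J)" for I J
      unfolding \<alpha>_def using del_dbar_wedge[OF open_punctured _ sublinear_C_on'[OF h1], of z \<omega> I J] z C_on_1_differentiable[OF C\<omega>]
      by (simp add: w\<omega>) (simp add: \<omega>_def)
    then have "hess_top ?hs z (\<lambda>I J. del \<alpha> I J z) = hess_top ?hs z (\<lambda>I J. ?b * wedge_mat (\<lambda>j k. HessC (sfun 1) z $ j $ k) coeffs_one I J
       + (\<Sum>j\<in>UNIV. \<Sum>k\<in>UNIV. dbar1 k z * ((?b' * cnj (z $ j)) * wedge_pair (j, k) coeffs_one I J)))"
      by (simp only: wedge_pair_linear(3) wedge_mat_def sum_distrib_left mult.left_commute[of ?b])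
    also have "\<dots> = ?b * (\<kappa> * hdisc z) + (\<Sum>j\<in>UNIV. \<Sum>k\<in>UNIV. dbar1 k z * ((?b' * cnj (z $ j)) * (\<kappa> * Zcoef A j k z)))"
      unfolding hess_top_linear hess_top_tail hess_top_tail_pair hdisc_Zcoef \<kappa>_def by (simp only: mult.assoc)
    also have "\<dots> = \<kappa> * (f1 z + f2 z)"
    proof -
      have "(\<Sum>j\<in>UNIV. \<Sum>k\<in>UNIV. dbar1 k z * ((?b' * cnj (z $ j)) * (\<kappa> * Zcoef A j k z))) = \<kappa> * f2 z"
        unfolding f2_def bdry_def sum_distrib_left by (intro sum.cong refl) (simp only: mult_ac)
      then show ?thesis by (simp only: f1_def distrib_left mult.left_commute[of ?b])
    qed
    finally show ?thesis .
  qed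
  have q: "?n \<le> 0 + (?N - 1)" "?n \<le> 2 + (?N - 1)" unfolding DIM_complex_vec using n2 by simp_all
  have mb: "(\<lambda>z::(complex, 'n) vec. complex_of_real (b ((norm z)\<^sup>2))) \<in> borel_measurable borel" if "continuous_on UNIV b" for b :: "real \<Rightarrow> real"
    by (intro borel_measurable_continuous_onI continuous_on_of_real continuous_on_compose2[OF that]) (auto intro!: continuous_intros)
  have mr: "(\<lambda>r::real. b (r\<^sup>2) * r ^ p / r ^ q) \<in> borel_measurable borel" if "continuous_on UNIV b" for b :: "real \<Rightarrow> real" and p q
  proof -
    have "(\<lambda>r. b (r\<^sup>2)) \<in> borel_measurable borel"
      by (intro borel_measurable_continuous_onI continuous_on_compose2[OF that]) (auto intro!: continuous_intros)
    then show ?thesis by measurable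
  qed
  have P1: "integrable lborel f1" "(LINT z|lborel. f1 z) = (LINT r|radial_measure ?N. annulus_bump (r\<^sup>2) * r ^ 0 / r ^ ?n) *\<^sub>R (LINT u|sphere_measure. hdisc u)"
  proof (atomize (full), intro conjI)
    have m: "f1 \<in> borel_measurable borel" unfolding f1_def[abs_def]
      by (intro borel_measurable_times mb continuous_on_annulus_bump borel_measurable_continuous_on_punctured[OF continuous_on_hdisc])
    have s: "f1 (r *\<^sub>R u) = (annulus_bump (r\<^sup>2) * r ^ 0 / r ^ ?n) *\<^sub>R hdisc u" if "r > 0" "norm u = 1" for r u
    proof -
      have "u \<noteq> 0" using that by auto
      have nr: "norm (r *\<^sub>R u) = r" using that by simp
      show ?thesis unfolding f1_def hdisc_scale[OF that(1) \<open>u \<noteq> 0\<close>] nr by (simp add: scaleR_conv_of_real power_one_over)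
    qed
    note P = polar_integral_product[OF m borel_measurable_continuous_on_punctured[OF continuous_on_hdisc] mr[OF continuous_on_annulus_bump(1)]
      radial_annulus(1)[OF continuous_on_annulus_bump(1) annulus_bump_eq_0(1) q(1)] LINT_sphere(1)[OF continuous_on_hdisc] s]
    show "integrable lborel f1" by (rule P(1))
    show "(LINT z|lborel. f1 z) = (LINT r|radial_measure ?N. annulus_bump (r\<^sup>2) * r ^ 0 / r ^ ?n) *\<^sub>R (LINT u|sphere_measure. hdisc u)" by (rule P(2))
  qed
  have P2: "integrable lborel f2" "(LINT z|lborel. f2 z) = (LINT r|radial_measure ?N. annulus_bump' (r\<^sup>2) * r ^ 2 / r ^ ?n) *\<^sub>R (LINT u|sphere_measure. bdry u)"
  proof (atomize (full), intro conjI)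
    have m: "f2 \<in> borel_measurable borel" unfolding f2_def[abs_def]
      by (intro borel_measurable_times mb continuous_on_annulus_bump borel_measurable_continuous_on_punctured[OF continuous_on_bdry])
    have s: "f2 (r *\<^sub>R u) = (annulus_bump' (r\<^sup>2) * r ^ 2 / r ^ ?n) *\<^sub>R bdry u" if "r > 0" "norm u = 1" for r u
    proof -
      have "u \<noteq> 0" using that by auto
      have nr: "norm (r *\<^sub>R u) = r" using that by simp
      show ?thesis unfolding f2_def bdry_scale[OF that(1) \<open>u \<noteq> 0\<close>] nr by (simp add: scaleR_conv_of_real)
    qed
    note P = polar_integral_product[OF m borel_measurable_continuous_on_punctured[OF continuous_on_bdry] mr[OF continuous_on_annulus_bump(2)]
      radial_annulus(1)[OF continuous_on_annulus_bump(2) annulus_bump_eq_0(2) q(2)] LINT_sphere(1)[OF continuous_on_bdry] s]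
    show "integrable lborel f2" by (rule P(1))
    show "(LINT z|lborel. f2 z) = (LINT r|radial_measure ?N. annulus_bump' (r\<^sup>2) * r ^ 2 / r ^ ?n) *\<^sub>R (LINT u|sphere_measure. bdry u)" by (rule P(2))
  qed
  have "(LINT z|lborel. hess_top ?hs z (\<lambda>I J. del \<alpha> I J z)) = (LINT z|lborel. \<kappa> * (f1 z + f2 z))"
  proof (rule integral_cong_AE)
    show "(\<lambda>z. hess_top ?hs z (\<lambda>I J. del \<alpha> I J z)) \<in> borel_measurable lborel"
      using measurable_hess_top[OF hs cc_form_measurable[OF cc]] by simp
    show "(\<lambda>z. \<kappa> * (f1 z + f2 z)) \<in> borel_measurable lborel" using P1(1) P2(1) by auto
    have "AE z in lborel. z \<noteq> (0 :: (complex, 'n) vec)" by (rule AE_lborel_singleton)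
    then show "AE z in lborel. hess_top ?hs z (\<lambda>I J. del \<alpha> I J z) = \<kappa> * (f1 z + f2 z)"
      by eventually_elim (rule integrand)
  qed
  also have "\<dots> = \<kappa> * ((LINT z|lborel. f1 z) + (LINT z|lborel. f2 z))" using P1(1) P2(1) by simp
  finally have sum0: "(LINT z|lborel. f1 z) + (LINT z|lborel. f2 z) = 0" using zero \<kappa> by simp
  define a where "a = (LINT r|lborel. indicator {1..2} r *\<^sub>R (annulus_bump (r\<^sup>2) * r ^ (?n - 1)))"
  have a: "a > 0" unfolding a_def by (rule annulus_integral_pos)
  \<comment> \<open>Against r^(2n-1) dr the degrees -n and 2 - n leave r^(n-1) and r^(n+1), the pair
    of exponents related by integration by parts with k = n - 1.\<close>
  have e1: "0 + (?N - 1) - ?n = ?n - 1" and e2: "2 + (?N - 1) - ?n = ?n - 1 + 2" unfolding DIM_complex_vec using n2 by simp_all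
  have r1: "(LINT r|radial_measure ?N. annulus_bump (r\<^sup>2) * r ^ 0 / r ^ ?n) = a"
    using radial_annulus(2)[OF continuous_on_annulus_bump(1) annulus_bump_eq_0(1) q(1)] unfolding e1 a_def .
  have r2: "(LINT r|radial_measure ?N. annulus_bump' (r\<^sup>2) * r ^ 2 / r ^ ?n) = - (real ?n / 2) * a"
  proof -
    have "2 * (LINT r|radial_measure ?N. annulus_bump' (r\<^sup>2) * r ^ 2 / r ^ ?n) + real (Suc (?n - 1)) * a = 0"
      using annulus_integral_by_parts[of "?n - 1"] radial_annulus(2)[OF continuous_on_annulus_bump(2) annulus_bump_eq_0(2) q(2)]
      unfolding e2 a_def by (simp only:)
    then show ?thesis using n2 by simp
  qed
  have "of_real a * ((LINT u|sphere_measure. hdisc u) - of_nat ?n / 2 * (LINT u|sphere_measure. bdry u)) = 0"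
    using sum0 unfolding P1(2) P2(2) r1 r2 by (simp add: scaleR_conv_of_real algebra_simps)
  then show ?thesis using a by simp
qed

text \<open>The value 0 at the origin replaces the arbitrary value of the Hessians there, so that
  nonnegativity holds at every point.\<close>

definition MA_density :: "(complex, 'n) vec \<Rightarrow> real" where
  "MA_density z = (if z = 0 then 0 else 4 ^ CARD('n) * fact CARD('n) * Re (hdisc z))"

lemma MA_density_nonneg: "MA_density z \<ge> 0"
  using hdisc_nonneg(2) by (simp add: MA_density_def)

lemma of_real_MA_density: "z \<noteq> 0 \<Longrightarrow> complex_of_real (MA_density z) = 4 ^ CARD('n) * fact CARD('n) * hdisc z"
  using hdisc_nonneg(1)[of z] by (simp add: MA_density_def)

lemma measurable_MA_density: "MA_density \<in> borel_measurable borel"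
proof (rule borel_measurable_continuous_on_punctured)
  have "continuous_on (- {0}) (\<lambda>z. 4 ^ CARD('n) * fact CARD('n) * Re (hdisc z))"
    by (intro continuous_on_mult continuous_on_const continuous_on_Re continuous_on_hdisc)
  then show "continuous_on (- {0}) MA_density"
    by (rule continuous_on_eq) (simp add: MA_density_def)
qed

text \<open>Degree -n against r^(2n-1) dr leaves r^(n-1), whose integral over the unit interval is
  1/n.\<close>

lemma hdisc_ball:
  "integrable lborel (\<lambda>z. complex_of_real (indicator (cball 0 R) z) * hdisc z)"
  "(LINT z|lborel. complex_of_real (indicator (cball 0 1) z) * hdisc z) = of_real (1 / CARD('n)) * (LINT u|sphere_measure. hdisc u)"
proof -
  let ?n = "CARD('n)" and ?N = "DIM((complex, 'n) vec)"
  have lt: "?n < ?N" unfolding DIM_complex_vec using n2 by simp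
  have m1: "(\<lambda>z. complex_of_real (indicator (cball 0 R) z) * hdisc z) \<in> borel_measurable borel" for R
  proof (rule borel_measurable_times)
    have "complex_of_real \<in> borel_measurable borel" by (intro borel_measurable_continuous_onI continuous_intros)
    moreover have "(indicator (cball 0 R) :: (complex, 'n) vec \<Rightarrow> real) \<in> borel_measurable borel"
      by (intro borel_measurable_indicator borel_closed closed_cball)
    ultimately show "(\<lambda>z::(complex, 'n) vec. complex_of_real (indicator (cball 0 R) z)) \<in> borel_measurable borel"
      by (rule measurable_compose[rotated])
    show "hdisc \<in> borel_measurable borel" by (rule borel_measurable_continuous_on_punctured[OF continuous_on_hdisc])
  qed
  have m2: "(\<lambda>r::real. indicator {..R} r / r ^ ?n :: real) \<in> borel_measurable borel" for R
    by (intro borel_measurable_divide borel_measurable_indicator borel_measurable_power) auto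
  have s: "complex_of_real (indicator (cball 0 R) (r *\<^sub>R u)) * hdisc (r *\<^sub>R u) = (indicator {..R} r / r ^ ?n) *\<^sub>R hdisc u"
    if "r > 0" "norm u = 1" for r u R
  proof -
    have "u \<noteq> 0" using that by auto
    have nr: "norm (r *\<^sub>R u) = r" using that by simp
    have "indicator (cball 0 R) (r *\<^sub>R u) = (indicator {..R} r :: real)" by (simp only: indicator_def mem_cball_0 nr atMost_iff)
    then show ?thesis unfolding hdisc_scale[OF that(1) \<open>u \<noteq> 0\<close>]
      by (simp only:) (simp add: scaleR_conv_of_real power_one_over)
  qed
  note P = polar_integral_product[OF m1 borel_measurable_continuous_on_punctured[OF continuous_on_hdisc] m2
      integrable_radial_power[OF lt] LINT_sphere(1)[OF continuous_on_hdisc] s]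
  show "integrable lborel (\<lambda>z. complex_of_real (indicator (cball 0 R) z) * hdisc z)" by (rule P(1))
  have "(LINT r|radial_measure ?N. indicator {..1} r / r ^ ?n) = (LINT r|lborel. (indicator {0<..} r * r ^ (?N - 1)) *\<^sub>R (indicator {..1} r / r ^ ?n))"
    by (rule integral_radial_measure(2)[OF m2])
  also have "\<dots> = (LINT r|lborel. r ^ (?n - 1) * indicator {0..1} r)"
  proof (rule Bochner_Integration.integral_cong[OF refl])
    fix r :: real
    show "(indicator {0<..} r * r ^ (?N - 1)) *\<^sub>R (indicator {..1} r / r ^ ?n) = r ^ (?n - 1) * indicator {0..1} r"
    proof (cases "r > 0")
      case True
      have "?N - 1 = (?n - 1) + ?n" unfolding DIM_complex_vec using n2 by simp
      then have "r ^ (?N - 1) = r ^ (?n - 1) * r ^ ?n" by (simp only: power_add)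
      then show ?thesis using True by (simp add: indicator_def)
    next
      \<comment> \<open>At r = 0 the right-hand side is 0 because the exponent n - 1 is positive;
        for r < 0 both indicators vanish.\<close>
      case False
      then show ?thesis using n2 by (cases "r = 0") (auto simp: indicator_def power_0_left)
    qed
  qed
  also have "\<dots> = 1 / real ?n"
    using integral_power[of 0 1 "?n - 1"] n2 by simp
  finally have rad: "(LINT r|radial_measure ?N. indicator {..1} r / r ^ ?n) = 1 / real ?n" .
  have "(LINT z|lborel. complex_of_real (indicator (cball 0 1) z) * hdisc z) =
      (LINT r|radial_measure ?N. indicator {..1} r / r ^ ?n) *\<^sub>R (LINT u|sphere_measure. hdisc u)"
    by (rule P(2))
  then show "(LINT z|lborel. complex_of_real (indicator (cball 0 1) z) * hdisc z) = of_real (1 / ?n) * (LINT u|sphere_measure. hdisc u)"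
    unfolding rad scaleR_conv_of_real .
qed

text \<open>The constant is 4^n n! times 1/n from the radial integral times n/2 from Stokes'
  theorem.\<close>

lemma MA_density_ball:
  "integrable lborel (\<lambda>z. indicator (cball 0 R) z * MA_density z)"
  "(LINT z|lborel. indicator (cball 0 1) z * MA_density z) = 4 ^ CARD('n) * fact CARD('n) / 2 * Re (LINT u|sphere_measure. bdry u)"
proof -
  have Re_of_real_mult: "Re (of_real c * w) = c * Re w" for c w by simp
  let ?c = "4 ^ CARD('n) * fact CARD('n) :: complex"
  have cr: "?c = of_real (4 ^ CARD('n) * fact CARD('n))" by simp
  have ae: "AE z in lborel. ?c * (complex_of_real (indicator (cball 0 R) z) * hdisc z) = of_real (indicator (cball 0 R) z * MA_density z)" for R
  proof -
    have "AE z in lborel. z \<noteq> (0 :: (complex, 'n) vec)" by (rule AE_lborel_singleton)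
    then show ?thesis by eventually_elim (simp add: of_real_MA_density)
  qed
  have mC: "complex_of_real \<in> borel_measurable borel" by (intro borel_measurable_continuous_onI continuous_intros)
  have mr: "(\<lambda>z. indicator (cball 0 R) z * MA_density z) \<in> borel_measurable lborel" for R
    using measurable_MA_density by (intro borel_measurable_times borel_measurable_indicator) auto
  have mc: "(\<lambda>z. complex_of_real (indicator (cball 0 R) z * MA_density z)) \<in> borel_measurable lborel" for R
    using measurable_compose[OF mr mC] .
  have i1: "integrable lborel (\<lambda>z. ?c * (complex_of_real (indicator (cball 0 R) z) * hdisc z))" for R
    by (intro integrable_mult_right hdisc_ball)
  have "integrable lborel (\<lambda>z. complex_of_real (indicator (cball 0 R) z * MA_density z))"
    using integrable_cong_AE[OF borel_measurable_integrable[OF i1] mc ae] i1 by blast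
  from integrable_Re[OF this] show "integrable lborel (\<lambda>z. indicator (cball 0 R) z * MA_density z)" by (simp only: Re_complex_of_real)
  have "complex_of_real (LINT z|lborel. indicator (cball 0 1) z * MA_density z) = (LINT z|lborel. complex_of_real (indicator (cball 0 1) z * MA_density z))"
    by (rule integral_complex_of_real[symmetric])
  also have "\<dots> = (LINT z|lborel. ?c * (complex_of_real (indicator (cball 0 1) z) * hdisc z))"
    by (rule integral_cong_AE[OF mc borel_measurable_integrable[OF i1] AE_symmetric[OF ae]])
  also have "\<dots> = ?c * (of_real (1 / CARD('n)) * (of_nat CARD('n) / 2 * (LINT u|sphere_measure. bdry u)))"
    unfolding integral_mult_right_zero hdisc_ball(2) sphere_Stokes ..
  also have "\<dots> = of_real (4 ^ CARD('n) * fact CARD('n) / 2) * (LINT u|sphere_measure. bdry u)"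
    using n2 by simp
  finally have "Re (complex_of_real (LINT z|lborel. indicator (cball 0 1) z * MA_density z)) =
      Re (of_real (4 ^ CARD('n) * fact CARD('n) / 2) * (LINT u|sphere_measure. bdry u))" by (rule arg_cong)
  then show "(LINT z|lborel. indicator (cball 0 1) z * MA_density z) = 4 ^ CARD('n) * fact CARD('n) / 2 * Re (LINT u|sphere_measure. bdry u)"
    by (simp only: Re_complex_of_real Re_of_real_mult)
qed

section \<open>The pseudovolume as an integral over the sphere\<close>

lemma cc_form_form_of_fun:
  assumes "continuous_on UNIV f" "bounded {z. f z \<noteq> 0}"
  shows "cc_form (form_of_fun f :: 'n form)"
  unfolding cc_form_iff
proof (intro allI conjI)
  fix I J :: "'n set"
  show "continuous_on UNIV (form_of_fun f I J)"
  proof (cases "I = {} \<and> J = {}")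
    case True
    then have "form_of_fun f I J = (\<lambda>z. complex_of_real (f z))" by (simp add: form_of_fun_def fun_eq_iff)
    then show ?thesis by (simp only: continuous_on_of_real assms)
  next
    case False
    then have "form_of_fun f I J = (\<lambda>z. 0)" by (simp only: form_of_fun_def fun_eq_iff if_False) blast
    then show ?thesis by (simp only: continuous_on_const)
  qed
  show "bounded {z. form_of_fun f I J z \<noteq> 0}"
    by (rule bounded_subset[OF assms(2)]) (auto simp: form_of_fun_def)
qed

lemma BT_product_form_of_fun:
  assumes f: "continuous_on UNIV f" "bounded {z. f z \<noteq> 0}"
  shows "BT_product (map sfun [1..<CARD('n) + 1]) (form_of_fun f) = of_real (LINT z|lborel. MA_density z * f z)"
proof -
  let ?n = "CARD('n)" and ?hs = "map sfun [1..<CARD('n) + 1]"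
  have hs: "\<forall>h\<in>set ?hs. sublinear_C2 h" using sublin by auto
  have len: "length ?hs < DIM((complex, 'n) vec)" unfolding DIM_complex_vec using n2 by simp
  let ?s = "(-1) ^ (?n * (?n - 1) div 2) :: complex"
  \<comment> \<open>The orientation sign occurs here and in the top coefficient, hence squares to 1;
    the factor -2i of integration and the factor 2i of dd^c multiply to 4 in each of the n
    variables.\<close>
  define c where "c = ?s * (- 2 * \<i>) ^ ?n * (2 * \<i>) ^ ?n"
  have c: "c * ?s = 4 ^ ?n"
  proof -
    have "?s * ?s = 1" unfolding power_mult_distrib[symmetric] by simp
    moreover have "(- 2 * \<i>) ^ ?n * (2 * \<i>) ^ ?n = 4 ^ ?n" unfolding power_mult_distrib[symmetric] by simp
    moreover have "c * ?s = (?s * ?s) * ((- 2 * \<i>) ^ ?n * (2 * \<i>) ^ ?n)" by (simp only: c_def mult_ac)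
    ultimately show ?thesis by (simp only: mult_1_left)
  qed
  note cc = cc_form_form_of_fun[OF f]
  have form: "form_of_fun f I J z = of_real (f z) * coeffs_one I J" for I J :: "'n set" and z
    by (simp add: form_of_fun_def coeffs_one_def)
  have top: "hess_top ?hs z (\<lambda>I J. form_of_fun f I J z) = of_real (f z) * (?s * (fact ?n * hdisc z))" for z
    unfolding form hess_top_linear hess_top_full ..
  have mC: "complex_of_real \<in> borel_measurable borel" by (intro borel_measurable_continuous_onI continuous_intros)
  have mf: "(\<lambda>z. MA_density z * f z) \<in> borel_measurable lborel"
    using measurable_MA_density borel_measurable_continuous_onI[OF f(1)] by (intro borel_measurable_times) auto
  have int: "integrable lborel (\<lambda>z. hess_top ?hs z (\<lambda>I J. form_of_fun f I J z))"
    by (rule cc_form_hess_top_integrable[OF hs len cc])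
  have "BT_product ?hs (form_of_fun f) = c * (LINT z|lborel. hess_top ?hs z (\<lambda>I J. form_of_fun f I J z))"
    unfolding BT_product_eq_ddc_current[OF hs len] ddc_current_def if_P[OF cc] c_def length_map length_upt add_diff_cancel_right' ..
  also have "\<dots> = (LINT z|lborel. c * hess_top ?hs z (\<lambda>I J. form_of_fun f I J z))" by (rule integral_mult_right_zero[symmetric])
  also have "\<dots> = (LINT z|lborel. complex_of_real (MA_density z * f z))"
  proof (rule integral_cong_AE)
    show "(\<lambda>z. c * hess_top ?hs z (\<lambda>I J. form_of_fun f I J z)) \<in> borel_measurable lborel"
      by (rule borel_measurable_integrable[OF integrable_mult_right[OF int]])
    show "(\<lambda>z. complex_of_real (MA_density z * f z)) \<in> borel_measurable lborel" using measurable_compose[OF mf mC] .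
    have "AE z in lborel. z \<noteq> (0 :: (complex, 'n) vec)" by (rule AE_lborel_singleton)
    then show "AE z in lborel. c * hess_top ?hs z (\<lambda>I J. form_of_fun f I J z) = complex_of_real (MA_density z * f z)"
    proof eventually_elim
      case (elim z)
      have "c * (of_real (f z) * (?s * (fact ?n * hdisc z))) = (c * ?s) * fact ?n * hdisc z * of_real (f z)" by (simp only: mult_ac)
      then show ?case unfolding top c of_real_mult of_real_MA_density[OF elim] .
    qed
  qed
  also have "\<dots> = of_real (LINT z|lborel. MA_density z * f z)" by (rule integral_complex_of_real)
  finally show ?thesis .
qed

lemma mixed_pseudovolume_eq:
  "mixed_pseudovolume A = 4 ^ CARD('n) / (2 * unit_ball_vol (real CARD('n))) * Re (LINT u|sphere_measure. bdry u)"
proof -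
  let ?\<mu> = "density lborel (\<lambda>z. ennreal (MA_density z))"
  have "current_measure (BT_product (map sfun [1..<CARD('n) + 1])) = ?\<mu>"
    by (rule current_measure_eq_density[OF measurable_MA_density MA_density_nonneg MA_density_ball(1) BT_product_form_of_fun])
  moreover have "measure ?\<mu> (cball 0 1) = (LINT z|lborel. indicator (cball 0 1) z * MA_density z)"
  proof -
    have "emeasure ?\<mu> (cball 0 1) = (\<integral>\<^sup>+ z. ennreal (MA_density z) * indicator (cball 0 1) z \<partial>lborel)"
      using measurable_MA_density by (intro emeasure_density) auto
    also have "\<dots> = (\<integral>\<^sup>+ z. ennreal (indicator (cball 0 1) z * MA_density z) \<partial>lborel)"
      by (intro nn_integral_cong) (simp add: indicator_def)
    also have "\<dots> = ennreal (LINT z|lborel. indicator (cball 0 1) z * MA_density z)"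
      by (rule nn_integral_eq_integral[OF MA_density_ball(1)]) (simp add: MA_density_nonneg)
    finally show ?thesis using MA_density_nonneg by (simp add: measure_def integral_nonneg)
  qed
  ultimately have "mixed_pseudovolume A = 1 / (fact CARD('n) * unit_ball_vol (real CARD('n))) *
     (4 ^ CARD('n) * fact CARD('n) / 2 * Re (LINT u|sphere_measure. bdry u))"
    unfolding mixed_pseudovolume_def MA_density_ball(2)[symmetric] by (simp only:)
  then show ?thesis by simp
qed

text \<open>\<open>herm\<close> conjugates its second argument, and Hermitian symmetry turns the
  conjugated entries of Z into transposed ones, so the gradient meets Z as in \<open>bdry\<close>;
  its factor 2 gives 2 b. The trace is real and so passes through the real part onto Euler's
  identity.\<close>

lemma Re_herm_grad_Xi:
  assumes u: "u \<noteq> 0"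
  shows "Re (herm (grad (sfun 1) u) (Xi A u *v u)) = 2 * Re (bdry u) - Re (\<Sum>l\<in>UNIV. Zcoef A l l u) * sfun 1 u"
proof -
  let ?g = "grad (sfun 1) u" and ?t = "\<Sum>l\<in>UNIV. Zcoef A l l u"
  have herm_Z: "Zcoef A k j u = cnj (Zcoef A j k u)" for j k by (rule Zcoef_hermitian[OF u])
  have t: "cnj ?t = ?t" unfolding cnj_sum by (intro sum.cong refl) (rule herm_Z[symmetric])
  have Xi: "Xi A u $ j $ k = Zcoef A j k u - (if j = k then ?t else 0)" for j k
  proof (cases "j = k")
    case True
    have "?t = Zcoef A j j u + (\<Sum>l\<in>UNIV - {j}. Zcoef A l l u)" by (rule sum.remove) auto
    then show ?thesis using True by (simp add: Xi_def)
  qed (simp add: Xi_def)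
  have "herm ?g (Xi A u *v u) = (\<Sum>j\<in>UNIV. \<Sum>k\<in>UNIV. ?g $ j * (Zcoef A k j u * cnj (u $ k) - (if j = k then ?t else 0) * cnj (u $ k)))"
    unfolding herm_def matrix_vector_mult_def
    by (simp add: Xi herm_Z[symmetric] t cnj_sum sum_distrib_left left_diff_distrib if_distrib[of cnj] cong: if_cong)
  also have "\<dots> = (\<Sum>j\<in>UNIV. \<Sum>k\<in>UNIV. ?g $ j * (Zcoef A k j u * cnj (u $ k))) - (\<Sum>j\<in>UNIV. \<Sum>k\<in>UNIV. if j = k then ?g $ j * (?t * cnj (u $ k)) else 0)"
    unfolding right_diff_distrib sum_subtractf by (intro arg_cong2[of _ _ _ _ minus] refl sum.cong) simp
  also have "(\<Sum>j\<in>UNIV. \<Sum>k\<in>UNIV. if j = k then ?g $ j * (?t * cnj (u $ k)) else 0) = ?t * herm ?g u"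
    by (simp add: herm_def sum_distrib_left mult_ac)
  also have "(\<Sum>j\<in>UNIV. \<Sum>k\<in>UNIV. ?g $ j * (Zcoef A k j u * cnj (u $ k))) = 2 * bdry u"
  proof -
    have g: "?g $ j = 2 * wirt \<i> j (\<lambda>w. complex_of_real (sfun 1 w)) u" for j by (simp add: grad_def dzbar_eq_wirt)
    have "(\<Sum>j\<in>UNIV. \<Sum>k\<in>UNIV. ?g $ j * (Zcoef A k j u * cnj (u $ k))) = (\<Sum>k\<in>UNIV. \<Sum>j\<in>UNIV. ?g $ j * (Zcoef A k j u * cnj (u $ k)))"
      by (rule sum.swap)
    also have "\<dots> = 2 * bdry u"
      unfolding bdry_def g sum_distrib_left by (intro sum.cong refl) (simp only: mult_ac)
    finally show ?thesis .
  qed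
  finally have eq: "herm ?g (Xi A u *v u) = 2 * bdry u - ?t * herm ?g u" .
  have Re_real_mult: "Re (t * w) = Re t * Re w" if "cnj t = t" for t w
    using arg_cong[OF that, of Im] by simp
  from Re_real_mult[OF t, of "herm ?g u"] show ?thesis unfolding eq using sublinear_Euler[OF sublin[OF one_in] u] by simp
qed

lemma mixed_disc_mat_1:
  assumes u: "u \<noteq> 0"
  shows "mixed_disc CARD('n) (\<lambda>l. nat_mat (if l = 1 then mat 1 else HessC (sfun l) u)) = of_real (Re (\<Sum>l\<in>UNIV. Zcoef A l l u))"
proof -
  let ?t = "\<Sum>l\<in>UNIV. Zcoef A l l u"
  have real: "t = of_real (Re t)" if "cnj t = t" for t
    using arg_cong[OF that, of Im] by (simp add: complex_eq_iff)
  have "cnj ?t = ?t" unfolding cnj_sum by (intro sum.cong refl) (rule Zcoef_hermitian[OF u, symmetric])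
  note t = real[OF this]
  have "mixed_disc CARD('n) (\<lambda>l. nat_mat (if l = 1 then mat 1 else HessC (sfun l) u)) = (\<Sum>j\<in>UNIV. \<Sum>k\<in>UNIV. mat 1 $ j $ k * Zcoef A j k u)"
    by (rule mixed_disc_Zcoef)
  also have "\<dots> = (\<Sum>j\<in>UNIV. \<Sum>k\<in>UNIV. if j = k then Zcoef A j k u else 0)"
    by (intro sum.cong refl) (simp add: mat_def)
  also have "\<dots> = ?t" by simp
  also note t
  finally show ?thesis .
qed

lemma mixed_pseudovolume_mat_1:
  assumes "(LINT u:sphere 0 1|sphere_measure. Re (herm (grad (sfun 1) u) (Xi A u *v u))) = 0"
  shows "complex_of_real (mixed_pseudovolume A) =
    4 ^ (CARD('n) - 1) / of_real (unit_ball_vol (real CARD('n))) *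
    (LINT u:sphere 0 1|sphere_measure.
       of_real (sfun 1 u) * mixed_disc CARD('n) (\<lambda>l. nat_mat (if l = 1 then mat 1 else HessC (sfun l) u)))"
proof -
  define tr where "tr u = Re (\<Sum>l\<in>UNIV. Zcoef A l l u)" for u
  have ctr: "continuous_on (- {0}) (\<lambda>u. tr u * sfun 1 u)"
    unfolding tr_def
    by (intro continuous_on_mult continuous_on_Re continuous_on_sum continuous_on_Zcoef
      continuous_on_subset[OF sublinear_continuous[OF sublin[OF one_in]]]) auto
  have cre: "continuous_on (- {0}) (\<lambda>u. 2 * Re (bdry u))"
    by (intro continuous_on_mult continuous_on_const continuous_on_Re continuous_on_bdry)
  note itr = LINT_sphere(1)[OF ctr] and ire = LINT_sphere(1)[OF cre]
  have "(LINT u:sphere 0 1|sphere_measure. Re (herm (grad (sfun 1) u) (Xi A u *v u))) =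
    (LINT u:sphere 0 1|sphere_measure. 2 * Re (bdry u) - tr u * sfun 1 u)"
  proof (rule set_lebesgue_integral_cong)
    show "\<forall>u. u \<in> sphere 0 1 \<longrightarrow> Re (herm (grad (sfun 1) u) (Xi A u *v u)) = 2 * Re (bdry u) - tr u * sfun 1 u"
    proof (intro allI impI)
      fix u :: "(complex, 'n) vec" assume "u \<in> sphere 0 1"
      then have "u \<noteq> 0" by auto
      then show "Re (herm (grad (sfun 1) u) (Xi A u *v u)) = 2 * Re (bdry u) - tr u * sfun 1 u"
        unfolding tr_def by (rule Re_herm_grad_Xi)
    qed
  qed simp
  also have "\<dots> = (LINT u|sphere_measure. 2 * Re (bdry u) - tr u * sfun 1 u)"
    by (rule LINT_sphere(2)[OF continuous_on_diff[OF cre ctr]])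
  also have "\<dots> = 2 * (LINT u|sphere_measure. Re (bdry u)) - (LINT u|sphere_measure. tr u * sfun 1 u)"
    using itr ire by simp
  also have "(LINT u|sphere_measure. Re (bdry u)) = Re (LINT u|sphere_measure. bdry u)"
    by (rule integral_Re[OF LINT_sphere(1)[OF continuous_on_bdry]])
  finally have key: "2 * Re (LINT u|sphere_measure. bdry u) = (LINT u|sphere_measure. tr u * sfun 1 u)" using assms by simp
  have "(LINT u:sphere 0 1|sphere_measure. of_real (sfun 1 u) * mixed_disc CARD('n) (\<lambda>l. nat_mat (if l = 1 then mat 1 else HessC (sfun l) u))) =
    (LINT u:sphere 0 1|sphere_measure. complex_of_real (tr u * sfun 1 u))"
  proof (rule set_lebesgue_integral_cong)
    show "\<forall>u. u \<in> sphere 0 1 \<longrightarrow> of_real (sfun 1 u) * mixed_disc CARD('n) (\<lambda>l. nat_mat (if l = 1 then mat 1 else HessC (sfun l) u)) = complex_of_real (tr u * sfun 1 u)"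
    proof (intro allI impI)
      fix u :: "(complex, 'n) vec" assume "u \<in> sphere 0 1"
      then have "u \<noteq> 0" by auto
      then show "of_real (sfun 1 u) * mixed_disc CARD('n) (\<lambda>l. nat_mat (if l = 1 then mat 1 else HessC (sfun l) u)) = complex_of_real (tr u * sfun 1 u)"
        unfolding mixed_disc_mat_1[OF \<open>u \<noteq> 0\<close>] by (simp add: tr_def)
    qed
  qed simp
  also have "\<dots> = (LINT u|sphere_measure. complex_of_real (tr u * sfun 1 u))"
    by (rule LINT_sphere(2)[OF continuous_on_of_real[OF ctr]])
  also have "\<dots> = of_real (LINT u|sphere_measure. tr u * sfun 1 u)" by (rule integral_complex_of_real)
  also have "\<dots> = of_real (2 * Re (LINT u|sphere_measure. bdry u))" by (simp only: key)
  finally have rhs: "(LINT u:sphere 0 1|sphere_measure. of_real (sfun 1 u) * mixed_disc CARD('n) (\<lambda>l. nat_mat (if l = 1 then mat 1 else HessC (sfun l) u))) =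
    of_real (2 * Re (LINT u|sphere_measure. bdry u))" .
  \<comment> \<open>Half of 4^n times Re of the boundary integral is 4^(n-1) times twice that real
    part, and twice it is what the hypothesis has expressed through \<open>tr\<close>.\<close>
  have "(4::real) ^ CARD('n) = 4 * 4 ^ (CARD('n) - 1)" using n2 by (cases "CARD('n)") auto
  then have "mixed_pseudovolume A = 4 ^ (CARD('n) - 1) / unit_ball_vol (real CARD('n)) * (2 * Re (LINT u|sphere_measure. bdry u))"
    unfolding mixed_pseudovolume_eq by simp
  then show ?thesis unfolding rhs by (simp only: of_real_mult of_real_divide of_real_power of_real_numeral)
qed

end

theorem corollary9p3:
  fixes A :: "nat \<Rightarrow> (complex^'n::{finite,wellorder}) set"
  assumes "CARD('n) \<ge> 2"
    and "\<forall>l\<in>{1..CARD('n)}. A l \<in> K2"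
    and "(LINT u:sphere 0 1|sphere_measure. Re (herm (grad (support_fun (A 1)) u) (Xi A u *v u))) = 0"
  shows "complex_of_real (mixed_pseudovolume A) =
    4 ^ (CARD('n) - 1) / of_real (unit_ball_vol (real CARD('n))) *
    (LINT u:sphere 0 1|sphere_measure.
       of_real (support_fun (A 1) u) *
       mixed_disc CARD('n)
         (\<lambda>l. nat_mat (if l = 1 then mat 1 else HessC (support_fun (A l)) u)))"
  by (rule mixed_pseudovolume_mat_1[OF assms])

end
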